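(* Let $(E,g,J)\to(M,I)$ be a holomorphic Hermitian vector bundle over a complex manifold, let $D\in\Gamma(T^{*0,1}\otimes\wedge^2E^{*1,0})$ satisfy $\overline{\partial}D=0$, and let $B\in\Gamma(\wedge^2E^{*1,0})$. Let $\nabla$ and $\nabla'$ be the real connections on $E$ with $\nabla^{0,1}=\nabla^{Ch(0,1)}+g^{-1}D$ and $\nabla'^{0,1}=\nabla^{Ch(0,1)}+g^{-1}(D+\overline{\partial}B)$. Then $\exp(-g^{-1}B)$ induces, by sending $K\in\mathcal{T}(E,g)$ to the element $K'$ with $E^{0,1}_{K'}=\exp(-g^{-1}B)(E^{0,1}_K)$, a fiber preserving biholomorphism between $(\mathcal{T}(E,g),\mathcal{J}^{(\nabla,I)})$ and $(\mathcal{T}(E,g),\mathcal{J}^{(\nabla',I)})$.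
   Context: $E$ is viewed as a real bundle with fiberwise complex structure $J$ and $J$-compatible positive definite fiberwise metric $g$. $E^{1,0},E^{0,1}$ are the $\pm i$ eigenbundles of $J$ in $E_{\mathbb{C}}=E\otimes_{\mathbb{R}}\mathbb{C}$; $E^{1,0}$ is a holomorphic bundle with dual $E^{*1,0}$; $\overline{\partial}$ is the natural $\overline{\partial}$-operator on these and associated bundles. $T^{*0,1}$ is the bundle of $(0,1)$-forms on $M$. $\nabla^{Ch}$ is the Chern connection of $(E,g,J)$, considered as a real connection on $E$ and extended $\mathbb{C}$-linearly to $E_{\mathbb{C}}$. The $\mathbb{C}$-bilinear extension of $g$ gives an isomorphism $g:E^{0,1}\to E^{*1,0}$; $g^{-1}B$ denotes the endomorphism of $E_{\mathbb{C}}$ which is $E^{1,0}\to E^{*1,0}\xrightarrow{g^{-1}}E^{0,1}$ (the first map being $v\mapsto B(v,\cdot)$) on $E^{1,0}$ and zero on $E^{0,1}$, and similarly for $g^{-1}D$, which is a $(0,1)$-form with values in $\mathrm{End}(E_{\mathbb{C}})$. Explicitly $\nabla=\nabla^{Ch}+g^{-1}D+\overline{g^{-1}D}$, and likewise for $\nabla'$ with $D+\overline{\partial}B$ in place of $D$; these are metric connections with curvature of type $(1,1)$. $\mathcal{T}=\mathcal{T}(E,g)=\{K\in\mathrm{End}\,E:K^2=-1,\ g(K\cdot,K\cdot)=g(\cdot,\cdot)\}$ with projection $\pi$ to $M$; $E^{0,1}_K$ is the $-i$ eigenspace of $K$. For a metric connection $\nabla$, $T_K\mathcal{T}=V_K\mathcal{T}\oplus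 H^\nabla_K\mathcal{T}$, where $V_K\mathcal{T}=\{A\in\mathfrak{o}(E_{\pi(K)},g):AK+KA=0\}$ is the vertical space and $H^\nabla_K\mathcal{T}$ is the set of velocities at $t=0$ of $\nabla$-parallel translates of $K$ along curves in $M$ starting at $\pi(K)$; $v^\nabla$ denotes the horizontal lift of $v\in T_{\pi(K)}M$. $\mathcal{J}^{(\nabla,I)}$ is defined by $\mathcal{J}^{(\nabla,I)}A=KA$ for $A\in V_K\mathcal{T}$ and $\mathcal{J}^{(\nabla,I)}v^\nabla=(Iv)^\nabla$. *)

theory Defs
  imports "HOL-Analysis.Analysis"
begin

section \<open>Smooth and holomorphic maps between open sets of normed spaces\<close>

primrec Ck_on :: "nat \<Rightarrow> 'a::real_normed_vector set \<Rightarrow> ('a \<Rightarrow> 'b::real_normed_vector) \<Rightarrow> bool" where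
  "Ck_on 0 S f \<longleftrightarrow> continuous_on S f"
| "Ck_on (Suc k) S f \<longleftrightarrow>
     (\<forall>x\<in>S. f differentiable (at x)) \<and> (\<forall>v. Ck_on k S (\<lambda>x. frechet_derivative f (at x) v))"

text \<open>Only used for open sets in finite-dimensional spaces, where continuity of all iterated
  directional derivatives is the usual notion of being of class C-infinity.\<close>

definition smooth_on :: "'a::real_normed_vector set \<Rightarrow> ('a \<Rightarrow> 'b::real_normed_vector) \<Rightarrow> bool" where
  "smooth_on S f \<longleftrightarrow> (\<forall>k. Ck_on k S f)"

definition holo_on :: "(complex^'n) set \<Rightarrow> (complex^'n \<Rightarrow> complex^'k) \<Rightarrow> bool" where
  "holo_on S f \<longleftrightarrow> smooth_on S f \<and>
     (\<forall>x\<in>S. \<forall>v. frechet_derivative f (at x) (\<i> *s v) = \<i> *s frechet_derivative f (at x) v)"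


section \<open>Charts, curves, tangent vectors, smooth maps\<close>

text \<open>A chart is a pair of its domain and the coordinate map.  A tangent vector is represented by
  the family of its coordinate vectors in all charts of the atlas around the base point (and
  0 in the other charts); such families are added and scaled chart by chart.\<close>

type_synonym ('p, 'a) chart = "'p set \<times> ('p \<Rightarrow> 'a)"
type_synonym ('p, 'a) tvec = "('p, 'a) chart \<Rightarrow> 'a"

definition tadd :: "('p, 'a::real_normed_vector) tvec \<Rightarrow> ('p, 'a) tvec \<Rightarrow> ('p, 'a) tvec" where
  "tadd v w = (\<lambda>c. v c + w c)"

definition tscale :: "real \<Rightarrow> ('p, 'a::real_normed_vector) tvec \<Rightarrow> ('p, 'a) tvec" where
  "tscale r v = (\<lambda>c. r *\<^sub>R v c)"

definition velocity ::
  "('p, 'a::real_normed_vector) chart set \<Rightarrow> (real \<Rightarrow> 'p) \<Rightarrow> real \<Rightarrow> ('p, 'a) tvec" where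
  "velocity A \<gamma> t =
     (\<lambda>c. if c \<in> A \<and> \<gamma> t \<in> fst c then vector_derivative (snd c \<circ> \<gamma>) (at t) else 0)"

text \<open>Smooth curves in a subset \<open>S\<close> of a manifold, defined for \<open>\<bar>t\<bar> < \<epsilon>\<close>.\<close>

definition smooth_curve ::
  "('p, 'a::real_normed_vector) chart set \<Rightarrow> 'p set \<Rightarrow> real \<Rightarrow> (real \<Rightarrow> 'p) \<Rightarrow> bool" where
  "smooth_curve A S \<epsilon> \<gamma> \<longleftrightarrow> (\<forall>t. \<bar>t\<bar> < \<epsilon> \<longrightarrow> \<gamma> t \<in> S \<and>
     (\<forall>(U, z)\<in>A. \<gamma> t \<in> U \<longrightarrow> (\<exists>\<delta>>0. \<gamma> ` ball t \<delta> \<subseteq> U \<and> smooth_on (ball t \<delta>) (z \<circ> \<gamma>))))"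

definition tangent_space ::
  "('p, 'a::real_normed_vector) chart set \<Rightarrow> 'p set \<Rightarrow> 'p \<Rightarrow> ('p, 'a) tvec set" where
  "tangent_space A S p = {velocity A \<gamma> 0 | \<gamma> \<epsilon>. \<epsilon> > 0 \<and> smooth_curve A S \<epsilon> \<gamma> \<and> \<gamma> 0 = p}"

text \<open>Smooth maps between (embedded) submanifolds \<open>S\<close>, \<open>S'\<close>: in charts of the ambient
  manifolds the map extends locally to a smooth map.\<close>

definition smooth_map ::
  "('p, 'a::real_normed_vector) chart set \<Rightarrow> 'p set \<Rightarrow>
   ('q, 'b::real_normed_vector) chart set \<Rightarrow> 'q set \<Rightarrow> ('p \<Rightarrow> 'q) \<Rightarrow> bool" where
  "smooth_map A S A' S' f \<longleftrightarrow> f ` S \<subseteq> S' \<and>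
     (\<forall>p\<in>S. \<forall>(U, z)\<in>A. \<forall>(U', z')\<in>A'. p \<in> U \<longrightarrow> f p \<in> U' \<longrightarrow>
       (\<exists>W F. open W \<and> z p \<in> W \<and> smooth_on W F \<and>
          (\<forall>q\<in>S \<inter> U. z q \<in> W \<longrightarrow> f q \<in> U' \<and> z' (f q) = F (z q))))"

definition differential ::
  "('p, 'a::real_normed_vector) chart set \<Rightarrow> 'p set \<Rightarrow>
   ('q, 'b::real_normed_vector) chart set \<Rightarrow> ('p \<Rightarrow> 'q) \<Rightarrow> 'p \<Rightarrow> ('p, 'a) tvec \<Rightarrow> ('q, 'b) tvec" where
  "differential A S A' f p w = (THE w'. \<exists>\<gamma> \<epsilon>. \<epsilon> > 0 \<and> smooth_curve A S \<epsilon> \<gamma> \<and> \<gamma> 0 = p \<and>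
     velocity A \<gamma> 0 = w \<and> w' = velocity A' (f \<circ> \<gamma>) 0)"

definition almost_complex ::
  "('p, 'a::real_normed_vector) chart set \<Rightarrow> 'p set \<Rightarrow>
   ('p \<Rightarrow> ('p, 'a) tvec \<Rightarrow> ('p, 'a) tvec) \<Rightarrow> bool" where
  "almost_complex A S J \<longleftrightarrow> (\<forall>p\<in>S. \<forall>w\<in>tangent_space A S p.
     J p w \<in> tangent_space A S p \<and> J p (J p w) = tscale (- 1) w)"

text \<open>Biholomorphisms: diffeomorphisms whose differential intertwines the complex structures.\<close>

definition biholomorphism ::
  "('p, 'a::real_normed_vector) chart set \<Rightarrow> 'p set \<Rightarrow>
   ('p \<Rightarrow> ('p, 'a) tvec \<Rightarrow> ('p, 'a) tvec) \<Rightarrow>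
   ('q, 'b::real_normed_vector) chart set \<Rightarrow> 'q set \<Rightarrow>
   ('q \<Rightarrow> ('q, 'b) tvec \<Rightarrow> ('q, 'b) tvec) \<Rightarrow> ('p \<Rightarrow> 'q) \<Rightarrow> bool" where
  "biholomorphism A S J A' S' J' f \<longleftrightarrow>
     almost_complex A S J \<and> almost_complex A' S' J' \<and>
     bij_betw f S S' \<and> smooth_map A S A' S' f \<and> smooth_map A' S' A S (inv_into S f) \<and>
     (\<forall>p\<in>S. \<forall>w\<in>tangent_space A S p.
        differential A S A' f p (J p w) = J' (f p) (differential A S A' f p w))"


section \<open>Complex manifolds\<close>

definition complex_manifold ::
  "('m::{t2_space,second_countable_topology}, complex^'n) chart set \<Rightarrow> bool" where
  "complex_manifold A \<longleftrightarrow>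
     (\<Union>(U, z)\<in>A. U) = UNIV \<and>
     (\<forall>(U, z)\<in>A. open U \<and> open (z ` U) \<and> homeomorphism U (z ` U) z (inv_into U z)) \<and>
     (\<forall>(U, z)\<in>A. \<forall>(U', z')\<in>A. holo_on (z ` (U \<inter> U')) (z' \<circ> inv_into U z))"

text \<open>The complex structure \<open>I\<close> of the manifold.\<close>

definition cI :: "('m, complex^'n) tvec \<Rightarrow> ('m, complex^'n) tvec" where
  "cI v = (\<lambda>c. \<i> *s v c)"

definition smooth_fun ::
  "('m, complex^'n) chart set \<Rightarrow> 'm set \<Rightarrow> ('m \<Rightarrow> 'b::real_normed_vector) \<Rightarrow> bool" where
  "smooth_fun A W f \<longleftrightarrow> (\<forall>(U, z)\<in>A. smooth_on (z ` (U \<inter> W)) (f \<circ> inv_into U z))"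

definition holo_fun ::
  "('m, complex^'n) chart set \<Rightarrow> 'm set \<Rightarrow> ('m \<Rightarrow> complex^'k) \<Rightarrow> bool" where
  "holo_fun A W f \<longleftrightarrow> (\<forall>(U, z)\<in>A. holo_on (z ` (U \<inter> W)) (f \<circ> inv_into U z))"

definition chart_at :: "('m, complex^'n) chart set \<Rightarrow> 'm \<Rightarrow> ('m, complex^'n) chart" where
  "chart_at A x = (SOME c. c \<in> A \<and> x \<in> fst c)"

definition dfun ::
  "('m, complex^'n) chart set \<Rightarrow> ('m \<Rightarrow> 'b::real_normed_vector) \<Rightarrow> 'm \<Rightarrow>
   ('m, complex^'n) tvec \<Rightarrow> 'b" where
  "dfun A f x v = (let c = chart_at A x in
     frechet_derivative (f \<circ> inv_into (fst c) (snd c)) (at (snd c x)) (v c))"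

text \<open>A complex-valued form on real tangent vectors has (0,1)-part
  \<open>v \<mapsto> (\<alpha>(v) + \<i> \<alpha>(I v)) / 2\<close>; here \<open>\<alpha> = df\<close>.\<close>

definition dbar_fun ::
  "('m, complex^'n) chart set \<Rightarrow> ('m \<Rightarrow> complex) \<Rightarrow> 'm \<Rightarrow> ('m, complex^'n) tvec \<Rightarrow> complex" where
  "dbar_fun A f x v = (dfun A f x v + \<i> * dfun A f x (cI v)) / 2"

text \<open>The vector at \<open>y\<close> with coordinates \<open>\<xi>\<close> in the chart \<open>c\<close>.\<close>

definition coord_vec ::
  "('m, complex^'n) chart set \<Rightarrow> ('m, complex^'n) chart \<Rightarrow> complex^'n \<Rightarrow> 'm \<Rightarrow>
   ('m, complex^'n) tvec" where
  "coord_vec A c \<xi> y = velocity A (\<lambda>t. inv_into (fst c) (snd c) (snd c y + t *\<^sub>R \<xi>)) 0"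


section \<open>Holomorphic Hermitian vector bundles\<close>

text \<open>The fibres are subspaces of one real vector space \<open>'v\<close>, in which they may lie arbitrarily:
  neither the position of the fibres nor the norm of \<open>'v\<close> carries geometric
  information (any family of finite-dimensional real vector spaces is of this form, e.g. inside
  its direct sum).  The bundle structure is given by the local trivializations \<open>(V, \<phi>)\<close> in
  \<open>trivs\<close>, where \<open>\<phi> x\<close> maps the model fibre isomorphically onto the fibre at \<open>x \<in> V\<close>.
  The base manifold is the type \<open>'m\<close>.\<close>

record ('m, 'v, 'n::finite, 'r::finite) herm_bundle =
  charts :: "('m, complex^'n) chart set"
  fibre :: "'m \<Rightarrow> 'v set"
  cstr :: "'m \<Rightarrow> 'v \<Rightarrow> 'v"
  trivs :: "('m set \<times> ('m \<Rightarrow> complex^'r \<Rightarrow> 'v)) set"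
  metric :: "'m \<Rightarrow> 'v \<Rightarrow> 'v \<Rightarrow> real"

definition holomorphic_vector_bundle ::
  "('m::{t2_space,second_countable_topology}, 'v::real_normed_vector, 'n::finite, 'r::finite) herm_bundle \<Rightarrow> bool" where
  "holomorphic_vector_bundle X \<longleftrightarrow>
     complex_manifold (charts X) \<and>
     (\<forall>x. subspace (fibre X x)) \<and>
     (\<Union>(V, \<phi>)\<in>trivs X. V) = UNIV \<and>
     (\<forall>(V, \<phi>)\<in>trivs X. open V \<and>
        (\<forall>x\<in>V. linear (\<phi> x) \<and> bij_betw (\<phi> x) UNIV (fibre X x) \<and>
               (\<forall>a. \<phi> x (\<i> *s a) = cstr X x (\<phi> x a)))) \<and>
     (\<forall>(V, \<phi>)\<in>trivs X. \<forall>(V', \<phi>')\<in>trivs X. \<forall>a.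
        holo_fun (charts X) (V \<inter> V') (\<lambda>x. inv (\<phi>' x) (\<phi> x a)))"

definition smooth_section ::
  "('m::topological_space, 'v::real_normed_vector, 'n::finite, 'r::finite) herm_bundle \<Rightarrow> 'm set \<Rightarrow> ('m \<Rightarrow> 'v) \<Rightarrow> bool" where
  "smooth_section X U s \<longleftrightarrow> (\<forall>x\<in>U. s x \<in> fibre X x) \<and>
     (\<forall>(V, \<phi>)\<in>trivs X. smooth_fun (charts X) (U \<inter> V) (\<lambda>x. inv (\<phi> x) (s x)))"

definition hermitian_metric ::
  "('m::topological_space, 'v::real_normed_vector, 'n::finite, 'r::finite) herm_bundle \<Rightarrow> bool" where
  "hermitian_metric X \<longleftrightarrow>
     (\<forall>x. \<forall>u\<in>fibre X x. \<forall>v\<in>fibre X x. \<forall>w\<in>fibre X x. \<forall>r.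
        metric X x (r *\<^sub>R u + v) w = r * metric X x u w + metric X x v w \<and>
        metric X x u v = metric X x v u \<and>
        metric X x (cstr X x u) (cstr X x v) = metric X x u v \<and>
        (u \<noteq> 0 \<longrightarrow> metric X x u u > 0)) \<and>
     (\<forall>U s t. open U \<and> smooth_section X U s \<and> smooth_section X U t \<longrightarrow>
        smooth_fun (charts X) U (\<lambda>x. metric X x (s x) (t x)))"


section \<open>The complexification \<open>E \<otimes> \<complex>\<close> and its eigenbundles\<close>

text \<open>The element \<open>a + \<i> b\<close> of the complexified fibre is represented by the pair \<open>(a, b)\<close>;
  \<open>map_prod F F\<close> is the complex-linear extension of a real-linear map \<open>F\<close>.\<close>

definition cmul :: "complex \<Rightarrow> 'v::real_vector \<times> 'v \<Rightarrow> 'v \<times> 'v" where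
  "cmul z w = (Re z *\<^sub>R fst w - Im z *\<^sub>R snd w, Re z *\<^sub>R snd w + Im z *\<^sub>R fst w)"

definition fibre_C :: "('m, 'v::real_normed_vector, 'n::finite, 'r::finite) herm_bundle \<Rightarrow> 'm \<Rightarrow> ('v \<times> 'v) set" where
  "fibre_C X x = fibre X x \<times> fibre X x"

definition metric_C ::
  "('m, 'v::real_normed_vector, 'n::finite, 'r::finite) herm_bundle \<Rightarrow> 'm \<Rightarrow> 'v \<times> 'v \<Rightarrow> 'v \<times> 'v \<Rightarrow> complex" where
  "metric_C X x u v =
     Complex (metric X x (fst u) (fst v) - metric X x (snd u) (snd v))
             (metric X x (fst u) (snd v) + metric X x (snd u) (fst v))"

definition eigenspace ::
  "('m, 'v::real_normed_vector, 'n::finite, 'r::finite) herm_bundle \<Rightarrow> complex \<Rightarrow> 'm \<Rightarrow> ('v \<Rightarrow> 'v) \<Rightarrow> ('v \<times> 'v) set" where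
  "eigenspace X z x K = {w \<in> fibre_C X x. map_prod K K w = cmul z w}"

abbreviation E10 :: "('m, 'v::real_normed_vector, 'n::finite, 'r::finite) herm_bundle \<Rightarrow> 'm \<Rightarrow> ('v \<times> 'v) set" where
  "E10 X x \<equiv> eigenspace X \<i> x (cstr X x)"

abbreviation E01 :: "('m, 'v::real_normed_vector, 'n::finite, 'r::finite) herm_bundle \<Rightarrow> 'm \<Rightarrow> ('v \<times> 'v) set" where
  "E01 X x \<equiv> eigenspace X (- \<i>) x (cstr X x)"

definition proj10 ::
  "('m, 'v::real_normed_vector, 'n::finite, 'r::finite) herm_bundle \<Rightarrow> 'm \<Rightarrow> 'v \<times> 'v \<Rightarrow> 'v \<times> 'v" where
  "proj10 X x u = cmul (1/2) (u - cmul \<i> (map_prod (cstr X x) (cstr X x) u))"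

definition smooth_section_C ::
  "('m::topological_space, 'v::real_normed_vector, 'n::finite, 'r::finite) herm_bundle \<Rightarrow> 'm set \<Rightarrow> ('m \<Rightarrow> 'v \<times> 'v) \<Rightarrow> bool" where
  "smooth_section_C X U s \<longleftrightarrow> smooth_section X U (fst \<circ> s) \<and> smooth_section X U (snd \<circ> s)"

definition smooth_section10 ::
  "('m::topological_space, 'v::real_normed_vector, 'n::finite, 'r::finite) herm_bundle \<Rightarrow> 'm set \<Rightarrow> ('m \<Rightarrow> 'v \<times> 'v) \<Rightarrow> bool" where
  "smooth_section10 X U s \<longleftrightarrow> smooth_section_C X U s \<and> (\<forall>x\<in>U. s x \<in> E10 X x)"


section \<open>The \<open>\<partial>\<close>-bar operators\<close>

text \<open>\<open>E\<^sup>1\<^sup>0\<close> is a holomorphic bundle via \<open>E \<cong> E\<^sup>1\<^sup>0\<close>, \<open>v \<mapsto> (v - \<i> J v) / 2\<close>, whose inverse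
  is \<open>w \<mapsto> 2 Re w\<close>.  On it and its associated bundles \<open>\<partial>\<close>-bar differentiates the coefficients
  with respect to the holomorphic frame given by a trivialization.\<close>

definition triv_at ::
  "('m, 'v::real_normed_vector, 'n::finite, 'r::finite) herm_bundle \<Rightarrow> 'm \<Rightarrow> 'm \<Rightarrow> complex^'r \<Rightarrow> 'v" where
  "triv_at X x = snd (SOME T. T \<in> trivs X \<and> x \<in> fst T)"

definition dbar_E10 ::
  "('m, 'v::real_normed_vector, 'n::finite, 'r::finite) herm_bundle \<Rightarrow> ('m \<Rightarrow> 'v \<times> 'v) \<Rightarrow> 'm \<Rightarrow>
   ('m, complex^'n) tvec \<Rightarrow> 'v \<times> 'v" where
  "dbar_E10 X s x v = (let \<phi> = triv_at X x in
     proj10 X x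
       (\<phi> x (\<chi> k. dbar_fun (charts X) (\<lambda>y. inv (\<phi> y) (2 *\<^sub>R fst (s y)) $ k) x v), 0))"

text \<open>The local holomorphic section of \<open>E\<^sup>1\<^sup>0\<close> with value \<open>a\<close> at \<open>x\<close> which is constant in the
  frame of \<open>triv_at X x\<close>.\<close>

definition holo_ext ::
  "('m, 'v::real_normed_vector, 'n::finite, 'r::finite) herm_bundle \<Rightarrow> 'm \<Rightarrow> 'v \<times> 'v \<Rightarrow> 'm \<Rightarrow> 'v \<times> 'v" where
  "holo_ext X x a y = (let \<phi> = triv_at X x in
     proj10 X y (\<phi> y (inv (\<phi> x) (2 *\<^sub>R fst a)), 0))"

text \<open>Elements of \<open>\<Lambda>\<^sup>2 E*\<^sup>1\<^sup>0\<close> are alternating complex-bilinear forms on \<open>E\<^sup>1\<^sup>0\<close>; their values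
  off \<open>E\<^sup>1\<^sup>0\<close> are irrelevant.\<close>

type_synonym 'v bform = "'v \<times> 'v \<Rightarrow> 'v \<times> 'v \<Rightarrow> complex"

definition alt_form10 ::
  "('m, 'v::real_normed_vector, 'n::finite, 'r::finite) herm_bundle \<Rightarrow> 'm \<Rightarrow> 'v bform \<Rightarrow> bool" where
  "alt_form10 X x \<beta> \<longleftrightarrow> (\<forall>u\<in>E10 X x. \<forall>v\<in>E10 X x. \<forall>w\<in>E10 X x. \<forall>z.
     \<beta> (cmul z u + v) w = z * \<beta> u w + \<beta> v w \<and> \<beta> u v = - \<beta> v u)"

definition section_L2 ::
  "('m::topological_space, 'v::real_normed_vector, 'n::finite, 'r::finite) herm_bundle \<Rightarrow> ('m \<Rightarrow> 'v bform) \<Rightarrow> bool" where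
  "section_L2 X B \<longleftrightarrow> (\<forall>x. alt_form10 X x (B x)) \<and>
     (\<forall>U s t. open U \<and> smooth_section10 X U s \<and> smooth_section10 X U t \<longrightarrow>
        smooth_fun (charts X) U (\<lambda>x. B x (s x) (t x)))"

text \<open>\<open>(0,1)\<close>-forms are regarded as complex-valued real-linear forms \<open>\<alpha>\<close> on \<open>TM\<close> with
  \<open>\<alpha>(I v) = - \<i> \<alpha>(v)\<close>.\<close>

definition section_form01_L2 ::
  "('m::topological_space, 'v::real_normed_vector, 'n::finite, 'r::finite) herm_bundle \<Rightarrow>
   ('m \<Rightarrow> ('m, complex^'n) tvec \<Rightarrow> 'v bform) \<Rightarrow> bool" where
  "section_form01_L2 X D \<longleftrightarrow>
     (\<forall>x. \<forall>v\<in>tangent_space (charts X) UNIV x. \<forall>w\<in>tangent_space (charts X) UNIV x.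
        alt_form10 X x (D x v) \<and>
        (\<forall>a\<in>E10 X x. \<forall>b\<in>E10 X x. \<forall>r.
           D x (tadd (tscale r v) w) a b = complex_of_real r * D x v a b + D x w a b \<and>
           D x (cI v) a b = - \<i> * D x v a b)) \<and>
     (\<forall>c\<in>charts X. \<forall>\<xi> U s t. open U \<and> smooth_section10 X U s \<and> smooth_section10 X U t \<longrightarrow>
        smooth_fun (charts X) (U \<inter> fst c) (\<lambda>x. D x (coord_vec (charts X) c \<xi> x) (s x) (t x)))"

definition dbar_L2 ::
  "('m, 'v::real_normed_vector, 'n::finite, 'r::finite) herm_bundle \<Rightarrow> ('m \<Rightarrow> 'v bform) \<Rightarrow>
   'm \<Rightarrow> ('m, complex^'n) tvec \<Rightarrow> 'v bform" where
  "dbar_L2 X B x v a b =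
     dbar_fun (charts X) (\<lambda>y. B y (holo_ext X x a y) (holo_ext X x b y)) x v"

text \<open>On a scalar \<open>(0,1)\<close>-form \<open>\<alpha>\<close> and vector fields \<open>v, w\<close> with constant coordinates, \<open>\<partial>\<close>-bar is
  normalized as the \<open>(0,2)\<close>-part of \<open>d\<alpha>\<close>, i.e. the \<open>\<partial>\<close>-bar derivative of \<open>\<alpha>(w)\<close> along \<open>v\<close> minus
  that of \<open>\<alpha>(v)\<close> along \<open>w\<close>.\<close>

definition dbar_form01_L2 ::
  "('m, 'v::real_normed_vector, 'n::finite, 'r::finite) herm_bundle \<Rightarrow>
   ('m \<Rightarrow> ('m, complex^'n) tvec \<Rightarrow> 'v bform) \<Rightarrow>
   'm \<Rightarrow> ('m, complex^'n) tvec \<Rightarrow> ('m, complex^'n) tvec \<Rightarrow> 'v bform" where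
  "dbar_form01_L2 X D x v w a b = (let A = charts X; c = chart_at A x in
     dbar_fun A (\<lambda>y. D y (coord_vec A c (w c) y) (holo_ext X x a y) (holo_ext X x b y)) x v -
     dbar_fun A (\<lambda>y. D y (coord_vec A c (v c) y) (holo_ext X x a y) (holo_ext X x b y)) x w)"

definition dbar_closed ::
  "('m, 'v::real_normed_vector, 'n::finite, 'r::finite) herm_bundle \<Rightarrow>
   ('m \<Rightarrow> ('m, complex^'n) tvec \<Rightarrow> 'v bform) \<Rightarrow> bool" where
  "dbar_closed X D \<longleftrightarrow>
     (\<forall>x. \<forall>v\<in>tangent_space (charts X) UNIV x. \<forall>w\<in>tangent_space (charts X) UNIV x.
        \<forall>a\<in>E10 X x. \<forall>b\<in>E10 X x. dbar_form01_L2 X D x v w a b = 0)"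


section \<open>The endomorphisms \<open>g\<^sup>-\<^sup>1 \<beta>\<close> and their exponentials\<close>

text \<open>\<open>g\<^sup>-\<^sup>1 \<beta>\<close> for \<open>\<beta> \<in> \<Lambda>\<^sup>2 E*\<^sup>1\<^sup>0\<close>, an endomorphism of the complexified fibre vanishing on \<open>E\<^sup>0\<^sup>1\<close>.\<close>

definition g_inv ::
  "('m, 'v::real_normed_vector, 'n::finite, 'r::finite) herm_bundle \<Rightarrow> 'm \<Rightarrow> 'v bform \<Rightarrow> 'v \<times> 'v \<Rightarrow> 'v \<times> 'v" where
  "g_inv X x \<beta> u =
     (THE w. w \<in> E01 X x \<and> (\<forall>v\<in>E10 X x. metric_C X x w v = \<beta> (proj10 X x u) v))"

definition endo_exp :: "('a::real_normed_vector \<Rightarrow> 'a) \<Rightarrow> 'a \<Rightarrow> 'a" where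
  "endo_exp F u = (\<Sum>k. (F ^^ k) u /\<^sub>R fact k)"


section \<open>Connections\<close>

text \<open>A connection acts on local sections: \<open>N x v s\<close> is the derivative in direction \<open>v\<close> at \<open>x\<close> of a
  section \<open>s\<close> that is smooth on some neighbourhood of \<open>x\<close>.\<close>

type_synonym ('m, 'v, 'n) conn = "'m \<Rightarrow> ('m, complex^'n) tvec \<Rightarrow> ('m \<Rightarrow> 'v) \<Rightarrow> 'v"

definition connection ::
  "('m::topological_space, 'v::real_normed_vector, 'n::finite, 'r::finite) herm_bundle \<Rightarrow> ('m, 'v, 'n) conn \<Rightarrow> bool" where
  "connection X N \<longleftrightarrow>
     (\<forall>U x s s'. open U \<and> x \<in> U \<and> smooth_section X U s \<and> smooth_section X U s' \<longrightarrow>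
        (\<forall>v\<in>tangent_space (charts X) UNIV x.
           N x v s \<in> fibre X x \<and>
           ((\<forall>y\<in>U. s y = s' y) \<longrightarrow> N x v s = N x v s') \<and>
           N x v (\<lambda>y. s y + s' y) = N x v s + N x v s' \<and>
           (\<forall>f. smooth_fun (charts X) U f \<longrightarrow>
              N x v (\<lambda>y. f y *\<^sub>R s y) = dfun (charts X) f x v *\<^sub>R s x + f x *\<^sub>R N x v s) \<and>
           (\<forall>w\<in>tangent_space (charts X) UNIV x. \<forall>r.
              N x (tadd (tscale r v) w) s = r *\<^sub>R N x v s + N x w s))) \<and>
     (\<forall>c\<in>charts X. \<forall>\<xi> U s. open U \<and> smooth_section X U s \<longrightarrow>
        smooth_section X (U \<inter> fst c) (\<lambda>x. N x (coord_vec (charts X) c \<xi> x) s))"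

definition conn_C :: "('m, 'v::real_normed_vector, 'n::finite) conn \<Rightarrow> ('m, 'v \<times> 'v, 'n) conn" where
  "conn_C N x v s = (N x v (fst \<circ> s), N x v (snd \<circ> s))"

definition conn01 :: "('m, 'v::real_normed_vector, 'n::finite) conn \<Rightarrow> ('m, 'v \<times> 'v, 'n) conn" where
  "conn01 N x v s = cmul (1/2) (conn_C N x v s + cmul \<i> (conn_C N x (cI v) s))"

definition chern_connection ::
  "('m::topological_space, 'v::real_normed_vector, 'n::finite, 'r::finite) herm_bundle \<Rightarrow> ('m, 'v, 'n) conn \<Rightarrow> bool" where
  "chern_connection X N \<longleftrightarrow> connection X N \<and>
     (\<forall>U x. open U \<and> x \<in> U \<longrightarrow> (\<forall>v\<in>tangent_space (charts X) UNIV x.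
        (\<forall>s t. smooth_section X U s \<and> smooth_section X U t \<longrightarrow>
           dfun (charts X) (\<lambda>y. metric X y (s y) (t y)) x v =
             metric X x (N x v s) (t x) + metric X x (s x) (N x v t)) \<and>
        (\<forall>s. smooth_section X U s \<longrightarrow> N x v (\<lambda>y. cstr X y (s y)) = cstr X x (N x v s)) \<and>
        (\<forall>s. smooth_section10 X U s \<longrightarrow> conn01 N x v s = dbar_E10 X s x v)))"

text \<open>\<open>N\<^sup>0\<^sup>1 = N'\<^sup>0\<^sup>1 + g\<^sup>-\<^sup>1 D\<close> on sections of the complexified bundle.\<close>

definition conn01_eq_plus ::
  "('m::topological_space, 'v::real_normed_vector, 'n::finite, 'r::finite) herm_bundle \<Rightarrow> ('m, 'v, 'n) conn \<Rightarrow>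
   ('m, 'v, 'n) conn \<Rightarrow> ('m \<Rightarrow> ('m, complex^'n) tvec \<Rightarrow> 'v bform) \<Rightarrow> bool" where
  "conn01_eq_plus X N N' D \<longleftrightarrow>
     (\<forall>U x s. open U \<and> x \<in> U \<and> smooth_section_C X U s \<longrightarrow>
        (\<forall>v\<in>tangent_space (charts X) UNIV x.
           conn01 N x v s = conn01 N' x v s + g_inv X x (D x v) (s x)))"


section \<open>Twistor space\<close>

text \<open>Real endomorphisms of a fibre, as functions that are \<open>undefined\<close> off the fibre, and the atlas
  which they inherit on the total space of the endomorphism bundle.\<close>

definition End_fibre :: "('m, 'v::real_normed_vector, 'n::finite, 'r::finite) herm_bundle \<Rightarrow> 'm \<Rightarrow> ('v \<Rightarrow> 'v) set" where
  "End_fibre X x = {K \<in> fibre X x \<rightarrow>\<^sub>E fibre X x.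
     \<forall>u\<in>fibre X x. \<forall>v\<in>fibre X x. \<forall>r. K (r *\<^sub>R u + v) = r *\<^sub>R K u + K v}"

definition End_total :: "('m, 'v::real_normed_vector, 'n::finite, 'r::finite) herm_bundle \<Rightarrow> ('m \<times> ('v \<Rightarrow> 'v)) set" where
  "End_total X = (SIGMA x:UNIV. End_fibre X x)"

definition End_charts ::
  "('m, 'v::real_normed_vector, 'n::finite, 'r::finite) herm_bundle \<Rightarrow>
   ('m \<times> ('v \<Rightarrow> 'v), (complex^'n) \<times> ((complex^'r) \<Rightarrow>\<^sub>L (complex^'r))) chart set" where
  "End_charts X = {((SIGMA x:U \<inter> V. End_fibre X x),
                    (\<lambda>(x, K). (z x, Blinfun (\<lambda>a. inv (\<phi> x) (K (\<phi> x a)))))) | U z V \<phi>.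
                    (U, z) \<in> charts X \<and> (V, \<phi>) \<in> trivs X}"

type_synonym ('m, 'v, 'n, 'r) End_tvec =
  "('m \<times> ('v \<Rightarrow> 'v), (complex^'n) \<times> ((complex^'r) \<Rightarrow>\<^sub>L (complex^'r))) tvec"

definition twistor_space ::
  "('m, 'v::real_normed_vector, 'n::finite, 'r::finite) herm_bundle \<Rightarrow> ('m \<times> ('v \<Rightarrow> 'v)) set" where
  "twistor_space X = {(x, K). K \<in> End_fibre X x \<and>
     (\<forall>u\<in>fibre X x. K (K u) = - u) \<and>
     (\<forall>u\<in>fibre X x. \<forall>v\<in>fibre X x. metric X x (K u) (K v) = metric X x u v)}"

definition vertical_space ::
  "('m, 'v::real_normed_vector, 'n::finite, 'r::finite) herm_bundle \<Rightarrow> 'm \<times> ('v \<Rightarrow> 'v) \<Rightarrow> ('v \<Rightarrow> 'v) set" where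
  "vertical_space X = (\<lambda>(x, K). {A \<in> End_fibre X x.
     (\<forall>u\<in>fibre X x. \<forall>v\<in>fibre X x. metric X x (A u) v = - metric X x u (A v)) \<and>
     (\<forall>u\<in>fibre X x. A (K u) + K (A u) = 0)})"

definition vert_vec ::
  "('m, 'v::real_normed_vector, 'n::finite, 'r::finite) herm_bundle \<Rightarrow> 'm \<times> ('v \<Rightarrow> 'v) \<Rightarrow> ('v \<Rightarrow> 'v) \<Rightarrow>
   ('m, 'v, 'n, 'r) End_tvec" where
  "vert_vec X = (\<lambda>(x, K) A.
     velocity (End_charts X) (\<lambda>t. (x, \<lambda>u\<in>fibre X x. K u + t *\<^sub>R A u)) 0)"

text \<open>Smooth sections along a curve \<open>\<gamma>\<close> over an open set \<open>T\<close> of times, and their covariant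
  derivative, computed in a local frame via the Leibniz rule from the values of the connection on
  the frame.\<close>

definition smooth_along ::
  "('m, 'v::real_normed_vector, 'n::finite, 'r::finite) herm_bundle \<Rightarrow> real set \<Rightarrow> (real \<Rightarrow> 'm) \<Rightarrow> (real \<Rightarrow> 'v) \<Rightarrow> bool" where
  "smooth_along X T \<gamma> s \<longleftrightarrow> (\<forall>t\<in>T. s t \<in> fibre X (\<gamma> t) \<and>
     (\<forall>(V, \<phi>)\<in>trivs X. \<gamma> t \<in> V \<longrightarrow> (\<exists>\<delta>>0. \<gamma> ` ball t \<delta> \<subseteq> V \<and>
        smooth_on (ball t \<delta>) (\<lambda>\<tau>. inv (\<phi> (\<gamma> \<tau>)) (s \<tau>)))))"

definition cov_along ::
  "('m, 'v::real_normed_vector, 'n::finite, 'r::finite) herm_bundle \<Rightarrow> ('m, 'v, 'n) conn \<Rightarrow>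
   (real \<Rightarrow> 'm) \<Rightarrow> (real \<Rightarrow> 'v) \<Rightarrow> real \<Rightarrow> 'v" where
  "cov_along X N \<gamma> s t = (let \<phi> = triv_at X (\<gamma> t); f = (\<lambda>\<tau>. inv (\<phi> (\<gamma> \<tau>)) (s \<tau>)) in
     \<phi> (\<gamma> t) (vector_derivative f (at t)) +
     (\<Sum>b\<in>Basis. (f t \<bullet> b) *\<^sub>R N (\<gamma> t) (velocity (charts X) \<gamma> t) (\<lambda>y. \<phi> y b)))"

text \<open>\<open>t \<mapsto> K t\<close> is parallel along \<open>\<gamma>\<close> for the induced connection
  \<open>(\<nabla>K) s = \<nabla>(K s) - K (\<nabla>s)\<close> on the endomorphism bundle.\<close>

definition parallel_endo ::
  "('m, 'v::real_normed_vector, 'n::finite, 'r::finite) herm_bundle \<Rightarrow> ('m, 'v, 'n) conn \<Rightarrow>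
   real \<Rightarrow> (real \<Rightarrow> 'm) \<Rightarrow> (real \<Rightarrow> 'v \<Rightarrow> 'v) \<Rightarrow> bool" where
  "parallel_endo X N \<epsilon> \<gamma> K \<longleftrightarrow>
     smooth_curve (charts X) UNIV \<epsilon> \<gamma> \<and>
     smooth_curve (End_charts X) (End_total X) \<epsilon> (\<lambda>t. (\<gamma> t, K t)) \<and>
     (\<forall>T s. open T \<and> T \<subseteq> {-\<epsilon><..<\<epsilon>} \<and> smooth_along X T \<gamma> s \<longrightarrow>
        (\<forall>t\<in>T. cov_along X N \<gamma> (\<lambda>\<tau>. K \<tau> (s \<tau>)) t = K t (cov_along X N \<gamma> s t)))"

text \<open>The horizontal lift of \<open>v\<close> to \<open>p = (x, K)\<close>: the initial velocity of the parallel translate of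
  \<open>K\<close> along a curve with initial velocity \<open>v\<close>.\<close>

definition hlift ::
  "('m, 'v::real_normed_vector, 'n::finite, 'r::finite) herm_bundle \<Rightarrow> ('m, 'v, 'n) conn \<Rightarrow>
   'm \<times> ('v \<Rightarrow> 'v) \<Rightarrow> ('m, complex^'n) tvec \<Rightarrow> ('m, 'v, 'n, 'r) End_tvec" where
  "hlift X N p v = (THE w. \<exists>\<epsilon> \<gamma> K. \<epsilon> > 0 \<and> parallel_endo X N \<epsilon> \<gamma> K \<and> (\<gamma> 0, K 0) = p \<and>
     velocity (charts X) \<gamma> 0 = v \<and> w = velocity (End_charts X) (\<lambda>t. (\<gamma> t, K t)) 0)"

text \<open>Vertical \<open>A\<close> goes to \<open>K A\<close> (composition on the fibre), and the lift of \<open>v\<close> to the lift of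
  \<open>I v\<close>.\<close>

definition twistor_J ::
  "('m, 'v::real_normed_vector, 'n::finite, 'r::finite) herm_bundle \<Rightarrow> ('m, 'v, 'n) conn \<Rightarrow>
   'm \<times> ('v \<Rightarrow> 'v) \<Rightarrow> ('m, 'v, 'n, 'r) End_tvec \<Rightarrow> ('m, 'v, 'n, 'r) End_tvec" where
  "twistor_J X N p w = (THE w'. \<exists>A\<in>vertical_space X p. \<exists>v\<in>tangent_space (charts X) UNIV (fst p).
     w = tadd (vert_vec X p A) (hlift X N p v) \<and>
     w' = tadd (vert_vec X p (compose (fibre X (fst p)) (snd p) A)) (hlift X N p (cI v)))"

text \<open>\<open>K'\<close> corresponds to \<open>K\<close> under the complex endomorphisms \<open>P x\<close> of the complexified fibres if
  the \<open>-\<i>\<close> eigenspace of \<open>K'\<close> is the image of that of \<open>K\<close>.\<close>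

definition corresponds ::
  "('m, 'v::real_normed_vector, 'n::finite, 'r::finite) herm_bundle \<Rightarrow> ('m \<Rightarrow> 'v \<times> 'v \<Rightarrow> 'v \<times> 'v) \<Rightarrow>
   'm \<Rightarrow> ('v \<Rightarrow> 'v) \<Rightarrow> ('v \<Rightarrow> 'v) \<Rightarrow> bool" where
  "corresponds X P x K K' \<longleftrightarrow> (x, K') \<in> twistor_space X \<and>
     eigenspace X (- \<i>) x K' = P x ` eigenspace X (- \<i>) x K"

definition induced_map ::
  "('m, 'v::real_normed_vector, 'n::finite, 'r::finite) herm_bundle \<Rightarrow> ('m \<Rightarrow> 'v \<times> 'v \<Rightarrow> 'v \<times> 'v) \<Rightarrow>
   'm \<times> ('v \<Rightarrow> 'v) \<Rightarrow> 'm \<times> ('v \<Rightarrow> 'v)" where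
  "induced_map X P = (\<lambda>(x, K). (x, THE K'. corresponds X P x K K'))"

end

theory Submission
  imports Defs
begin

text \<open>
  The proof reduces the statement to an identity between matrices.

  A complex structure \<open>K\<close> is recovered from \<open>E\<^sup>0\<^sup>1\<^sub>K\<close>, which consists of the vectors \<open>u + \<i> K u\<close>.  For
  real \<open>u\<close> one has \<open>g\<^sup>-\<^sup>1 B u = b u + \<i> J b u\<close> with a real endomorphism \<open>b\<close> that is skew and anticommutes
  with \<open>J\<close>.  Since \<open>g\<^sup>-\<^sup>1 B\<close> has square zero, \<open>exp(- g\<^sup>-\<^sup>1 B) = 1 - g\<^sup>-\<^sup>1 B\<close>, and it maps \<open>u + \<i> K u\<close> to
  \<open>A u + \<i> A K u\<close> with \<open>A = 1 - b + J b K\<close>.  The space \<open>E\<^sup>0\<^sup>1\<^sub>K\<close> is isotropic and the exponential is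
  orthogonal; hence \<open>A\<close> is invertible and the new structure is \<open>K' = A K A\<^sup>-\<^sup>1\<close>
  (\<open>twist_invertible\<close>, \<open>corresponds_iff\<close>).  The formula is smooth in \<open>K\<close> and in the base point, and
  \<open>-B\<close> yields the inverse map (\<open>deform_inverse\<close>).

  In a holomorphic frame let \<open>\<theta>(v)\<close> be the matrix of a connection in the direction \<open>v\<close>.  The Chern
  connection satisfies \<open>\<theta>(I v) = J \<theta>(v)\<close>, and adding \<open>g\<^sup>-\<^sup>1 D\<close> to its (0,1)-part preserves this relation
  and the compatibility with the metric.  For the two connections at hand,
  \<open>\<theta>'(v) = \<theta>(v) + \<partial>\<^sub>v b - J \<partial>\<^sub>I\<^sub>v b + (\<theta>(v) - J \<theta>(v) J) b\<close> (\<open>conn_mat_gauge\<close>).  This expresses in real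
  terms that the exponential carries one (0,1)-part to the other.

  A tangent vector of the twistor space at \<open>K\<close> has coordinates \<open>(\<xi>, \<kappa>)\<close>, with \<open>\<xi>\<close> its projection to the
  base.  Horizontal lifts satisfy \<open>\<kappa> = [K, \<theta>(\<xi>)]\<close>, so the vertical part is \<open>\<kappa> + [\<theta>(\<xi>), K]\<close>, and the
  almost complex structure maps \<open>(\<xi>, \<kappa>)\<close> to \<open>(\<i> \<xi>, K (\<kappa> + [\<theta>(\<xi>), K]) - [J \<theta>(\<xi>), K])\<close>
  (\<open>twistor_J_coords\<close>).  Horizontal lifts exist because parallel transport is a linear differential
  equation (\<open>parallel_frame\<close>).  Its solution is an isometry between fibres; transporting curves of
  orthogonal complex structures of one fibre shows that every sum of a vertical and a horizontal
  vector is tangent to the twistor space (\<open>transported_curve\<close>, \<open>orth_cstr_curve\<close>).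

  Differentiating \<open>K' A = A K\<close> gives the differential of the map in these coordinates.  That it
  intertwines the two almost complex structures is then a consequence of the relations between
  \<open>J\<close>, \<open>b\<close>, \<open>K\<close>, \<open>\<theta>\<close> and \<open>\<theta>'\<close> above (\<open>deformation_holomorphic_identity\<close>).
\<close>

section \<open>Iterated directional derivatives\<close>

lemma Ck_on_cong:
  assumes "open S" "\<And>x. x \<in> S \<Longrightarrow> f x = g x" "Ck_on k S f"
  shows "Ck_on k S g"
  using assms(2,3)
proof (induction k arbitrary: f g)
  case 0
  then show ?case by (auto cong: continuous_on_cong)
next
  case (Suc k)
  have D: "f differentiable (at x)" if "x \<in> S" for x using Suc.prems(2) that by auto
  have "g differentiable (at x) \<and> frechet_derivative g (at x) = frechet_derivative f (at x)" if x: "x \<in> S" for x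
  proof -
    have "(f has_derivative frechet_derivative f (at x)) (at x)"
      using D[OF x] frechet_derivative_works by blast
    then have "(g has_derivative frechet_derivative f (at x)) (at x)"
      using has_derivative_transform_within_open[OF _ assms(1) x] Suc.prems(1) by blast
    then show ?thesis
      by (metis differentiableI frechet_derivative_at)
  qed
  then show ?case
    using Suc.IH[of "\<lambda>x. frechet_derivative f (at x) _" "\<lambda>x. frechet_derivative g (at x) _"] Suc.prems(2)
    by auto
qed

lemma Ck_on_subset: "Ck_on k S f \<Longrightarrow> T \<subseteq> S \<Longrightarrow> Ck_on k T f"
  by (induction k arbitrary: f) (auto intro: continuous_on_subset)

lemma Ck_on_SucI:
  assumes "open S" "\<And>x. x \<in> S \<Longrightarrow> (f has_derivative f' x) (at x)"
    "\<And>v. Ck_on k S (\<lambda>x. f' x v)"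
  shows "Ck_on (Suc k) S f"
proof -
  have "frechet_derivative f (at x) = f' x" if "x \<in> S" for x
    using assms(2)[OF that] frechet_derivative_at by metis
  moreover have "Ck_on k S (\<lambda>x. frechet_derivative f (at x) v)" for v
    by (rule Ck_on_cong[OF assms(1) _ assms(3)[of v]]) (simp add: calculation)
  ultimately show ?thesis
    using assms(2) by (auto simp: differentiable_def)
qed

lemma Ck_on_Suc_has_derivative:
  "Ck_on (Suc k) S f \<Longrightarrow> x \<in> S \<Longrightarrow> (f has_derivative frechet_derivative f (at x)) (at x)"
  by (simp add: frechet_derivative_works)

lemma Ck_on_SucD: "Ck_on (Suc k) S f \<Longrightarrow> Ck_on k S f"
proof (induction k arbitrary: f)
  case 0
  then show ?case
    by (auto intro!: continuous_at_imp_continuous_on differentiable_imp_continuous_within)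
next
  case (Suc k)
  then show ?case by auto
qed

lemma Ck_on_const: "open S \<Longrightarrow> Ck_on k S (\<lambda>x. c)"
  by (induction k arbitrary: c) (auto simp del: Ck_on.simps(2) intro!: Ck_on_SucI[where f' = "\<lambda>x v. 0"])

lemma Ck_on_linear: "open S \<Longrightarrow> bounded_linear L \<Longrightarrow> Ck_on k S L"
  by (cases k) (auto simp del: Ck_on.simps(2) intro!: Ck_on_SucI[where f' = "\<lambda>x. L"] Ck_on_const
      linear_continuous_on bounded_linear_imp_has_derivative)

lemma Ck_on_add:
  "open S \<Longrightarrow> Ck_on k S f \<Longrightarrow> Ck_on k S g \<Longrightarrow> Ck_on k S (\<lambda>x. f x + g x)"
proof (induction k arbitrary: f g)
  case 0
  then show ?case by (auto intro: continuous_intros)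
next
  case (Suc k)
  note d = Suc.prems(2,3)[THEN Ck_on_Suc_has_derivative]
  show ?case
    by (rule Ck_on_SucI[OF \<open>open S\<close> has_derivative_add[OF d]])
      (use Suc in auto)
qed

lemma Ck_on_bounded_linear:
  "open S \<Longrightarrow> bounded_linear L \<Longrightarrow> Ck_on k S f \<Longrightarrow> Ck_on k S (\<lambda>x. L (f x))"
proof (induction k arbitrary: f)
  case 0
  then show ?case by (auto intro: bounded_linear.continuous_on)
next
  case (Suc k)
  note d = Suc.prems(3)[THEN Ck_on_Suc_has_derivative]
  show ?case
    by (rule Ck_on_SucI[OF \<open>open S\<close> bounded_linear.has_derivative[OF \<open>bounded_linear L\<close> d]])
      (use Suc in auto)
qed

lemma Ck_on_bilinear:
  assumes "bounded_bilinear bop" "open S"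
  shows "Ck_on k S f \<Longrightarrow> Ck_on k S g \<Longrightarrow> Ck_on k S (\<lambda>x. bop (f x) (g x))"
proof (induction k arbitrary: f g)
  case 0
  then show ?case using bounded_bilinear.continuous_on[OF assms(1)] by auto
next
  case (Suc k)
  note d = Suc.prems[THEN Ck_on_Suc_has_derivative]
  show ?case
    by (rule Ck_on_SucI[OF assms(2) bounded_bilinear.FDERIV[OF assms(1) d]])
      (use Suc Suc.prems[THEN Ck_on_SucD] in \<open>auto intro!: Ck_on_add assms(2)\<close>)
qed

lemma Ck_on_sum:
  "open S \<Longrightarrow> (\<And>i. i \<in> I \<Longrightarrow> Ck_on k S (f i)) \<Longrightarrow> Ck_on k S (\<lambda>x. \<Sum>i\<in>I. f i x)"
  by (induction I rule: infinite_finite_induct) (auto intro!: Ck_on_const Ck_on_add)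

text \<open>Differentiability of \<open>f\<close> refers to full neighbourhoods, so it is a local condition even on a
  set that is not open.\<close>

lemma Ck_on_local:
  assumes "\<And>x. x \<in> S \<Longrightarrow> \<exists>T. open T \<and> x \<in> T \<and> Ck_on k T f"
  shows "Ck_on k S f"
  using assms
proof (induction k arbitrary: f)
  case 0
  then show ?case
    by (simp add: continuous_on_eq_continuous_at continuous_at_imp_continuous_on) 
     (metis continuous_at_imp_continuous_on continuous_on_eq_continuous_at)
next
  case (Suc k)
  then show ?case by (fastforce)
qed

text \<open>Finite dimension without an inner product: charts of the endomorphism bundle take values in a
  product with a space of linear maps under the operator norm.\<close>

definition fin_dim :: "'a::real_normed_vector itself \<Rightarrow> bool" where
  "fin_dim _ \<longleftrightarrow> (\<exists>(B::'a set) c. finite B \<and> (\<forall>b. bounded_linear (c b)) \<and>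
     (\<forall>v. v = (\<Sum>b\<in>B. c b v *\<^sub>R b)))"

lemma fin_dim_euclidean: "fin_dim TYPE('a::euclidean_space)"
  unfolding fin_dim_def
  by (rule exI[of _ Basis], rule exI[of _ "\<lambda>b v. v \<bullet> b"])
    (auto simp: euclidean_representation intro: bounded_linear_inner_left)

lemma fin_dimI:
  assumes "finite I" "\<And>i. i \<in> I \<Longrightarrow> bounded_linear (c i)" 
    "\<And>v. (v::'a::real_normed_vector) = (\<Sum>i\<in>I. c i v *\<^sub>R e i)"
  shows "fin_dim TYPE('a)"
proof -
  let ?c = "\<lambda>b v. \<Sum>i\<in>{i\<in>I. e i = b}. c i v"
  have "v = (\<Sum>b\<in>e ` I. ?c b v *\<^sub>R b)" for v
  proof -
    have "(\<Sum>b\<in>e ` I. ?c b v *\<^sub>R b) = (\<Sum>b\<in>e ` I. \<Sum>i\<in>{i\<in>I. e i = b}. c i v *\<^sub>R e i)"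
      by (auto simp: scaleR_sum_left intro!: sum.cong)
    also have "\<dots> = (\<Sum>i\<in>I. c i v *\<^sub>R e i)"
      by (rule sum.image_gen[symmetric]) (rule assms)
    finally show ?thesis using assms(3)[of v] by simp
  qed
  moreover have "bounded_linear (?c b)" for b
    by (rule bounded_linear_sum) (use assms in auto)
  ultimately show ?thesis unfolding fin_dim_def 
    using assms(1) by (intro exI[of _ "e ` I"] exI[of _ ?c]) auto
qed

lemma fin_dim_prod:
  assumes "fin_dim TYPE('a::real_normed_vector)" "fin_dim TYPE('b::real_normed_vector)"
  shows "fin_dim TYPE('a \<times> 'b)"
proof -
  obtain B :: "'a set" and c where B: "finite B" "\<And>b. bounded_linear (c b)" "\<And>v. v = (\<Sum>b\<in>B. c b v *\<^sub>R b)"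
    using assms(1) unfolding fin_dim_def by blast
  obtain B' :: "'b set" and c' where B': "finite B'" "\<And>b. bounded_linear (c' b)" "\<And>v. v = (\<Sum>b\<in>B'. c' b v *\<^sub>R b)"
    using assms(2) unfolding fin_dim_def by blast
  show ?thesis
  proof (rule fin_dimI[of "B <+> B'" "case_sum (\<lambda>b v. c b (fst v)) (\<lambda>b v. c' b (snd v))"
        "case_sum (\<lambda>b. (b, 0)) (\<lambda>b. (0, b))"])
    show "v = (\<Sum>i\<in>B <+> B'. case_sum (\<lambda>b v. c b (fst v)) (\<lambda>b v. c' b (snd v)) i v *\<^sub>R
      case_sum (\<lambda>b. (b, 0)) (\<lambda>b. (0, b)) i)" for v
      using B(3)[of "fst v", symmetric] B'(3)[of "snd v", symmetric] B(1) B'(1)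
      by (simp add: prod_eq_iff fst_sum snd_sum sum.Plus)
  qed (use B(1) B'(1) in \<open>auto intro: bounded_linear_compose[OF B(2) bounded_linear_fst]
      bounded_linear_compose[OF B'(2) bounded_linear_snd]\<close>)
qed

definition rank_one :: "'a::euclidean_space \<Rightarrow> 'b::real_normed_vector \<Rightarrow> 'a \<Rightarrow>\<^sub>L 'b" where
  "rank_one b w = Blinfun (\<lambda>x. (x \<bullet> b) *\<^sub>R w)"

lemma rank_one_apply [simp]: "blinfun_apply (rank_one b w) x = (x \<bullet> b) *\<^sub>R w"
  unfolding rank_one_def
  by (subst bounded_linear_Blinfun_apply) (auto intro: bounded_linear_intros)

lemma blinfun_rank_one: "f = (\<Sum>b\<in>Basis. rank_one b (blinfun_apply f b))"
proof (rule blinfun_eqI)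
  fix x
  have "blinfun_apply f x = blinfun_apply f (\<Sum>b\<in>Basis. (x \<bullet> b) *\<^sub>R b)"
    by (simp add: euclidean_representation)
  also have "\<dots> = blinfun_apply (\<Sum>b\<in>Basis. rank_one b (blinfun_apply f b)) x"
    by (simp add: blinfun.sum_left blinfun.sum_right blinfun.scaleR_right)
  finally show "blinfun_apply f x = blinfun_apply (\<Sum>b\<in>Basis. rank_one b (blinfun_apply f b)) x" .
qed

lemma bounded_linear_rank_one: "bounded_linear (rank_one b)"
proof (rule bounded_linear_intro[where K = "norm b"])
  show "norm (rank_one b x) \<le> norm x * norm b" for x
    by (rule norm_blinfun_bound)
      (auto simp: intro!: order.trans[OF mult_right_mono[OF Cauchy_Schwarz_ineq2]] mult_nonneg_nonneg)
qed (auto intro!: blinfun_eqI simp: blinfun.add_left blinfun.scaleR_left algebra_simps)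

lemma fin_dim_blinfun: "fin_dim TYPE('a::euclidean_space \<Rightarrow>\<^sub>L 'b::euclidean_space)"
proof (rule fin_dimI[of "Basis \<times> Basis" "\<lambda>(a, b) f. blinfun_apply f a \<bullet> b" "\<lambda>(a, b). rank_one a b"])
  interpret r: bounded_linear "rank_one b" for b :: 'a by (rule bounded_linear_rank_one)
  show "f = (\<Sum>i\<in>Basis \<times> Basis. (case i of (a, b) \<Rightarrow> \<lambda>f. blinfun_apply f a \<bullet> b) f *\<^sub>R
      (case i of (a, b) \<Rightarrow> rank_one a b))" for f :: "'a \<Rightarrow>\<^sub>L 'b"
  proof -
    have "f = (\<Sum>a\<in>Basis. rank_one a (blinfun_apply f a))" by (rule blinfun_rank_one)
    also have "\<dots> = (\<Sum>a\<in>Basis. rank_one a (\<Sum>b\<in>Basis. (blinfun_apply f a \<bullet> b) *\<^sub>R b))"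
      by (simp add: euclidean_representation)
    also have "\<dots> = (\<Sum>a\<in>Basis. \<Sum>b\<in>Basis. (blinfun_apply f a \<bullet> b) *\<^sub>R rank_one a b)"
      by (simp add: r.sum r.scaleR)
    finally show ?thesis by (simp add: sum.cartesian_product case_prod_beta)
  qed
qed (auto intro!: bounded_linear_intros)

text \<open>The derivative of \<open>g \<circ> f\<close> in direction \<open>v\<close> is \<open>g'(f x)\<close> applied to the moving vector
  \<open>f'(x) v\<close>, whereas the induction only controls \<open>g'(\<cdot>) b\<close> for fixed \<open>b\<close>.  Expanding \<open>f'(x) v\<close> in
  a finite basis bridges this gap.\<close>

lemma Ck_on_compose:
  assumes "fin_dim TYPE('b::real_normed_vector)" "open S" 
  shows "Ck_on k S f \<Longrightarrow> Ck_on k T g \<Longrightarrow> f ` S \<subseteq> T \<Longrightarrow> Ck_on k S (\<lambda>x. g (f x :: 'b))"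
proof (induction k arbitrary: g)
  case 0
  then show ?case using continuous_on_compose2[of T g S f] by simp
next
  case (Suc k)
  obtain B :: "'b set" and c where B: "finite B" "\<And>b. bounded_linear (c b)" "\<And>v. v = (\<Sum>b\<in>B. c b v *\<^sub>R b)"
    using assms(1) unfolding fin_dim_def by blast
  note df = Suc.prems(1)[THEN Ck_on_Suc_has_derivative]
  note dg = Suc.prems(2)[THEN Ck_on_Suc_has_derivative]
  let ?f' = "\<lambda>x. frechet_derivative f (at x)" and ?g' = "\<lambda>x. frechet_derivative g (at x)"
  have "((\<lambda>x. g (f x)) has_derivative (\<lambda>v. \<Sum>b\<in>B. c b (?f' x v) *\<^sub>R ?g' (f x) b)) (at x)" if x: "x \<in> S" for x
  proof -
    have fx: "f x \<in> T" using Suc.prems(3) x by auto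
    interpret l: bounded_linear "?g' (f x)" using dg[OF fx] has_derivative_bounded_linear by blast
    have "((\<lambda>x. g (f x)) has_derivative (\<lambda>v. ?g' (f x) (?f' x v))) (at x)"
      using diff_chain_at[OF df[OF x] dg[OF fx]] by (simp add: o_def)
    moreover have "?g' (f x) (?f' x v) = (\<Sum>b\<in>B. c b (?f' x v) *\<^sub>R ?g' (f x) b)" for v
      using arg_cong[OF B(3)[of "?f' x v"], of "?g' (f x)"] by (simp add: l.sum l.scaleR)
    ultimately show ?thesis by simp
  qed
  then show ?case
  proof (rule Ck_on_SucI[OF \<open>open S\<close>])
    show "Ck_on k S (\<lambda>x. \<Sum>b\<in>B. c b (?f' x v) *\<^sub>R ?g' (f x) b)" for v
    proof (rule Ck_on_sum[OF \<open>open S\<close>], rule Ck_on_bilinear[OF bounded_bilinear_scaleR \<open>open S\<close>])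
      show "Ck_on k S (\<lambda>x. c b (?f' x v))" for b
        by (rule Ck_on_bounded_linear[OF \<open>open S\<close> B(2)]) (use Suc.prems(1) in auto)
      show "Ck_on k S (\<lambda>x. ?g' (f x) b)" for b
        by (rule Suc.IH[of "\<lambda>y. ?g' y b"])
          (use Suc.prems Ck_on_SucD[OF Suc.prems(1)] in auto)
    qed
  qed
qed

section \<open>Inverses of linear maps\<close>

definition blinfun_inv :: "'a::real_normed_vector \<Rightarrow>\<^sub>L 'a \<Rightarrow> 'a \<Rightarrow>\<^sub>L 'a" where
  "blinfun_inv f = (SOME g. g o\<^sub>L f = id_blinfun \<and> f o\<^sub>L g = id_blinfun)"

definition blinfun_invertible :: "'a::real_normed_vector \<Rightarrow>\<^sub>L 'a \<Rightarrow> bool" where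
  "blinfun_invertible f \<longleftrightarrow> (\<exists>g. g o\<^sub>L f = id_blinfun \<and> f o\<^sub>L g = id_blinfun)"

lemma blinfun_inv:
  assumes "blinfun_invertible f"
  shows "blinfun_inv f o\<^sub>L f = id_blinfun" "f o\<^sub>L blinfun_inv f = id_blinfun"
proof -
  have "blinfun_inv f o\<^sub>L f = id_blinfun \<and> f o\<^sub>L blinfun_inv f = id_blinfun"
    unfolding blinfun_inv_def by (rule someI_ex) (use assms blinfun_invertible_def in blast)
  then show "blinfun_inv f o\<^sub>L f = id_blinfun" "f o\<^sub>L blinfun_inv f = id_blinfun" by auto
qed

lemma blinfun_inv_apply:
  assumes "blinfun_invertible f"
  shows "blinfun_apply (blinfun_inv f) (blinfun_apply f x) = x"
    "blinfun_apply f (blinfun_apply (blinfun_inv f) x) = x"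
  using blinfun_inv[OF assms, THEN arg_cong, of "\<lambda>h. blinfun_apply h x"] by simp_all

lemma blinfun_invertibleI:
  assumes "\<And>x. blinfun_apply f x = 0 \<Longrightarrow> x = 0"
  shows "blinfun_invertible (f :: 'a::euclidean_space \<Rightarrow>\<^sub>L 'a)"
proof -
  have l: "linear (blinfun_apply f)" by (simp add: blinfun.bounded_linear_right bounded_linear.linear)
  have "inj (blinfun_apply f)" using assms linear_injective_0[OF l] by auto
  then obtain g where g: "linear g" "g \<circ> blinfun_apply f = id" "blinfun_apply f \<circ> g = id"
    using linear_injective_isomorphism[OF l] by (auto simp: o_def id_def fun_eq_iff)
  show ?thesis unfolding blinfun_invertible_def
  proof (rule exI[of _ "Blinfun g"])
    have "blinfun_apply (Blinfun g) = g"
      using g(1) by (simp add: bounded_linear_Blinfun_apply linear_conv_bounded_linear)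
    then show "Blinfun g o\<^sub>L f = id_blinfun \<and> f o\<^sub>L Blinfun g = id_blinfun"
      using g by (auto intro!: blinfun_eqI simp: fun_eq_iff)
  qed
qed

lemmas blinfun_compose_simps =
  bounded_bilinear.add_left[OF bounded_bilinear_blinfun_compose]
  bounded_bilinear.add_right[OF bounded_bilinear_blinfun_compose]
  bounded_bilinear.diff_left[OF bounded_bilinear_blinfun_compose]
  bounded_bilinear.diff_right[OF bounded_bilinear_blinfun_compose]
  bounded_bilinear.minus_left[OF bounded_bilinear_blinfun_compose]
  bounded_bilinear.minus_right[OF bounded_bilinear_blinfun_compose]
  bounded_bilinear.scaleR_left[OF bounded_bilinear_blinfun_compose]
  bounded_bilinear.scaleR_right[OF bounded_bilinear_blinfun_compose]
  bounded_bilinear.zero_left[OF bounded_bilinear_blinfun_compose]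
  bounded_bilinear.zero_right[OF bounded_bilinear_blinfun_compose]

lemma blinfun_compose_id [simp]: "id_blinfun o\<^sub>L f = f" "f o\<^sub>L id_blinfun = f"
  by (auto intro!: blinfun_eqI)

lemma blinfun_compose_assoc: "(f o\<^sub>L g) o\<^sub>L h = f o\<^sub>L (g o\<^sub>L h)"
  by (auto intro!: blinfun_eqI)

text \<open>At a zero of \<open>\<psi>\<close> the first factor need only be continuous.  Applied to
  \<open>g\<^sub>y - g\<^sub>x = - g\<^sub>y (f y - f x) g\<^sub>x\<close>, with \<open>g\<^sub>y\<close> the inverse of \<open>f y\<close>, this differentiates the inverse
  once its continuity is known.\<close>

lemma has_derivative_bilinear_vanishing:
  assumes "bounded_bilinear bop" "isCont \<phi> x" "(\<psi> has_derivative \<psi>') (at x)" "\<psi> x = 0"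
  shows "((\<lambda>y. bop (\<phi> y) (\<psi> y)) has_derivative (\<lambda>v. bop (\<phi> x) (\<psi>' v))) (at x)"
proof -
  interpret b: bounded_bilinear bop by fact
  obtain K where K: "K > 0" "\<And>a b. norm (bop a b) \<le> norm a * norm b * K"
    using b.pos_bounded by blast
  obtain B where B: "B > 0" "\<And>v. norm (\<psi>' v) \<le> norm v * B"
    using bounded_linear.pos_bounded[OF has_derivative_bounded_linear[OF assms(3)]] by blast
  have "((\<lambda>y. bop (\<phi> y - \<phi> x) (\<psi> y)) has_derivative (\<lambda>v. 0)) (at x)"
    unfolding has_derivative_at_alt
  proof (intro conjI allI impI)
    fix e :: real assume e: "e > 0"
    define e' where "e' = e / (K * (1 + B))"
    have e': "e' > 0" using e K B by (simp add: e'_def)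
    obtain d1 where d1: "d1 > 0" "\<And>y. norm (y - x) < d1 \<Longrightarrow> norm (\<psi> y - \<psi> x - \<psi>' (y - x)) \<le> 1 * norm (y - x)"
      using assms(3) unfolding has_derivative_at_alt by (meson zero_less_one)
    obtain d2 where d2: "d2 > 0" "\<And>y. norm (y - x) < d2 \<Longrightarrow> norm (\<phi> y - \<phi> x) < e'"
      using assms(2) e' unfolding continuous_at_eps_delta dist_norm by blast
    show "\<exists>d>0. \<forall>y. norm (y - x) < d \<longrightarrow>
      norm (bop (\<phi> y - \<phi> x) (\<psi> y) - bop (\<phi> x - \<phi> x) (\<psi> x) - 0) \<le> e * norm (y - x)"
    proof (intro exI[of _ "min d1 d2"] conjI allI impI)
      fix y assume y: "norm (y - x) < min d1 d2"
      have "norm (\<psi> y) \<le> norm (\<psi> y - \<psi>' (y - x)) + norm (\<psi>' (y - x))"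
        by (metis diff_add_cancel norm_triangle_ineq)
      also have "\<dots> \<le> norm (y - x) + norm (y - x) * B"
        using d1(2)[of y] y B(2)[of "y - x"] assms(4) by (intro add_mono) auto
      finally have 1: "norm (\<psi> y) \<le> (1 + B) * norm (y - x)" by (simp add: algebra_simps)
      have "norm (bop (\<phi> y - \<phi> x) (\<psi> y)) \<le> norm (\<phi> y - \<phi> x) * norm (\<psi> y) * K" by (rule K)
      also have "\<dots> \<le> e' * ((1 + B) * norm (y - x)) * K"
        using d2(2)[of y] y 1 K e' B by (intro mult_right_mono mult_mono) auto
      also have "\<dots> = (e' * (K * (1 + B))) * norm (y - x)" by (simp only: mult_ac)
      also have "e' * (K * (1 + B)) = e" using K B by (simp add: e'_def)
      finally show "norm (bop (\<phi> y - \<phi> x) (\<psi> y) - bop (\<phi> x - \<phi> x) (\<psi> x) - 0) \<le> e * norm (y - x)"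
        by (simp add: assms(4) b.zero_right)
    qed (use d1 d2 in auto)
  qed simp
  moreover have "((\<lambda>y. bop (\<phi> x) (\<psi> y)) has_derivative (\<lambda>v. bop (\<phi> x) (\<psi>' v))) (at x)"
    by (rule bounded_linear.has_derivative[OF b.bounded_linear_right assms(3)])
  ultimately show ?thesis
    using has_derivative_add[of "\<lambda>y. bop (\<phi> y - \<phi> x) (\<psi> y)" "\<lambda>v. 0" "at x" "\<lambda>y. bop (\<phi> x) (\<psi> y)"]
    by (simp add: b.diff_left)
qed

lemma blinfun_inv_diff:
  assumes "blinfun_invertible f" "blinfun_invertible h"
  shows "blinfun_inv h - blinfun_inv f = - (blinfun_inv h o\<^sub>L ((h - f) o\<^sub>L blinfun_inv f))"
proof -
  have "blinfun_inv h o\<^sub>L ((h - f) o\<^sub>L blinfun_inv f) =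
      ((blinfun_inv h o\<^sub>L h) o\<^sub>L blinfun_inv f) - (blinfun_inv h o\<^sub>L (f o\<^sub>L blinfun_inv f))"
    by (simp only: blinfun_compose_simps blinfun_compose_assoc)
  then show ?thesis by (simp add: blinfun_inv[OF assms(1)] blinfun_inv[OF assms(2)])
qed

lemma isCont_blinfun_inv:
  fixes f :: "'x::real_normed_vector \<Rightarrow> 'a::real_normed_vector \<Rightarrow>\<^sub>L 'a"
  assumes "open S" "x \<in> S" "isCont f x" "\<And>y. y \<in> S \<Longrightarrow> blinfun_invertible (f y)"
  shows "isCont (\<lambda>y. blinfun_inv (f y)) x"
proof -
  let ?g = "\<lambda>y. blinfun_inv (f y)"
  define C where "C = norm (?g x) + 1"
  have C: "C > 0" "norm (?g x) \<le> C" unfolding C_def by (auto intro: add_nonneg_pos)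
  have est: "norm (?g y - ?g x) \<le> norm (?g y) * norm (f y - f x) * C" if "y \<in> S" for y
  proof -
    have "norm (?g y - ?g x) = norm (?g y o\<^sub>L ((f y - f x) o\<^sub>L ?g x))"
      using blinfun_inv_diff[OF assms(4)[OF assms(2)] assms(4)[OF that]] by simp
    also have "\<dots> \<le> norm (?g y) * norm ((f y - f x) o\<^sub>L ?g x)" by (rule norm_blinfun_compose)
    also have "\<dots> \<le> norm (?g y) * (norm (f y - f x) * norm (?g x))"
      by (intro mult_left_mono norm_blinfun_compose) auto
    also have "\<dots> \<le> norm (?g y) * (norm (f y - f x) * C)"
      by (intro mult_left_mono C) auto
    finally show ?thesis by (simp add: mult.assoc)
  qed
  show ?thesis unfolding continuous_at_eps_delta
  proof (intro allI impI)
    fix e :: real assume e: "e > 0"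
    \<comment> \<open>The first bound keeps the norm of the inverse below \<open>2 C\<close>, the second then makes the
        difference of the inverses smaller than \<open>e\<close>.\<close>
    define e' where "e' = min (1 / (2 * C)) (e / (2 * C * C))"
    have e': "e' > 0" using e C by (simp add: e'_def)
    obtain d1 where d1: "d1 > 0" "ball x d1 \<subseteq> S" using assms(1,2) open_contains_ball by blast
    obtain d2 where d2: "d2 > 0" "\<And>y. norm (y - x) < d2 \<Longrightarrow> norm (f y - f x) < e'"
      using assms(3) e' unfolding continuous_at_eps_delta dist_norm by blast
    show "\<exists>d>0. \<forall>y. dist y x < d \<longrightarrow> dist (?g y) (?g x) < e"
    proof (intro exI[of _ "min d1 d2"] conjI allI impI)
      fix y assume y: "dist y x < min d1 d2"
      have yS: "y \<in> S" using d1 y by (auto simp: dist_commute)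
      have f1: "norm (f y - f x) < 1 / (2 * C)" and f2: "norm (f y - f x) < e / (2 * C * C)"
        using d2(2)[of y] y by (auto simp: dist_norm e'_def)
      have fC: "norm (f y - f x) * C \<le> 1 / 2" using f1 C by (simp add: field_simps)
      have "norm (?g y) \<le> norm (?g x) + norm (?g y - ?g x)"
        by (metis add.commute diff_add_cancel norm_triangle_ineq)
      also have "\<dots> \<le> C + norm (?g y) * (norm (f y - f x) * C)"
        using est[OF yS] C by (simp add: mult.assoc)
      also have "\<dots> \<le> C + norm (?g y) * (1 / 2)"
        by (intro add_left_mono mult_left_mono fC) auto
      finally have g: "norm (?g y) \<le> 2 * C" by simp
      have "norm (?g y - ?g x) \<le> norm (?g y) * norm (f y - f x) * C" by (rule est[OF yS])
      also have "\<dots> \<le> 2 * C * norm (f y - f x) * C"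
        using g C by (intro mult_right_mono) auto
      also have "\<dots> < e" using f2 C by (simp add: field_simps)
      finally show "dist (?g y) (?g x) < e" by (simp add: dist_norm)
    qed (use d1 d2 in auto)
  qed
qed

lemma has_derivative_blinfun_inv:
  assumes "open S" "x \<in> S" "(f has_derivative f') (at x)" "\<And>y. y \<in> S \<Longrightarrow> blinfun_invertible (f y)"
  shows "((\<lambda>y. blinfun_inv (f y)) has_derivative
    (\<lambda>v. - (blinfun_inv (f x) o\<^sub>L (f' v o\<^sub>L blinfun_inv (f x))))) (at x)"
proof -
  let ?g = "\<lambda>y. blinfun_inv (f y)"
  have c: "isCont ?g x"
    by (rule isCont_blinfun_inv[OF assms(1,2) has_derivative_continuous[OF assms(3)] assms(4)])
  have "((\<lambda>y. (f y - f x) o\<^sub>L ?g x) has_derivative (\<lambda>v. f' v o\<^sub>L ?g x)) (at x)"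
    using bounded_linear.has_derivative[OF bounded_bilinear.bounded_linear_left[OF bounded_bilinear_blinfun_compose]
        has_derivative_diff[OF assms(3) has_derivative_const[of "f x"]], of "?g x"] by simp
  from has_derivative_bilinear_vanishing[OF bounded_bilinear_blinfun_compose c this]
  have "((\<lambda>y. ?g y o\<^sub>L ((f y - f x) o\<^sub>L ?g x)) has_derivative (\<lambda>v. ?g x o\<^sub>L (f' v o\<^sub>L ?g x))) (at x)"
    by (simp add: blinfun_compose_simps)
  from has_derivative_add[OF has_derivative_const[of "?g x"] has_derivative_minus[OF this]]
  have "((\<lambda>y. ?g x + - (?g y o\<^sub>L ((f y - f x) o\<^sub>L ?g x))) has_derivative (\<lambda>v. - (?g x o\<^sub>L (f' v o\<^sub>L ?g x)))) (at x)"
    by simp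
  then show ?thesis
  proof (rule has_derivative_transform_within_open[OF _ assms(1,2)])
    show "?g x + - (?g y o\<^sub>L ((f y - f x) o\<^sub>L ?g x)) = ?g y" if "y \<in> S" for y
      using blinfun_inv_diff[OF assms(4)[OF assms(2)] assms(4)[OF that]]
      by (simp add: algebra_simps)
  qed
qed

lemma Ck_on_blinfun_inv:
  assumes "open S" "\<And>y. y \<in> S \<Longrightarrow> blinfun_invertible (f y)"
  shows "Ck_on k S f \<Longrightarrow> Ck_on k S (\<lambda>y. blinfun_inv (f y))"
proof (induction k)
  case 0
  then have "continuous_on S f" by simp
  then show ?case
    using isCont_blinfun_inv[OF assms(1) _ _ assms(2)] assms(1)
    by (auto simp: continuous_on_eq_continuous_at)
next
  case (Suc k)
  note d = has_derivative_blinfun_inv[OF assms(1) _ Ck_on_Suc_has_derivative[OF Suc.prems] assms(2)]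
  have c: "Ck_on k S (\<lambda>y. blinfun_inv (f y))" using Suc.IH Ck_on_SucD[OF Suc.prems] by blast
  show ?case
  proof (rule Ck_on_SucI[OF \<open>open S\<close> d])
    fix v
    have "Ck_on k S (\<lambda>x. frechet_derivative f (at x) v)" using Suc.prems by auto
    note b = Ck_on_bilinear[OF bounded_bilinear_blinfun_compose assms(1)]
    have "Ck_on k S (\<lambda>x. - (blinfun_inv (f x) o\<^sub>L (frechet_derivative f (at x) v o\<^sub>L blinfun_inv (f x))))"
      by (rule Ck_on_bounded_linear[OF \<open>open S\<close> bounded_linear_minus[OF bounded_linear_ident]])
        (intro b c \<open>Ck_on k S (\<lambda>x. frechet_derivative f (at x) v)\<close>)
    then show "Ck_on k S (\<lambda>x. - (blinfun_inv (f x) o\<^sub>L (frechet_derivative f (at x) v o\<^sub>L blinfun_inv (f x))))" .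
  qed auto
qed

section \<open>Closure properties of smooth maps\<close>

lemma smooth_on_cong: "open S \<Longrightarrow> smooth_on S f \<Longrightarrow> (\<And>x. x \<in> S \<Longrightarrow> f x = g x) \<Longrightarrow> smooth_on S g"
  unfolding smooth_on_def by (auto intro: Ck_on_cong[of S f g])

lemma smooth_on_subset: "smooth_on S f \<Longrightarrow> T \<subseteq> S \<Longrightarrow> smooth_on T f"
  unfolding smooth_on_def by (auto intro: Ck_on_subset[of _ S])

lemma smooth_on_const: "open S \<Longrightarrow> smooth_on S (\<lambda>x. c)"
  unfolding smooth_on_def by (simp add: Ck_on_const)

lemma smooth_on_linear: "open S \<Longrightarrow> bounded_linear L \<Longrightarrow> smooth_on S L"
  unfolding smooth_on_def by (simp add: Ck_on_linear)

lemma smooth_on_add: "open S \<Longrightarrow> smooth_on S f \<Longrightarrow> smooth_on S g \<Longrightarrow> smooth_on S (\<lambda>x. f x + g x)"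
  unfolding smooth_on_def by (simp add: Ck_on_add)

lemma smooth_on_bounded_linear:
  "open S \<Longrightarrow> bounded_linear L \<Longrightarrow> smooth_on S f \<Longrightarrow> smooth_on S (\<lambda>x. L (f x))"
  unfolding smooth_on_def by (simp add: Ck_on_bounded_linear)

lemma smooth_on_minus: "open S \<Longrightarrow> smooth_on S f \<Longrightarrow> smooth_on S (\<lambda>x. - f x)"
  by (rule smooth_on_bounded_linear[OF _ bounded_linear_minus[OF bounded_linear_ident]])

lemma smooth_on_diff:
  "open S \<Longrightarrow> smooth_on S f \<Longrightarrow> smooth_on S g \<Longrightarrow> smooth_on S (\<lambda>x. f x - g x)"
  using smooth_on_add[OF _ _ smooth_on_minus, of S f g] by simp

lemma smooth_on_bilinear:
  "bounded_bilinear bop \<Longrightarrow> open S \<Longrightarrow> smooth_on S f \<Longrightarrow> smooth_on S g \<Longrightarrow> smooth_on S (\<lambda>x. bop (f x) (g x))"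
  unfolding smooth_on_def by (simp add: Ck_on_bilinear)

lemmas smooth_on_blinfun_compose = smooth_on_bilinear[OF bounded_bilinear_blinfun_compose]

lemma smooth_on_sum:
  "open S \<Longrightarrow> (\<And>i. i \<in> I \<Longrightarrow> smooth_on S (f i)) \<Longrightarrow> smooth_on S (\<lambda>x. \<Sum>i\<in>I. f i x)"
  unfolding smooth_on_def by (simp add: Ck_on_sum)

lemma smooth_on_Pair:
  assumes "open S" "smooth_on S f" "smooth_on S g"
  shows "smooth_on S (\<lambda>x. (f x, g x))"
proof -
  have "smooth_on S (\<lambda>x. (f x, 0) + (0, g x))"
    by (intro smooth_on_add assms smooth_on_bounded_linear[OF _ bounded_linear_Pair[OF bounded_linear_ident bounded_linear_zero]]
        smooth_on_bounded_linear[OF _ bounded_linear_Pair[OF bounded_linear_zero bounded_linear_ident]])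
  then show ?thesis by simp
qed

lemma smooth_on_local:
  "(\<And>x. x \<in> S \<Longrightarrow> \<exists>T. open T \<and> x \<in> T \<and> smooth_on T f) \<Longrightarrow> smooth_on S f"
  unfolding smooth_on_def by (rule allI, rule Ck_on_local) meson

lemma smooth_on_compose:
  "fin_dim TYPE('b::real_normed_vector) \<Longrightarrow> open S \<Longrightarrow> smooth_on S f \<Longrightarrow> smooth_on T g \<Longrightarrow> f ` S \<subseteq> T \<Longrightarrow>
    smooth_on S (\<lambda>x. g (f x :: 'b))"
  unfolding smooth_on_def by (intro allI, rule Ck_on_compose[of S _ f T g]) simp_all

lemmas smooth_on_compose_euclidean = smooth_on_compose[OF fin_dim_euclidean]

lemma smooth_on_blinfun_inv:
  "open S \<Longrightarrow> smooth_on S f \<Longrightarrow> (\<And>y. y \<in> S \<Longrightarrow> blinfun_invertible (f y)) \<Longrightarrow>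
    smooth_on S (\<lambda>y. blinfun_inv (f y))"
  unfolding smooth_on_def by (simp add: Ck_on_blinfun_inv)

lemma smooth_on_blinfunI:
  assumes "open S" "\<And>a. smooth_on S (\<lambda>x. blinfun_apply (f x) (a::'a::euclidean_space))"
  shows "smooth_on S f"
proof -
  have "smooth_on S (\<lambda>x. \<Sum>b\<in>Basis. rank_one b (blinfun_apply (f x) b))"
    by (intro smooth_on_sum assms smooth_on_bounded_linear[OF _ bounded_linear_rank_one])
  then show ?thesis unfolding blinfun_rank_one[symmetric] .
qed

lemma smooth_on_continuous: "smooth_on S f \<Longrightarrow> continuous_on S f"
  unfolding smooth_on_def by (metis Ck_on.simps(1))

lemma smooth_on_has_derivative: "smooth_on S f \<Longrightarrow> x \<in> S \<Longrightarrow> (f has_derivative frechet_derivative f (at x)) (at x)"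
  unfolding smooth_on_def by (rule Ck_on_Suc_has_derivative[of 0]) auto

lemma smooth_on_has_vector_derivative:
  "smooth_on S f \<Longrightarrow> x \<in> S \<Longrightarrow> (f has_vector_derivative vector_derivative f (at x)) (at x)"
  by (rule vector_derivative_works[THEN iffD1, OF differentiableI[OF smooth_on_has_derivative]])

section \<open>Linear differential equations\<close>

text \<open>Picard iteration on bounded continuous functions.  The equation is integrated from the left
  end of the interval and the value at 0 subtracted, which avoids integrals over reversed
  intervals.\<close>

lemma linear_ode_solution:
  fixes \<theta> :: "real \<Rightarrow> 'a::banach \<Rightarrow>\<^sub>L 'a"
  assumes r: "r > 0" and cont: "continuous_on {-r..r} \<theta>"
  obtains U \<epsilon> where "0 < \<epsilon>" "\<epsilon> \<le> r" "U 0 = id_blinfun"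
    "\<And>t. \<bar>t\<bar> < \<epsilon> \<Longrightarrow> (U has_vector_derivative (\<theta> t o\<^sub>L U t)) (at t)"
proof -
  have "compact (\<theta> ` {-r..r})" using compact_continuous_image[OF cont] by simp
  then obtain M where M: "M > 0" "\<And>t. t \<in> {-r..r} \<Longrightarrow> norm (\<theta> t) \<le> M"
    using compact_imp_bounded bounded_pos by (metis image_eqI)
  \<comment> \<open>Two integrals over intervals of length at most \<open>2 \<epsilon>\<close> give the contraction constant \<open>4 \<epsilon> M \<le> 1/2\<close>.\<close>
  define \<epsilon> where "\<epsilon> = min r (1 / (8 * M))"
  have \<epsilon>: "\<epsilon> > 0" "\<epsilon> \<le> r" "\<epsilon> * M \<le> 1 / 8" using r M by (auto simp: \<epsilon>_def min_def field_simps)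
  \<comment> \<open>Functions on the interval are continued by their boundary values.\<close>
  define cl where "cl t = max (-\<epsilon>) (min \<epsilon> t)" for t
  have cl: "cl t \<in> {-\<epsilon>..\<epsilon>}" for t using \<epsilon> by (auto simp: cl_def)
  have clid: "cl t = t" if "t \<in> {-\<epsilon>..\<epsilon>}" for t using that by (auto simp: cl_def)
  have cl_cont: "continuous_on UNIV cl" unfolding cl_def by (intro continuous_intros)
  define I where "I u t = integral {-\<epsilon>..t} (\<lambda>s. \<theta> s o\<^sub>L apply_bcontfun u s)"
    for u :: "real \<Rightarrow>\<^sub>C ('a \<Rightarrow>\<^sub>L 'a)" and t
  have contI: "continuous_on {-\<epsilon>..\<epsilon>} (\<lambda>s. \<theta> s o\<^sub>L apply_bcontfun u s)" for u :: "real \<Rightarrow>\<^sub>C ('a \<Rightarrow>\<^sub>L 'a)"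
  proof -
    have "continuous_on {-\<epsilon>..\<epsilon>} \<theta>" by (rule continuous_on_subset[OF cont]) (use \<epsilon> in auto)
    moreover have "continuous_on {-\<epsilon>..\<epsilon>} (apply_bcontfun u)"
      using continuous_on_apply_bcontfun continuous_on_subset by blast
    ultimately show ?thesis
      using bounded_bilinear.continuous_on[OF bounded_bilinear_blinfun_compose] by blast
  qed
  have contIcl: "continuous_on UNIV (\<lambda>t. I u (cl t))" for u
  proof -
    have "continuous_on {-\<epsilon>..\<epsilon>} (I u)"
      unfolding I_def by (rule indefinite_integral_continuous_1[OF integrable_continuous_interval[OF contI]])
    then show ?thesis by (rule continuous_on_compose2[OF _ cl_cont]) (use cl in auto)
  qed
  have bndI: "norm (I u t) \<le> 2 * \<epsilon> * (M * C)" if "\<And>s. norm (apply_bcontfun u s) \<le> C" "t \<in> {-\<epsilon>..\<epsilon>}" for u t C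
  proof -
    have C: "C \<ge> 0" using that(1)[of 0] norm_ge_zero order_trans by blast
    have "norm (\<theta> s o\<^sub>L apply_bcontfun u s) \<le> M * C" if "s \<in> {-\<epsilon>..t}" for s
    proof -
      have "norm (\<theta> s o\<^sub>L apply_bcontfun u s) \<le> norm (\<theta> s) * norm (apply_bcontfun u s)"
        by (rule norm_blinfun_compose)
      also have "\<dots> \<le> M * C"
      proof (rule mult_mono)
        show "norm (\<theta> s) \<le> M" by (rule M(2)) (use \<open>t \<in> {-\<epsilon>..\<epsilon>}\<close> that \<epsilon>(1,2) in auto)
      qed (use M(1) \<open>\<And>s. norm (apply_bcontfun u s) \<le> C\<close> in auto)
      finally show ?thesis .
    qed
    then have "norm (I u t) \<le> (M * C) * (t - (-\<epsilon>))" unfolding I_def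
      using that(2) by (intro integral_bound continuous_on_subset[OF contI]) auto
    also have "\<dots> \<le> (M * C) * (2 * \<epsilon>)" using that(2) M C by (intro mult_left_mono) auto
    finally show ?thesis by (simp add: algebra_simps)
  qed
  have bcont: "(\<lambda>t. id_blinfun + (I u (cl t) - I u 0)) \<in> bcontfun" for u
  proof (rule bcontfun_normI)
    show "continuous_on UNIV (\<lambda>t. id_blinfun + (I u (cl t) - I u 0))"
      by (intro continuous_intros contIcl)
    fix t
    have u: "norm (apply_bcontfun u s) \<le> norm u" for s by (rule norm_bounded)
    have "norm (I u (cl t) - I u 0) \<le> norm (I u (cl t)) + norm (I u 0)" by (rule norm_triangle_ineq4)
    then show "norm (id_blinfun + (I u (cl t) - I u 0)) \<le> norm (id_blinfun :: 'a \<Rightarrow>\<^sub>L 'a) + 2 * (2 * \<epsilon> * (M * norm u))"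
      using bndI[OF u cl[of t]] bndI[OF u, of 0] \<epsilon>
      by (intro order.trans[OF norm_triangle_ineq]) auto
  qed
  define T where "T u = Bcontfun (\<lambda>t. id_blinfun + (I u (cl t) - I u 0))" for u
  have T: "apply_bcontfun (T u) t = id_blinfun + (I u (cl t) - I u 0)" for u t
    unfolding T_def by (simp add: Bcontfun_inverse[OF bcont])
  have Idiff: "I u t - I w t = I (u - w) t" if "t \<in> {-\<epsilon>..\<epsilon>}" for u w t
  proof -
    have "(\<lambda>s. \<theta> s o\<^sub>L apply_bcontfun v s) integrable_on {-\<epsilon>..t}" for v :: "real \<Rightarrow>\<^sub>C ('a \<Rightarrow>\<^sub>L 'a)"
      by (rule integrable_continuous_interval[OF continuous_on_subset[OF contI]]) (use that in auto)
    then show ?thesis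
      unfolding I_def by (subst integral_diff[symmetric]) (auto simp: blinfun_compose_simps)
  qed
  have "\<exists>!u. T u = u"
  proof (rule banach_fix_type[of "1/2"])
    show "\<forall>u w. dist (T u) (T w) \<le> 1 / 2 * dist u w"
    proof (intro allI)
      fix u w :: "real \<Rightarrow>\<^sub>C ('a \<Rightarrow>\<^sub>L 'a)"
      have n: "norm (apply_bcontfun (u - w) s) \<le> norm (u - w)" for s by (rule norm_bounded)
      show "dist (T u) (T w) \<le> 1 / 2 * dist u w"
      proof (rule dist_bound)
        fix t
        have "apply_bcontfun (T u) t - apply_bcontfun (T w) t = (I u (cl t) - I w (cl t)) - (I u 0 - I w 0)"
          by (simp add: T algebra_simps)
        also have "\<dots> = I (u - w) (cl t) - I (u - w) 0"
          using Idiff[OF cl[of t], of u w] Idiff[of 0 u w] \<epsilon> by simp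
        finally have "norm (apply_bcontfun (T u) t - apply_bcontfun (T w) t) \<le>
            norm (I (u - w) (cl t)) + norm (I (u - w) 0)" by (simp add: norm_triangle_ineq4)
        also have "\<dots> \<le> 2 * (2 * \<epsilon> * (M * norm (u - w)))"
          using bndI[OF n cl[of t]] bndI[OF n, of 0] \<epsilon> by simp
        also have "\<dots> = 4 * (\<epsilon> * M) * norm (u - w)" by simp
        also have "\<dots> \<le> 4 * (1 / 8) * norm (u - w)"
          using \<epsilon>(3) by (intro mult_right_mono) auto
        finally show "dist (apply_bcontfun (T u) t) (apply_bcontfun (T w) t) \<le> 1 / 2 * dist u w"
          by (simp add: dist_norm)
      qed
    qed
  qed auto
  then obtain u where u: "T u = u" by blast
  define U where "U = apply_bcontfun u"
  have U: "U t = id_blinfun + (I u t - I u 0)" if "t \<in> {-\<epsilon>..\<epsilon>}" for t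
    using T[of u t] clid[OF that] by (simp add: u U_def)
  show ?thesis
  proof (rule that[OF \<epsilon>(1,2), of U])
    show "U 0 = id_blinfun" using U[of 0] \<epsilon> by simp
    fix t :: real assume t: "\<bar>t\<bar> < \<epsilon>"
    then have t': "t \<in> {-\<epsilon><..<\<epsilon>}" by auto
    have "(I u has_vector_derivative (\<theta> t o\<^sub>L U t)) (at t within {-\<epsilon>..\<epsilon>})"
      unfolding I_def U_def by (rule integral_has_vector_derivative[OF contI]) (use t in auto)
    then have "(I u has_vector_derivative (\<theta> t o\<^sub>L U t)) (at t within {-\<epsilon><..<\<epsilon>})"
      by (rule has_vector_derivative_within_subset) auto
    then have "(I u has_vector_derivative (\<theta> t o\<^sub>L U t)) (at t)"
      using at_within_open[OF t'] by simp
    then have "((\<lambda>t. id_blinfun + (I u t - I u 0)) has_vector_derivative (\<theta> t o\<^sub>L U t)) (at t)"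
      by (auto intro!: derivative_eq_intros)
    then show "(U has_vector_derivative (\<theta> t o\<^sub>L U t)) (at t)"
      by (rule has_vector_derivative_transform_within_open[OF _ _ t']) (use U in auto)
  qed
qed

lemma smooth_on_real_SucI:
  assumes "open S" "\<And>t. t \<in> S \<Longrightarrow> (f has_vector_derivative f' t) (at t)" "Ck_on k S f'"
  shows "Ck_on (Suc k) S f"
  by (rule Ck_on_SucI[OF assms(1) assms(2)[unfolded has_vector_derivative_def]])
    (auto intro: Ck_on_bounded_linear[OF assms(1) bounded_linear_scaleR_right assms(3)])

text \<open>Solutions of a linear equation with smooth coefficients are smooth, since the equation
  expresses the derivative by the solution itself.\<close>

lemma linear_ode_smooth:
  fixes \<theta> :: "real \<Rightarrow> 'a::real_normed_vector \<Rightarrow>\<^sub>L 'a"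
  assumes "open S" "smooth_on S \<theta>" "\<And>t. t \<in> S \<Longrightarrow> (U has_vector_derivative (\<theta> t o\<^sub>L U t)) (at t)"
  shows "smooth_on S U"
  unfolding smooth_on_def
proof
  fix k show "Ck_on k S U"
  proof (induction k)
    case 0
    then show ?case
      by (auto intro!: continuous_at_imp_continuous_on has_vector_derivative_continuous[OF assms(3)])
  next
    case (Suc k)
    show ?case
      by (rule smooth_on_real_SucI[OF assms(1,3) Ck_on_bilinear[OF bounded_bilinear_blinfun_compose]])
        (use assms Suc in \<open>auto simp: smooth_on_def\<close>)
  qed
qed

section \<open>Smooth maps and velocities\<close>

lemma smooth_mapE:
  assumes "smooth_map A S A' S' f" "p \<in> S" "c \<in> A" "c' \<in> A'" "p \<in> fst c" "f p \<in> fst c'"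
  obtains W F where "open W" "snd c p \<in> W" "smooth_on W F"
    "\<And>q. q \<in> S \<Longrightarrow> q \<in> fst c \<Longrightarrow> snd c q \<in> W \<Longrightarrow> f q \<in> fst c' \<and> snd c' (f q) = F (snd c q)"
proof -
  obtain U z U' z' where c: "c = (U, z)" "c' = (U', z')" by (cases c, cases c') auto
  have "\<exists>W F. open W \<and> z p \<in> W \<and> smooth_on W F \<and>
          (\<forall>q\<in>S \<inter> U. z q \<in> W \<longrightarrow> f q \<in> U' \<and> z' (f q) = F (z q))"
    using bspec[OF conjunct2[OF assms(1)[unfolded smooth_map_def]] assms(2)] assms(3-) unfolding c by auto
  then show ?thesis using that unfolding c by auto
qed

lemma smooth_mapI:
  assumes "f ` S \<subseteq> S'"
    "\<And>p c c'. p \<in> S \<Longrightarrow> c \<in> A \<Longrightarrow> c' \<in> A' \<Longrightarrow> p \<in> fst c \<Longrightarrow> f p \<in> fst c' \<Longrightarrow>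
      \<exists>W F. open W \<and> snd c p \<in> W \<and> smooth_on W F \<and>
        (\<forall>q\<in>S \<inter> fst c. snd c q \<in> W \<longrightarrow> f q \<in> fst c' \<and> snd c' (f q) = F (snd c q))"
  shows "smooth_map A S A' S' f"
  unfolding smooth_map_def
proof (intro conjI ballI assms(1))
  fix p c assume pc: "p \<in> S" "c \<in> A"
  show "case c of (U, z) \<Rightarrow> \<forall>(U', z')\<in>A'. p \<in> U \<longrightarrow> f p \<in> U' \<longrightarrow>
       (\<exists>W F. open W \<and> z p \<in> W \<and> smooth_on W F \<and>
          (\<forall>q\<in>S \<inter> U. z q \<in> W \<longrightarrow> f q \<in> U' \<and> z' (f q) = F (z q)))"
    unfolding case_prod_beta by (intro ballI impI, rule assms(2)) (use pc in auto)
qed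

lemma smooth_curveD:
  "smooth_curve A S \<epsilon> \<gamma> \<Longrightarrow> \<bar>t\<bar> < \<epsilon> \<Longrightarrow> \<gamma> t \<in> S \<and>
     (\<forall>(U, z)\<in>A. \<gamma> t \<in> U \<longrightarrow> (\<exists>\<delta>>0. \<gamma> ` ball t \<delta> \<subseteq> U \<and> smooth_on (ball t \<delta>) (z \<circ> \<gamma>)))"
  unfolding smooth_curve_def by (erule allE, erule mp)

lemma smooth_curveE:
  assumes "smooth_curve A S \<epsilon> \<gamma>" "\<bar>t\<bar> < \<epsilon>" "c \<in> A" "\<gamma> t \<in> fst c"
  obtains \<delta> where "\<delta> > 0" "\<bar>t\<bar> + \<delta> \<le> \<epsilon>" "\<gamma> ` ball t \<delta> \<subseteq> fst c" "\<gamma> ` ball t \<delta> \<subseteq> S"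
    "smooth_on (ball t \<delta>) (snd c \<circ> \<gamma>)"
proof -
  obtain U z where c: "c = (U, z)" by (cases c) auto
  obtain \<delta> where d: "\<delta> > 0" "\<gamma> ` ball t \<delta> \<subseteq> U" "smooth_on (ball t \<delta>) (z \<circ> \<gamma>)"
    using bspec[OF conjunct2[OF smooth_curveD[OF assms(1,2)]], of "(U, z)"] assms(3,4) unfolding c by auto
  define \<delta>' where "\<delta>' = min \<delta> (\<epsilon> - \<bar>t\<bar>)"
  have sub: "ball t \<delta>' \<subseteq> ball t \<delta>" by (auto simp: \<delta>'_def)
  show ?thesis
  proof (rule that[of \<delta>'])
    show "\<gamma> ` ball t \<delta>' \<subseteq> S"
    proof safe
      fix s assume "s \<in> ball t \<delta>'"
      then have "\<bar>s\<bar> < \<epsilon>" by (auto simp: \<delta>'_def dist_real_def)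
      then show "\<gamma> s \<in> S" using conjunct1[OF smooth_curveD[OF assms(1)]] by blast
    qed
    show "\<gamma> ` ball t \<delta>' \<subseteq> fst c" using d(2) sub unfolding c by auto
    show "smooth_on (ball t \<delta>') (snd c \<circ> \<gamma>)" using smooth_on_subset[OF d(3) sub] c by simp
  qed (use d(1) assms(2) in \<open>auto simp: \<delta>'_def\<close>)
qed

lemma smooth_curveI:
  assumes "\<And>t. \<bar>t\<bar> < \<epsilon> \<Longrightarrow> \<gamma> t \<in> S"
    "\<And>t c. \<bar>t\<bar> < \<epsilon> \<Longrightarrow> c \<in> A \<Longrightarrow> \<gamma> t \<in> fst c \<Longrightarrow>
      \<exists>\<delta>>0. \<gamma> ` ball t \<delta> \<subseteq> fst c \<and> smooth_on (ball t \<delta>) (snd c \<circ> \<gamma>)"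
  shows "smooth_curve A S \<epsilon> \<gamma>"
  unfolding smooth_curve_def
proof (intro allI impI conjI ballI)
  fix t c assume "\<bar>t\<bar> < \<epsilon>" "c \<in> A"
  then show "case c of (U, z) \<Rightarrow> \<gamma> t \<in> U \<longrightarrow> (\<exists>\<delta>>0. \<gamma> ` ball t \<delta> \<subseteq> U \<and> smooth_on (ball t \<delta>) (z \<circ> \<gamma>))"
    using assms(2)[of t c] by (cases c) simp
qed (rule assms)

lemma smooth_curve_shrink: "smooth_curve A S \<epsilon> \<gamma> \<Longrightarrow> \<epsilon>' \<le> \<epsilon> \<Longrightarrow> smooth_curve A S \<epsilon>' \<gamma>"
  unfolding smooth_curve_def[of A S \<epsilon>'] by (intro allI impI, rule smooth_curveD, assumption, linarith)

lemma smooth_curve_subset: "smooth_curve A S \<epsilon> \<gamma> \<Longrightarrow> S \<subseteq> S' \<Longrightarrow> smooth_curve A S' \<epsilon> \<gamma>"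
  unfolding smooth_curve_def[of A S'] by (intro allI impI, frule smooth_curveD) auto

lemma smooth_curve_mem: "smooth_curve A S \<epsilon> \<gamma> \<Longrightarrow> \<bar>t\<bar> < \<epsilon> \<Longrightarrow> \<gamma> t \<in> S"
  using smooth_curveD by (rule conjunct1)

lemma tangent_space_mono: "S \<subseteq> S' \<Longrightarrow> tangent_space A S p \<subseteq> tangent_space A S' p"
  unfolding tangent_space_def by (auto dest: smooth_curve_subset)

lemma tangent_spaceI:
  "\<epsilon> > 0 \<Longrightarrow> smooth_curve A S \<epsilon> \<gamma> \<Longrightarrow> \<gamma> 0 = p \<Longrightarrow> velocity A \<gamma> 0 \<in> tangent_space A S p"
  unfolding tangent_space_def by blast

lemma tangent_spaceE:
  assumes "w \<in> tangent_space A S p"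
  obtains \<gamma> \<epsilon> where "\<epsilon> > 0" "smooth_curve A S \<epsilon> \<gamma>" "\<gamma> 0 = p" "w = velocity A \<gamma> 0"
  using assms unfolding tangent_space_def by blast

lemma velocity_apply: "c \<in> A \<Longrightarrow> \<gamma> t \<in> fst c \<Longrightarrow> velocity A \<gamma> t c = vector_derivative (snd c \<circ> \<gamma>) (at t)"
  by (simp add: velocity_def)

lemma smooth_curve_has_velocity:
  assumes "smooth_curve A S \<epsilon> \<gamma>" "\<bar>t\<bar> < \<epsilon>" "c \<in> A" "\<gamma> t \<in> fst c"
  shows "((snd c \<circ> \<gamma>) has_vector_derivative velocity A \<gamma> t c) (at t)"
proof -
  obtain \<delta> where "\<delta> > 0" "smooth_on (ball t \<delta>) (snd c \<circ> \<gamma>)"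
    by (rule smooth_curveE[OF assms])
  then show ?thesis
    using smooth_on_has_vector_derivative[of "ball t \<delta>" "snd c \<circ> \<gamma>" t]
    by (simp add: velocity_apply assms(3,4))
qed

lemma curve_through_smooth_map:
  fixes A :: "('p, 'a::real_normed_vector) chart set"
  assumes fd: "fin_dim TYPE('a)" and f: "smooth_map A S A' S' f"
    and \<delta>: "\<delta> > 0" "\<gamma> ` ball t \<delta> \<subseteq> fst c" "\<gamma> ` ball t \<delta> \<subseteq> S" "smooth_on (ball t \<delta>) (snd c \<circ> \<gamma>)"
    and c: "c \<in> A" "c' \<in> A'" "f (\<gamma> t) \<in> fst c'"
  obtains \<delta>' where "\<delta>' > 0" "\<delta>' \<le> \<delta>" "(f \<circ> \<gamma>) ` ball t \<delta>' \<subseteq> fst c'"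
    "smooth_on (ball t \<delta>') (snd c' \<circ> (f \<circ> \<gamma>))"
proof -
  have t: "\<gamma> t \<in> S" "\<gamma> t \<in> fst c" using \<delta> by auto
  obtain W F where W: "open W" "snd c (\<gamma> t) \<in> W" "smooth_on W F"
    "\<And>q. q \<in> S \<Longrightarrow> q \<in> fst c \<Longrightarrow> snd c q \<in> W \<Longrightarrow> f q \<in> fst c' \<and> snd c' (f q) = F (snd c q)"
    using smooth_mapE[OF f t(1) c(1,2) t(2) c(3)] by blast
  have cont: "continuous_on (ball t \<delta>) (snd c \<circ> \<gamma>)" by (rule smooth_on_continuous[OF \<delta>(4)])
  have "open (ball t \<delta> \<inter> (snd c \<circ> \<gamma>) -` W)"
    using continuous_open_preimage[OF cont open_ball W(1)] .
  moreover have "t \<in> ball t \<delta> \<inter> (snd c \<circ> \<gamma>) -` W" using W(2) \<delta>(1) by auto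
  ultimately obtain \<delta>1 where \<delta>1: "\<delta>1 > 0" "ball t \<delta>1 \<subseteq> ball t \<delta> \<inter> (snd c \<circ> \<gamma>) -` W"
    using open_contains_ball by metis
  define \<delta>' where "\<delta>' = min \<delta> \<delta>1"
  have sub: "ball t \<delta>' \<subseteq> ball t \<delta>" "ball t \<delta>' \<subseteq> ball t \<delta> \<inter> (snd c \<circ> \<gamma>) -` W"
    using \<delta>1(2) by (auto simp: \<delta>'_def)
  have in_W: "f (\<gamma> s) \<in> fst c' \<and> snd c' (f (\<gamma> s)) = F (snd c (\<gamma> s))" if "s \<in> ball t \<delta>'" for s
  proof (rule W(4))
    have s: "s \<in> ball t \<delta>" "s \<in> (snd c \<circ> \<gamma>) -` W" using sub(1,2) that by auto
    show "\<gamma> s \<in> S" "\<gamma> s \<in> fst c" using \<delta>(2,3) s(1) by auto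
    show "snd c (\<gamma> s) \<in> W" using s(2) by simp
  qed
  show ?thesis
  proof (rule that[of \<delta>'])
    have "smooth_on (ball t \<delta>') (\<lambda>s. F ((snd c \<circ> \<gamma>) s))"
      by (rule smooth_on_compose[OF fd open_ball smooth_on_subset[OF \<delta>(4) sub(1)] W(3)]) (use sub in auto)
    then show "smooth_on (ball t \<delta>') (snd c' \<circ> (f \<circ> \<gamma>))"
      by (rule smooth_on_cong[OF open_ball]) (use in_W in auto)
  qed (use in_W \<delta> \<delta>1 in \<open>auto simp: \<delta>'_def\<close>)
qed

lemma smooth_map_curve:
  fixes A :: "('p, 'a::real_normed_vector) chart set"
  assumes fd: "fin_dim TYPE('a)" and f: "smooth_map A S A' S' f"
    and cov: "\<And>p. p \<in> S \<Longrightarrow> \<exists>c\<in>A. p \<in> fst c" and \<gamma>: "smooth_curve A S \<epsilon> \<gamma>"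
  shows "smooth_curve A' S' \<epsilon> (f \<circ> \<gamma>)"
proof (rule smooth_curveI)
  show "(f \<circ> \<gamma>) t \<in> S'" if "\<bar>t\<bar> < \<epsilon>" for t
    using smooth_curve_mem[OF \<gamma> that] f by (auto simp: smooth_map_def)
  fix t c' assume t: "\<bar>t\<bar> < \<epsilon>" and c': "c' \<in> A'" "(f \<circ> \<gamma>) t \<in> fst c'"
  obtain c where c: "c \<in> A" "\<gamma> t \<in> fst c" using cov[OF smooth_curve_mem[OF \<gamma> t]] by blast
  obtain \<delta> where \<delta>: "\<delta> > 0" "\<gamma> ` ball t \<delta> \<subseteq> fst c" "\<gamma> ` ball t \<delta> \<subseteq> S"
    "smooth_on (ball t \<delta>) (snd c \<circ> \<gamma>)"
    using smooth_curveE[OF \<gamma> t c] by metis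
  show "\<exists>\<delta>>0. (f \<circ> \<gamma>) ` ball t \<delta> \<subseteq> fst c' \<and> smooth_on (ball t \<delta>) (snd c' \<circ> (f \<circ> \<gamma>))"
    using curve_through_smooth_map[OF fd f \<delta> c(1) c'(1)] c'(2) by (metis comp_apply)
qed

text \<open>One linear map serves all curves through \<open>p\<close>, namely the derivative of a local extension of
  \<open>f\<close> in charts.  Hence the velocity of an image curve depends only on the velocity of the curve,
  and does so linearly.\<close>

lemma smooth_map_velocity:
  fixes A :: "('p, 'a::real_normed_vector) chart set"
  assumes f: "smooth_map A S A' S' f" and p: "p \<in> S" "c \<in> A" "p \<in> fst c"
  obtains \<Lambda> where "bounded_linear \<Lambda>"
    "\<And>\<gamma> \<epsilon>. \<epsilon> > 0 \<Longrightarrow> smooth_curve A S \<epsilon> \<gamma> \<Longrightarrow> \<gamma> 0 = p \<Longrightarrow>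
      velocity A' (f \<circ> \<gamma>) 0 c' = \<Lambda> (velocity A \<gamma> 0 c)"
proof (cases "c' \<in> A' \<and> f p \<in> fst c'")
  case False
  show ?thesis
    by (rule that[of "\<lambda>_. 0"]) (use False in \<open>auto simp: velocity_def\<close>)
next
  case True
  obtain W F where W: "open W" "snd c p \<in> W" "smooth_on W F"
    "\<And>q. q \<in> S \<Longrightarrow> q \<in> fst c \<Longrightarrow> snd c q \<in> W \<Longrightarrow> f q \<in> fst c' \<and> snd c' (f q) = F (snd c q)"
    using smooth_mapE[OF f p(1,2) _ p(3)] True by blast
  let ?L = "frechet_derivative F (at (snd c p))"
  have dF: "(F has_derivative ?L) (at (snd c p))" by (rule smooth_on_has_derivative[OF W(3,2)])
  show ?thesis
  proof (rule that[of ?L])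
    show "bounded_linear ?L" using dF has_derivative_bounded_linear by blast
    fix \<gamma> :: "real \<Rightarrow> 'p" and \<epsilon> :: real
    assume \<gamma>: "\<epsilon> > 0" "smooth_curve A S \<epsilon> \<gamma>" "\<gamma> 0 = p"
    have v: "((snd c \<circ> \<gamma>) has_vector_derivative velocity A \<gamma> 0 c) (at 0)"
      using smooth_curve_has_velocity[OF \<gamma>(2) _ p(2), of 0] \<gamma> p by simp
    obtain \<delta> where \<delta>: "\<delta> > 0" "\<gamma> ` ball 0 \<delta> \<subseteq> fst c" "\<gamma> ` ball 0 \<delta> \<subseteq> S"
      "smooth_on (ball 0 \<delta>) (snd c \<circ> \<gamma>)"
      using smooth_curveE[OF \<gamma>(2) _ p(2), of 0] \<gamma> p by (metis abs_zero)
    let ?T = "ball 0 \<delta> \<inter> (snd c \<circ> \<gamma>) -` W"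
    have "open ?T"
      by (rule continuous_open_preimage[OF smooth_on_continuous[OF \<delta>(4)] open_ball W(1)])
    moreover have "0 \<in> ?T" using W(2) \<delta>(1) \<gamma>(3) by auto
    moreover have "((F \<circ> (snd c \<circ> \<gamma>)) has_vector_derivative ?L (velocity A \<gamma> 0 c)) (at 0)"
      by (rule vector_derivative_diff_chain_within[OF v])
        (use dF \<gamma>(3) in \<open>auto intro: has_derivative_at_withinI\<close>)
    moreover have "(F \<circ> (snd c \<circ> \<gamma>)) s = (snd c' \<circ> (f \<circ> \<gamma>)) s" if "s \<in> ?T" for s
    proof -
      have "f (\<gamma> s) \<in> fst c' \<and> snd c' (f (\<gamma> s)) = F (snd c (\<gamma> s))"
        by (rule W(4)) (use that \<delta>(2,3) in auto)
      then show ?thesis by simp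
    qed
    ultimately have "((snd c' \<circ> (f \<circ> \<gamma>)) has_vector_derivative ?L (velocity A \<gamma> 0 c)) (at 0)"
      by (metis (no_types, lifting) has_vector_derivative_transform_within_open)
    then show "velocity A' (f \<circ> \<gamma>) 0 c' = ?L (velocity A \<gamma> 0 c)"
      using True \<gamma>(3) by (simp add: velocity_def vector_derivative_at)
  qed
qed

text \<open>Compatibility of the charts is smoothness of the identity, so that facts about smooth maps
  specialize to changes of charts.\<close>

definition atlas_on :: "('p, 'a::real_normed_vector) chart set \<Rightarrow> 'p set \<Rightarrow> bool" where
  "atlas_on A S \<longleftrightarrow> (\<forall>p\<in>S. \<exists>c\<in>A. p \<in> fst c) \<and> smooth_map A S A S (\<lambda>p. p)"

lemma atlas_on_subset: "atlas_on A S \<Longrightarrow> S' \<subseteq> S \<Longrightarrow> atlas_on A S'"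
  unfolding atlas_on_def
proof (intro conjI ballI smooth_mapI)
  assume A: "(\<forall>p\<in>S. \<exists>c\<in>A. p \<in> fst c) \<and> smooth_map A S A S (\<lambda>p. p)" and sub: "S' \<subseteq> S"
  show "\<exists>c\<in>A. p \<in> fst c" if "p \<in> S'" for p using A sub that by blast
  fix p c c' assume p: "p \<in> S'" "c \<in> A" "c' \<in> A" "p \<in> fst c" "p \<in> fst c'"
  obtain W F where W: "open W" "snd c p \<in> W" "smooth_on W F"
    "\<And>q. q \<in> S \<Longrightarrow> q \<in> fst c \<Longrightarrow> snd c q \<in> W \<Longrightarrow> q \<in> fst c' \<and> snd c' q = F (snd c q)"
    by (rule smooth_mapE[OF conjunct2[OF A], of p c c']) (use p sub in auto)
  show "\<exists>W F. open W \<and> snd c p \<in> W \<and> smooth_on W F \<and>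
        (\<forall>q\<in>S' \<inter> fst c. snd c q \<in> W \<longrightarrow> q \<in> fst c' \<and> snd c' q = F (snd c q))"
    by (rule exI[of _ W], rule exI[of _ F]) (use W sub in auto)
qed simp

lemma tangent_space_transition:
  assumes "atlas_on A S" and p: "p \<in> S" "c \<in> A" "p \<in> fst c"
  obtains \<Lambda> where "bounded_linear \<Lambda>" "\<forall>w\<in>tangent_space A S p. w c' = \<Lambda> (w c)"
proof (rule smooth_map_velocity[OF conjunct2[OF assms(1)[unfolded atlas_on_def]] p, where c' = c'])
  fix \<Lambda> assume \<Lambda>: "bounded_linear \<Lambda>"
    "\<And>\<gamma> \<epsilon>. \<epsilon> > 0 \<Longrightarrow> smooth_curve A S \<epsilon> \<gamma> \<Longrightarrow> \<gamma> 0 = p \<Longrightarrow>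
      velocity A ((\<lambda>p. p) \<circ> \<gamma>) 0 c' = \<Lambda> (velocity A \<gamma> 0 c)"
  show thesis
    by (rule that[OF \<Lambda>(1)]) (use \<Lambda>(2) in \<open>auto elim!: tangent_spaceE simp: o_def\<close>)
qed

text \<open>A tangent vector is a family over all charts, but one chart determines it.  Equations between
  tangent vectors are therefore checked in a single chart; the next two lemmas do the same for the
  linear operations.\<close>

lemma tangent_space_eqI:
  assumes "atlas_on A S" "p \<in> S" "c \<in> A" "p \<in> fst c"
    "w \<in> tangent_space A S p" "w' \<in> tangent_space A S p" "w c = w' c"
  shows "w = w'"
proof
  fix c'
  show "w c' = w' c'"
    by (rule tangent_space_transition[OF assms(1-4), of c']) (use assms(5-7) in metis)
qed

lemma tangent_space_taddI:
  assumes "atlas_on A S" "p \<in> S" "c \<in> A" "p \<in> fst c"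
    "w \<in> tangent_space A S p" "w1 \<in> tangent_space A S p" "w2 \<in> tangent_space A S p" "w c = w1 c + w2 c"
  shows "w = tadd w1 w2"
proof
  fix c'
  obtain \<Lambda> where \<Lambda>: "bounded_linear \<Lambda>" "\<forall>w\<in>tangent_space A S p. w c' = \<Lambda> (w c)"
    by (rule tangent_space_transition[OF assms(1-4), where c' = c'])
  interpret bounded_linear \<Lambda> by (rule \<Lambda>)
  show "w c' = tadd w1 w2 c'"
    unfolding tadd_def \<Lambda>(2)[THEN bspec, OF assms(5)] \<Lambda>(2)[THEN bspec, OF assms(6)] \<Lambda>(2)[THEN bspec, OF assms(7)] assms(8) by (rule add)
qed

lemma tangent_space_tscaleI:
  assumes "atlas_on A S" "p \<in> S" "c \<in> A" "p \<in> fst c"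
    "w \<in> tangent_space A S p" "w1 \<in> tangent_space A S p" "w c = r *\<^sub>R w1 c"
  shows "w = tscale r w1"
proof
  fix c'
  obtain \<Lambda> where \<Lambda>: "bounded_linear \<Lambda>" "\<forall>w\<in>tangent_space A S p. w c' = \<Lambda> (w c)"
    by (rule tangent_space_transition[OF assms(1-4), where c' = c'])
  interpret bounded_linear \<Lambda> by (rule \<Lambda>)
  show "w c' = tscale r w1 c'"
    unfolding tscale_def \<Lambda>(2)[THEN bspec, OF assms(5)] \<Lambda>(2)[THEN bspec, OF assms(6)] assms(7) by (rule scaleR)
qed

lemma differential_velocity:
  fixes A :: "('p, 'a::real_normed_vector) chart set"
  assumes f: "smooth_map A S A' S' f" and p: "p \<in> S" "\<exists>c\<in>A. p \<in> fst c"
    and \<gamma>: "\<epsilon> > 0" "smooth_curve A S \<epsilon> \<gamma>" "\<gamma> 0 = p"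
  shows "differential A S A' f p (velocity A \<gamma> 0) = velocity A' (f \<circ> \<gamma>) 0"
  unfolding differential_def
proof (rule the_equality)
  show "\<exists>\<gamma>' \<epsilon>. \<epsilon> > 0 \<and> smooth_curve A S \<epsilon> \<gamma>' \<and> \<gamma>' 0 = p \<and> velocity A \<gamma>' 0 = velocity A \<gamma> 0 \<and>
     velocity A' (f \<circ> \<gamma>) 0 = velocity A' (f \<circ> \<gamma>') 0"
    using \<gamma> by blast
  fix w' assume "\<exists>\<gamma>' \<epsilon>. \<epsilon> > 0 \<and> smooth_curve A S \<epsilon> \<gamma>' \<and> \<gamma>' 0 = p \<and> velocity A \<gamma>' 0 = velocity A \<gamma> 0 \<and>
     w' = velocity A' (f \<circ> \<gamma>') 0"
  then obtain \<gamma>' \<epsilon>' where \<gamma>': "\<epsilon>' > 0" "smooth_curve A S \<epsilon>' \<gamma>'" "\<gamma>' 0 = p" "velocity A \<gamma>' 0 = velocity A \<gamma> 0"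
     "w' = velocity A' (f \<circ> \<gamma>') 0" by blast
  show "w' = velocity A' (f \<circ> \<gamma>) 0"
  proof
    fix c'
    obtain c where c: "c \<in> A" "p \<in> fst c" using p by blast
    show "w' c' = velocity A' (f \<circ> \<gamma>) 0 c'"
      by (rule smooth_map_velocity[OF f p(1) c, of c']) (use \<gamma> \<gamma>' in metis)
  qed
qed

lemma smooth_on_shift:
  assumes "smooth_on (ball (t + s) \<delta>) (f :: real \<Rightarrow> 'a::real_normed_vector)"
  shows "smooth_on (ball s \<delta>) (\<lambda>s. f (t + s))"
proof (rule smooth_on_compose_euclidean[OF open_ball _ assms])
  show "smooth_on (ball s \<delta>) (\<lambda>s. t + s)"
    by (intro smooth_on_add smooth_on_const smooth_on_linear open_ball bounded_linear_ident)
qed (auto simp: dist_real_def)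

lemma smooth_curve_shift:
  assumes "smooth_curve A S \<epsilon> \<gamma>" "\<bar>t\<bar> < \<epsilon>"
  shows "smooth_curve A S (\<epsilon> - \<bar>t\<bar>) (\<lambda>s. \<gamma> (t + s))"
proof (rule smooth_curveI)
  show "\<gamma> (t + s) \<in> S" if "\<bar>s\<bar> < \<epsilon> - \<bar>t\<bar>" for s
    by (rule smooth_curve_mem[OF assms(1)]) (use that in auto)
  fix s c assume s: "\<bar>s\<bar> < \<epsilon> - \<bar>t\<bar>" and c: "c \<in> A" "\<gamma> (t + s) \<in> fst c"
  have ts: "\<bar>t + s\<bar> < \<epsilon>" using s by auto
  obtain \<delta> where \<delta>: "\<delta> > 0" "\<gamma> ` ball (t + s) \<delta> \<subseteq> fst c" "smooth_on (ball (t + s) \<delta>) (snd c \<circ> \<gamma>)"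
    using smooth_curveE[OF assms(1) ts c] by metis
  show "\<exists>\<delta>>0. (\<lambda>s. \<gamma> (t + s)) ` ball s \<delta> \<subseteq> fst c \<and> smooth_on (ball s \<delta>) (snd c \<circ> (\<lambda>s. \<gamma> (t + s)))"
  proof (intro exI[of _ \<delta>] conjI)
    show "(\<lambda>s. \<gamma> (t + s)) ` ball s \<delta> \<subseteq> fst c"
      using \<delta>(2) by (auto simp: dist_real_def image_subset_iff)
    show "smooth_on (ball s \<delta>) (snd c \<circ> (\<lambda>s. \<gamma> (t + s)))"
      using smooth_on_shift[OF \<delta>(3)] by (simp add: o_def)
  qed (rule \<delta>)
qed

lemma has_vector_derivative_id_at_shift:
  "((\<lambda>s. t + s) has_vector_derivative 1) (at s)" "((\<lambda>s. s - t) has_vector_derivative 1) (at s)"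
  by (auto intro!: derivative_eq_intros)

lemma velocity_shift:
  fixes A :: "('p, 'a::real_normed_vector) chart set"
  shows "velocity A \<gamma> t = velocity A (\<lambda>s. \<gamma> (t + s)) 0"
proof
  fix c :: "('p, 'a) chart"
  have "vector_derivative (snd c \<circ> \<gamma>) (at t) = vector_derivative (snd c \<circ> (\<lambda>s. \<gamma> (t + s))) (at 0)"
  proof -
    have "((\<lambda>s. (snd c \<circ> \<gamma>) (t + s)) has_vector_derivative d) (at 0)" if "((snd c \<circ> \<gamma>) has_vector_derivative d) (at t)" for d
      using vector_diff_chain_at[of "\<lambda>s. t + s" 1 0 "snd c \<circ> \<gamma>" d] that
      by (simp add: o_def has_vector_derivative_id_at_shift)
    moreover have "((\<lambda>s. (snd c \<circ> \<gamma>) (t + (s - t))) has_vector_derivative d) (at t)"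
      if "((\<lambda>s. (snd c \<circ> \<gamma>) (t + s)) has_vector_derivative d) (at 0)" for d
      using vector_diff_chain_at[of "\<lambda>s. s - t" 1 t "\<lambda>s. (snd c \<circ> \<gamma>) (t + s)" d] that
      by (simp add: o_def has_vector_derivative_id_at_shift)
    ultimately have "(snd c \<circ> \<gamma> has_vector_derivative d) (at t) \<longleftrightarrow>
        (snd c \<circ> (\<lambda>s. \<gamma> (t + s)) has_vector_derivative d) (at 0)" for d
      by (auto simp: o_def)
    then show ?thesis unfolding vector_derivative_def by simp
  qed
  then show "velocity A \<gamma> t c = velocity A (\<lambda>s. \<gamma> (t + s)) 0 c"
    by (simp add: velocity_def)
qed

lemma velocity_in_tangent_space:
  assumes "smooth_curve A S \<epsilon> \<gamma>" "\<bar>t\<bar> < \<epsilon>"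
  shows "velocity A \<gamma> t \<in> tangent_space A S (\<gamma> t)"
  unfolding velocity_shift[of A \<gamma> t]
  by (rule tangent_spaceI[OF _ smooth_curve_shift[OF assms]]) (use assms in auto)

section \<open>Functions and vectors on a complex manifold\<close>

locale complex_mfd =
  fixes A :: "('m::{t2_space,second_countable_topology}, complex^'n) chart set"
  assumes complex_manifold: "complex_manifold A"
begin

lemmas mfd_conjs = complex_manifold[unfolded complex_manifold_def, THEN conjunct1]
  complex_manifold[unfolded complex_manifold_def, THEN conjunct2, THEN conjunct1]
  complex_manifold[unfolded complex_manifold_def, THEN conjunct2, THEN conjunct2]

lemma chart_covers: "\<exists>c\<in>A. x \<in> fst c"
proof -
  have "x \<in> (\<Union>(U, z)\<in>A. U)" unfolding mfd_conjs(1) by simp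
  then show ?thesis by (auto simp: case_prod_beta)
qed

lemma chart_at: "chart_at A x \<in> A" "x \<in> fst (chart_at A x)"
  using someI_ex[of "\<lambda>c. c \<in> A \<and> x \<in> fst c"] chart_covers[of x] unfolding chart_at_def by blast+

lemma chart_props:
  assumes "c \<in> A"
  shows "open (fst c)" "open (snd c ` fst c)"
    "homeomorphism (fst c) (snd c ` fst c) (snd c) (inv_into (fst c) (snd c))"
proof -
  have "\<forall>(U, z)\<in>A. open U \<and> open (z ` U) \<and> homeomorphism U (z ` U) z (inv_into U z)"
    by (rule mfd_conjs(2))
  from bspec[OF this assms] show "open (fst c)" "open (snd c ` fst c)"
    "homeomorphism (fst c) (snd c ` fst c) (snd c) (inv_into (fst c) (snd c))"
    by (auto simp: case_prod_beta)
qed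

lemma chart_inj: "c \<in> A \<Longrightarrow> inj_on (snd c) (fst c)"
  using chart_props(3)[of c] unfolding homeomorphism_def by (intro inj_onI) metis

lemma chart_inv: "c \<in> A \<Longrightarrow> x \<in> fst c \<Longrightarrow> inv_into (fst c) (snd c) (snd c x) = x"
  by (simp add: chart_inj)

lemma chart_inv': 
  "\<zeta> \<in> snd c ` V \<Longrightarrow> V \<subseteq> fst c \<Longrightarrow> c \<in> A \<Longrightarrow>
    snd c (inv_into (fst c) (snd c) \<zeta>) = \<zeta> \<and> inv_into (fst c) (snd c) \<zeta> \<in> V"
  using chart_inv by auto

lemma chart_image_open: "c \<in> A \<Longrightarrow> open W \<Longrightarrow> open (snd c ` (fst c \<inter> W))"
proof -
  assume c: "c \<in> A" and W: "open W"
  have "openin (top_of_set (snd c ` fst c)) (snd c ` (fst c \<inter> W))"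
    by (rule homeomorphism_imp_open_map[OF chart_props(3)[OF c]])
      (use W in \<open>auto simp: openin_open\<close>)
  then show ?thesis using chart_props(2)[OF c] openin_open_eq by blast
qed

lemma chart_transition_holo:
  assumes "c \<in> A" "c' \<in> A"
  shows "holo_on (snd c ` (fst c \<inter> fst c')) (snd c' \<circ> inv_into (fst c) (snd c))"
proof -
  have "\<forall>(U, z)\<in>A. \<forall>(U', z')\<in>A. holo_on (z ` (U \<inter> U')) (z' \<circ> inv_into U z)"
    by (rule mfd_conjs(3))
  from bspec[OF this assms(1)] have "\<forall>(U', z')\<in>A. holo_on (snd c ` (fst c \<inter> U')) (z' \<circ> inv_into (fst c) (snd c))"
    by (simp add: case_prod_beta)
  from bspec[OF this assms(2)] show ?thesis by (simp add: case_prod_beta)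
qed

lemma chart_transition_smooth:
  "c \<in> A \<Longrightarrow> c' \<in> A \<Longrightarrow> smooth_on (snd c ` (fst c \<inter> fst c')) (snd c' \<circ> inv_into (fst c) (snd c))"
  using chart_transition_holo unfolding holo_on_def by blast

lemma atlas_on_UNIV: "atlas_on A UNIV"
  unfolding atlas_on_def
proof (intro conjI ballI smooth_mapI)
  show "\<exists>c\<in>A. p \<in> fst c" for p by (rule chart_covers)
  fix p c c' assume c: "c \<in> A" "c' \<in> A" "p \<in> fst c" "p \<in> fst c'"
  show "\<exists>W F. open W \<and> snd c p \<in> W \<and> smooth_on W F \<and>
        (\<forall>q\<in>UNIV \<inter> fst c. snd c q \<in> W \<longrightarrow> q \<in> fst c' \<and> snd c' q = F (snd c q))"
  proof (rule exI[of _ "snd c ` (fst c \<inter> fst c')"], rule exI[of _ "snd c' \<circ> inv_into (fst c) (snd c)"],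
      intro conjI ballI impI)
    fix q assume q: "q \<in> UNIV \<inter> fst c" "snd c q \<in> snd c ` (fst c \<inter> fst c')"
    then show "q \<in> fst c'" using chart_inj[OF c(1)] by (auto dest: inj_onD)
    show "snd c' q = (snd c' \<circ> inv_into (fst c) (snd c)) (snd c q)"
      using q chart_inv[OF c(1)] by simp
  qed (use c chart_image_open[OF c(1) chart_props(1)[OF c(2)]] chart_transition_smooth[OF c(1,2)] in auto)
qed simp

lemma curve_continuous:
  assumes "smooth_curve A UNIV \<epsilon> \<gamma>" "\<bar>t\<bar> < \<epsilon>" "open W" "\<gamma> t \<in> W"
  obtains \<delta> where "\<delta> > 0" "\<bar>t\<bar> + \<delta> \<le> \<epsilon>" "\<gamma> ` ball t \<delta> \<subseteq> W"
proof -
  obtain c where c: "c \<in> A" "\<gamma> t \<in> fst c" using chart_covers by blast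
  obtain \<delta> where \<delta>: "\<delta> > 0" "\<bar>t\<bar> + \<delta> \<le> \<epsilon>" "\<gamma> ` ball t \<delta> \<subseteq> fst c" 
    "smooth_on (ball t \<delta>) (snd c \<circ> \<gamma>)"
    by (rule smooth_curveE[OF assms(1,2) c])
  have "open (ball t \<delta> \<inter> (snd c \<circ> \<gamma>) -` (snd c ` (fst c \<inter> W)))"
    by (rule continuous_open_preimage[OF smooth_on_continuous[OF \<delta>(4)] open_ball chart_image_open[OF c(1) assms(3)]])
  moreover have "t \<in> ball t \<delta> \<inter> (snd c \<circ> \<gamma>) -` (snd c ` (fst c \<inter> W))" using c assms(4) \<delta>(1) by auto
  ultimately obtain d where d: "d > 0" "ball t d \<subseteq> ball t \<delta> \<inter> (snd c \<circ> \<gamma>) -` (snd c ` (fst c \<inter> W))"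
    using open_contains_ball by metis
  show ?thesis
  proof (rule that[of "min \<delta> d"])
    show "\<gamma> ` ball t (min \<delta> d) \<subseteq> W"
    proof safe
      fix s assume s: "s \<in> ball t (min \<delta> d)"
      then have "s \<in> ball t \<delta>" "s \<in> (snd c \<circ> \<gamma>) -` (snd c ` (fst c \<inter> W))" using d(2) by auto
      then have "\<gamma> s \<in> fst c" "snd c (\<gamma> s) \<in> snd c ` (fst c \<inter> W)" using \<delta>(3) by auto
      then show "\<gamma> s \<in> W" using chart_inj[OF c(1)] by (auto dest: inj_onD)
    qed
  qed (use \<delta> d in auto)
qed

subsection \<open>Smooth functions\<close>

lemma smooth_funD:
  "smooth_fun A W f \<Longrightarrow> c \<in> A \<Longrightarrow> smooth_on (snd c ` (fst c \<inter> W)) (f \<circ> inv_into (fst c) (snd c))"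
  unfolding smooth_fun_def by (auto simp: case_prod_beta)

lemma smooth_funI:
  "(\<And>c. c \<in> A \<Longrightarrow> smooth_on (snd c ` (fst c \<inter> W)) (f \<circ> inv_into (fst c) (snd c))) \<Longrightarrow> smooth_fun A W f"
  unfolding smooth_fun_def by (auto simp: case_prod_beta)

lemma smooth_fun_subset: "smooth_fun A W f \<Longrightarrow> V \<subseteq> W \<Longrightarrow> smooth_fun A V f"
  by (rule smooth_funI, rule smooth_on_subset[OF smooth_funD]) auto

lemma smooth_fun_cong:
  assumes "open W" "smooth_fun A W f" "\<And>x. x \<in> W \<Longrightarrow> f x = g x"
  shows "smooth_fun A W g"
proof (rule smooth_funI)
  fix c assume c: "c \<in> A"
  show "smooth_on (snd c ` (fst c \<inter> W)) (g \<circ> inv_into (fst c) (snd c))"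
    by (rule smooth_on_cong[OF chart_image_open[OF c assms(1)] smooth_funD[OF assms(2) c]])
      (use chart_inv'[OF _ _ c, of _ "fst c \<inter> W"] assms(3) in auto)
qed

lemma smooth_fun_const: "open W \<Longrightarrow> smooth_fun A W (\<lambda>x. k)"
  by (rule smooth_funI) (simp add: o_def smooth_on_const chart_image_open)

lemma smooth_fun_add: "open W \<Longrightarrow> smooth_fun A W f \<Longrightarrow> smooth_fun A W g \<Longrightarrow> smooth_fun A W (\<lambda>x. f x + g x)"
  by (rule smooth_funI)
    (use smooth_on_add[OF chart_image_open smooth_funD smooth_funD] in \<open>simp add: o_def\<close>)

lemma smooth_fun_bounded_linear:
  "open W \<Longrightarrow> bounded_linear L \<Longrightarrow> smooth_fun A W f \<Longrightarrow> smooth_fun A W (\<lambda>x. L (f x))"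
  by (rule smooth_funI)
    (use smooth_on_bounded_linear[OF chart_image_open _ smooth_funD] in \<open>simp add: o_def\<close>)

lemma smooth_fun_bilinear:
  "bounded_bilinear bop \<Longrightarrow> open W \<Longrightarrow> smooth_fun A W f \<Longrightarrow> smooth_fun A W g \<Longrightarrow>
    smooth_fun A W (\<lambda>x. bop (f x) (g x))"
  by (rule smooth_funI)
    (use smooth_on_bilinear[OF _ chart_image_open smooth_funD smooth_funD] in \<open>simp add: o_def\<close>)

lemma smooth_fun_sum:
  "open W \<Longrightarrow> (\<And>i. i \<in> I \<Longrightarrow> smooth_fun A W (f i)) \<Longrightarrow> smooth_fun A W (\<lambda>x. \<Sum>i\<in>I. f i x)"
  by (induction I rule: infinite_finite_induct) (auto intro!: smooth_fun_const smooth_fun_add)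

lemma smooth_fun_blinfunI:
  "open W \<Longrightarrow> (\<And>a. smooth_fun A W (\<lambda>x. blinfun_apply (f x) (a::'e::euclidean_space))) \<Longrightarrow> smooth_fun A W f"
  by (rule smooth_funI, rule smooth_on_blinfunI[OF chart_image_open])
    (use smooth_funD[of W "\<lambda>x. blinfun_apply (f x) _"] in \<open>auto simp: o_def\<close>)

lemma smooth_fun_blinfun_inv:
  assumes "open W" "smooth_fun A W f" "\<And>x. x \<in> W \<Longrightarrow> blinfun_invertible (f x)"
  shows "smooth_fun A W (\<lambda>x. blinfun_inv (f x))"
proof (rule smooth_funI)
  fix c assume c: "c \<in> A"
  show "smooth_on (snd c ` (fst c \<inter> W)) ((\<lambda>x. blinfun_inv (f x)) \<circ> inv_into (fst c) (snd c))"
    using smooth_on_blinfun_inv[OF chart_image_open[OF c assms(1)] smooth_funD[OF assms(2) c]]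
      chart_inv'[OF _ _ c, of _ "fst c \<inter> W"] assms(3) by (auto simp: o_def)
qed

lemma smooth_fun_along_ball:
  assumes "open W" "smooth_fun A W f" "smooth_curve A UNIV \<epsilon> \<gamma>" "\<bar>t\<bar> < \<epsilon>" "\<gamma> t \<in> W" "c \<in> A" "\<gamma> t \<in> fst c"
  obtains \<delta> where "\<delta> > 0" "\<bar>t\<bar> + \<delta> \<le> \<epsilon>" "\<gamma> ` ball t \<delta> \<subseteq> W \<inter> fst c" "smooth_on (ball t \<delta>) (snd c \<circ> \<gamma>)"
    "\<And>s. s \<in> ball t \<delta> \<Longrightarrow> ((f \<circ> inv_into (fst c) (snd c)) \<circ> (snd c \<circ> \<gamma>)) s = (f \<circ> \<gamma>) s"
proof -
  obtain \<delta> where \<delta>: "\<delta> > 0" "\<bar>t\<bar> + \<delta> \<le> \<epsilon>" "\<gamma> ` ball t \<delta> \<subseteq> fst c" "smooth_on (ball t \<delta>) (snd c \<circ> \<gamma>)"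
    by (rule smooth_curveE[OF assms(3,4,6,7)])
  obtain \<delta>' where \<delta>': "\<delta>' > 0" "\<bar>t\<bar> + \<delta>' \<le> \<epsilon>" "\<gamma> ` ball t \<delta>' \<subseteq> W"
    by (rule curve_continuous[OF assms(3,4,1,5)])
  let ?d = "min \<delta> \<delta>'"
  have sub: "\<gamma> ` ball t ?d \<subseteq> W \<inter> fst c"
  proof safe
    fix s assume s: "s \<in> ball t ?d"
    then have "s \<in> ball t \<delta>" "s \<in> ball t \<delta>'" by auto
    then show "\<gamma> s \<in> W" "\<gamma> s \<in> fst c" using \<delta>(3) \<delta>'(3) by auto
  qed
  show ?thesis
    by (rule that[of ?d, OF _ _ sub smooth_on_subset[OF \<delta>(4)]])
      (use \<delta>(1,2) \<delta>'(1) sub chart_inv[OF assms(6)] in \<open>auto simp: image_subset_iff\<close>)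
qed

lemma smooth_fun_along:
  assumes "open W" "smooth_fun A W f" "smooth_curve A UNIV \<epsilon> \<gamma>" "T \<subseteq> {-\<epsilon><..<\<epsilon>}" "\<gamma> ` T \<subseteq> W"
  shows "smooth_on T (f \<circ> \<gamma>)"
proof (rule smooth_on_local)
  fix t assume t: "t \<in> T"
  then have "t \<in> {-\<epsilon><..<\<epsilon>}" "\<gamma> t \<in> W" using assms by auto
  then have t': "\<bar>t\<bar> < \<epsilon>" "\<gamma> t \<in> W" by auto
  obtain c where c: "c \<in> A" "\<gamma> t \<in> fst c" using chart_covers by blast
  obtain \<delta> where \<delta>: "\<delta> > 0" "\<gamma> ` ball t \<delta> \<subseteq> W \<inter> fst c" "smooth_on (ball t \<delta>) (snd c \<circ> \<gamma>)"
    "\<And>s. s \<in> ball t \<delta> \<Longrightarrow> ((f \<circ> inv_into (fst c) (snd c)) \<circ> (snd c \<circ> \<gamma>)) s = (f \<circ> \<gamma>) s"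
    using smooth_fun_along_ball[OF assms(1,2,3) t' c] by metis
  have "smooth_on (ball t \<delta>) (\<lambda>s. (f \<circ> inv_into (fst c) (snd c)) ((snd c \<circ> \<gamma>) s))"
    by (rule smooth_on_compose_euclidean[OF open_ball \<delta>(3) smooth_funD[OF assms(2) c(1)]])
      (use \<delta>(2) in auto)
  then have "smooth_on (ball t \<delta>) (f \<circ> \<gamma>)"
    by (rule smooth_on_cong[OF open_ball]) (use \<delta>(4) in auto)
  then show "\<exists>T. open T \<and> t \<in> T \<and> smooth_on T (f \<circ> \<gamma>)" using \<delta>(1) by (intro exI[of _ "ball t \<delta>"]) auto
qed

text \<open>The differential of a function is independent of the chart used in \<open>dfun\<close>: it
  differentiates the function along curves.\<close>

lemma dfun_along:
  assumes "open W" "smooth_fun A W f" "smooth_curve A UNIV \<epsilon> \<gamma>" "\<bar>t\<bar> < \<epsilon>" "\<gamma> t \<in> W"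
  shows "((f \<circ> \<gamma>) has_vector_derivative dfun A f (\<gamma> t) (velocity A \<gamma> t)) (at t)"
proof -
  define c where "c = chart_at A (\<gamma> t)"
  have c: "c \<in> A" "\<gamma> t \<in> fst c" using chart_at by (auto simp: c_def)
  obtain \<delta> where \<delta>: "\<delta> > 0" "\<gamma> ` ball t \<delta> \<subseteq> W \<inter> fst c" "smooth_on (ball t \<delta>) (snd c \<circ> \<gamma>)"
    "\<And>s. s \<in> ball t \<delta> \<Longrightarrow> ((f \<circ> inv_into (fst c) (snd c)) \<circ> (snd c \<circ> \<gamma>)) s = (f \<circ> \<gamma>) s"
    using smooth_fun_along_ball[OF assms c] by metis
  let ?f = "f \<circ> inv_into (fst c) (snd c)"
  have "snd c (\<gamma> t) \<in> snd c ` (fst c \<inter> W)" using c assms(5) by auto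
  from smooth_on_has_derivative[OF smooth_funD[OF assms(2) c(1)] this]
  have "(?f has_derivative frechet_derivative ?f (at (snd c (\<gamma> t)))) (at (snd c (\<gamma> t)))" .
  then have "(?f has_derivative frechet_derivative ?f (at (snd c (\<gamma> t)))) (at ((snd c \<circ> \<gamma>) t) within (snd c \<circ> \<gamma>) ` UNIV)"
    by (auto intro: has_derivative_at_withinI)
  from vector_derivative_diff_chain_within[OF smooth_curve_has_velocity[OF assms(3,4) c] this]
  have "((?f \<circ> (snd c \<circ> \<gamma>)) has_vector_derivative dfun A f (\<gamma> t) (velocity A \<gamma> t)) (at t)"
    unfolding dfun_def Let_def c_def[symmetric] by (simp only: comp_def)
  then show ?thesis
    by (rule has_vector_derivative_transform_within_open[OF _ open_ball]) (use \<delta> in auto)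
qed

lemma dfun_eqI:
  assumes "open W" "smooth_fun A W f" "\<epsilon> > 0" "smooth_curve A UNIV \<epsilon> \<gamma>" "\<gamma> 0 \<in> W"
    "((f \<circ> \<gamma>) has_vector_derivative d) (at 0)"
  shows "dfun A f (\<gamma> 0) (velocity A \<gamma> 0) = d"
  using vector_derivative_unique_at[OF dfun_along[OF assms(1,2,4) _ assms(5)] assms(6)] assms(3) by simp

lemma dfun_has_derivative:
  assumes "open W" "smooth_fun A W f" "x \<in> W" "v \<in> tangent_space A UNIV x"
  obtains \<epsilon> \<gamma> where "\<epsilon> > 0" "smooth_curve A UNIV \<epsilon> \<gamma>" "\<gamma> 0 = x" "v = velocity A \<gamma> 0"
    "((f \<circ> \<gamma>) has_vector_derivative dfun A f x v) (at 0)"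
  using assms(4)
proof (rule tangent_spaceE)
  fix \<gamma> \<epsilon> assume \<gamma>: "\<epsilon> > 0" "smooth_curve A UNIV \<epsilon> \<gamma>" "\<gamma> 0 = x" "v = velocity A \<gamma> 0"
  show thesis
    by (rule that[OF \<gamma>]) (use dfun_along[OF assms(1,2) \<gamma>(2), of 0] \<gamma> assms(3) in simp)
qed

lemma dfun_cong:
  assumes "open W" "smooth_fun A W f" "\<And>y. y \<in> W \<Longrightarrow> f y = h y" "x \<in> W" "v \<in> tangent_space A UNIV x"
  shows "dfun A f x v = dfun A h x v"
proof -
  obtain \<epsilon> \<gamma> where \<gamma>: "\<epsilon> > 0" "smooth_curve A UNIV \<epsilon> \<gamma>" "\<gamma> 0 = x" "v = velocity A \<gamma> 0"
    "((h \<circ> \<gamma>) has_vector_derivative dfun A h x v) (at 0)"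
    by (rule dfun_has_derivative[OF assms(1) smooth_fun_cong[OF assms(1,2,3)] assms(4,5)]) 
  obtain \<delta> where \<delta>: "\<delta> > 0" "\<gamma> ` ball 0 \<delta> \<subseteq> W"
    by (rule curve_continuous[OF \<gamma>(2) _ assms(1), of 0]) (use \<gamma> assms(4) in auto)
  have "((f \<circ> \<gamma>) has_vector_derivative dfun A h x v) (at 0)"
    by (rule has_vector_derivative_transform_within_open[OF \<gamma>(5) open_ball[of 0 \<delta>]]) (use \<delta> assms(3) in \<open>auto simp: image_subset_iff\<close>)
  from dfun_eqI[OF assms(1,2) \<gamma>(1,2) _ this] show ?thesis using \<gamma> assms(4) by simp
qed

lemma dfun_const: "x \<in> W \<Longrightarrow> open W \<Longrightarrow> v \<in> tangent_space A UNIV x \<Longrightarrow> dfun A (\<lambda>y. k) x v = 0"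
  by (rule dfun_has_derivative[OF _ smooth_fun_const[of W k]])
    (auto simp: o_def intro: vector_derivative_unique_at)

lemma dfun_bilinear:
  assumes "bounded_bilinear bop" "open W" "smooth_fun A W f" "smooth_fun A W h" "x \<in> W" "v \<in> tangent_space A UNIV x"
  shows "dfun A (\<lambda>y. bop (f y) (h y)) x v = bop (f x) (dfun A h x v) + bop (dfun A f x v) (h x)"
  using assms(6)
proof (rule tangent_spaceE)
  fix \<gamma> \<epsilon> assume \<gamma>: "\<epsilon> > 0" "smooth_curve A UNIV \<epsilon> \<gamma>" "\<gamma> 0 = x" "v = velocity A \<gamma> 0"
  have "((\<lambda>t. bop ((f \<circ> \<gamma>) t) ((h \<circ> \<gamma>) t)) has_vector_derivative
      (bop ((f \<circ> \<gamma>) 0) (dfun A h (\<gamma> 0) v) + bop (dfun A f (\<gamma> 0) v) ((h \<circ> \<gamma>) 0))) (at 0)"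
    unfolding \<gamma>(4)
    by (intro bounded_bilinear.has_vector_derivative[OF assms(1)] dfun_along[OF assms(2)] assms(3,4))
      (use \<gamma> assms(5) in auto)
  then have "(((\<lambda>y. bop (f y) (h y)) \<circ> \<gamma>) has_vector_derivative
      (bop (f x) (dfun A h x v) + bop (dfun A f x v) (h x))) (at 0)"
    by (simp add: o_def \<gamma>(3))
  from dfun_eqI[OF assms(2) smooth_fun_bilinear[OF assms(1-4)] \<gamma>(1,2) _ this] show ?thesis
    using \<gamma> assms(5) by simp
qed

lemma dfun_bounded_linear:
  assumes "bounded_linear L" "open W" "smooth_fun A W f" "x \<in> W" "v \<in> tangent_space A UNIV x"
  shows "dfun A (\<lambda>y. L (f y)) x v = L (dfun A f x v)"
  using assms(5)
proof (rule tangent_spaceE)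
  fix \<gamma> \<epsilon> assume \<gamma>: "\<epsilon> > 0" "smooth_curve A UNIV \<epsilon> \<gamma>" "\<gamma> 0 = x" "v = velocity A \<gamma> 0"
  have "((\<lambda>t. L ((f \<circ> \<gamma>) t)) has_vector_derivative L (dfun A f (\<gamma> 0) v)) (at 0)"
    unfolding \<gamma>(4)
    by (intro bounded_linear.has_vector_derivative[OF assms(1)] dfun_along[OF assms(2)] assms(3))
      (use \<gamma> assms(4) in auto)
  then have "(((\<lambda>y. L (f y)) \<circ> \<gamma>) has_vector_derivative L (dfun A f x v)) (at 0)"
    by (simp add: o_def \<gamma>(3))
  from dfun_eqI[OF assms(2) smooth_fun_bounded_linear[OF assms(2,1,3)] \<gamma>(1,2) _ this] show ?thesis
    using \<gamma> assms(4) by simp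
qed

lemma dfun_add:
  assumes "open W" "smooth_fun A W f" "smooth_fun A W h" "x \<in> W" "v \<in> tangent_space A UNIV x"
  shows "dfun A (\<lambda>y. f y + h y) x v = dfun A f x v + dfun A h x v"
  using assms(5)
proof (rule tangent_spaceE)
  fix \<gamma> \<epsilon> assume \<gamma>: "\<epsilon> > 0" "smooth_curve A UNIV \<epsilon> \<gamma>" "\<gamma> 0 = x" "v = velocity A \<gamma> 0"
  have "((\<lambda>t. (f \<circ> \<gamma>) t + (h \<circ> \<gamma>) t) has_vector_derivative dfun A f (\<gamma> 0) v + dfun A h (\<gamma> 0) v) (at 0)"
    unfolding \<gamma>(4)
    by (intro has_vector_derivative_add dfun_along[OF assms(1)] assms(2,3)) (use \<gamma> assms(4) in auto)
  then have "(((\<lambda>y. f y + h y) \<circ> \<gamma>) has_vector_derivative dfun A f x v + dfun A h x v) (at 0)"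
    by (simp add: o_def \<gamma>(3))
  from dfun_eqI[OF assms(1) smooth_fun_add[OF assms(1-3)] \<gamma>(1,2) _ this] show ?thesis
    using \<gamma> assms(4) by simp
qed

subsection \<open>Coordinate lines\<close>

lemma coord_line:
  assumes c: "c \<in> A" "x \<in> fst c" "open W" "x \<in> W"
  obtains \<epsilon> where "\<epsilon> > 0" "smooth_curve A UNIV \<epsilon> (\<lambda>t. inv_into (fst c) (snd c) (snd c x + t *\<^sub>R \<xi>))"
    "\<And>t. \<bar>t\<bar> < \<epsilon> \<Longrightarrow> inv_into (fst c) (snd c) (snd c x + t *\<^sub>R \<xi>) \<in> fst c \<inter> W"
    "\<And>t. \<bar>t\<bar> < \<epsilon> \<Longrightarrow> snd c (inv_into (fst c) (snd c) (snd c x + t *\<^sub>R \<xi>)) = snd c x + t *\<^sub>R \<xi>"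
proof -
  let ?\<gamma> = "\<lambda>t. inv_into (fst c) (snd c) (snd c x + t *\<^sub>R \<xi>)"
  have cont: "continuous_on UNIV (\<lambda>t::real. snd c x + t *\<^sub>R \<xi>)" by (intro continuous_intros)
  have "open ((\<lambda>t::real. snd c x + t *\<^sub>R \<xi>) -` (snd c ` (fst c \<inter> W)))"
    using open_vimage[OF chart_image_open[OF c(1,3)] cont] .
  moreover have "0 \<in> (\<lambda>t::real. snd c x + t *\<^sub>R \<xi>) -` (snd c ` (fst c \<inter> W))" using c by auto
  ultimately obtain \<epsilon> where \<epsilon>: "\<epsilon> > 0" "ball 0 \<epsilon> \<subseteq> (\<lambda>t::real. snd c x + t *\<^sub>R \<xi>) -` (snd c ` (fst c \<inter> W))"
    using open_contains_ball by metis
  have mem: "snd c (?\<gamma> t) = snd c x + t *\<^sub>R \<xi> \<and> ?\<gamma> t \<in> fst c \<inter> W" if "\<bar>t\<bar> < \<epsilon>" for t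
    by (rule chart_inv'[OF _ _ c(1)]) (use \<epsilon>(2) that in auto)
  show ?thesis
  proof (rule that[OF \<epsilon>(1)])
    show "smooth_curve A UNIV \<epsilon> ?\<gamma>"
    proof (rule smooth_curveI)
      fix t c' assume t: "\<bar>t\<bar> < \<epsilon>" and c': "c' \<in> A" "?\<gamma> t \<in> fst c'"
      let ?\<delta> = "\<epsilon> - \<bar>t\<bar>"
      have sub: "\<bar>s\<bar> < \<epsilon>" if "s \<in> ball t ?\<delta>" for s using that by (auto simp: dist_real_def)
      have "smooth_on (ball t ?\<delta>) (\<lambda>s. snd c x + s *\<^sub>R \<xi>)"
        by (intro smooth_on_add smooth_on_const open_ball smooth_on_linear bounded_linear_scaleR_left)
      then have sm: "smooth_on (ball t ?\<delta>) (snd c \<circ> ?\<gamma>)"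
        by (rule smooth_on_cong[OF open_ball]) (use mem sub in auto)
      have "?\<delta> > 0" using t by simp
      moreover have "?\<gamma> ` ball t ?\<delta> \<subseteq> fst c" using mem sub by auto
      ultimately obtain \<delta>' where "\<delta>' > 0" "((\<lambda>p. p) \<circ> ?\<gamma>) ` ball t \<delta>' \<subseteq> fst c'"
          "smooth_on (ball t \<delta>') (snd c' \<circ> ((\<lambda>p. p) \<circ> ?\<gamma>))"
        by (rule curve_through_smooth_map[OF fin_dim_euclidean conjunct2[OF atlas_on_UNIV[unfolded atlas_on_def]]
            _ _ _ sm c(1) c'(1)]) (use c' in auto)
      then show "\<exists>\<delta>>0. ?\<gamma> ` ball t \<delta> \<subseteq> fst c' \<and> smooth_on (ball t \<delta>) (snd c' \<circ> ?\<gamma>)"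
        by (auto simp: o_def)
    qed simp
  qed (use mem in auto)
qed

lemma coord_vec_tangent:
  assumes "c \<in> A" "x \<in> fst c"
  shows "coord_vec A c \<xi> x \<in> tangent_space A UNIV x" "coord_vec A c \<xi> x c = \<xi>"
proof -
  obtain \<epsilon> where \<epsilon>: "\<epsilon> > 0" "smooth_curve A UNIV \<epsilon> (\<lambda>t. inv_into (fst c) (snd c) (snd c x + t *\<^sub>R \<xi>))"
    "\<And>t. \<bar>t\<bar> < \<epsilon> \<Longrightarrow> snd c (inv_into (fst c) (snd c) (snd c x + t *\<^sub>R \<xi>)) = snd c x + t *\<^sub>R \<xi>"
    using coord_line[OF assms open_UNIV UNIV_I, of \<xi>] by metis
  show "coord_vec A c \<xi> x \<in> tangent_space A UNIV x" unfolding coord_vec_def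
    by (rule tangent_spaceI[OF \<epsilon>(1,2)]) (simp add: chart_inv[OF assms])
  have "((\<lambda>t. snd c x + t *\<^sub>R \<xi>) has_vector_derivative \<xi>) (at 0)"
    by (auto intro!: derivative_eq_intros)
  then have "((snd c \<circ> (\<lambda>t. inv_into (fst c) (snd c) (snd c x + t *\<^sub>R \<xi>))) has_vector_derivative \<xi>) (at 0)"
    by (rule has_vector_derivative_transform_within_open[OF _ open_ball[of 0 \<epsilon>]]) (use \<epsilon> in auto)
  then show "coord_vec A c \<xi> x c = \<xi>" unfolding coord_vec_def
    using assms by (simp add: velocity_def chart_inv vector_derivative_at)
qed

lemma tangent_vector_coord:
  "v \<in> tangent_space A UNIV x \<Longrightarrow> c \<in> A \<Longrightarrow> x \<in> fst c \<Longrightarrow> coord_vec A c (v c) x = v"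
  by (rule tangent_space_eqI[OF atlas_on_UNIV UNIV_I]) (auto simp: coord_vec_tangent)

lemma coord_vec_apply:
  assumes "c \<in> A" "x \<in> fst c" "c' \<in> A" "x \<in> fst c'"
  shows "coord_vec A c \<xi> x c' = frechet_derivative (snd c' \<circ> inv_into (fst c) (snd c)) (at (snd c x)) \<xi>"
proof -
  let ?F = "snd c' \<circ> inv_into (fst c) (snd c)"
  have "snd c x \<in> snd c ` (fst c \<inter> fst c')" using assms by auto
  from smooth_on_has_derivative[OF chart_transition_smooth[OF assms(1,3)] this]
  have "(?F has_derivative frechet_derivative ?F (at (snd c x))) (at (snd c x))" .
  then have "(?F has_derivative frechet_derivative ?F (at (snd c x))) (at (snd c x + 0 *\<^sub>R \<xi>) within (\<lambda>t::real. snd c x + t *\<^sub>R \<xi>) ` UNIV)"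
    by (auto intro: has_derivative_at_withinI)
  moreover have "((\<lambda>t. snd c x + t *\<^sub>R \<xi>) has_vector_derivative \<xi>) (at 0)"
    by (auto intro!: derivative_eq_intros)
  ultimately have "((?F \<circ> (\<lambda>t. snd c x + t *\<^sub>R \<xi>)) has_vector_derivative frechet_derivative ?F (at (snd c x)) \<xi>) (at 0)"
    using vector_derivative_diff_chain_within by blast
  then show ?thesis unfolding coord_vec_def
    using assms by (simp add: velocity_def chart_inv vector_derivative_at o_def)
qed

text \<open>The transition maps are holomorphic, so multiplying all coordinate vectors by \<open>\<i>\<close> is compatible
  with changes of charts.\<close>

lemma cI_tangent:
  assumes "v \<in> tangent_space A UNIV x"
  shows "cI v \<in> tangent_space A UNIV x"
proof -
  obtain c where c: "c \<in> A" "x \<in> fst c" using chart_covers by blast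
  have "cI v = coord_vec A c (\<i> *s v c) x"
  proof
    fix c'
    show "cI v c' = coord_vec A c (\<i> *s v c) x c'"
    proof (cases "c' \<in> A \<and> x \<in> fst c'")
      case True
      have "v c' = coord_vec A c (v c) x c'" using tangent_vector_coord[OF assms c] by simp
      moreover have "snd c x \<in> snd c ` (fst c \<inter> fst c')" using True c by auto
      ultimately show ?thesis
        using bspec[OF conjunct2[OF chart_transition_holo[OF c(1), of c', unfolded holo_on_def]], of "snd c x"] True
        unfolding cI_def by (simp only: coord_vec_apply[OF c])
    next
      case False
      have "w c' = 0" if "w \<in> tangent_space A UNIV x" for w
        using that False by (auto elim!: tangent_spaceE simp: velocity_def)
      from this[OF assms] this[OF coord_vec_tangent(1)[OF c]] show ?thesis by (simp add: cI_def)
    qed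
  qed
  then show ?thesis using coord_vec_tangent(1)[OF c] by simp
qed

lemma cI_apply: "cI v c = \<i> *s v c"
  by (simp add: cI_def)

lemma velocity_coord_line:
  assumes "c \<in> A" "x \<in> fst c" 
    "snd c (inv_into (fst c) (snd c) (snd c x + t *\<^sub>R \<xi>)) = snd c x + t *\<^sub>R \<xi>"
  shows "velocity A (\<lambda>t. inv_into (fst c) (snd c) (snd c x + t *\<^sub>R \<xi>)) t =
    coord_vec A c \<xi> (inv_into (fst c) (snd c) (snd c x + t *\<^sub>R \<xi>))"
  unfolding velocity_shift[of A _ t] coord_vec_def assms(3) by (simp add: algebra_simps)

end

section \<open>Deforming orthogonal complex structures\<close>

lemma blinfun_compose_assoc_eq:
  "(f o\<^sub>L g) = h \<Longrightarrow> f o\<^sub>L (g o\<^sub>L x) = h o\<^sub>L x"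
  by (metis blinfun_compose_assoc)

text \<open>If \<open>\<beta> u = b u + \<i> J b u\<close> for real \<open>u\<close>, then \<open>1 - \<beta>\<close> sends the vector \<open>u + \<i> k u\<close> of the
  \<open>-\<i>\<close> eigenspace of \<open>k\<close> to one whose real part is \<open>twist J b k u\<close>; the imaginary part is
  \<open>twist J b k (k u)\<close>.  So \<open>deform J b k\<close> is the complex structure whose graph is the image.\<close>

definition twist :: "('a::real_normed_vector \<Rightarrow>\<^sub>L 'a) \<Rightarrow> ('a \<Rightarrow>\<^sub>L 'a) \<Rightarrow> ('a \<Rightarrow>\<^sub>L 'a) \<Rightarrow> 'a \<Rightarrow>\<^sub>L 'a" where
  "twist J b k = id_blinfun - b + (J o\<^sub>L (b o\<^sub>L k))"

definition deform :: "('a::real_normed_vector \<Rightarrow>\<^sub>L 'a) \<Rightarrow> ('a \<Rightarrow>\<^sub>L 'a) \<Rightarrow> ('a \<Rightarrow>\<^sub>L 'a) \<Rightarrow> 'a \<Rightarrow>\<^sub>L 'a" where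
  "deform J b k = twist J b k o\<^sub>L (k o\<^sub>L blinfun_inv (twist J b k))"

definition orth_cstr :: "('a::real_inner \<Rightarrow>\<^sub>L 'a) \<Rightarrow> ('a \<Rightarrow>\<^sub>L 'a) \<Rightarrow> bool" where
  "orth_cstr L k \<longleftrightarrow> k o\<^sub>L k = - id_blinfun \<and> (\<forall>u v. L (k u) \<bullet> k v = L u \<bullet> v)"

lemma orth_cstr_apply: "orth_cstr L k \<Longrightarrow> k (k u) = - u"
  unfolding orth_cstr_def
  by (metis blinfun_apply_blinfun_compose blinfun_apply_id_blinfun id_apply uminus_blinfun.rep_eq)

text \<open>\<open>L\<close> is the Gram matrix of the metric, \<open>J\<close> the complex structure of the bundle and \<open>b\<close> the real
  endomorphism belonging to an alternating complex bilinear form.\<close>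

locale skew_deformation =
  fixes L J b :: "'a::euclidean_space \<Rightarrow>\<^sub>L 'a"
  assumes L_sym: "L u \<bullet> v = L v \<bullet> u"
    and L_pos: "u \<noteq> 0 \<Longrightarrow> L u \<bullet> u > 0"
    and J_J: "J o\<^sub>L J = - id_blinfun"
    and J_iso: "L (J u) \<bullet> J v = L u \<bullet> v"
    and b_skew: "L (b u) \<bullet> v = - (L u \<bullet> b v)"
    and b_J: "b o\<^sub>L J = - (J o\<^sub>L b)"
begin

lemma pointwise:
  "J (J u) = - u" "b (J u) = - J (b u)"
  using J_J b_J by (metis blinfun_apply_blinfun_compose blinfun_apply_id_blinfun id_apply uminus_blinfun.rep_eq)+

lemma J_skew: "L (J u) \<bullet> v = - (L u \<bullet> J v)"
  using J_iso[of u "J v"] by (simp add: pointwise blinfun.minus_right)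

lemma twist_apply: "twist J b k u = u - b u + J (b (k u))"
  by (simp add: twist_def blinfun.add_left blinfun.diff_left)

text \<open>This says that the image of the isotropic graph of \<open>k\<close> under the orthogonal map \<open>1 - \<beta>\<close> is
  isotropic (the real part of \<open>g(w, w') = 0\<close>).\<close>

lemma twist_isotropic:
  assumes k: "orth_cstr L k"
  shows "L (twist J b k (k u)) \<bullet> twist J b k (k v) = L (twist J b k u) \<bullet> twist J b k v"
proof -
  note kk = orth_cstr_apply[OF k]
  have iso: "L (k u) \<bullet> k v = L u \<bullet> v" for u v using k by (simp add: orth_cstr_def)
  define S where "S u = J (b (k u)) - b u" for u
  have S: "twist J b k u = u + S u" for u by (simp add: twist_apply S_def)
  \<comment> \<open>\<open>S u\<close> is the real part of \<open>-\<beta>\<close> at \<open>u + \<i> k u\<close> and \<open>S (k u)\<close> the imaginary part; they determine each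
    other, since \<open>\<beta>\<close> takes values in the \<open>-\<i>\<close> eigenspace of \<open>J\<close>.\<close>
  have SJ: "S u = - J (S (k u))" for u
    by (simp add: S_def kk blinfun.diff_right blinfun.minus_right pointwise)
  have 1: "L (S (k u)) \<bullet> S (k v) = L (S u) \<bullet> S v"
    by (subst (3) SJ, subst (4) SJ) (simp add: blinfun.minus_right J_iso)
  have Jb: "L (J (b u)) \<bullet> v = - (L u \<bullet> J (b v))" for u v
    using b_skew[of u "J v"] by (simp add: J_skew pointwise inner_minus_right)
  have "L (S u) \<bullet> v + L u \<bullet> S v = L (J (b (k u))) \<bullet> v + L u \<bullet> J (b (k v))" for u v
    using b_skew[of u v] by (simp add: S_def blinfun.diff_right inner_diff_left inner_diff_right)
  then have 2: "L (S u) \<bullet> v + L u \<bullet> S v = - (L (k u) \<bullet> J (b v)) - L (J (b u)) \<bullet> k v" for u v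
    using Jb[of "k u" v] Jb[of u "k v"] by simp
  have 3: "L (S (k u)) \<bullet> k v + L (k u) \<bullet> S (k v) = - (L (J (b u)) \<bullet> k v) - L (k u) \<bullet> J (b v)" for u v
    using b_skew[of "k u" "k v"]
    by (simp add: S_def kk blinfun.diff_right blinfun.minus_right inner_diff_left inner_diff_right inner_minus_left inner_minus_right)
  show ?thesis using 1 2[of u v] 3[of u v] iso[of u v]
    by (simp add: S blinfun.add_right inner_add_left inner_add_right)
qed

text \<open>If \<open>1 - \<beta>\<close> maps \<open>u + \<i> k u\<close> to a purely imaginary vector, then isotropy and positivity of the
  metric make this vector vanish.\<close>

lemma twist_invertible:
  assumes k: "orth_cstr L k"
  shows "blinfun_invertible (twist J b k)"
proof (rule blinfun_invertibleI)
  fix u assume u: "twist J b k u = 0"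
  then have "twist J b k (k u) = 0"
    using twist_isotropic[OF k, of u u] L_pos[of "twist J b k (k u)"] by fastforce
  then have eq: "k u - b (k u) - J (b u) = 0"
    by (simp add: twist_apply orth_cstr_apply[OF k] blinfun.minus_right)
  have u0: "u - b u + J (b (k u)) = 0" using u by (simp add: twist_apply)
  have "J (k u - b (k u) - J (b u)) = 0" using eq by simp
  then have "J (k u) - J (b (k u)) + b u = 0"
    by (simp add: blinfun.diff_right pointwise)
  from arg_cong2[OF this u0, of "(+)"] have "J (k u) + u = 0" by (simp add: algebra_simps)
  then have "J (k u) = - u" by (simp add: eq_neg_iff_add_eq_0)
  then have "k u = J u" using pointwise(1)[of "k u"] by (simp add: blinfun.minus_right)
  then show "u = 0" using u0 by (simp add: pointwise blinfun.minus_right)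
qed

lemma deform_twist: "orth_cstr L k \<Longrightarrow> deform J b k o\<^sub>L twist J b k = twist J b k o\<^sub>L k"
  by (simp add: deform_def blinfun_compose_assoc blinfun_inv[OF twist_invertible])

lemma twist_compose: "orth_cstr L k \<Longrightarrow> twist J b k o\<^sub>L k = k - (b o\<^sub>L k) - (J o\<^sub>L b)"
  by (simp add: twist_def blinfun_compose_simps blinfun_compose_assoc orth_cstr_def)

lemma deform_orth_cstr:
  assumes k: "orth_cstr L k"
  shows "orth_cstr L (deform J b k)"
proof -
  note inv = blinfun_inv_apply[OF twist_invertible[OF k]]
  have "deform J b k (deform J b k u) = - u" for u
    by (simp add: deform_def inv orth_cstr_apply[OF k] blinfun.minus_right)
  moreover have "L (deform J b k u) \<bullet> deform J b k v = L u \<bullet> v" for u v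
    by (simp add: deform_def twist_isotropic[OF k] inv)
  ultimately show ?thesis
    unfolding orth_cstr_def by (auto intro!: blinfun_eqI simp: uminus_blinfun.rep_eq)
qed

end

text \<open>Here \<open>k'\<close> is the deformation of \<open>k\<close>, and \<open>\<theta>\<close>, \<open>\<theta>'\<close> are the connection matrices in a base
  direction \<open>v\<close>; those in the direction \<open>I v\<close> are \<open>J \<theta>\<close> and \<open>J \<theta>'\<close>.  The maps \<open>db\<close>, \<open>dbI\<close> are the
  derivatives of \<open>b\<close> along \<open>v\<close> and \<open>I v\<close>.  By \<open>d1\<close> and \<open>d2\<close>, which differentiate \<open>k' A = A k\<close>, the
  deformation takes the velocities \<open>\<kappa>\<close>, \<open>\<kappa>2\<close> to \<open>\<kappa>'\<close>, \<open>\<kappa>2'\<close>.  If \<open>\<kappa>2\<close> arises from \<open>\<kappa>\<close> by the almost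
  complex structure of the first connection, then \<open>\<kappa>2'\<close> arises from \<open>\<kappa>'\<close> by that of the second.\<close>

lemma deformation_holomorphic_identity:
  fixes J b k k' A \<theta> \<theta>' db dbI \<kappa> \<kappa>2 \<kappa>' \<kappa>2' :: "'a::real_normed_vector \<Rightarrow>\<^sub>L 'a"
  assumes J: "J o\<^sub>L J = - id_blinfun"
    and b: "b o\<^sub>L J = - (J o\<^sub>L b)" "db o\<^sub>L J = - (J o\<^sub>L db)" "dbI o\<^sub>L J = - (J o\<^sub>L dbI)"
    and k: "k o\<^sub>L k = - id_blinfun" and k': "k' o\<^sub>L k' = - id_blinfun"
    and A: "A = id_blinfun - b + (J o\<^sub>L (b o\<^sub>L k))"
    and k'A: "k' o\<^sub>L A = k - (b o\<^sub>L k) - (J o\<^sub>L b)"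
    and inv: "blinfun_invertible A"
    and d1: "(\<kappa>' o\<^sub>L A) + (k' o\<^sub>L (- db + (J o\<^sub>L ((db o\<^sub>L k) + (b o\<^sub>L \<kappa>))))) =
      \<kappa> - (db o\<^sub>L k) - (b o\<^sub>L \<kappa>) - (J o\<^sub>L db)"
    and d2: "(\<kappa>2' o\<^sub>L A) + (k' o\<^sub>L (- dbI + (J o\<^sub>L ((dbI o\<^sub>L k) + (b o\<^sub>L \<kappa>2))))) =
      \<kappa>2 - (dbI o\<^sub>L k) - (b o\<^sub>L \<kappa>2) - (J o\<^sub>L dbI)"
    and \<kappa>2: "\<kappa>2 = (k o\<^sub>L (\<kappa> + (\<theta> o\<^sub>L k) - (k o\<^sub>L \<theta>))) - ((J o\<^sub>L \<theta>) o\<^sub>L k) + (k o\<^sub>L (J o\<^sub>L \<theta>))"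
    and \<theta>': "\<theta>' = \<theta> + db - (J o\<^sub>L dbI) + ((\<theta> - (J o\<^sub>L (\<theta> o\<^sub>L J))) o\<^sub>L b)"
  shows "\<kappa>2' = (k' o\<^sub>L (\<kappa>' + (\<theta>' o\<^sub>L k') - (k' o\<^sub>L \<theta>'))) - ((J o\<^sub>L \<theta>') o\<^sub>L k') + (k' o\<^sub>L (J o\<^sub>L \<theta>'))"
proof -
  note rules = blinfun_compose_simps blinfun_compose_assoc
    J b k k' J[THEN blinfun_compose_assoc_eq] b[THEN blinfun_compose_assoc_eq] 
    k[THEN blinfun_compose_assoc_eq] k'[THEN blinfun_compose_assoc_eq]
  \<comment> \<open>The relation \<open>k' A = A k\<close>, oriented so that it removes every product \<open>k' J b\<close>.  Together with the
    quadratic and anticommutation relations this is a terminating rewrite system which brings both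
    sides of the claim, multiplied by \<open>A\<close>, to the same normal form.\<close>
  have kJb: "k' o\<^sub>L (J o\<^sub>L (b o\<^sub>L x)) = x - (b o\<^sub>L x) + (J o\<^sub>L (b o\<^sub>L (k o\<^sub>L x))) + (k' o\<^sub>L (k o\<^sub>L x)) -
      (k' o\<^sub>L (b o\<^sub>L (k o\<^sub>L x)))" for x
  proof -
    have "(k' o\<^sub>L A) o\<^sub>L (k o\<^sub>L x) = (k - (b o\<^sub>L k) - (J o\<^sub>L b)) o\<^sub>L (k o\<^sub>L x)" by (simp only: k'A)
    then have "(k' o\<^sub>L (k o\<^sub>L x)) - (k' o\<^sub>L (b o\<^sub>L (k o\<^sub>L x))) - (k' o\<^sub>L (J o\<^sub>L (b o\<^sub>L x))) =
      - x + (b o\<^sub>L x) - (J o\<^sub>L (b o\<^sub>L (k o\<^sub>L x)))"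
      by (simp add: A rules)
    then show ?thesis by (simp add: algebra_simps)
  qed
  have kJb1: "k' o\<^sub>L (J o\<^sub>L b) = id_blinfun - b + (J o\<^sub>L (b o\<^sub>L k)) + (k' o\<^sub>L k) - (k' o\<^sub>L (b o\<^sub>L k))"
    using kJb[of id_blinfun] by simp
  have d1': "\<kappa>' o\<^sub>L A = \<kappa> - (db o\<^sub>L k) - (b o\<^sub>L \<kappa>) - (J o\<^sub>L db) -
    (k' o\<^sub>L (- db + (J o\<^sub>L ((db o\<^sub>L k) + (b o\<^sub>L \<kappa>)))))"
    using d1 by (simp add: algebra_simps)
  have d2': "\<kappa>2' o\<^sub>L A = \<kappa>2 - (dbI o\<^sub>L k) - (b o\<^sub>L \<kappa>2) - (J o\<^sub>L dbI) -
    (k' o\<^sub>L (- dbI + (J o\<^sub>L ((dbI o\<^sub>L k) + (b o\<^sub>L \<kappa>2)))))"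
    using d2 by (simp add: algebra_simps)
  let ?R = "(k' o\<^sub>L (\<kappa>' + (\<theta>' o\<^sub>L k') - (k' o\<^sub>L \<theta>'))) - ((J o\<^sub>L \<theta>') o\<^sub>L k') + (k' o\<^sub>L (J o\<^sub>L \<theta>'))"
  have "?R o\<^sub>L A = (k' o\<^sub>L (\<kappa>' o\<^sub>L A)) + (k' o\<^sub>L (\<theta>' o\<^sub>L (k' o\<^sub>L A))) + (\<theta>' o\<^sub>L A) - (J o\<^sub>L (\<theta>' o\<^sub>L (k' o\<^sub>L A)))
      + (k' o\<^sub>L (J o\<^sub>L (\<theta>' o\<^sub>L A)))"
    by (simp add: rules)
  also have "\<dots> = \<kappa>2' o\<^sub>L A"
    unfolding d1' d2' k'A unfolding A \<kappa>2 \<theta>'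
    by (simp add: rules kJb kJb1 algebra_simps)
  finally have "?R o\<^sub>L A = \<kappa>2' o\<^sub>L A" .
  then have "(?R o\<^sub>L A) o\<^sub>L blinfun_inv A = (\<kappa>2' o\<^sub>L A) o\<^sub>L blinfun_inv A" by simp
  then show ?thesis by (simp only: blinfun_compose_assoc blinfun_inv[OF inv] blinfun_compose_id)
qed

section \<open>Hermitian holomorphic bundles in a frame\<close>

text \<open>The isomorphism \<open>E \<cong> E\<^sup>1\<^sup>0\<close>.\<close>

definition hol_part :: "('m, 'v::real_normed_vector, 'n::finite, 'r::finite) herm_bundle \<Rightarrow> 'm \<Rightarrow> 'v \<Rightarrow> 'v \<times> 'v" where
  "hol_part X x u = ((1/2) *\<^sub>R u, - ((1/2) *\<^sub>R cstr X x u))"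

definition mul_i :: "(complex^'r) \<Rightarrow>\<^sub>L (complex^'r)" where
  "mul_i = Blinfun (\<lambda>a. \<i> *s a)"

lemma linear_mul_i: "linear (\<lambda>a::complex^'r. \<i> *s a)"
  by (rule linearI) (auto simp: vec_eq_iff algebra_simps)

lemma mul_i_apply [simp]: "blinfun_apply mul_i a = \<i> *s a"
  unfolding mul_i_def by (simp add: bounded_linear_Blinfun_apply linear_mul_i linear_conv_bounded_linear[symmetric])

lemma Blinfun_apply_linear: "linear f \<Longrightarrow> blinfun_apply (Blinfun f) (a::'a::euclidean_space) = f a"
  by (simp add: bounded_linear_Blinfun_apply linear_conv_bounded_linear[symmetric])

definition frame_form :: "(complex^'r \<Rightarrow> complex^'r \<Rightarrow> real) \<Rightarrow> (complex^'r) \<Rightarrow>\<^sub>L (complex^'r)" where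
  "frame_form \<omega> = Blinfun (\<lambda>a. \<Sum>b\<in>Basis. \<omega> a b *\<^sub>R b)"

lemma frame_form_apply:
  fixes \<omega> :: "complex^'r \<Rightarrow> complex^'r \<Rightarrow> real"
  assumes "\<And>b. linear (\<lambda>a. \<omega> a b)"
  shows "blinfun_apply (frame_form \<omega>) a = (\<Sum>b\<in>Basis. \<omega> a b *\<^sub>R b)"
proof -
  have "linear (\<lambda>a. \<Sum>b\<in>Basis. \<omega> a b *\<^sub>R b)"
    using assms by (intro linear_compose_sum ballI linear_compose[unfolded o_def, OF _ linear_scaleR_left]) auto
  then show ?thesis unfolding frame_form_def by (rule Blinfun_apply_linear)
qed

lemma frame_form_inner:
  fixes \<omega> :: "complex^'r \<Rightarrow> complex^'r \<Rightarrow> real"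
  assumes "\<And>b. linear (\<lambda>a. \<omega> a b)" "\<And>a. linear (\<omega> a)"
  shows "blinfun_apply (frame_form \<omega>) a \<bullet> c = \<omega> a c"
proof -
  have "\<omega> a c = \<omega> a (\<Sum>b\<in>Basis. (c \<bullet> b) *\<^sub>R b)" by (simp add: euclidean_representation)
  also have "\<dots> = (\<Sum>b\<in>Basis. (c \<bullet> b) * \<omega> a b)"
    unfolding linear_sum[OF assms(2)] linear_scale[OF assms(2)] by simp
  finally show ?thesis
    by (simp add: frame_form_apply[OF assms(1)] inner_sum_left inner_sum_right inner_commute[of _ c] mult.commute)
qed

definition gram :: "('m, 'v::real_normed_vector, 'n::finite, 'r::finite) herm_bundle \<Rightarrow> ('m \<Rightarrow> complex^'r \<Rightarrow> 'v) \<Rightarrow> 'm \<Rightarrow> (complex^'r) \<Rightarrow>\<^sub>L (complex^'r)" where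
  "gram X \<phi> x = frame_form (\<lambda>a b. metric X x (\<phi> x a) (\<phi> x b))"

definition form_mat :: "('m, 'v::real_normed_vector, 'n::finite, 'r::finite) herm_bundle \<Rightarrow> ('m \<Rightarrow> complex^'r \<Rightarrow> 'v) \<Rightarrow> 'm \<Rightarrow> 'v bform \<Rightarrow> (complex^'r) \<Rightarrow>\<^sub>L (complex^'r)" where
  "form_mat X \<phi> x \<beta> = frame_form (\<lambda>a b. Re (\<beta> (hol_part X x (\<phi> x a)) (hol_part X x (\<phi> x b))))"

text \<open>In the frame \<open>\<phi>\<close>, the real endomorphism \<open>b\<close> with \<open>g(b u, q) = Re \<beta>(u\<^sup>1\<^sup>0, q\<^sup>1\<^sup>0)\<close>.  It is the
  composition of \<open>g\<^sup>-\<^sup>1 \<beta>\<close> on real vectors with the real part.\<close>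

definition form_end :: "('m, 'v::real_normed_vector, 'n::finite, 'r::finite) herm_bundle \<Rightarrow> ('m \<Rightarrow> complex^'r \<Rightarrow> 'v) \<Rightarrow> 'm \<Rightarrow> 'v bform \<Rightarrow> (complex^'r) \<Rightarrow>\<^sub>L (complex^'r)" where
  "form_end X \<phi> x \<beta> = blinfun_inv (gram X \<phi> x) o\<^sub>L form_mat X \<phi> x \<beta>"

definition to_frame :: "('m \<Rightarrow> complex^'r \<Rightarrow> 'v::real_normed_vector) \<Rightarrow> 'm \<Rightarrow> ('v \<Rightarrow> 'v) \<Rightarrow> (complex^'r) \<Rightarrow>\<^sub>L (complex^'r)" where
  "to_frame \<phi> x K = Blinfun (\<lambda>a. inv (\<phi> x) (K (\<phi> x a)))"

definition of_frame :: "('m, 'v::real_normed_vector, 'n::finite, 'r::finite) herm_bundle \<Rightarrow> ('m \<Rightarrow> complex^'r \<Rightarrow> 'v) \<Rightarrow> 'm \<Rightarrow> ((complex^'r) \<Rightarrow>\<^sub>L (complex^'r)) \<Rightarrow> 'v \<Rightarrow> 'v" where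
  "of_frame X \<phi> x k = (\<lambda>u\<in>fibre X x. \<phi> x (blinfun_apply k (inv (\<phi> x) u)))"

definition dom_at :: "('m, 'v::real_normed_vector, 'n::finite, 'r::finite) herm_bundle \<Rightarrow> 'm \<Rightarrow> 'm set" where
  "dom_at X x = fst (SOME T. T \<in> trivs X \<and> x \<in> fst T)"

locale herm_hol_bundle =
  fixes X :: "('m::{t2_space,second_countable_topology}, 'v::real_normed_vector, 'n::finite, 'r::finite) herm_bundle"
  assumes hol: "holomorphic_vector_bundle X" and herm: "hermitian_metric X"
begin

lemmas hol_conjs =
  hol[unfolded holomorphic_vector_bundle_def, THEN conjunct1]
  hol[unfolded holomorphic_vector_bundle_def, THEN conjunct2, THEN conjunct1]
  hol[unfolded holomorphic_vector_bundle_def, THEN conjunct2, THEN conjunct2, THEN conjunct1]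
  hol[unfolded holomorphic_vector_bundle_def, THEN conjunct2, THEN conjunct2, THEN conjunct2, THEN conjunct1]
  hol[unfolded holomorphic_vector_bundle_def, THEN conjunct2, THEN conjunct2, THEN conjunct2, THEN conjunct2]

end

sublocale herm_hol_bundle \<subseteq> complex_mfd "charts X"
  by standard (rule hol_conjs)

context herm_hol_bundle
begin

lemma subspace_fibre: "subspace (fibre X x)"
  using hol_conjs(2) by simp

lemma triv_open: "(V, \<phi>) \<in> trivs X \<Longrightarrow> open V"
  using bspec[OF hol_conjs(4)] by auto

lemma triv_props:
  assumes "(V, \<phi>) \<in> trivs X" "x \<in> V"
  shows "linear (\<phi> x)" "bij_betw (\<phi> x) UNIV (fibre X x)" "\<phi> x (\<i> *s a) = cstr X x (\<phi> x a)"
proof -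
  have "\<forall>x\<in>V. linear (\<phi> x) \<and> bij_betw (\<phi> x) UNIV (fibre X x) \<and> (\<forall>a. \<phi> x (\<i> *s a) = cstr X x (\<phi> x a))"
    using bspec[OF hol_conjs(4) assms(1)] by simp
  then show "linear (\<phi> x)" "bij_betw (\<phi> x) UNIV (fibre X x)" "\<phi> x (\<i> *s a) = cstr X x (\<phi> x a)"
    using assms(2) by auto
qed

lemma triv_transition_holo:
  assumes "(V, \<phi>) \<in> trivs X" "(V', \<phi>') \<in> trivs X"
  shows "holo_fun (charts X) (V \<inter> V') (\<lambda>x. inv (\<phi>' x) (\<phi> x a))"
  using bspec[OF hol_conjs(5) assms(1), simplified case_prod_conv, THEN bspec, OF assms(2)] by simp

lemma triv_transition_smooth:
  assumes "(V, \<phi>) \<in> trivs X" "(V', \<phi>') \<in> trivs X"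
  shows "smooth_fun (charts X) (V \<inter> V') (\<lambda>x. inv (\<phi>' x) (\<phi> x a))"
  using triv_transition_holo[OF assms, of a] unfolding holo_fun_def smooth_fun_def holo_on_def
  by (auto simp: case_prod_beta)

lemma triv_at: "(dom_at X x, triv_at X x) \<in> trivs X" "x \<in> dom_at X x"
proof -
  have "x \<in> (\<Union>(V, \<phi>)\<in>trivs X. V)" using hol_conjs(3) by simp
  then have "\<exists>T. T \<in> trivs X \<and> x \<in> fst T" by (auto simp: case_prod_beta)
  then have "(SOME T. T \<in> trivs X \<and> x \<in> fst T) \<in> trivs X \<and> x \<in> fst (SOME T. T \<in> trivs X \<and> x \<in> fst T)"
    by (rule someI_ex)
  then show "(dom_at X x, triv_at X x) \<in> trivs X" "x \<in> dom_at X x"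
    by (auto simp: dom_at_def triv_at_def)
qed

lemmas fibre_closed [simp] = subspace_add[OF subspace_fibre] subspace_diff[OF subspace_fibre]
  subspace_neg[OF subspace_fibre] subspace_scale[OF subspace_fibre] subspace_0[OF subspace_fibre]

lemmas herm1 = herm[unfolded hermitian_metric_def, THEN conjunct1, rule_format]

lemma metric_sym: "u \<in> fibre X x \<Longrightarrow> v \<in> fibre X x \<Longrightarrow> metric X x u v = metric X x v u"
  using herm1[of u x v u] by blast

lemma metric_cstr: "u \<in> fibre X x \<Longrightarrow> v \<in> fibre X x \<Longrightarrow> metric X x (cstr X x u) (cstr X x v) = metric X x u v"
  using herm1[of u x v u] by blast

lemma metric_pos: "u \<in> fibre X x \<Longrightarrow> u \<noteq> 0 \<Longrightarrow> metric X x u u > 0"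
  using herm1[of u x u u] by blast

lemma metric_lin: "u \<in> fibre X x \<Longrightarrow> v \<in> fibre X x \<Longrightarrow> w \<in> fibre X x \<Longrightarrow>
    metric X x (r *\<^sub>R u + v) w = r * metric X x u w + metric X x v w"
  using herm1[of u x v w] by blast

lemma metric_add_left: "u \<in> fibre X x \<Longrightarrow> v \<in> fibre X x \<Longrightarrow> w \<in> fibre X x \<Longrightarrow>
    metric X x (u + v) w = metric X x u w + metric X x v w"
  using metric_lin[of u x v w 1] by simp

lemma metric_zero_left: "w \<in> fibre X x \<Longrightarrow> metric X x 0 w = 0"
  using metric_add_left[of 0 x 0 w] by simp

lemma metric_scale_left: "u \<in> fibre X x \<Longrightarrow> w \<in> fibre X x \<Longrightarrow> metric X x (r *\<^sub>R u) w = r * metric X x u w"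
  using metric_lin[of u x 0 w r] by (simp add: metric_zero_left)

lemma metric_minus_left: "u \<in> fibre X x \<Longrightarrow> w \<in> fibre X x \<Longrightarrow> metric X x (- u) w = - metric X x u w"
  using metric_scale_left[of u x w "-1"] by simp

lemma metric_diff_left: "u \<in> fibre X x \<Longrightarrow> v \<in> fibre X x \<Longrightarrow> w \<in> fibre X x \<Longrightarrow>
    metric X x (u - v) w = metric X x u w - metric X x v w"
  using metric_add_left[of u x "- v" w] by (simp add: metric_minus_left)

lemma metric_add_right: "u \<in> fibre X x \<Longrightarrow> v \<in> fibre X x \<Longrightarrow> w \<in> fibre X x \<Longrightarrow>
    metric X x w (u + v) = metric X x w u + metric X x w v"
  by (simp add: metric_sym[of w] metric_add_left)

lemma metric_scale_right: "u \<in> fibre X x \<Longrightarrow> w \<in> fibre X x \<Longrightarrow> metric X x w (r *\<^sub>R u) = r * metric X x w u"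
  by (simp add: metric_sym[of w] metric_scale_left)

lemma metric_minus_right: "u \<in> fibre X x \<Longrightarrow> w \<in> fibre X x \<Longrightarrow> metric X x w (- u) = - metric X x w u"
  by (simp add: metric_sym[of w] metric_minus_left)

text \<open>Smoothness of sections is tested in every trivialization; expanding the coefficients \<open>h\<close> in a
  basis reduces the change of trivialization to that of the frame.\<close>

lemma frame_smooth_section:
  assumes "(V, \<phi>) \<in> trivs X" "open W" "W \<subseteq> V" "smooth_fun (charts X) W h"
  shows "smooth_section X W (\<lambda>y. \<phi> y (h y))"
  unfolding smooth_section_def
proof (intro conjI ballI)
  show "\<phi> y (h y) \<in> fibre X y" if "y \<in> W" for y
    using triv_props(2)[OF assms(1), of y] that assms(3) by (auto simp: bij_betw_def)
  fix T assume "T \<in> trivs X"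
  then obtain V' \<phi>' where T: "T = (V', \<phi>')" "(V', \<phi>') \<in> trivs X" by (cases T) auto
  have V': "open (W \<inter> V')" using assms(2) triv_open[OF T(2)] by auto
  have "smooth_fun (charts X) (W \<inter> V') (\<lambda>y. \<Sum>b\<in>Basis. (h y \<bullet> b) *\<^sub>R inv (\<phi>' y) (\<phi> y b))"
  proof (intro smooth_fun_sum V' smooth_fun_bilinear[OF bounded_bilinear_scaleR])
    show "smooth_fun (charts X) (W \<inter> V') (\<lambda>y. h y \<bullet> b)" for b
      by (rule smooth_fun_bounded_linear[OF V' bounded_linear_inner_left smooth_fun_subset[OF assms(4)]]) auto
    show "smooth_fun (charts X) (W \<inter> V') (\<lambda>y. inv (\<phi>' y) (\<phi> y b))" for b
      by (rule smooth_fun_subset[OF triv_transition_smooth[OF assms(1) T(2)]]) (use assms in auto)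
  qed
  moreover have "(\<Sum>b\<in>Basis. (h y \<bullet> b) *\<^sub>R inv (\<phi>' y) (\<phi> y b)) = inv (\<phi>' y) (\<phi> y (h y))" if "y \<in> W \<inter> V'" for y
  proof -
    have y: "y \<in> V" "y \<in> V'" using that assms(3) by auto
    note p = triv_props[OF assms(1) y(1)] and p' = triv_props[OF T(2) y(2)]
    interpret f: linear "\<phi> y" by (rule p)
    interpret f': linear "\<phi>' y" by (rule p')
    have inj: "inj (\<phi>' y)" using p'(2) by (simp add: bij_betw_def)
    have surj: "\<phi>' y (inv (\<phi>' y) (\<phi> y a)) = \<phi> y a" for a
      using p(2) p'(2) unfolding bij_betw_def by (metis f_inv_into_f rangeI)
    have "\<phi>' y (\<Sum>b\<in>Basis. (h y \<bullet> b) *\<^sub>R inv (\<phi>' y) (\<phi> y b)) = \<phi> y (\<Sum>b\<in>Basis. (h y \<bullet> b) *\<^sub>R b)"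
      by (simp add: f'.sum f'.scale f.sum f.scale surj)
    also have "\<dots> = \<phi>' y (inv (\<phi>' y) (\<phi> y (h y)))" by (simp add: euclidean_representation surj)
    finally show ?thesis using inj by (simp add: inj_eq)
  qed
  ultimately show "case T of (V, \<phi>'') \<Rightarrow> smooth_fun (charts X) (W \<inter> V) (\<lambda>x. inv (\<phi>'' x) (\<phi> x (h x)))"
    unfolding T by (auto intro: smooth_fun_cong[OF V'])
qed

lemma frame_const_section: "(V, \<phi>) \<in> trivs X \<Longrightarrow> smooth_section X V (\<lambda>y. \<phi> y a)"
  by (rule frame_smooth_section[OF _ triv_open subset_refl smooth_fun_const[OF triv_open]]) auto

end

locale frame_at = herm_hol_bundle X
  for X :: "('m::{t2_space,second_countable_topology}, 'v::real_normed_vector, 'n::finite, 'r::finite) herm_bundle" +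
  fixes V :: "'m set" and \<phi> :: "'m \<Rightarrow> complex^'r \<Rightarrow> 'v" and x :: 'm
  assumes triv: "(V, \<phi>) \<in> trivs X" and xV: "x \<in> V"
begin

abbreviation "f \<equiv> \<phi> x"
abbreviation "fi \<equiv> inv (\<phi> x)"

lemma f_linear: "linear f" and f_bij: "bij_betw f UNIV (fibre X x)" and f_i: "f (\<i> *s a) = cstr X x (f a)"
  using triv_props[OF triv xV] by auto

sublocale f: linear f by (rule f_linear)

lemma f_in [simp]: "f a \<in> fibre X x" using f_bij by (auto simp: bij_betw_def)
lemma fi_f [simp]: "fi (f a) = a" using f_bij by (simp add: bij_betw_def)
lemma f_fi [simp]: "u \<in> fibre X x \<Longrightarrow> f (fi u) = u"
  using f_bij unfolding bij_betw_def by (metis f_inv_into_f)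
lemma f_eq [simp]: "f a = f c \<longleftrightarrow> a = c" by (metis fi_f)
lemma f_0 [simp]: "f a = 0 \<longleftrightarrow> a = 0" using f_eq[of a 0] by (simp add: f.zero)
lemma fibreE: assumes "u \<in> fibre X x" obtains a where "u = f a" using f_fi[OF assms] by metis

lemma ii: "\<i> *s (\<i> *s a) = - (a :: complex^'r)" by (simp add: vec_eq_iff)

lemma cstr_in [simp]: "u \<in> fibre X x \<Longrightarrow> cstr X x u \<in> fibre X x"
  by (erule fibreE) (simp add: f_i[symmetric])

lemma cstr_cstr [simp]: "u \<in> fibre X x \<Longrightarrow> cstr X x (cstr X x u) = - u"
  by (erule fibreE) (simp add: f_i[symmetric] ii f.neg)

lemma cstr_add: "u \<in> fibre X x \<Longrightarrow> v \<in> fibre X x \<Longrightarrow> cstr X x (u + v) = cstr X x u + cstr X x v"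
  by (elim fibreE) (simp add: f_i[symmetric] f.add[symmetric] vec.scale_right_distrib)

lemma cstr_scale: "u \<in> fibre X x \<Longrightarrow> cstr X x (r *\<^sub>R u) = r *\<^sub>R cstr X x u"
  by (erule fibreE) (simp add: f_i[symmetric] f.scale[symmetric] linear_scale[OF linear_mul_i])

lemma cstr_0 [simp]: "cstr X x 0 = 0"
  using cstr_scale[of 0 0] by simp

lemma cstr_minus: "u \<in> fibre X x \<Longrightarrow> cstr X x (- u) = - cstr X x u"
  using cstr_scale[of u "-1"] by simp

lemma metric_cstr_left: "u \<in> fibre X x \<Longrightarrow> v \<in> fibre X x \<Longrightarrow> metric X x (cstr X x u) v = - metric X x u (cstr X x v)"
  using metric_cstr[of u x "cstr X x v"] by (simp add: metric_minus_right)

lemma hol_part_E10: "u \<in> fibre X x \<Longrightarrow> hol_part X x u \<in> E10 X x"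
  by (simp add: eigenspace_def fibre_C_def hol_part_def cmul_def cstr_scale cstr_minus)

lemma E10E:
  assumes "w \<in> E10 X x" obtains u where "u \<in> fibre X x" "w = hol_part X x u"
proof -
  have w: "fst w \<in> fibre X x" "snd w \<in> fibre X x" "cstr X x (fst w) = - snd w"
    using assms by (auto simp: eigenspace_def fibre_C_def cmul_def map_prod_def case_prod_beta)
  then have "w = hol_part X x (2 *\<^sub>R fst w)"
    by (simp add: hol_part_def cstr_scale prod_eq_iff)
  moreover have "2 *\<^sub>R fst w \<in> fibre X x" using w(1) by simp
  ultimately show ?thesis by (rule that[rotated])
qed

lemma E01_iff: "w \<in> E01 X x \<longleftrightarrow> fst w \<in> fibre X x \<and> snd w = cstr X x (fst w)"
proof -
  have "w \<in> E01 X x \<longleftrightarrow> fst w \<in> fibre X x \<and> snd w \<in> fibre X x \<and> cstr X x (fst w) = snd w \<and> cstr X x (snd w) = - fst w"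
    by (cases w) (auto simp: eigenspace_def fibre_C_def cmul_def)
  then show ?thesis by auto
qed

lemma proj10_hol_part: "u \<in> fibre X x \<Longrightarrow> w \<in> fibre X x \<Longrightarrow> proj10 X x (u, w) = hol_part X x (u + cstr X x w)"
  by (simp add: proj10_def hol_part_def cmul_def cstr_add algebra_simps)

lemma proj10_real: "proj10 X x (u, 0) = hol_part X x u"
  by (simp add: proj10_def hol_part_def cmul_def)

lemma hol_part_add: "u \<in> fibre X x \<Longrightarrow> v \<in> fibre X x \<Longrightarrow> hol_part X x (u + v) = hol_part X x u + hol_part X x v"
  by (simp add: hol_part_def cstr_add algebra_simps)

lemma hol_part_scale: "u \<in> fibre X x \<Longrightarrow> hol_part X x (r *\<^sub>R u) = cmul (of_real r) (hol_part X x u)"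
  by (simp add: hol_part_def cstr_scale cmul_def)

lemma hol_part_cstr: "u \<in> fibre X x \<Longrightarrow> hol_part X x (cstr X x u) = cmul \<i> (hol_part X x u)"
  by (simp add: hol_part_def cmul_def)

context
  fixes \<beta> assumes alt: "alt_form10 X x \<beta>"
begin

lemma alt_lin: "u \<in> E10 X x \<Longrightarrow> v \<in> E10 X x \<Longrightarrow> w \<in> E10 X x \<Longrightarrow> \<beta> (cmul z u + v) w = z * \<beta> u w + \<beta> v w"
  and alt_skew: "u \<in> E10 X x \<Longrightarrow> v \<in> E10 X x \<Longrightarrow> \<beta> u v = - \<beta> v u"
  using alt unfolding alt_form10_def by blast+

abbreviation "bh u q \<equiv> \<beta> (hol_part X x u) (hol_part X x q)"

lemma bh_add: "u \<in> fibre X x \<Longrightarrow> v \<in> fibre X x \<Longrightarrow> q \<in> fibre X x \<Longrightarrow> bh (u + v) q = bh u q + bh v q"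
  using alt_lin[OF hol_part_E10 hol_part_E10 hol_part_E10, of u v q 1]
  by (simp add: hol_part_add cmul_def)

lemma bh_0: "q \<in> fibre X x \<Longrightarrow> bh 0 q = 0"
  using bh_add[of 0 0 q] by simp

lemma hol_part_0: "hol_part X x 0 = 0" by (simp add: hol_part_def zero_prod_def)

lemma bh_cmul: "u \<in> fibre X x \<Longrightarrow> q \<in> fibre X x \<Longrightarrow> \<beta> (cmul z (hol_part X x u)) (hol_part X x q) = z * bh u q"
  using alt_lin[OF hol_part_E10 hol_part_E10 hol_part_E10, of u 0 q z] bh_0[of q]
  by (simp add: hol_part_0)

lemma bh_scale: "u \<in> fibre X x \<Longrightarrow> q \<in> fibre X x \<Longrightarrow> bh (r *\<^sub>R u) q = of_real r * bh u q"
  by (simp add: hol_part_scale bh_cmul)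

lemma bh_cstr: "u \<in> fibre X x \<Longrightarrow> q \<in> fibre X x \<Longrightarrow> bh (cstr X x u) q = \<i> * bh u q"
  by (simp add: hol_part_cstr bh_cmul)

lemma bh_skew: "u \<in> fibre X x \<Longrightarrow> q \<in> fibre X x \<Longrightarrow> bh u q = - bh q u"
  by (rule alt_skew) (auto intro: hol_part_E10)

lemma bh_cstr_right: "u \<in> fibre X x \<Longrightarrow> q \<in> fibre X x \<Longrightarrow> bh u (cstr X x q) = \<i> * bh u q"
  using bh_skew[of u "cstr X x q"] bh_skew[of u q] by (simp add: bh_cstr)

end

lemma gram_inner: "gram X \<phi> x a \<bullet> c = metric X x (f a) (f c)"
  unfolding gram_def
  by (rule frame_form_inner)
    (auto intro!: linearI simp: f.add f.scale metric_add_left metric_add_right metric_scale_left metric_scale_right)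

lemma gram_invertible: "blinfun_invertible (gram X \<phi> x)"
proof (rule blinfun_invertibleI, rule ccontr)
  fix a assume a: "gram X \<phi> x a = 0" "a \<noteq> 0"
  then show False using metric_pos[of "f a" x] gram_inner[of a a] by simp
qed

lemma form_mat_inner: "alt_form10 X x \<beta> \<Longrightarrow> form_mat X \<phi> x \<beta> a \<bullet> c = Re (bh \<beta> (f a) (f c))"
proof -
  assume alt: "alt_form10 X x \<beta>"
  have 1: "linear (\<lambda>a. Re (bh \<beta> (f a) (f c)))" for c
    by (rule linearI) (simp_all add: f.add f.scale bh_add[OF alt] bh_scale[OF alt])
  have "linear (\<lambda>c. Re (bh \<beta> (f a) (f c)))" for a
    using linear_compose_neg[OF 1[of a]] bh_skew[OF alt, of "f a"] by (simp add: linear_iff)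
  then show ?thesis unfolding form_mat_def using 1 by (intro frame_form_inner) auto
qed

lemma form_end_inner: "alt_form10 X x \<beta> \<Longrightarrow> gram X \<phi> x (form_end X \<phi> x \<beta> a) \<bullet> c = Re (bh \<beta> (f a) (f c))"
  by (simp add: form_end_def blinfun_inv_apply[OF gram_invertible] form_mat_inner)

lemma gram_eqI: "(\<And>c. gram X \<phi> x a \<bullet> c = gram X \<phi> x a' \<bullet> c) \<Longrightarrow> a = a'"
  using blinfun_inv_apply(1)[OF gram_invertible] by (metis inner_commute vector_eq_ldot)

lemma skew_deformation_frame:
  assumes alt: "alt_form10 X x \<beta>"
  shows "skew_deformation (gram X \<phi> x) mul_i (form_end X \<phi> x \<beta>)"
proof
  show "gram X \<phi> x u \<bullet> v = gram X \<phi> x v \<bullet> u" for u v by (simp add: gram_inner metric_sym)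
  show "u \<noteq> 0 \<Longrightarrow> gram X \<phi> x u \<bullet> u > 0" for u by (simp add: gram_inner metric_pos)
  show "mul_i o\<^sub>L mul_i = - (id_blinfun :: (complex^'r) \<Rightarrow>\<^sub>L (complex^'r))"
    by (auto intro!: blinfun_eqI simp: ii uminus_blinfun.rep_eq)
  show "gram X \<phi> x (mul_i u) \<bullet> mul_i v = gram X \<phi> x u \<bullet> v" for u v
    by (simp add: gram_inner f_i metric_cstr)
  show sk: "gram X \<phi> x (form_end X \<phi> x \<beta> u) \<bullet> v = - (gram X \<phi> x u \<bullet> form_end X \<phi> x \<beta> v)" for u v
  proof -
    have "gram X \<phi> x u \<bullet> form_end X \<phi> x \<beta> v = gram X \<phi> x (form_end X \<phi> x \<beta> v) \<bullet> u"
      by (simp add: gram_inner metric_sym)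
    then show ?thesis using bh_skew[OF alt, of "f u" "f v"] by (simp add: form_end_inner[OF alt])
  qed
  show "form_end X \<phi> x \<beta> o\<^sub>L mul_i = - (mul_i o\<^sub>L form_end X \<phi> x \<beta>)"
  proof (rule blinfun_eqI, rule gram_eqI)
    fix a c
    have "gram X \<phi> x (\<i> *s form_end X \<phi> x \<beta> a) \<bullet> c = - (gram X \<phi> x (form_end X \<phi> x \<beta> a) \<bullet> (\<i> *s c))"
      by (simp add: gram_inner f_i metric_cstr_left)
    then show "gram X \<phi> x ((form_end X \<phi> x \<beta> o\<^sub>L mul_i) a) \<bullet> c = gram X \<phi> x ((- (mul_i o\<^sub>L form_end X \<phi> x \<beta>)) a) \<bullet> c"
      by (simp add: uminus_blinfun.rep_eq blinfun.minus_right inner_minus_left form_end_inner[OF alt] f_i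
          bh_cstr[OF alt] bh_cstr_right[OF alt])
  qed
qed

text \<open>Elements of \<open>E\<^sup>0\<^sup>1\<close> are of the form \<open>p + \<i> J p\<close>, and the pairing with \<open>E\<^sup>1\<^sup>0\<close> is complex linear; so the
  real part of the equation that defines \<open>g\<^sup>-\<^sup>1 \<beta>\<close> suffices.\<close>

lemma g_inv_eqI:
  assumes alt: "alt_form10 X x \<beta>" and u: "u \<in> fibre X x" "w \<in> fibre X x" and p: "p \<in> fibre X x"
    and eq: "\<And>q. q \<in> fibre X x \<Longrightarrow> metric X x p q = Re (bh \<beta> (u + cstr X x w) q)"
  shows "g_inv X x \<beta> (u, w) = (p, cstr X x p)"
  unfolding g_inv_def
proof (rule the_equality)
  let ?u = "u + cstr X x w"
  have mC: "metric_C X x (p', cstr X x p') (hol_part X x q) = Complex (metric X x p' q) (metric X x (cstr X x p') q)"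
    if "p' \<in> fibre X x" "q \<in> fibre X x" for p' q
    using that by (simp add: metric_C_def hol_part_def metric_scale_right metric_minus_right metric_cstr metric_cstr_left)
  have im: "metric X x (cstr X x p) q = Im (bh \<beta> ?u q)" if "q \<in> fibre X x" for q
    using eq[of "cstr X x q"] bh_cstr_right[OF alt, of ?u q] that u p by (simp add: metric_cstr_left)
  show "(p, cstr X x p) \<in> E01 X x \<and> (\<forall>v\<in>E10 X x. metric_C X x (p, cstr X x p) v = \<beta> (proj10 X x (u, w)) v)"
  proof (intro conjI ballI)
    fix v assume "v \<in> E10 X x"
    then obtain q where q: "q \<in> fibre X x" "v = hol_part X x q" by (rule E10E)
    show "metric_C X x (p, cstr X x p) v = \<beta> (proj10 X x (u, w)) v"
      using eq[OF q(1)] im[OF q(1)] by (simp add: q(2) mC[OF p q(1)] proj10_hol_part[OF u] complex_eq_iff)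
  qed (use p in \<open>simp add: E01_iff\<close>)
  fix z assume z: "z \<in> E01 X x \<and> (\<forall>v\<in>E10 X x. metric_C X x z v = \<beta> (proj10 X x (u, w)) v)"
  define p' where "p' = fst z"
  have p': "p' \<in> fibre X x" "z = (p', cstr X x p')" using z by (auto simp: E01_iff p'_def prod_eq_iff)
  have "metric X x p' q = metric X x p q" if q: "q \<in> fibre X x" for q
  proof -
    have "metric_C X x z (hol_part X x q) = \<beta> (proj10 X x (u, w)) (hol_part X x q)"
      using z hol_part_E10[OF q] by blast
    then show ?thesis using eq[OF q] mC[OF p'(1) q] by (simp add: p'(2) proj10_hol_part[OF u] complex_eq_iff)
  qed
  then have "metric X x (p' - p) (p' - p) = 0" using p p'(1) by (simp add: metric_diff_left)
  then have "p' = p" using metric_pos[of "p' - p" x] p p'(1) by fastforce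
  then show "z = (p, cstr X x p)" using p'(2) by simp
qed

lemma g_inv_frame:
  assumes alt: "alt_form10 X x \<beta>"
  shows "g_inv X x \<beta> (f a, f c) =
    (f (form_end X \<phi> x \<beta> (a + \<i> *s c)), f (\<i> *s form_end X \<phi> x \<beta> (a + \<i> *s c)))"
  unfolding f_i
proof (rule g_inv_eqI[OF alt f_in f_in f_in])
  fix q assume "q \<in> fibre X x"
  then obtain d where "q = f d" by (rule fibreE)
  then show "metric X x (f (form_end X \<phi> x \<beta> (a + \<i> *s c))) q = Re (bh \<beta> (f a + cstr X x (f c)) q)"
    using form_end_inner[OF alt, of "a + \<i> *s c" d] by (simp add: gram_inner f.add f_i)
qed

text \<open>\<open>g\<^sup>-\<^sup>1 \<beta>\<close> takes values in \<open>E\<^sup>0\<^sup>1\<close> and vanishes there, so its square is zero and the exponential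
  series stops after the linear term.\<close>

lemma endo_exp_frame:
  assumes alt: "alt_form10 X x \<beta>"
  shows "endo_exp (\<lambda>u. - g_inv X x \<beta> u) (f a, f c) =
    (f (a - form_end X \<phi> x \<beta> (a + \<i> *s c)), f (c - \<i> *s form_end X \<phi> x \<beta> (a + \<i> *s c)))"
proof -
  let ?F = "\<lambda>u. - g_inv X x \<beta> u"
  define d where "d = form_end X \<phi> x \<beta> (a + \<i> *s c)"
  have F1: "?F (f a, f c) = (f (- d), f (- (\<i> *s d)))"
    by (simp add: g_inv_frame[OF alt] d_def f.neg)
  have F2: "?F (f (- d), f (- (\<i> *s d))) = (f 0, f 0)"
    by (simp only: g_inv_frame[OF alt]) (simp add: vec_eq_iff f.zero blinfun.zero_right zero_prod_def)
  have F0: "?F (f 0, f 0) = (f 0, f 0)"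
    by (simp only: g_inv_frame[OF alt]) (simp add: f.zero blinfun.zero_right zero_prod_def)
  have Fk: "(?F ^^ k) (f a, f c) = (f 0, f 0)" if "k \<ge> 2" for k
    using that
  proof (induction k rule: dec_induct)
    case base
    then show ?case using F1 F2 by (simp add: numeral_2_eq_2)
  next
    case (step n)
    then show ?case using F0 by simp
  qed
  have "endo_exp ?F (f a, f c) = (\<Sum>k\<in>{0, 1}. (?F ^^ k) (f a, f c) /\<^sub>R fact k)"
    unfolding endo_exp_def
  proof (rule suminf_finite)
    fix k :: nat assume "k \<notin> {0, 1}"
    then have "k \<ge> 2" by auto
    then show "(?F ^^ k) (f a, f c) /\<^sub>R fact k = 0" using Fk by (simp add: f.zero zero_prod_def)
  qed simp
  also have "\<dots> = (f a, f c) + (f (- d), f (- (\<i> *s d)))"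
    using F1 by simp
  finally show ?thesis by (simp add: d_def f.diff f.neg)
qed

lemma to_frame_apply: "K \<in> End_fibre X x \<Longrightarrow> to_frame \<phi> x K a = fi (K (f a))"
proof -
  assume K: "K \<in> End_fibre X x"
  have Kin: "K u \<in> fibre X x" if "u \<in> fibre X x" for u using K that by (auto simp: End_fibre_def)
  have Klin: "K (r *\<^sub>R u + v) = r *\<^sub>R K u + K v" if "u \<in> fibre X x" "v \<in> fibre X x" for u v r
    using K that by (auto simp: End_fibre_def)
  have eq: "f (fi (K (f a))) = K (f a)" for a by (rule f_fi) (simp add: Kin)
  have "linear (\<lambda>a. fi (K (f a)))"
  proof (rule linearI)
    show "fi (K (f (a + c))) = fi (K (f a)) + fi (K (f c))" for a c
      using Klin[of "f a" "f c" 1] by (subst f_eq[symmetric]) (simp add: f.add eq Kin)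
    show "fi (K (f (r *\<^sub>R a))) = r *\<^sub>R fi (K (f a))" for a r
      using Klin[of "f a" 0 r] Klin[of 0 0 1] by (subst f_eq[symmetric]) (simp add: f.scale eq Kin)
  qed
  then show ?thesis unfolding to_frame_def by (rule Blinfun_apply_linear)
qed

lemma f_to_frame: "K \<in> End_fibre X x \<Longrightarrow> f (to_frame \<phi> x K a) = K (f a)"
  by (simp add: to_frame_apply End_fibre_def PiE_iff)

lemma of_frame_End: "of_frame X \<phi> x k \<in> End_fibre X x"
proof -
  have "fi (r *\<^sub>R u + v) = r *\<^sub>R fi u + fi v" if "u \<in> fibre X x" "v \<in> fibre X x" for r u v
    using that by (subst f_eq[symmetric]) (simp add: f.add f.scale)
  then show ?thesis
    by (auto simp: End_fibre_def of_frame_def blinfun.add_right blinfun.scaleR_right f.add f.scale)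
qed

lemma of_frame_apply: "of_frame X \<phi> x k (f a) = f (k a)"
  by (simp add: of_frame_def)

lemma to_frame_of_frame: "to_frame \<phi> x (of_frame X \<phi> x k) = k"
  by (rule blinfun_eqI) (simp add: to_frame_apply[OF of_frame_End] of_frame_apply)

lemma End_fibre_eqI:
  assumes "K \<in> End_fibre X x" "K' \<in> End_fibre X x" "\<And>a. K (f a) = K' (f a)"
  shows "K = K'"
proof
  fix u show "K u = K' u"
  proof (cases "u \<in> fibre X x")
    case True then show ?thesis using assms(3) by (metis fibreE)
  next
    case False
    then show ?thesis using assms(1,2) by (auto simp: End_fibre_def PiE_def extensional_def)
  qed
qed

lemma of_frame_to_frame: "K \<in> End_fibre X x \<Longrightarrow> of_frame X \<phi> x (to_frame \<phi> x K) = K"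
  by (rule End_fibre_eqI[OF of_frame_End]) (simp_all add: of_frame_apply f_to_frame)

lemma twistor_frame: "(x, K) \<in> twistor_space X \<longleftrightarrow> K \<in> End_fibre X x \<and> orth_cstr (gram X \<phi> x) (to_frame \<phi> x K)"
proof (cases "K \<in> End_fibre X x")
  case True
  have "(\<forall>u\<in>fibre X x. K (K u) = - u) \<longleftrightarrow> (\<forall>a. K (K (f a)) = - f a)"
    using fibreE f_in by metis
  also have "\<dots> \<longleftrightarrow> (\<forall>a. to_frame \<phi> x K (to_frame \<phi> x K a) = - a)"
    by (simp add: f_to_frame[OF True, symmetric] f.neg[symmetric] del: f.neg)
  also have "\<dots> \<longleftrightarrow> to_frame \<phi> x K o\<^sub>L to_frame \<phi> x K = - id_blinfun"
    by (metis (no_types, lifting) blinfun_apply_blinfun_compose blinfun_apply_id_blinfun blinfun_eqI id_apply uminus_blinfun.rep_eq)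
  finally have 1: "(\<forall>u\<in>fibre X x. K (K u) = - u) \<longleftrightarrow> to_frame \<phi> x K o\<^sub>L to_frame \<phi> x K = - id_blinfun" .
  have "(\<forall>u\<in>fibre X x. \<forall>v\<in>fibre X x. metric X x (K u) (K v) = metric X x u v) \<longleftrightarrow>
    (\<forall>a c. metric X x (K (f a)) (K (f c)) = metric X x (f a) (f c))"
    using fibreE f_in by metis
  then show ?thesis using True 1
    by (simp add: twistor_space_def orth_cstr_def gram_inner f_to_frame)
qed (simp add: twistor_space_def)

text \<open>The \<open>-\<i>\<close> eigenspace is the graph of the complex structure: \<open>u + \<i> w\<close> belongs to it iff \<open>w = K u\<close>.\<close>

lemma twistor_eigenspace:
  assumes "(x, K) \<in> twistor_space X"
  shows "eigenspace X (- \<i>) x K = {(f a, f (to_frame \<phi> x K a)) | a. True}"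
proof -
  have K: "K \<in> End_fibre X x" "\<And>u. u \<in> fibre X x \<Longrightarrow> K (K u) = - u"
    using assms by (auto simp: twistor_space_def)
  have Kin: "K u \<in> fibre X x" if "u \<in> fibre X x" for u using K that by (auto simp: End_fibre_def)
  have "w \<in> eigenspace X (- \<i>) x K \<longleftrightarrow> fst w \<in> fibre X x \<and> snd w = K (fst w)" for w
    by (cases w) (auto simp: eigenspace_def fibre_C_def cmul_def K Kin)
  then show ?thesis
    by (auto simp: f_to_frame[OF K(1)] elim!: fibreE)
qed

lemma twistor_eqI:
  assumes "(x, K) \<in> twistor_space X" "(x, K') \<in> twistor_space X" 
    "eigenspace X (- \<i>) x K = eigenspace X (- \<i>) x K'"
  shows "K = K'"
proof (rule End_fibre_eqI)
  fix a
  have "(f a, f (to_frame \<phi> x K a)) \<in> eigenspace X (- \<i>) x K'"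
    using assms twistor_eigenspace by blast
  then have "to_frame \<phi> x K a = to_frame \<phi> x K' a" using twistor_eigenspace[OF assms(2)] by auto
  then show "K (f a) = K' (f a)"
    using assms(1,2) f_to_frame[of K a] f_to_frame[of K' a] by (simp add: twistor_space_def)
qed (use assms in \<open>auto simp: twistor_space_def\<close>)

lemma corresponds_iff:
  assumes K: "(x, K) \<in> twistor_space X" and alt: "alt_form10 X x (B x)"
  shows "corresponds X (\<lambda>x. endo_exp (\<lambda>u. - g_inv X x (B x) u)) x K K' \<longleftrightarrow>
    K' = of_frame X \<phi> x (deform mul_i (form_end X \<phi> x (B x)) (to_frame \<phi> x K))"
proof -
  define b where "b = form_end X \<phi> x (B x)"
  define k where "k = to_frame \<phi> x K"
  interpret s: skew_deformation "gram X \<phi> x" mul_i b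
    unfolding b_def by (rule skew_deformation_frame[OF alt])
  have k: "orth_cstr (gram X \<phi> x) k" using K by (simp add: twistor_frame k_def)
  let ?K' = "of_frame X \<phi> x (deform mul_i b k)"
  have K': "(x, ?K') \<in> twistor_space X"
    using s.deform_orth_cstr[OF k] by (simp add: twistor_frame of_frame_End to_frame_of_frame)
  have P: "endo_exp (\<lambda>u. - g_inv X x (B x) u) (f a, f (k a)) = (f (twist mul_i b k a), f (deform mul_i b k (twist mul_i b k a)))" for a
  proof -
    have "deform mul_i b k (twist mul_i b k a) = (deform mul_i b k o\<^sub>L twist mul_i b k) a" by simp
    also have "\<dots> = twist mul_i b k (k a)" unfolding s.deform_twist[OF k] by simp
    finally have D: "deform mul_i b k (twist mul_i b k a) = twist mul_i b k (k a)" .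
    have bi: "b (\<i> *s c) = - (\<i> *s b c)" for c using s.pointwise(2)[of c] by simp
    show ?thesis unfolding endo_exp_frame[OF alt] D b_def[symmetric]
      by (simp add: s.twist_apply blinfun.add_right bi orth_cstr_apply[OF k] blinfun.minus_right)
  qed
  have surj: "\<exists>a. c = twist mul_i b k a" for c
    using blinfun_inv_apply(2)[OF s.twist_invertible[OF k]] by metis
  define G where "G = (\<lambda>c. (f c, f (deform mul_i b k c)))"
  have "endo_exp (\<lambda>u. - g_inv X x (B x) u) ` eigenspace X (- \<i>) x K = range (\<lambda>a. G (twist mul_i b k a))"
  proof -
    have "{(f a, f (k a)) | a. True} = range (\<lambda>a. (f a, f (k a)))" by auto
    then show ?thesis
      unfolding twistor_eigenspace[OF K] k_def[symmetric] by (simp add: image_image P G_def)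
  qed
  also have "\<dots> = G ` range (twist mul_i b k)" by (simp add: image_image)
  also have "range (twist mul_i b k) = UNIV" using surj by auto
  also have "G ` UNIV = {(f c, f (deform mul_i b k c)) | c. True}" by (auto simp: G_def)
  also have "\<dots> = eigenspace X (- \<i>) x ?K'"
    by (simp add: twistor_eigenspace[OF K'] to_frame_of_frame)
  finally show ?thesis
    unfolding corresponds_def b_def[symmetric] k_def[symmetric] using K' twistor_eqI by metis
qed

end

section \<open>Connections in a frame\<close>

definition conn_mat :: "('m \<Rightarrow> complex^'r \<Rightarrow> 'v) \<Rightarrow> ('m, 'v::real_normed_vector, 'n) conn \<Rightarrow> 'm \<Rightarrow>
    ('m, complex^'n) tvec \<Rightarrow> (complex^'r) \<Rightarrow>\<^sub>L (complex^'r)" where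
  "conn_mat \<phi> N x v = Blinfun (\<lambda>a. inv (\<phi> x) (N x v (\<lambda>y. \<phi> y a)))"

text \<open>The two properties of a connection on which the twistor construction rests.  The second one
  says that the connection form of a holomorphic frame satisfies \<open>\<theta>(I v) = J \<theta>(v)\<close>; it is what
  remains, for real sections, of the prescription of the (0,1)-part.\<close>

definition metric_in_frames :: "('m::{t2_space,second_countable_topology}, 'v::real_normed_vector, 'n::finite, 'r::finite) herm_bundle \<Rightarrow>
    ('m, 'v, 'n) conn \<Rightarrow> bool" where
  "metric_in_frames X N \<longleftrightarrow> (\<forall>V \<phi> x v a c. (V, \<phi>) \<in> trivs X \<longrightarrow> x \<in> V \<longrightarrow> v \<in> tangent_space (charts X) UNIV x \<longrightarrow>
     dfun (charts X) (\<lambda>y. metric X y (\<phi> y a) (\<phi> y c)) x v =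
       gram X \<phi> x (conn_mat \<phi> N x v a) \<bullet> c + gram X \<phi> x a \<bullet> conn_mat \<phi> N x v c)"

definition holo_in_frames :: "('m::{t2_space,second_countable_topology}, 'v::real_normed_vector, 'n::finite, 'r::finite) herm_bundle \<Rightarrow>
    ('m, 'v, 'n) conn \<Rightarrow> bool" where
  "holo_in_frames X N \<longleftrightarrow> (\<forall>x. \<forall>v\<in>tangent_space (charts X) UNIV x.
     conn_mat (triv_at X x) N x (cI v) = mul_i o\<^sub>L conn_mat (triv_at X x) N x v)"

context herm_hol_bundle
begin

lemma frame_atI: "(V, \<phi>) \<in> trivs X \<Longrightarrow> x \<in> V \<Longrightarrow> frame_at X V \<phi> x"
  by (simp add: frame_at_def frame_at_axioms_def herm_hol_bundle_axioms)

lemma frame_at_triv_at: "frame_at X (dom_at X x) (triv_at X x) x"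
  by (rule frame_atI[OF triv_at])

lemma metric_smooth: "open U \<Longrightarrow> smooth_section X U s \<Longrightarrow> smooth_section X U t \<Longrightarrow>
    smooth_fun (charts X) U (\<lambda>x. metric X x (s x) (t x))"
  using herm[unfolded hermitian_metric_def, THEN conjunct2] by blast

lemma gram_apply: "frame_at X V \<phi> x \<Longrightarrow> gram X \<phi> x a = (\<Sum>b\<in>Basis. metric X x (\<phi> x a) (\<phi> x b) *\<^sub>R b)"
  by (subst euclidean_representation[symmetric]) (simp add: frame_at.gram_inner)

lemma gram_smooth:
  assumes t: "(V, \<phi>) \<in> trivs X" shows "smooth_fun (charts X) V (gram X \<phi>)"
proof (rule smooth_fun_blinfunI[OF triv_open[OF t]])
  fix a
  have "smooth_fun (charts X) V (\<lambda>x. \<Sum>b\<in>Basis. metric X x (\<phi> x a) (\<phi> x b) *\<^sub>R b)"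
    by (intro smooth_fun_sum smooth_fun_bounded_linear[OF _ bounded_linear_scaleR_left] metric_smooth
        frame_const_section[OF t] triv_open[OF t])
  then show "smooth_fun (charts X) V (\<lambda>x. gram X \<phi> x a)"
    by (rule smooth_fun_cong[OF triv_open[OF t]]) (simp add: gram_apply[OF frame_atI[OF t]])
qed

lemma smooth_section_cong:
  assumes "open U" "smooth_section X U s" "\<And>y. y \<in> U \<Longrightarrow> s y = t y"
  shows "smooth_section X U t"
  unfolding smooth_section_def
proof (intro conjI ballI)
  show "t y \<in> fibre X y" if "y \<in> U" for y using assms that by (auto simp: smooth_section_def)
  fix T assume T: "T \<in> trivs X"
  have "smooth_fun (charts X) (U \<inter> fst T) (\<lambda>x. inv (snd T x) (s x))"
    using assms(2) T unfolding smooth_section_def by (auto simp: case_prod_beta)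
  then have "smooth_fun (charts X) (U \<inter> fst T) (\<lambda>x. inv (snd T x) (t x))"
    by (rule smooth_fun_cong[rotated]) (use assms triv_open[of "fst T" "snd T"] T in auto)
  then show "case T of (V, \<phi>) \<Rightarrow> smooth_fun (charts X) (U \<inter> V) (\<lambda>x. inv (\<phi> x) (t x))"
    by (simp add: case_prod_beta)
qed

lemma hol_part_frame:
  assumes "frame_at X V \<phi> x"
  shows "hol_part X x (\<phi> x a) = (\<phi> x ((1/2) *\<^sub>R a), \<phi> x (- ((1/2) *\<^sub>R (\<i> *s a))))"
proof -
  interpret frame_at X V \<phi> x by fact
  show ?thesis by (simp add: hol_part_def f.scale f.neg f_i)
qed

lemma hol_part_section10:
  assumes t: "(V, \<phi>) \<in> trivs X"
  shows "smooth_section10 X V (\<lambda>y. hol_part X y (\<phi> y a))"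
  unfolding smooth_section10_def smooth_section_C_def
proof (intro conjI ballI)
  show "smooth_section X V (fst \<circ> (\<lambda>y. hol_part X y (\<phi> y a)))"
    by (rule smooth_section_cong[OF triv_open[OF t] frame_const_section[OF t, of "(1/2) *\<^sub>R a"]])
      (simp add: hol_part_frame[OF frame_atI[OF t]])
  show "smooth_section X V (snd \<circ> (\<lambda>y. hol_part X y (\<phi> y a)))"
    by (rule smooth_section_cong[OF triv_open[OF t] frame_const_section[OF t, of "- ((1/2) *\<^sub>R (\<i> *s a))"]])
      (simp add: hol_part_frame[OF frame_atI[OF t]])
  show "hol_part X y (\<phi> y a) \<in> E10 X y" if "y \<in> V" for y
  proof -
    interpret frame_at X V \<phi> y by (rule frame_atI[OF t that])
    show ?thesis by (rule hol_part_E10[OF f_in])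
  qed
qed

subsection \<open>Sections of the second exterior power\<close>

context
  fixes B assumes B: "section_L2 X B"
begin

lemma B_alt: "alt_form10 X x (B x)"
  using B unfolding section_L2_def by blast

lemma B_smooth: "(V, \<phi>) \<in> trivs X \<Longrightarrow>
    smooth_fun (charts X) V (\<lambda>y. B y (hol_part X y (\<phi> y a)) (hol_part X y (\<phi> y c)))"
  using conjunct2[OF B[unfolded section_L2_def]] triv_open hol_part_section10 by blast

lemma form_mat_apply: "frame_at X V \<phi> x \<Longrightarrow> form_mat X \<phi> x (B x) a =
    (\<Sum>b\<in>Basis. Re (B x (hol_part X x (\<phi> x a)) (hol_part X x (\<phi> x b))) *\<^sub>R b)"
  by (subst euclidean_representation[symmetric]) (simp add: frame_at.form_mat_inner B_alt)

lemma form_end_smooth: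
  assumes t: "(V, \<phi>) \<in> trivs X" shows "smooth_fun (charts X) V (\<lambda>x. form_end X \<phi> x (B x))"
  unfolding form_end_def
proof (rule smooth_fun_bilinear[OF bounded_bilinear_blinfun_compose triv_open[OF t]])
  show "smooth_fun (charts X) V (\<lambda>x. blinfun_inv (gram X \<phi> x))"
    by (rule smooth_fun_blinfun_inv[OF triv_open[OF t] gram_smooth[OF t]])
      (rule frame_at.gram_invertible[OF frame_atI[OF t]])
  show "smooth_fun (charts X) V (\<lambda>x. form_mat X \<phi> x (B x))"
  proof (rule smooth_fun_blinfunI[OF triv_open[OF t]])
    fix a
    have "smooth_fun (charts X) V (\<lambda>x. \<Sum>b\<in>Basis. Re (B x (hol_part X x (\<phi> x a)) (hol_part X x (\<phi> x b))) *\<^sub>R b)"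
      by (intro smooth_fun_sum smooth_fun_bounded_linear[OF _ bounded_linear_scaleR_left]
          smooth_fun_bounded_linear[OF _ bounded_linear_Re] B_smooth[OF t] triv_open[OF t])
    then show "smooth_fun (charts X) V (\<lambda>x. form_mat X \<phi> x (B x) a)"
      by (rule smooth_fun_cong[OF triv_open[OF t]]) (simp add: form_mat_apply[OF frame_atI[OF t]])
  qed
qed

end

subsection \<open>The axioms of a connection\<close>

context
  fixes N assumes conn: "connection X N"
begin

lemma conn_ax:
  assumes "open U" "x \<in> U" "smooth_section X U s" "smooth_section X U s'" "v \<in> tangent_space (charts X) UNIV x"
  shows "N x v s \<in> fibre X x" "(\<And>y. y \<in> U \<Longrightarrow> s y = s' y) \<Longrightarrow> N x v s = N x v s'"
    "N x v (\<lambda>y. s y + s' y) = N x v s + N x v s'"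
    "smooth_fun (charts X) U h \<Longrightarrow>
      N x v (\<lambda>y. h y *\<^sub>R s y) = dfun (charts X) h x v *\<^sub>R s x + h x *\<^sub>R N x v s"
proof -
  have a: "open U \<and> x \<in> U \<and> smooth_section X U s \<and> smooth_section X U s'" using assms by blast
  note * = conjunct1[OF conn[unfolded connection_def], THEN spec, THEN spec, THEN spec, THEN spec, THEN mp, OF a, THEN bspec, OF assms(5)]
  show "N x v s \<in> fibre X x" by (rule *[THEN conjunct1])
  show "(\<And>y. y \<in> U \<Longrightarrow> s y = s' y) \<Longrightarrow> N x v s = N x v s'" using *[THEN conjunct2, THEN conjunct1] by simp
  show "N x v (\<lambda>y. s y + s' y) = N x v s + N x v s'" by (rule *[THEN conjunct2, THEN conjunct2, THEN conjunct1])
  show "smooth_fun (charts X) U h \<Longrightarrow>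
      N x v (\<lambda>y. h y *\<^sub>R s y) = dfun (charts X) h x v *\<^sub>R s x + h x *\<^sub>R N x v s"
    using *[THEN conjunct2, THEN conjunct2, THEN conjunct2, THEN conjunct1] by simp
qed

text \<open>The axioms of a connection speak of two summands and one real coefficient at a time, hence the
  induction over the basis vectors.\<close>

lemma conn_Leibniz_frame:
  assumes t: "(V, \<phi>) \<in> trivs X" and W: "open W" "W \<subseteq> V" "x \<in> W" and h: "smooth_fun (charts X) W h"
    and v: "v \<in> tangent_space (charts X) UNIV x"
  shows "N x v (\<lambda>y. \<phi> y (h y)) = \<phi> x (dfun (charts X) h x v) + (\<Sum>b\<in>Basis. (h x \<bullet> b) *\<^sub>R N x v (\<lambda>y. \<phi> y b))"
proof -
  have lin: "linear (\<phi> y)" if "y \<in> W" for y using triv_props(1)[OF t] that W by auto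
  interpret f: linear "\<phi> x" by (rule lin[OF W(3)])
  have hb: "smooth_fun (charts X) W (\<lambda>y. h y \<bullet> b)" for b
    by (rule smooth_fun_bounded_linear[OF W(1) bounded_linear_inner_left h])
  have sm: "smooth_section X W (\<lambda>y. \<phi> y (k y))" if "smooth_fun (charts X) W k" for k
    by (rule frame_smooth_section[OF t W(1,2) that])
  have const: "smooth_section X W (\<lambda>y. \<phi> y b)" for b
    by (rule sm[OF smooth_fun_const[OF W(1)]])
  have part: "smooth_fun (charts X) W (\<lambda>y. \<Sum>b\<in>I. (h y \<bullet> b) *\<^sub>R b)" for I
    by (intro smooth_fun_sum W smooth_fun_bounded_linear[OF W(1) bounded_linear_scaleR_left hb])
  have "N x v (\<lambda>y. \<phi> y (\<Sum>b\<in>I. (h y \<bullet> b) *\<^sub>R b)) =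
      (\<Sum>b\<in>I. dfun (charts X) (\<lambda>y. h y \<bullet> b) x v *\<^sub>R \<phi> x b + (h x \<bullet> b) *\<^sub>R N x v (\<lambda>y. \<phi> y b))" if "finite I" for I
    using that
  proof (induction I rule: finite_induct)
    case empty
    have z: "smooth_section X W (\<lambda>y. \<phi> y 0)" by (rule const)
    have "N x v (\<lambda>y. \<phi> y 0) = N x v (\<lambda>y. 0 *\<^sub>R \<phi> y 0)"
    proof (rule conn_ax(2)[OF W(1,3) z _ v])
      show eq: "\<phi> y 0 = 0 *\<^sub>R \<phi> y 0" if "y \<in> W" for y using linear_0[OF lin[OF that]] by simp
      show "smooth_section X W (\<lambda>y. 0 *\<^sub>R \<phi> y 0)" by (rule smooth_section_cong[OF W(1) z eq])
    qed
    also have "\<dots> = 0"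
      using conn_ax(4)[OF W(1,3) z z v smooth_fun_const[OF W(1), of 0]] dfun_const[OF W(3,1) v, of "0::real"] by simp
    finally show ?case by simp
  next
    case (insert b I)
    let ?r = "\<lambda>y. \<Sum>b\<in>I. (h y \<bullet> b) *\<^sub>R b"
    have s1: "smooth_section X W (\<lambda>y. (h y \<bullet> b) *\<^sub>R \<phi> y b)"
      by (rule smooth_section_cong[OF W(1) sm[OF smooth_fun_bounded_linear[OF W(1) bounded_linear_scaleR_left hb]]])
        (simp add: linear_scale[OF lin])
    have s2: "smooth_section X W (\<lambda>y. \<phi> y (?r y))" by (rule sm[OF part])
    have s3: "smooth_section X W (\<lambda>y. \<phi> y (\<Sum>b\<in>insert b I. (h y \<bullet> b) *\<^sub>R b))" by (rule sm[OF part])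
    have eq: "\<phi> y (\<Sum>b\<in>insert b I. (h y \<bullet> b) *\<^sub>R b) = (h y \<bullet> b) *\<^sub>R \<phi> y b + \<phi> y (?r y)" if "y \<in> W" for y
      using insert.hyps by (simp add: linear_add[OF lin[OF that]] linear_scale[OF lin[OF that]])
    have "N x v (\<lambda>y. \<phi> y (\<Sum>b\<in>insert b I. (h y \<bullet> b) *\<^sub>R b)) = N x v (\<lambda>y. (h y \<bullet> b) *\<^sub>R \<phi> y b + \<phi> y (?r y))"
      by (rule conn_ax(2)[OF W(1,3) s3 smooth_section_cong[OF W(1) s3 eq] v eq])
    also have "\<dots> = N x v (\<lambda>y. (h y \<bullet> b) *\<^sub>R \<phi> y b) + N x v (\<lambda>y. \<phi> y (?r y))"
      by (rule conn_ax(3)[OF W(1,3) s1 s2 v])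
    also have "N x v (\<lambda>y. (h y \<bullet> b) *\<^sub>R \<phi> y b) = dfun (charts X) (\<lambda>y. h y \<bullet> b) x v *\<^sub>R \<phi> x b + (h x \<bullet> b) *\<^sub>R N x v (\<lambda>y. \<phi> y b)"
      by (rule conn_ax(4)[OF W(1,3) const const v hb])
    finally show ?case using insert by simp
  qed
  from this[OF finite_Basis]
  have "N x v (\<lambda>y. \<phi> y (h y)) = (\<Sum>b\<in>Basis. (dfun (charts X) h x v \<bullet> b) *\<^sub>R \<phi> x b) + (\<Sum>b\<in>Basis. (h x \<bullet> b) *\<^sub>R N x v (\<lambda>y. \<phi> y b))"
    by (simp add: euclidean_representation sum.distrib dfun_bounded_linear[OF bounded_linear_inner_left W(1) h W(3) v])
  also have "(\<Sum>b\<in>Basis. (dfun (charts X) h x v \<bullet> b) *\<^sub>R \<phi> x b) = \<phi> x (\<Sum>b\<in>Basis. (dfun (charts X) h x v \<bullet> b) *\<^sub>R b)"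
    by (simp add: f.sum f.scale)
  finally show ?thesis by (simp add: euclidean_representation)
qed

lemma conn_zero:
  assumes "v \<in> tangent_space (charts X) UNIV x"
  shows "N x v (\<lambda>y. 0) = 0"
proof -
  interpret frame_at X "dom_at X x" "triv_at X x" x by (rule frame_at_triv_at)
  have z: "smooth_section X (dom_at X x) (\<lambda>y. 0)"
  proof (rule smooth_section_cong[OF triv_open[OF triv_at(1)] frame_const_section[OF triv_at(1), of _ 0]])
    show "triv_at X x y 0 = 0" if "y \<in> dom_at X x" for y
      by (rule linear_0[OF triv_props(1)[OF triv_at(1) that]])
  qed
  show ?thesis using conn_ax(3)[OF triv_open[OF triv_at(1)] triv_at(2) z z assms] by simp
qed

lemma conn_mat_apply:
  assumes t: "(V, \<phi>) \<in> trivs X" "x \<in> V" and v: "v \<in> tangent_space (charts X) UNIV x"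
  shows "\<phi> x (conn_mat \<phi> N x v a) = N x v (\<lambda>y. \<phi> y a)"
proof -
  interpret frame_at X V \<phi> x by (rule frame_atI[OF t])
  have Nin: "N x v (\<lambda>y. \<phi> y a) \<in> fibre X x" for a
    by (rule conn_ax(1)[OF triv_open[OF t(1)] t(2) frame_const_section[OF t(1)] frame_const_section[OF t(1)] v])
  have exp: "N x v (\<lambda>y. \<phi> y a) = (\<Sum>b\<in>Basis. (a \<bullet> b) *\<^sub>R N x v (\<lambda>y. \<phi> y b))" for a
    using conn_Leibniz_frame[OF t(1) triv_open[OF t(1)] subset_refl t(2) smooth_fun_const[OF triv_open[OF t(1)], of a] v]
      dfun_const[OF t(2) triv_open[OF t(1)] v, of a] by (simp add: f.zero)
  have lin: "linear (\<lambda>a. N x v (\<lambda>y. \<phi> y a))"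
    by (rule linearI, subst (1 2 3) exp, simp add: inner_add_left scaleR_add_left sum.distrib,
        subst (1 2) exp, simp add: scaleR_sum_right)
  have "linear (\<lambda>a. fi (N x v (\<lambda>y. \<phi> y a)))"
  proof (rule linearI)
    show "fi (N x v (\<lambda>y. \<phi> y (a + c))) = fi (N x v (\<lambda>y. \<phi> y a)) + fi (N x v (\<lambda>y. \<phi> y c))" for a c
      using linear_add[OF lin, of a c] by (subst f_eq[symmetric]) (simp add: f.add Nin)
    show "fi (N x v (\<lambda>y. \<phi> y (r *\<^sub>R a))) = r *\<^sub>R fi (N x v (\<lambda>y. \<phi> y a))" for r a
      using linear_scale[OF lin, of r a] by (subst f_eq[symmetric]) (simp add: f.scale Nin)
  qed
  then show ?thesis
    unfolding conn_mat_def by (simp add: Blinfun_apply_linear Nin)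
qed

lemma conn_Leibniz:
  assumes t: "(V, \<phi>) \<in> trivs X" and W: "open W" "W \<subseteq> V" "x \<in> W" and h: "smooth_fun (charts X) W h"
    and v: "v \<in> tangent_space (charts X) UNIV x"
  shows "N x v (\<lambda>y. \<phi> y (h y)) = \<phi> x (dfun (charts X) h x v + conn_mat \<phi> N x v (h x))"
proof -
  have xV: "x \<in> V" using W by blast
  interpret f: linear "\<phi> x" by (rule triv_props(1)[OF t xV])
  have "(\<Sum>b\<in>Basis. (h x \<bullet> b) *\<^sub>R N x v (\<lambda>y. \<phi> y b)) = \<phi> x (conn_mat \<phi> N x v (\<Sum>b\<in>Basis. (h x \<bullet> b) *\<^sub>R b))"
    by (simp add: conn_mat_apply[OF t xV v, symmetric] blinfun.sum_right blinfun.scaleR_right f.sum f.scale)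
  then show ?thesis using conn_Leibniz_frame[OF assms] by (simp add: euclidean_representation f.add)
qed

lemma conn_mat_smooth:
  assumes t: "(V, \<phi>) \<in> trivs X" and c: "c \<in> charts X"
  shows "smooth_fun (charts X) (V \<inter> fst c) (\<lambda>x. conn_mat \<phi> N x (coord_vec (charts X) c \<xi> x))"
proof (rule smooth_fun_blinfunI)
  show o: "open (V \<inter> fst c)" using triv_open[OF t] chart_props(1)[OF c] by auto
  fix a
  have "smooth_section X (V \<inter> fst c) (\<lambda>x. N x (coord_vec (charts X) c \<xi> x) (\<lambda>y. \<phi> y a))"
    using bspec[OF conjunct2[OF conn[unfolded connection_def]] c] triv_open[OF t] frame_const_section[OF t] by simp
  then have "smooth_fun (charts X) (V \<inter> fst c \<inter> V) (\<lambda>x. inv (\<phi> x) (N x (coord_vec (charts X) c \<xi> x) (\<lambda>y. \<phi> y a)))"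
    unfolding smooth_section_def by (drule_tac conjunct2, drule_tac bspec[OF _ t], simp)
  then have "smooth_fun (charts X) (V \<inter> fst c) (\<lambda>x. inv (\<phi> x) (N x (coord_vec (charts X) c \<xi> x) (\<lambda>y. \<phi> y a)))"
    by (rule smooth_fun_subset) auto
  then show "smooth_fun (charts X) (V \<inter> fst c) (\<lambda>x. conn_mat \<phi> N x (coord_vec (charts X) c \<xi> x) a)"
  proof (rule smooth_fun_cong[OF o])
    fix x assume x: "x \<in> V \<inter> fst c"
    then have v: "coord_vec (charts X) c \<xi> x \<in> tangent_space (charts X) UNIV x"
      using coord_vec_tangent(1)[OF c] by blast
    interpret frame_at X V \<phi> x by (rule frame_atI[OF t]) (use x in auto)
    show "fi (N x (coord_vec (charts X) c \<xi> x) (\<lambda>y. \<phi> y a)) = conn_mat \<phi> N x (coord_vec (charts X) c \<xi> x) a"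
      using conn_mat_apply[OF t _ v, of a] x by (metis IntD1 fi_f)
  qed
qed

end

end

context herm_hol_bundle
begin

subsection \<open>The Chern connection\<close>

context
  fixes N assumes chern: "chern_connection X N"
begin

lemma chern_conn: "connection X N"
  using chern unfolding chern_connection_def by (rule conjunct1)

lemma chern_ax:
  assumes "open U" "x \<in> U" "v \<in> tangent_space (charts X) UNIV x"
  shows "smooth_section X U s \<Longrightarrow> smooth_section X U t \<Longrightarrow>
      dfun (charts X) (\<lambda>y. metric X y (s y) (t y)) x v = metric X x (N x v s) (t x) + metric X x (s x) (N x v t)"
    "smooth_section X U s \<Longrightarrow> N x v (\<lambda>y. cstr X y (s y)) = cstr X x (N x v s)"
    "smooth_section10 X U s' \<Longrightarrow> conn01 N x v s' = dbar_E10 X s' x v"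
proof -
  have a: "open U \<and> x \<in> U" using assms by blast
  note * = conjunct2[OF chern[unfolded chern_connection_def], THEN spec, THEN spec, THEN mp, OF a, THEN bspec, OF assms(3)]
  show "smooth_section X U s \<Longrightarrow> smooth_section X U t \<Longrightarrow>
      dfun (charts X) (\<lambda>y. metric X y (s y) (t y)) x v = metric X x (N x v s) (t x) + metric X x (s x) (N x v t)"
    using *[THEN conjunct1] by simp
  show "smooth_section X U s \<Longrightarrow> N x v (\<lambda>y. cstr X y (s y)) = cstr X x (N x v s)"
    using *[THEN conjunct2, THEN conjunct1] by simp
  show "smooth_section10 X U s' \<Longrightarrow> conn01 N x v s' = dbar_E10 X s' x v"
    using *[THEN conjunct2, THEN conjunct2] by simp
qed

lemma chern_metric: "metric_in_frames X N"
  unfolding metric_in_frames_def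
proof (intro allI impI)
  fix V \<phi> x v a c assume t: "(V, \<phi>) \<in> trivs X" "x \<in> V" and v: "v \<in> tangent_space (charts X) UNIV x"
  interpret frame_at X V \<phi> x by (rule frame_atI[OF t])
  show "dfun (charts X) (\<lambda>y. metric X y (\<phi> y a) (\<phi> y c)) x v =
       gram X \<phi> x (conn_mat \<phi> N x v a) \<bullet> c + gram X \<phi> x a \<bullet> conn_mat \<phi> N x v c"
    using chern_ax(1)[OF triv_open[OF t(1)] t(2) v frame_const_section[OF t(1)] frame_const_section[OF t(1)]]
    by (simp add: gram_inner conn_mat_apply[OF chern_conn t v])
qed

lemma chern_cstr:
  assumes t: "(V, \<phi>) \<in> trivs X" "x \<in> V" and v: "v \<in> tangent_space (charts X) UNIV x"
  shows "conn_mat \<phi> N x v (\<i> *s a) = \<i> *s conn_mat \<phi> N x v a"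
proof -
  interpret frame_at X V \<phi> x by (rule frame_atI[OF t])
  have o: "open V" by (rule triv_open[OF t(1)])
  have eq: "\<phi> y (\<i> *s a) = cstr X y (\<phi> y a)" if "y \<in> V" for y by (rule triv_props(3)[OF t(1) that])
  have s: "smooth_section X V (\<lambda>y. \<phi> y (\<i> *s a))" by (rule frame_const_section[OF t(1)])
  have "N x v (\<lambda>y. \<phi> y (\<i> *s a)) = N x v (\<lambda>y. cstr X y (\<phi> y a))"
    by (rule conn_ax(2)[OF chern_conn o t(2) s smooth_section_cong[OF o s eq] v eq])
  also have "\<dots> = cstr X x (N x v (\<lambda>y. \<phi> y a))"
    by (rule chern_ax(2)[OF o t(2) v frame_const_section[OF t(1)]])
  finally have "f (conn_mat \<phi> N x v (\<i> *s a)) = f (\<i> *s conn_mat \<phi> N x v a)"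
    by (simp add: conn_mat_apply[OF chern_conn t v] f_i)
  then show ?thesis by simp
qed

lemma dbar_E10_frame:
  assumes v: "v \<in> tangent_space (charts X) UNIV x"
  shows "dbar_E10 X (\<lambda>y. hol_part X y (triv_at X x y a)) x v = 0"
proof -
  let ?\<phi> = "triv_at X x"
  interpret frame_at X "dom_at X x" ?\<phi> x by (rule frame_at_triv_at)
  have o: "open (dom_at X x)" by (rule triv_open[OF triv_at(1)])
  have z: "dfun (charts X) (\<lambda>y. inv (?\<phi> y) (2 *\<^sub>R fst (hol_part X y (?\<phi> y a))) $ k) x w = 0"
    if w: "w \<in> tangent_space (charts X) UNIV x" for k w
  proof -
    have "dfun (charts X) (\<lambda>y. a $ k) x w = dfun (charts X) (\<lambda>y. inv (?\<phi> y) (2 *\<^sub>R fst (hol_part X y (?\<phi> y a))) $ k) x w"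
    proof (rule dfun_cong[OF o smooth_fun_const[OF o] _ triv_at(2) w])
      fix y assume "y \<in> dom_at X x"
      then interpret y: frame_at X "dom_at X x" ?\<phi> y by (rule frame_atI[OF triv_at(1)])
      show "a $ k = inv (?\<phi> y) (2 *\<^sub>R fst (hol_part X y (?\<phi> y a))) $ k" by (simp add: hol_part_def)
    qed
    then show ?thesis using dfun_const[OF triv_at(2) o w, of "a $ k"] by simp
  qed
  have "f (\<chi> k. 0) = 0" by (simp add: vec_eq_iff)
  then show ?thesis
    unfolding dbar_E10_def Let_def dbar_fun_def z[OF v] z[OF cI_tangent[OF v]]
    by (simp add: proj10_real hol_part_def zero_prod_def)
qed

text \<open>The frame is holomorphic, so the (0,1)-part of the connection kills the (1,0)-part of a constant
  section \<open>a\<close>; this reads \<open>\<theta>(v) a + \<theta>(I v) (\<i> a) = 0\<close>, and \<open>\<theta>(I v)\<close> commutes with \<open>\<i>\<close>.\<close>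

lemma chern_holo: "holo_in_frames X N"
  unfolding holo_in_frames_def
proof (intro allI ballI blinfun_eqI)
  fix x v a assume v: "v \<in> tangent_space (charts X) UNIV x"
  let ?\<phi> = "triv_at X x"
  let ?s = "\<lambda>y. hol_part X y (?\<phi> y a)"
  interpret frame_at X "dom_at X x" ?\<phi> x by (rule frame_at_triv_at)
  note t = triv_at[of x] and o = triv_open[OF triv_at(1)[of x]] and v' = cI_tangent[OF v]
  note const = frame_const_section[OF t(1)]
  have s: "smooth_section10 X (dom_at X x) ?s" by (rule hol_part_section10[OF t(1)])
  have s12: "smooth_section X (dom_at X x) (fst \<circ> ?s)" "smooth_section X (dom_at X x) (snd \<circ> ?s)"
    using s unfolding smooth_section10_def smooth_section_C_def by blast+
  have N1: "N x v (fst \<circ> ?s) = f (conn_mat ?\<phi> N x v ((1/2) *\<^sub>R a))"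
    unfolding conn_mat_apply[OF chern_conn t v]
    by (rule conn_ax(2)[OF chern_conn o t(2) s12(1) const v]) (simp add: hol_part_frame[OF frame_atI[OF t(1)]])
  have N2: "N x (cI v) (snd \<circ> ?s) = f (conn_mat ?\<phi> N x (cI v) (- ((1/2) *\<^sub>R (\<i> *s a))))"
    unfolding conn_mat_apply[OF chern_conn t v']
    by (rule conn_ax(2)[OF chern_conn o t(2) s12(2) const v']) (simp add: hol_part_frame[OF frame_atI[OF t(1)]])
  have "conn01 N x v ?s = 0"
    using chern_ax(3)[OF o t(2) v s] dbar_E10_frame[OF v] by simp
  then have "fst (conn01 N x v ?s) = 0" by simp
  then have "N x v (fst \<circ> ?s) = N x (cI v) (snd \<circ> ?s)"
    by (simp add: conn01_def conn_C_def cmul_def)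
  then have "conn_mat ?\<phi> N x v ((1/2) *\<^sub>R a) = conn_mat ?\<phi> N x (cI v) (- ((1/2) *\<^sub>R (\<i> *s a)))"
    unfolding N1 N2 by simp
  then have "conn_mat ?\<phi> N x v a = - conn_mat ?\<phi> N x (cI v) (\<i> *s a)"
    by (simp add: blinfun.scaleR_right blinfun.minus_right scaleR_minus_right[symmetric] del: scaleR_minus_right)
  then show "conn_mat ?\<phi> N x (cI v) a = (mul_i o\<^sub>L conn_mat ?\<phi> N x v) a"
    by (simp add: chern_cstr[OF t v'] vec_eq_iff)
qed

end

subsection \<open>Connections that differ from the Chern connection by a form\<close>

text \<open>On a real section, the real and imaginary parts of the equation between the (0,1)-parts determine
  the derivatives along \<open>v\<close> and along \<open>I v\<close> separately.\<close>

lemma eq_plus_frame: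
  assumes N: "connection X N" and Ch: "connection X N_Ch" and eq: "conn01_eq_plus X N N_Ch D"
    and alt: "alt_form10 X x (D x v)"
    and t: "(V, \<phi>) \<in> trivs X" "x \<in> V" and v: "v \<in> tangent_space (charts X) UNIV x"
  shows "conn_mat \<phi> N x v = conn_mat \<phi> N_Ch x v + 2 *\<^sub>R form_end X \<phi> x (D x v)"
    "conn_mat \<phi> N x (cI v) = conn_mat \<phi> N_Ch x (cI v) + 2 *\<^sub>R (mul_i o\<^sub>L form_end X \<phi> x (D x v))"
proof -
  interpret frame_at X V \<phi> x by (rule frame_atI[OF t])
  note o = triv_open[OF t(1)] and v' = cI_tangent[OF v]
  have *: "conn_mat \<phi> N x v a = conn_mat \<phi> N_Ch x v a + 2 *\<^sub>R form_end X \<phi> x (D x v) a \<and>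
      conn_mat \<phi> N x (cI v) a = conn_mat \<phi> N_Ch x (cI v) a + 2 *\<^sub>R (\<i> *s form_end X \<phi> x (D x v) a)" for a
  proof -
    let ?s = "\<lambda>y. (\<phi> y a, 0)"
    have z: "smooth_section X V (\<lambda>y. 0)"
      by (rule smooth_section_cong[OF o frame_const_section[OF t(1), of 0]]) (rule linear_0[OF triv_props(1)[OF t(1)]])
    have "smooth_section_C X V ?s"
      unfolding smooth_section_C_def using z frame_const_section[OF t(1), of a] by (simp add: o_def)
    then have "conn01 N x v ?s = conn01 N_Ch x v ?s + g_inv X x (D x v) (?s x)"
      using eq o t(2) v unfolding conn01_eq_plus_def by blast
    moreover have "g_inv X x (D x v) (?s x) = (f (form_end X \<phi> x (D x v) a), f (\<i> *s form_end X \<phi> x (D x v) a))"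
      using g_inv_frame[OF alt, of a 0] by (simp add: f.zero)
    moreover have c01: "conn01 M x v ?s = ((1/2) *\<^sub>R f (conn_mat \<phi> M x v a), (1/2) *\<^sub>R f (conn_mat \<phi> M x (cI v) a))"
      if M: "connection X M" for M
      by (simp add: conn01_def conn_C_def o_def conn_zero[OF M v] conn_zero[OF M v'] cmul_def
          conn_mat_apply[OF M t v] conn_mat_apply[OF M t v'])
    ultimately have e: "(1/2) *\<^sub>R f (conn_mat \<phi> N x v a) = (1/2) *\<^sub>R f (conn_mat \<phi> N_Ch x v a) + f (form_end X \<phi> x (D x v) a)"
      "(1/2) *\<^sub>R f (conn_mat \<phi> N x (cI v) a) = (1/2) *\<^sub>R f (conn_mat \<phi> N_Ch x (cI v) a) + f (\<i> *s form_end X \<phi> x (D x v) a)"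
      by (simp_all add: c01[OF N] c01[OF Ch])
    have "(1/2) *\<^sub>R p = (1/2) *\<^sub>R q + r \<Longrightarrow> p = q + 2 *\<^sub>R r" for p q r :: 'v
      by (drule arg_cong[of _ _ "\<lambda>u. 2 *\<^sub>R u"]) (simp add: scaleR_add_right)
    from this[OF e(1)] this[OF e(2)]
    have "f (conn_mat \<phi> N x v a) = f (conn_mat \<phi> N_Ch x v a + 2 *\<^sub>R form_end X \<phi> x (D x v) a)"
      "f (conn_mat \<phi> N x (cI v) a) = f (conn_mat \<phi> N_Ch x (cI v) a + 2 *\<^sub>R (\<i> *s form_end X \<phi> x (D x v) a))"
      by (simp_all add: f.add f.scale)
    then show ?thesis by simp
  qed
  show "conn_mat \<phi> N x v = conn_mat \<phi> N_Ch x v + 2 *\<^sub>R form_end X \<phi> x (D x v)"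
    by (rule blinfun_eqI) (simp add: * blinfun.add_left blinfun.scaleR_left)
  show "conn_mat \<phi> N x (cI v) = conn_mat \<phi> N_Ch x (cI v) + 2 *\<^sub>R (mul_i o\<^sub>L form_end X \<phi> x (D x v))"
    by (rule blinfun_eqI) (simp add: * blinfun.add_left blinfun.scaleR_left)
qed

lemma eq_plus_metric:
  assumes N: "connection X N" and chern: "chern_connection X N_Ch" and eq: "conn01_eq_plus X N N_Ch D"
    and alt: "\<And>x v. v \<in> tangent_space (charts X) UNIV x \<Longrightarrow> alt_form10 X x (D x v)"
  shows "metric_in_frames X N"
  unfolding metric_in_frames_def
proof (intro allI impI)
  fix V \<phi> x v a c assume t: "(V, \<phi>) \<in> trivs X" "x \<in> V" and v: "v \<in> tangent_space (charts X) UNIV x"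
  interpret frame_at X V \<phi> x by (rule frame_atI[OF t])
  interpret s: skew_deformation "gram X \<phi> x" mul_i "form_end X \<phi> x (D x v)"
    by (rule skew_deformation_frame[OF alt[OF v]])
  show "dfun (charts X) (\<lambda>y. metric X y (\<phi> y a) (\<phi> y c)) x v =
       gram X \<phi> x (conn_mat \<phi> N x v a) \<bullet> c + gram X \<phi> x a \<bullet> conn_mat \<phi> N x v c"
    using chern_metric[OF chern] t v s.b_skew[of a c] unfolding metric_in_frames_def
    by (simp add: eq_plus_frame(1)[OF N chern_conn[OF chern] eq alt[OF v] t v] blinfun.add_left blinfun.scaleR_left
        blinfun.add_right blinfun.scaleR_right inner_add_left inner_add_right)
qed

lemma eq_plus_holo:
  assumes N: "connection X N" and chern: "chern_connection X N_Ch" and eq: "conn01_eq_plus X N N_Ch D"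
    and alt: "\<And>x v. v \<in> tangent_space (charts X) UNIV x \<Longrightarrow> alt_form10 X x (D x v)"
  shows "holo_in_frames X N"
  unfolding holo_in_frames_def
proof (intro allI ballI)
  fix x v assume v: "v \<in> tangent_space (charts X) UNIV x"
  note p = eq_plus_frame[OF N chern_conn[OF chern] eq alt[OF v] triv_at v]
  show "conn_mat (triv_at X x) N x (cI v) = mul_i o\<^sub>L conn_mat (triv_at X x) N x v"
    using chern_holo[OF chern] v unfolding holo_in_frames_def p
    by (simp add: blinfun_compose_simps)
qed

subsection \<open>The Dolbeault derivative of a section of the second exterior power\<close>

lemma holo_ext_frame:
  "holo_ext X x (hol_part X x (triv_at X x x a)) y = hol_part X y (triv_at X x y a)"
proof -
  interpret frame_at X "dom_at X x" "triv_at X x" x by (rule frame_at_triv_at)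
  show ?thesis
    unfolding holo_ext_def Let_def frame_at.proj10_real[OF frame_at_triv_at] by (simp add: hol_part_def)
qed

context
  fixes B assumes B: "section_L2 X B"
begin

abbreviation "B_frame \<phi> a c y \<equiv> B y (hol_part X y (\<phi> y a)) (hol_part X y (\<phi> y c))"

lemma dbar_L2_frame:
  "dbar_L2 X B x v (hol_part X x (triv_at X x x a)) (hol_part X x (triv_at X x x c)) =
    dbar_fun (charts X) (B_frame (triv_at X x) a c) x v"
  by (simp add: dbar_L2_def holo_ext_frame)

lemma hol_part_cmul:
  assumes "frame_at X V \<phi> x"
  shows "cmul z (hol_part X x (\<phi> x a)) = hol_part X x (\<phi> x (z *s a))"
proof -
  interpret frame_at X V \<phi> x by fact
  have "z *s a = Re z *\<^sub>R a + Im z *\<^sub>R (\<i> *s a)"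
    by (simp add: vec_eq_iff complex_eq_iff)
  then have "\<phi> x (z *s a) = Re z *\<^sub>R f a + Im z *\<^sub>R cstr X x (f a)"
    by (simp add: f.add f.scale f_i)
  then show ?thesis
    by (simp add: hol_part_def cmul_def cstr_add cstr_scale algebra_simps)
qed

lemma dbar_L2_alt: 
  assumes v: "v \<in> tangent_space (charts X) UNIV x"
  shows "alt_form10 X x (dbar_L2 X B x v)"
  unfolding alt_form10_def
proof (intro ballI allI)
  let ?\<phi> = "triv_at X x"
  interpret frame_at X "dom_at X x" ?\<phi> x by (rule frame_at_triv_at)
  note t = triv_at[of x] and o = triv_open[OF triv_at(1)[of x]]
  have sm: "smooth_fun (charts X) (dom_at X x) (B_frame ?\<phi> a c)" for a c
    by (rule B_smooth[OF B t(1)])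
  have bl: "bounded_linear (\<lambda>w::complex. z * w)" for z by (rule bounded_linear_mult_right)
  have lin: "dfun (charts X) (B_frame ?\<phi> (z *s a + a') c) x w =
      z * dfun (charts X) (B_frame ?\<phi> a c) x w + dfun (charts X) (B_frame ?\<phi> a' c) x w"
    if w: "w \<in> tangent_space (charts X) UNIV x" for z a a' c w
  proof -
    have "dfun (charts X) (B_frame ?\<phi> (z *s a + a') c) x w = dfun (charts X) (\<lambda>y. z * B_frame ?\<phi> a c y + B_frame ?\<phi> a' c y) x w"
    proof (rule dfun_cong[OF o sm _ t(2) w])
      fix y assume "y \<in> dom_at X x"
      then interpret y: frame_at X "dom_at X x" ?\<phi> y by (rule frame_atI[OF t(1)])
      show "B_frame ?\<phi> (z *s a + a') c y = z * B_frame ?\<phi> a c y + B_frame ?\<phi> a' c y"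
        using y.alt_lin[OF B_alt[OF B] y.hol_part_E10[OF y.f_in] y.hol_part_E10[OF y.f_in] y.hol_part_E10[OF y.f_in], of z a a' c]
        by (simp add: y.f.add y.hol_part_add hol_part_cmul[OF y.frame_at_axioms])
    qed
    then show ?thesis
      by (simp add: dfun_add[OF o smooth_fun_bounded_linear[OF o bl sm] sm t(2) w] dfun_bounded_linear[OF bl o sm t(2) w])
  qed
  have skew: "dfun (charts X) (B_frame ?\<phi> a c) x w = - dfun (charts X) (B_frame ?\<phi> c a) x w"
    if w: "w \<in> tangent_space (charts X) UNIV x" for a c w
  proof -
    have "dfun (charts X) (B_frame ?\<phi> a c) x w = dfun (charts X) (\<lambda>y. - B_frame ?\<phi> c a y) x w"
    proof (rule dfun_cong[OF o sm _ t(2) w])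
      fix y assume "y \<in> dom_at X x"
      then interpret y: frame_at X "dom_at X x" ?\<phi> y by (rule frame_atI[OF t(1)])
      show "B_frame ?\<phi> a c y = - B_frame ?\<phi> c a y" by (rule y.bh_skew[OF B_alt[OF B] y.f_in y.f_in])
    qed
    then show ?thesis
      by (simp add: dfun_bounded_linear[OF bounded_linear_minus[OF bounded_linear_ident] o sm t(2) w])
  qed
  fix p q r z assume "p \<in> E10 X x" "q \<in> E10 X x" "r \<in> E10 X x"
  then obtain a b c where p: "p = hol_part X x (f a)" and q: "q = hol_part X x (f b)" and r: "r = hol_part X x (f c)"
    by (metis E10E fibreE)
  have pq: "cmul z p + q = hol_part X x (f (z *s a + b))"
    by (simp add: p q f.add hol_part_add hol_part_cmul[OF frame_at_axioms])
  note w = v cI_tangent[OF v]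
  show "dbar_L2 X B x v (cmul z p + q) r = z * dbar_L2 X B x v p r + dbar_L2 X B x v q r \<and>
        dbar_L2 X B x v p q = - dbar_L2 X B x v q p"
    unfolding pq unfolding p q r dbar_L2_frame dbar_fun_def lin[OF w(1)] lin[OF w(2)]
    using skew[OF w(1), of a b] skew[OF w(2), of a b] by (simp add: field_simps)
qed

lemma form_end_deriv_anti:
  assumes t: "(V, \<phi>) \<in> trivs X" "x \<in> V" and v: "v \<in> tangent_space (charts X) UNIV x"
  shows "dfun (charts X) (\<lambda>y. form_end X \<phi> y (B y)) x v o\<^sub>L mul_i =
    - (mul_i o\<^sub>L dfun (charts X) (\<lambda>y. form_end X \<phi> y (B y)) x v)"
proof -
  let ?b = "\<lambda>y. form_end X \<phi> y (B y)"
  note o = triv_open[OF t(1)] and sm = form_end_smooth[OF B t(1)]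
  have l1: "bounded_linear (\<lambda>b. b o\<^sub>L mul_i :: (complex^'r) \<Rightarrow>\<^sub>L (complex^'r))"
    by (rule bounded_bilinear.bounded_linear_left[OF bounded_bilinear_blinfun_compose])
  have l2: "bounded_linear (\<lambda>b. - (mul_i o\<^sub>L b) :: (complex^'r) \<Rightarrow>\<^sub>L (complex^'r))"
    by (rule bounded_linear_minus[OF bounded_bilinear.bounded_linear_right[OF bounded_bilinear_blinfun_compose]])
  have "dfun (charts X) (\<lambda>y. ?b y o\<^sub>L mul_i) x v = dfun (charts X) (\<lambda>y. - (mul_i o\<^sub>L ?b y)) x v"
  proof (rule dfun_cong[OF o smooth_fun_bounded_linear[OF o l1 sm] _ t(2) v])
    fix y assume "y \<in> V"
    then interpret y: frame_at X V \<phi> y by (rule frame_atI[OF t(1)])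
    show "?b y o\<^sub>L mul_i = - (mul_i o\<^sub>L ?b y)"
      by (rule skew_deformation.b_J[OF y.skew_deformation_frame[OF B_alt[OF B]]])
  qed
  then show ?thesis
    by (simp only: dfun_bounded_linear[OF l1 o sm t(2) v] dfun_bounded_linear[OF l2 o sm t(2) v])
qed

text \<open>This is the real form of \<open>g\<^sup>-\<^sup>1 \<partial>\<close>-bar \<open>B = \<nabla>\<^sup>0\<^sup>1 (g\<^sup>-\<^sup>1 B)\<close> for the Chern connection: one
  differentiates \<open>g(b a, c) = Re B(a\<^sup>1\<^sup>0, c\<^sup>1\<^sup>0)\<close> for sections \<open>a\<close>, \<open>c\<close> that are constant in a
  holomorphic frame.  The terms with \<open>\<nabla> c\<close> cancel because \<open>\<theta>(I v) = \<i> \<theta>(v)\<close>.\<close>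

lemma dbar_L2_form_end:
  assumes chern: "chern_connection X N" and v: "v \<in> tangent_space (charts X) UNIV x"
  defines "\<phi> \<equiv> triv_at X x"
  defines "b \<equiv> \<lambda>y. form_end X \<phi> y (B y)"
  shows "2 *\<^sub>R form_end X \<phi> x (dbar_L2 X B x v) =
    2 *\<^sub>R (conn_mat \<phi> N x v o\<^sub>L b x) + dfun (charts X) b x v - (mul_i o\<^sub>L dfun (charts X) b x (cI v))"
proof -
  define V where "V = dom_at X x"
  have t: "(V, \<phi>) \<in> trivs X" "x \<in> V" using triv_at by (auto simp: V_def \<phi>_def)
  interpret frame_at X V \<phi> x by (rule frame_atI[OF t])
  note o = triv_open[OF t(1)]
  let ?L = "gram X \<phi>" and ?\<theta> = "conn_mat \<phi> N x v" and ?\<theta>I = "conn_mat \<phi> N x (cI v)"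
  interpret s: skew_deformation "?L x" mul_i "b x"
    unfolding b_def by (rule skew_deformation_frame[OF B_alt[OF B]])
  have bsm: "smooth_fun (charts X) V b" unfolding b_def by (rule form_end_smooth[OF B t(1)])
  have Bsm: "smooth_fun (charts X) V (B_frame \<phi> a c)" for a c by (rule B_smooth[OF B t(1)])
  note Lsm = gram_smooth[OF t(1)]
  have Re_B: "Re (dfun (charts X) (B_frame \<phi> a c) x w) =
      ?L x (conn_mat \<phi> N x w (b x a)) \<bullet> c + ?L x (b x a) \<bullet> conn_mat \<phi> N x w c + ?L x (dfun (charts X) b x w a) \<bullet> c"
    if w: "w \<in> tangent_space (charts X) UNIV x" for a c w
  proof -
    have Ld: "dfun (charts X) ?L x w p \<bullet> c = ?L x (conn_mat \<phi> N x w p) \<bullet> c + ?L x p \<bullet> conn_mat \<phi> N x w c" for p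
    proof -
      have l: "bounded_linear (\<lambda>L. blinfun_apply L p \<bullet> c :: real)"
        by (intro bounded_linear_compose[OF bounded_linear_inner_left] blinfun.bounded_linear_left)
      have "dfun (charts X) (\<lambda>y. ?L y p \<bullet> c) x w = dfun (charts X) (\<lambda>y. metric X y (\<phi> y p) (\<phi> y c)) x w"
        by (rule dfun_cong[OF o smooth_fun_bounded_linear[OF o l Lsm] _ t(2) w])
          (rule frame_at.gram_inner[OF frame_atI[OF t(1)]])
      then show ?thesis
        using chern_metric[OF chern] t w unfolding metric_in_frames_def
        by (simp add: dfun_bounded_linear[OF l o Lsm t(2) w])
    qed
    have la: "bounded_linear (\<lambda>b. blinfun_apply b a)" by (rule blinfun.bounded_linear_left)
    have bsma: "smooth_fun (charts X) V (\<lambda>y. b y a)" by (rule smooth_fun_bounded_linear[OF o la bsm])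
    have Lb: "smooth_fun (charts X) V (\<lambda>y. ?L y (b y a))"
      by (rule smooth_fun_bilinear[OF bounded_bilinear_blinfun_apply o Lsm bsma])
    have "Re (dfun (charts X) (B_frame \<phi> a c) x w) = dfun (charts X) (\<lambda>y. Re (B_frame \<phi> a c y)) x w"
      by (simp add: dfun_bounded_linear[OF bounded_linear_Re o Bsm t(2) w])
    also have "\<dots> = dfun (charts X) (\<lambda>y. ?L y (b y a) \<bullet> c) x w"
    proof (rule dfun_cong[OF o smooth_fun_bounded_linear[OF o bounded_linear_Re Bsm] _ t(2) w])
      fix y assume "y \<in> V"
      then interpret y: frame_at X V \<phi> y by (rule frame_atI[OF t(1)])
      show "Re (B_frame \<phi> a c y) = ?L y (b y a) \<bullet> c"
        by (simp add: b_def y.form_end_inner[OF B_alt[OF B]])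
    qed
    also have "\<dots> = dfun (charts X) (\<lambda>y. ?L y (b y a)) x w \<bullet> c"
      by (rule dfun_bounded_linear[OF bounded_linear_inner_left o Lb t(2) w])
    also have "dfun (charts X) (\<lambda>y. ?L y (b y a)) x w = ?L x (dfun (charts X) b x w a) + dfun (charts X) ?L x w (b x a)"
      by (simp add: dfun_bilinear[OF bounded_bilinear_blinfun_apply o Lsm bsma t(2) w]
          dfun_bounded_linear[OF la o bsm t(2) w])
    finally show ?thesis by (simp add: inner_add_left Ld)
  qed
  have Im_B: "Im (dfun (charts X) (B_frame \<phi> a c) x w) = - Re (dfun (charts X) (B_frame \<phi> (\<i> *s a) c) x w)"
    if w: "w \<in> tangent_space (charts X) UNIV x" for a c w
  proof -
    have "dfun (charts X) (B_frame \<phi> (\<i> *s a) c) x w = dfun (charts X) (\<lambda>y. \<i> * B_frame \<phi> a c y) x w"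
    proof (rule dfun_cong[OF o Bsm _ t(2) w])
      fix y assume "y \<in> V"
      then interpret y: frame_at X V \<phi> y by (rule frame_atI[OF t(1)])
      show "B_frame \<phi> (\<i> *s a) c y = \<i> * B_frame \<phi> a c y"
        by (simp add: y.f_i y.bh_cstr[OF B_alt[OF B]])
    qed
    also have "\<dots> = \<i> * dfun (charts X) (B_frame \<phi> a c) x w"
      by (rule dfun_bounded_linear[OF bounded_linear_mult_right o Bsm t(2) w])
    finally show ?thesis by simp
  qed
  note w = v cI_tangent[OF v]
  have \<theta>I: "?\<theta>I c = \<i> *s ?\<theta> c" for c
    using chern_holo[OF chern] v unfolding holo_in_frames_def \<phi>_def by simp
  have \<theta>i: "?\<theta> (\<i> *s c) = \<i> *s ?\<theta> c" for c by (rule chern_cstr[OF chern t v])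
  have dbI: "dfun (charts X) b x (cI v) (\<i> *s c) = - (\<i> *s dfun (charts X) b x (cI v) c)" for c
    using arg_cong[OF form_end_deriv_anti[OF t w(2)], of "\<lambda>F. blinfun_apply F c"]
    by (simp add: b_def uminus_blinfun.rep_eq)
  have bi: "b x (\<i> *s c) = - (\<i> *s b x c)" for c using s.pointwise(2)[of c] by simp
  have Jsk: "?L x (\<i> *s p) \<bullet> (\<i> *s q) = ?L x p \<bullet> q" for p q using s.J_iso[of p q] by simp
  show ?thesis
  proof (rule blinfun_eqI, rule gram_eqI)
    fix a c
    have "?L x (form_end X \<phi> x (dbar_L2 X B x v) a) \<bullet> c = Re (dbar_fun (charts X) (B_frame \<phi> a c) x v)"
      unfolding form_end_inner[OF dbar_L2_alt[OF v]] unfolding \<phi>_def dbar_L2_frame ..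
    also have "\<dots> = (Re (dfun (charts X) (B_frame \<phi> a c) x v) + Re (dfun (charts X) (B_frame \<phi> (\<i> *s a) c) x (cI v))) / 2"
      by (simp add: dbar_fun_def Im_B[OF w(2)])
    also have "\<dots> = (2 * (?L x (?\<theta> (b x a)) \<bullet> c) + ?L x (dfun (charts X) b x v a) \<bullet> c
        - ?L x (\<i> *s dfun (charts X) b x (cI v) a) \<bullet> c) / 2"
      unfolding Re_B[OF w(1)] Re_B[OF w(2)] \<theta>I bi dbI
      by (simp add: blinfun.minus_right \<theta>i inner_minus_left Jsk ii)
    finally show "?L x ((2 *\<^sub>R form_end X \<phi> x (dbar_L2 X B x v)) a) \<bullet> c =
        ?L x ((2 *\<^sub>R (?\<theta> o\<^sub>L b x) + dfun (charts X) b x v - (mul_i o\<^sub>L dfun (charts X) b x (cI v))) a) \<bullet> c"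
      by (simp add: blinfun.add_left blinfun.diff_left blinfun.scaleR_left blinfun.add_right blinfun.diff_right
          blinfun.scaleR_right inner_add_left inner_diff_left)
  qed
qed

text \<open>The real form of the statement that \<open>exp(- g\<^sup>-\<^sup>1 B)\<close> carries the (0,1)-part of the first
  connection to that of the second.  The Chern connection is eliminated: \<open>\<theta>\<close> differs from its
  matrix by an antilinear one, so that \<open>\<theta> - J \<theta> J\<close> is twice that matrix.\<close>

lemma conn_mat_gauge:
  assumes chern: "chern_connection X N_Ch" and v: "v \<in> tangent_space (charts X) UNIV x"
    and N: "connection X N" "conn01_eq_plus X N N_Ch D"
    and N': "connection X N'" "conn01_eq_plus X N' N_Ch (\<lambda>x v a b. D x v a b + dbar_L2 X B x v a b)"
    and alt: "\<And>x v. v \<in> tangent_space (charts X) UNIV x \<Longrightarrow> alt_form10 X x (D x v)"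
    and alt': "\<And>x v. v \<in> tangent_space (charts X) UNIV x \<Longrightarrow> alt_form10 X x (\<lambda>a b. D x v a b + dbar_L2 X B x v a b)"
  defines "\<phi> \<equiv> triv_at X x"
  defines "b \<equiv> \<lambda>y. form_end X \<phi> y (B y)"
  defines "\<theta> \<equiv> conn_mat \<phi> N x v"
  shows "conn_mat \<phi> N' x v = \<theta> + dfun (charts X) b x v - (mul_i o\<^sub>L dfun (charts X) b x (cI v)) +
    ((\<theta> - (mul_i o\<^sub>L (\<theta> o\<^sub>L mul_i))) o\<^sub>L b x)"
proof -
  define V where "V = dom_at X x"
  have t: "(V, \<phi>) \<in> trivs X" "x \<in> V" using triv_at by (auto simp: V_def \<phi>_def)
  interpret frame_at X V \<phi> x by (rule frame_atI[OF t])
  let ?d = "form_end X \<phi> x (D x v)" and ?\<theta>C = "conn_mat \<phi> N_Ch x v"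
  interpret sd: skew_deformation "gram X \<phi> x" mul_i ?d by (rule skew_deformation_frame[OF alt[OF v]])
  have 1: "\<theta> = ?\<theta>C + 2 *\<^sub>R ?d" unfolding \<theta>_def
    by (rule eq_plus_frame(1)[OF N(1) chern_conn[OF chern] N(2) alt[OF v] t v])
  have 2: "conn_mat \<phi> N' x v = ?\<theta>C + 2 *\<^sub>R form_end X \<phi> x (\<lambda>a b. D x v a b + dbar_L2 X B x v a b)"
    by (rule eq_plus_frame(1)[OF N'(1) chern_conn[OF chern] N'(2) alt'[OF v] t v])
  have 3: "form_end X \<phi> x (\<lambda>a b. D x v a b + dbar_L2 X B x v a b) = ?d + form_end X \<phi> x (dbar_L2 X B x v)"
  proof (rule blinfun_eqI, rule gram_eqI)
    fix a c
    show "gram X \<phi> x (form_end X \<phi> x (\<lambda>a b. D x v a b + dbar_L2 X B x v a b) a) \<bullet> c =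
        gram X \<phi> x ((?d + form_end X \<phi> x (dbar_L2 X B x v)) a) \<bullet> c"
      by (simp add: form_end_inner[OF alt'[OF v]] form_end_inner[OF alt[OF v]] form_end_inner[OF dbar_L2_alt[OF v]]
          blinfun.add_left blinfun.add_right inner_add_left)
  qed
  have 4: "\<theta> - (mul_i o\<^sub>L (\<theta> o\<^sub>L mul_i)) = 2 *\<^sub>R ?\<theta>C"
  proof (rule blinfun_eqI)
    fix a
    have "?\<theta>C (\<i> *s a) = \<i> *s ?\<theta>C a" by (rule chern_cstr[OF chern t v])
    moreover have "?d (\<i> *s a) = - (\<i> *s ?d a)" using sd.pointwise(2)[of a] by simp
    ultimately show "(\<theta> - (mul_i o\<^sub>L (\<theta> o\<^sub>L mul_i))) a = (2 *\<^sub>R ?\<theta>C) a"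
      unfolding 1 by (simp add: blinfun.add_left blinfun.diff_left blinfun.scaleR_left vec_eq_iff algebra_simps scaleR_conv_of_real)
  qed
  show ?thesis
    unfolding 2 3 4 using dbar_L2_form_end[OF chern v]
    by (simp add: \<phi>_def[symmetric] b_def 1 scaleR_add_right blinfun_compose_simps)
qed

end

lemma alt_form_add:
  assumes "alt_form10 X x \<beta>" "alt_form10 X x \<beta>'"
  shows "alt_form10 X x (\<lambda>a b. \<beta> a b + \<beta>' a b)"
  unfolding alt_form10_def
proof (intro ballI allI)
  fix u v w z assume uvw: "u \<in> E10 X x" "v \<in> E10 X x" "w \<in> E10 X x"
  have "\<beta> (cmul z u + v) w = z * \<beta> u w + \<beta> v w \<and> \<beta> u v = - \<beta> v u"
    "\<beta>' (cmul z u + v) w = z * \<beta>' u w + \<beta>' v w \<and> \<beta>' u v = - \<beta>' v u"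
    using assms uvw unfolding alt_form10_def by blast+
  then show "\<beta> (cmul z u + v) w + \<beta>' (cmul z u + v) w = z * (\<beta> u w + \<beta>' u w) + (\<beta> v w + \<beta>' v w) \<and>
      \<beta> u v + \<beta>' u v = - (\<beta> v u + \<beta>' v u)"
    by (simp add: distrib_left)
qed

lemma section_form01_alt:
  assumes "section_form01_L2 X D" "v \<in> tangent_space (charts X) UNIV x"
  shows "alt_form10 X x (D x v)"
  by (rule conjunct1[OF bspec[OF bspec[OF spec[OF conjunct1[OF assms(1)[unfolded section_form01_L2_def]]] assms(2)] assms(2)]])

end

section \<open>The endomorphism bundle\<close>

lemma open_blinfun_invertible: "open {f :: 'a::euclidean_space \<Rightarrow>\<^sub>L 'a. blinfun_invertible f}"
  unfolding open_dist
proof (intro ballI)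
  fix f :: "'a \<Rightarrow>\<^sub>L 'a" assume "f \<in> {f. blinfun_invertible f}"
  then have f: "blinfun_invertible f" by simp
  define C where "C = norm (blinfun_inv f) + 1"
  have C: "C > 0" unfolding C_def by (simp add: add_nonneg_pos)
  have "blinfun_invertible h" if h: "dist h f < 1 / C" for h
  proof (rule blinfun_invertibleI, rule ccontr)
    fix x assume x: "blinfun_apply h x = 0" "x \<noteq> 0"
    have "x = blinfun_inv f (f x)" by (simp add: blinfun_inv_apply[OF f])
    also have "f x = (f - h) x" using x by (simp add: blinfun.diff_left)
    finally have "norm x \<le> norm (blinfun_inv f) * norm ((f - h) x)" by (metis norm_blinfun)
    also have "\<dots> \<le> C * (norm (f - h) * norm x)"
      unfolding C_def by (intro mult_mono norm_blinfun) (auto simp: add_nonneg_nonneg)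
    also have "\<dots> < C * (1 / C * norm x)"
      using h C x(2) by (intro mult_strict_left_mono mult_strict_right_mono) (auto simp: dist_norm norm_minus_commute)
    finally show False using C by simp
  qed
  then show "\<exists>e>0. \<forall>h. dist h f < e \<longrightarrow> h \<in> {f. blinfun_invertible f}"
    using C by (intro exI[of _ "1 / C"]) auto
qed

definition end_chart :: "('m, 'v::real_normed_vector, 'n::finite, 'r::finite) herm_bundle \<Rightarrow>
    ('m, complex^'n) chart \<Rightarrow> 'm set \<times> ('m \<Rightarrow> complex^'r \<Rightarrow> 'v) \<Rightarrow>
    ('m \<times> ('v \<Rightarrow> 'v), (complex^'n) \<times> ((complex^'r) \<Rightarrow>\<^sub>L (complex^'r))) chart" where
  "end_chart X c T = ((SIGMA x:fst c \<inter> fst T. End_fibre X x), (\<lambda>(x, K). (snd c x, to_frame (snd T) x K)))"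

lemma End_charts_end_chart: "End_charts X = {end_chart X c T | c T. c \<in> charts X \<and> T \<in> trivs X}"
  unfolding End_charts_def end_chart_def to_frame_def by (auto; metis fst_conv snd_conv)

lemma end_chart_mem [simp]: "(x, K) \<in> fst (end_chart X c T) \<longleftrightarrow> x \<in> fst c \<and> x \<in> fst T \<and> K \<in> End_fibre X x"
  by (auto simp: end_chart_def)

lemma end_chart_snd [simp]: "snd (end_chart X c T) (x, K) = (snd c x, to_frame (snd T) x K)"
  by (simp add: end_chart_def)

definition trans_mat :: "('m \<Rightarrow> complex^'r \<Rightarrow> 'v) \<Rightarrow> ('m \<Rightarrow> complex^'r \<Rightarrow> 'v) \<Rightarrow> 'm \<Rightarrow> (complex^'r) \<Rightarrow>\<^sub>L (complex^'r)" where
  "trans_mat \<phi> \<phi>' y = Blinfun (\<lambda>a. inv (\<phi>' y) (\<phi> y a))"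

lemma fin_dim_end_chart: "fin_dim TYPE((complex^'n) \<times> ((complex^'r) \<Rightarrow>\<^sub>L (complex^'r)))"
  by (rule fin_dim_prod[OF fin_dim_euclidean fin_dim_blinfun])

context herm_hol_bundle
begin

abbreviation "EC \<equiv> End_charts X"
abbreviation "ET \<equiv> End_total X"
abbreviation "TW \<equiv> twistor_space X"

lemma trans_mat_apply:
  assumes "frame_at X V \<phi> y" "frame_at X V' \<phi>' y"
  shows "\<phi>' y (trans_mat \<phi> \<phi>' y a) = \<phi> y a"
proof -
  interpret g: frame_at X V \<phi> y by fact
  interpret g': frame_at X V' \<phi>' y by fact
  have "linear (\<lambda>a. inv (\<phi>' y) (\<phi> y a))"
    by (rule linearI; subst g'.f_eq[symmetric]) (simp_all add: g.f.add g.f.scale g'.f.add g'.f.scale)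
  then show ?thesis by (simp add: trans_mat_def Blinfun_apply_linear)
qed

lemma trans_mat_smooth:
  assumes "(V, \<phi>) \<in> trivs X" "(V', \<phi>') \<in> trivs X"
  shows "smooth_fun (charts X) (V \<inter> V') (trans_mat \<phi> \<phi>')"
proof (rule smooth_fun_blinfunI)
  show o: "open (V \<inter> V')" using assms triv_open by auto
  fix a
  show "smooth_fun (charts X) (V \<inter> V') (\<lambda>y. trans_mat \<phi> \<phi>' y a)"
  proof (rule smooth_fun_cong[OF o triv_transition_smooth[OF assms, of a]])
    fix y assume y: "y \<in> V \<inter> V'"
    interpret g': frame_at X V' \<phi>' y by (rule frame_atI[OF assms(2)]) (use y in auto)
    show "inv (\<phi>' y) (\<phi> y a) = trans_mat \<phi> \<phi>' y a"
      using trans_mat_apply[OF frame_atI[OF assms(1)] g'.frame_at_axioms, of a] y by (metis IntD1 g'.fi_f)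
  qed
qed

lemma to_frame_trans:
  assumes g: "frame_at X V \<phi> y" and g': "frame_at X V' \<phi>' y" and K: "K \<in> End_fibre X y"
  shows "to_frame \<phi>' y K = trans_mat \<phi> \<phi>' y o\<^sub>L (to_frame \<phi> y K o\<^sub>L trans_mat \<phi>' \<phi> y)"
proof (rule blinfun_eqI)
  fix a
  interpret g: frame_at X V \<phi> y by fact
  interpret g': frame_at X V' \<phi>' y by fact
  have "\<phi>' y (to_frame \<phi>' y K a) = \<phi>' y ((trans_mat \<phi> \<phi>' y o\<^sub>L (to_frame \<phi> y K o\<^sub>L trans_mat \<phi>' \<phi> y)) a)"
    by (simp add: g'.f_to_frame[OF K] trans_mat_apply[OF g g'] g.f_to_frame[OF K] trans_mat_apply[OF g' g])
  then show "to_frame \<phi>' y K a = (trans_mat \<phi> \<phi>' y o\<^sub>L (to_frame \<phi> y K o\<^sub>L trans_mat \<phi>' \<phi> y)) a" by simp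
qed

lemma smooth_fun_fst:
  assumes c: "c \<in> charts X" and h: "smooth_fun (charts X) W0 h" and W: "open W"
    and sub: "fst ` W \<subseteq> snd c ` (fst c \<inter> W0)"
  shows "smooth_on W (\<lambda>p. h (inv_into (fst c) (snd c) (fst p)))"
  using smooth_on_compose_euclidean[OF W smooth_on_linear[OF W bounded_linear_fst] smooth_funD[OF h c] sub]
  by (simp add: o_def)

text \<open>Source and target may be described by the same chart and trivialization, since passing to
  another pair conjugates by the transition matrices, which depend smoothly on the base point.\<close>

lemma fibre_map_smooth:
  assumes S: "S \<subseteq> ET" and \<Psi>: "\<Psi> ` S \<subseteq> S'" "S' \<subseteq> ET" "\<And>p. p \<in> S \<Longrightarrow> fst (\<Psi> p) = fst p"
    and loc: "\<And>c V \<phi> p. c \<in> charts X \<Longrightarrow> (V, \<phi>) \<in> trivs X \<Longrightarrow> p \<in> S \<Longrightarrow> fst p \<in> fst c \<inter> V \<Longrightarrow>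
      \<exists>W F. open W \<and> (snd c (fst p), to_frame \<phi> (fst p) (snd p)) \<in> W \<and> smooth_on W F \<and>
        (\<forall>y K. (y, K) \<in> S \<longrightarrow> y \<in> fst c \<inter> V \<longrightarrow> (snd c y, to_frame \<phi> y K) \<in> W \<longrightarrow>
          to_frame \<phi> y (snd (\<Psi> (y, K))) = F (snd c y, to_frame \<phi> y K))"
  shows "smooth_map EC S EC S' \<Psi>"
proof (rule smooth_mapI[OF \<Psi>(1)])
  fix p d d' assume p: "p \<in> S" and d: "d \<in> EC" "d' \<in> EC" and pd: "p \<in> fst d" "\<Psi> p \<in> fst d'"
  obtain c V \<phi> where c: "c \<in> charts X" and t: "(V, \<phi>) \<in> trivs X" and dd: "d = end_chart X c (V, \<phi>)"
    using d(1) unfolding End_charts_end_chart by auto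
  obtain c' V' \<phi>' where c': "c' \<in> charts X" and t': "(V', \<phi>') \<in> trivs X" and dd': "d' = end_chart X c' (V', \<phi>')"
    using d(2) unfolding End_charts_end_chart by auto
  obtain x K where xK: "p = (x, K)" by (cases p)
  obtain K' where K': "\<Psi> p = (x, K')" using \<Psi>(3)[OF p] xK by (metis fst_conv prod.collapse)
  have x: "x \<in> fst c" "x \<in> V" "x \<in> fst c'" "x \<in> V'" using pd K'[unfolded xK] by (auto simp: dd dd' xK)
  obtain W F where W: "open W" "(snd c x, to_frame \<phi> x K) \<in> W" "smooth_on W F"
    "\<And>y K. (y, K) \<in> S \<Longrightarrow> y \<in> fst c \<inter> V \<Longrightarrow> (snd c y, to_frame \<phi> y K) \<in> W \<Longrightarrow>
      to_frame \<phi> y (snd (\<Psi> (y, K))) = F (snd c y, to_frame \<phi> y K)"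
    using loc[OF c t p] x unfolding xK by auto
  let ?O = "fst c' \<inter> (V \<inter> V')"
  let ?W = "W \<inter> fst -` (snd c ` (fst c \<inter> ?O))"
  let ?y = "\<lambda>q. inv_into (fst c) (snd c) (fst q)"
  let ?F = "\<lambda>q. (snd c' (?y q), trans_mat \<phi> \<phi>' (?y q) o\<^sub>L (F q o\<^sub>L trans_mat \<phi>' \<phi> (?y q)))"
  have oO: "open ?O" using triv_open[OF t] triv_open[OF t'] chart_props(1)[OF c'] by auto
  have oW: "open ?W"
    by (rule open_Int[OF W(1) open_vimage[OF chart_image_open[OF c oO] continuous_on_fst[OF continuous_on_id]]])
  have smO: "smooth_fun (charts X) ?O (trans_mat \<phi> \<phi>')" "smooth_fun (charts X) ?O (trans_mat \<phi>' \<phi>)"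
    by (rule smooth_fun_subset[OF trans_mat_smooth[OF t t']], blast,
        rule smooth_fun_subset[OF trans_mat_smooth[OF t' t]], blast)
  have sub: "fst ` ?W \<subseteq> snd c ` (fst c \<inter> ?O)" by auto
  have s1: "smooth_on ?W (\<lambda>q. snd c' (?y q))"
    using smooth_on_compose_euclidean[OF oW smooth_on_linear[OF oW bounded_linear_fst] chart_transition_smooth[OF c c']]
      sub by (auto simp: o_def)
  have sF: "smooth_on ?W ?F"
    by (intro smooth_on_Pair[OF oW] s1 smooth_on_blinfun_compose[OF oW] smooth_on_subset[OF W(3)]
        smooth_fun_fst[OF c smO(1) oW sub] smooth_fun_fst[OF c smO(2) oW sub]) auto
  show "\<exists>W F. open W \<and> snd d p \<in> W \<and> smooth_on W F \<and>
        (\<forall>q\<in>S \<inter> fst d. snd d q \<in> W \<longrightarrow> \<Psi> q \<in> fst d' \<and> snd d' (\<Psi> q) = F (snd d q))"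
  proof (rule exI[of _ ?W], rule exI[of _ ?F], intro conjI oW sF ballI impI)
    show "snd d p \<in> ?W" using W(2) x by (simp add: dd xK)
    fix q assume q: "q \<in> S \<inter> fst d" "snd d q \<in> ?W"
    obtain y L where yL: "q = (y, L)" by (cases q)
    obtain L' where L': "\<Psi> q = (y, L')" using \<Psi>(3)[of q] q yL by (metis IntD1 fst_conv prod.collapse)
    have y: "y \<in> fst c" "y \<in> V" "(snd c y, to_frame \<phi> y L) \<in> W" "snd c y \<in> snd c ` (fst c \<inter> ?O)"
      using q by (auto simp: yL dd)
    have yO: "y \<in> ?O" using y(1,4) chart_inj[OF c] by (auto dest: inj_onD)
    have "(y, L') \<in> ET" using \<Psi>(1,2) q L' by (metis IntD1 image_subset_iff subsetD)
    then have L'E: "L' \<in> End_fibre X y" by (simp add: End_total_def)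
    have "to_frame \<phi> y L' = F (snd c y, to_frame \<phi> y L)" using W(4)[of y L] q y(1-3) L' yL by simp
    then have "to_frame \<phi>' y L' = trans_mat \<phi> \<phi>' y o\<^sub>L (F (snd c y, to_frame \<phi> y L) o\<^sub>L trans_mat \<phi>' \<phi> y)"
      using to_frame_trans[OF frame_atI[OF t] frame_atI[OF t'] L'E] y(2) yO by simp
    then show "\<Psi> q \<in> fst d'" "snd d' (\<Psi> q) = ?F (snd d q)"
      using yO L'E y(1) chart_inv[OF c y(1)] by (auto simp: L'[unfolded yL] yL dd dd')
  qed
qed

lemma atlas_on_ET: "atlas_on EC ET"
  unfolding atlas_on_def
proof (intro conjI ballI)
  show "\<exists>d\<in>EC. p \<in> fst d" if "p \<in> ET" for p
  proof -
    obtain x K where p: "p = (x, K)" "K \<in> End_fibre X x" using \<open>p \<in> ET\<close> unfolding End_total_def by (rule SigmaE)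
    have "p \<in> fst (end_chart X (chart_at (charts X) x) (dom_at X x, triv_at X x))"
      using chart_at triv_at p by simp
    then show ?thesis using chart_at(1) triv_at(1) unfolding End_charts_end_chart by blast
  qed
  show "smooth_map EC ET EC ET (\<lambda>p. p)"
  proof (rule fibre_map_smooth)
    fix c V \<phi> p assume "c \<in> charts X" "(V, \<phi>) \<in> trivs X" "p \<in> ET" "fst p \<in> fst c \<inter> V"
    show "\<exists>W F. open W \<and> (snd c (fst p), to_frame \<phi> (fst p) (snd p)) \<in> W \<and> smooth_on W F \<and>
        (\<forall>y K. (y, K) \<in> ET \<longrightarrow> y \<in> fst c \<inter> V \<longrightarrow> (snd c y, to_frame \<phi> y K) \<in> W \<longrightarrow>
          to_frame \<phi> y (snd (y, K)) = F (snd c y, to_frame \<phi> y K))"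
      by (rule exI[of _ UNIV], rule exI[of _ snd]) (simp add: smooth_on_linear bounded_linear_snd)
  qed auto
qed

lemma TW_ET: "TW \<subseteq> ET"
  by (auto simp: twistor_space_def End_total_def)

lemma atlas_on_TW: "atlas_on EC TW"
  by (rule atlas_on_subset[OF atlas_on_ET TW_ET])

lemma fst_smooth: "smooth_map EC ET (charts X) UNIV fst"
proof (rule smooth_mapI)
  fix p d c' assume p: "p \<in> ET" and d: "d \<in> EC" and c': "c' \<in> charts X" and pd: "p \<in> fst d" "fst p \<in> fst c'"
  obtain c V \<phi> where c: "c \<in> charts X" and t: "(V, \<phi>) \<in> trivs X" and dd: "d = end_chart X c (V, \<phi>)"
    using d(1) unfolding End_charts_end_chart by auto
  let ?W = "fst -` (snd c ` (fst c \<inter> fst c')) :: ((complex^'n) \<times> ((complex^'r) \<Rightarrow>\<^sub>L (complex^'r))) set"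
  have oW: "open ?W"
    using open_vimage[OF chart_image_open[OF c chart_props(1)[OF c']] continuous_on_fst[OF continuous_on_id]] .
  have s1: "smooth_on ?W (\<lambda>q. (snd c' \<circ> inv_into (fst c) (snd c)) (fst q))"
    by (rule smooth_on_compose_euclidean[OF oW smooth_on_linear[OF oW bounded_linear_fst] chart_transition_smooth[OF c c']]) auto
  show "\<exists>W F. open W \<and> snd d p \<in> W \<and> smooth_on W F \<and>
        (\<forall>q\<in>ET \<inter> fst d. snd d q \<in> W \<longrightarrow> fst q \<in> fst c' \<and> snd c' (fst q) = F (snd d q))"
  proof (rule exI[of _ ?W], rule exI[of _ "\<lambda>q. (snd c' \<circ> inv_into (fst c) (snd c)) (fst q)"], intro conjI oW s1 ballI impI)
    show "snd d p \<in> ?W" using pd by (cases p) (auto simp: dd)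
    fix q assume q: "q \<in> ET \<inter> fst d" "snd d q \<in> ?W"
    obtain y L where yL: "q = (y, L)" by (cases q)
    have y: "y \<in> fst c" "snd c y \<in> snd c ` (fst c \<inter> fst c')" using q by (auto simp: yL dd)
    then show "fst q \<in> fst c'" using chart_inj[OF c] by (auto dest: inj_onD simp: yL)
    show "snd c' (fst q) = (snd c' \<circ> inv_into (fst c) (snd c)) (fst (snd d q))"
      using chart_inv[OF c y(1)] by (simp add: yL dd)
  qed
qed simp

lemma fst_curve:
  assumes "smooth_curve EC ET \<epsilon> \<Gamma>"
  shows "smooth_curve (charts X) UNIV \<epsilon> (fst \<circ> \<Gamma>)"
  by (rule smooth_map_curve[OF fin_dim_end_chart fst_smooth _ assms])
    (use atlas_on_ET in \<open>auto simp: atlas_on_def\<close>)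

lemma end_chart_curve:
  assumes t: "(V, \<phi>) \<in> trivs X" and \<gamma>: "smooth_curve (charts X) UNIV \<epsilon> \<gamma>" "\<And>t. \<bar>t\<bar> < \<epsilon> \<Longrightarrow> \<gamma> t \<in> V"
    and k: "smooth_on {-\<epsilon><..<\<epsilon>} k"
  shows "smooth_curve EC ET \<epsilon> (\<lambda>t. (\<gamma> t, of_frame X \<phi> (\<gamma> t) (k t)))"
proof (rule smooth_curveI)
  let ?\<Gamma> = "\<lambda>t. (\<gamma> t, of_frame X \<phi> (\<gamma> t) (k t))"
  have E: "of_frame X \<phi> (\<gamma> t) (k t) \<in> End_fibre X (\<gamma> t)" if "\<bar>t\<bar> < \<epsilon>" for t
    by (rule frame_at.of_frame_End[OF frame_atI[OF t \<gamma>(2)[OF that]]])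
  then show "?\<Gamma> t \<in> ET" if "\<bar>t\<bar> < \<epsilon>" for t using that by (simp add: End_total_def)
  fix s d' assume s: "\<bar>s\<bar> < \<epsilon>" and d': "d' \<in> EC" "?\<Gamma> s \<in> fst d'"
  obtain c where c: "c \<in> charts X" "\<gamma> s \<in> fst c" using chart_covers by blast
  obtain \<delta> where \<delta>: "\<delta> > 0" "\<bar>s\<bar> + \<delta> \<le> \<epsilon>" "\<gamma> ` ball s \<delta> \<subseteq> fst c" "smooth_on (ball s \<delta>) (snd c \<circ> \<gamma>)"
    by (rule smooth_curveE[OF \<gamma>(1) s c])
  have r: "\<bar>r\<bar> < \<epsilon>" if "r \<in> ball s \<delta>" for r using that \<delta>(2) by (auto simp: dist_real_def)
  let ?d = "end_chart X c (V, \<phi>)"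
  have d: "?d \<in> EC" using c t unfolding End_charts_end_chart by blast
  have sk: "smooth_on (ball s \<delta>) k" by (rule smooth_on_subset[OF k]) (use r in force)
  have "smooth_on (ball s \<delta>) (\<lambda>r. ((snd c \<circ> \<gamma>) r, k r))" by (rule smooth_on_Pair[OF open_ball \<delta>(4) sk])
  then have sm: "smooth_on (ball s \<delta>) (snd ?d \<circ> ?\<Gamma>)"
  proof (rule smooth_on_cong[OF open_ball])
    fix q assume "q \<in> ball s \<delta>"
    then show "((snd c \<circ> \<gamma>) q, k q) = (snd ?d \<circ> ?\<Gamma>) q"
      using frame_at.to_frame_of_frame[OF frame_atI[OF t \<gamma>(2)[OF r]]] by simp
  qed
  have sub: "?\<Gamma> ` ball s \<delta> \<subseteq> fst ?d" "?\<Gamma> ` ball s \<delta> \<subseteq> ET"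
    using \<delta>(3) r E \<gamma>(2) by (auto simp: End_total_def)
  obtain \<delta>' where "\<delta>' > 0" "((\<lambda>p. p) \<circ> ?\<Gamma>) ` ball s \<delta>' \<subseteq> fst d'"
      "smooth_on (ball s \<delta>') (snd d' \<circ> ((\<lambda>p. p) \<circ> ?\<Gamma>))"
    by (rule curve_through_smooth_map[OF fin_dim_end_chart conjunct2[OF atlas_on_ET[unfolded atlas_on_def]] \<delta>(1) sub sm d d'])
  then show "\<exists>\<delta>>0. ?\<Gamma> ` ball s \<delta> \<subseteq> fst d' \<and> smooth_on (ball s \<delta>) (snd d' \<circ> ?\<Gamma>)"
    by (auto simp: o_def)
qed

lemma end_curve_velocity:
  assumes \<Gamma>: "smooth_curve EC ET \<epsilon> \<Gamma>" "\<epsilon> > 0" and c: "c \<in> charts X" "fst (\<Gamma> 0) \<in> fst c"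
    and t: "(V, \<phi>) \<in> trivs X" "fst (\<Gamma> 0) \<in> V"
  shows "((\<lambda>t. to_frame \<phi> (fst (\<Gamma> t)) (snd (\<Gamma> t))) has_vector_derivative
      snd (velocity EC \<Gamma> 0 (end_chart X c (V, \<phi>)))) (at 0)"
    "fst (velocity EC \<Gamma> 0 (end_chart X c (V, \<phi>))) = velocity (charts X) (fst \<circ> \<Gamma>) 0 c"
proof -
  let ?d = "end_chart X c (V, \<phi>)"
  have d: "?d \<in> EC" using c t unfolding End_charts_end_chart by blast
  have "\<Gamma> 0 \<in> ET" using smooth_curve_mem[OF \<Gamma>(1)] \<Gamma>(2) by simp
  then have \<Gamma>0: "\<Gamma> 0 \<in> fst ?d" using c t by (cases "\<Gamma> 0") (simp add: End_total_def)
  have v: "((snd ?d \<circ> \<Gamma>) has_vector_derivative velocity EC \<Gamma> 0 ?d) (at 0)"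
    using smooth_curve_has_velocity[OF \<Gamma>(1) _ d \<Gamma>0] \<Gamma>(2) by simp
  show "((\<lambda>t. to_frame \<phi> (fst (\<Gamma> t)) (snd (\<Gamma> t))) has_vector_derivative snd (velocity EC \<Gamma> 0 ?d)) (at 0)"
    using bounded_linear.has_vector_derivative[OF bounded_linear_snd v]
    by (simp add: end_chart_def case_prod_beta o_def)
  have "((\<lambda>t. snd c (fst (\<Gamma> t))) has_vector_derivative fst (velocity EC \<Gamma> 0 ?d)) (at 0)"
    using bounded_linear.has_vector_derivative[OF bounded_linear_fst v]
    by (simp add: end_chart_def case_prod_beta o_def)
  then show "fst (velocity EC \<Gamma> 0 ?d) = velocity (charts X) (fst \<circ> \<Gamma>) 0 c"
    using c by (simp add: velocity_def vector_derivative_at o_def)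
qed

definition deform_map :: "('m \<Rightarrow> 'v bform) \<Rightarrow> 'm \<times> ('v \<Rightarrow> 'v) \<Rightarrow> 'm \<times> ('v \<Rightarrow> 'v)" where
  "deform_map B = induced_map X (\<lambda>x. endo_exp (\<lambda>u. - g_inv X x (B x) u))"

context
  fixes B assumes B: "section_L2 X B"
begin

lemma deform_map_frame:
  assumes p: "(x, K) \<in> TW" and g: "frame_at X V \<phi> x"
  shows "deform_map B (x, K) = (x, of_frame X \<phi> x (deform mul_i (form_end X \<phi> x (B x)) (to_frame \<phi> x K)))"
  unfolding deform_map_def induced_map_def case_prod_conv
  by (intro arg_cong2[of _ _ _ _ Pair] refl the_equality)
    (simp_all only: frame_at.corresponds_iff[where B = B, OF g p B_alt[OF B]])

lemma deform_map_TW: "p \<in> TW \<Longrightarrow> deform_map B p \<in> TW"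
proof -
  assume "p \<in> TW"
  then obtain x K where p: "p = (x, K)" "(x, K) \<in> TW" by (cases p) auto
  interpret frame_at X "dom_at X x" "triv_at X x" x by (rule frame_at_triv_at)
  interpret s: skew_deformation "gram X (triv_at X x) x" mul_i "form_end X (triv_at X x) x (B x)"
    by (rule skew_deformation_frame[OF B_alt[OF B]])
  show ?thesis
    using p s.deform_orth_cstr by (simp add: deform_map_frame[OF p(2) frame_at_axioms] twistor_frame of_frame_End to_frame_of_frame)
qed

lemma fst_deform_map: "p \<in> TW \<Longrightarrow> fst (deform_map B p) = fst p"
  by (simp add: deform_map_def induced_map_def case_prod_beta)

lemma to_frame_deform_map:
  assumes p: "(x, K) \<in> TW" and g: "frame_at X V \<phi> x"
  shows "to_frame \<phi> x (snd (deform_map B (x, K))) = deform mul_i (form_end X \<phi> x (B x)) (to_frame \<phi> x K)"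
  by (simp add: deform_map_frame[OF assms] frame_at.to_frame_of_frame[OF g])

text \<open>In a frame the map is given by a formula in \<open>b\<close> and \<open>k\<close> that makes sense wherever
  \<open>twist mul_i b k\<close> is invertible, also for \<open>k\<close> outside the twistor space.  This is the local
  extension that smoothness on a submanifold asks for.\<close>

lemma deform_map_smooth: "smooth_map EC TW EC TW (deform_map B)"
proof (rule fibre_map_smooth[OF TW_ET _ TW_ET fst_deform_map])
  show "deform_map B ` TW \<subseteq> TW" using deform_map_TW by auto
  fix c V \<phi> p assume c: "c \<in> charts X" and t: "(V, \<phi>) \<in> trivs X" and p: "p \<in> TW" "fst p \<in> fst c \<inter> V"
  let ?b = "\<lambda>y. form_end X \<phi> y (B y)"
  let ?W0 = "fst -` (snd c ` (fst c \<inter> V)) :: ((complex^'n) \<times> ((complex^'r) \<Rightarrow>\<^sub>L (complex^'r))) set"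
  let ?b' = "\<lambda>q :: (complex^'n) \<times> ((complex^'r) \<Rightarrow>\<^sub>L (complex^'r)). ?b (inv_into (fst c) (snd c) (fst q))"
  let ?A = "\<lambda>q. twist mul_i (?b' q) (snd q)"
  define W where "W = ?W0 \<inter> ?A -` {f. blinfun_invertible f}"
  have oW0: "open ?W0"
    using open_vimage[OF chart_image_open[OF c triv_open[OF t]] continuous_on_fst[OF continuous_on_id]] .
  have sb: "smooth_on ?W0 ?b'" by (rule smooth_fun_fst[OF c form_end_smooth[OF B t] oW0]) auto
  have ss: "smooth_on ?W0 snd" by (rule smooth_on_linear[OF oW0 bounded_linear_snd])
  have sA: "smooth_on ?W0 ?A" unfolding twist_def
    by (intro smooth_on_add[OF oW0] smooth_on_diff[OF oW0] smooth_on_const[OF oW0] smooth_on_blinfun_compose[OF oW0] sb ss)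
  have oW: "open W" unfolding W_def
    by (rule continuous_open_preimage[OF smooth_on_continuous[OF sA] oW0 open_blinfun_invertible])
  have sF: "smooth_on W (\<lambda>q. deform mul_i (?b' q) (snd q))" unfolding deform_def
    by (intro smooth_on_blinfun_compose[OF oW] smooth_on_blinfun_inv[OF oW] smooth_on_subset[OF sA] smooth_on_subset[OF ss])
      (auto simp: W_def)
  obtain x K where xK: "p = (x, K)" by (cases p)
  show "\<exists>W F. open W \<and> (snd c (fst p), to_frame \<phi> (fst p) (snd p)) \<in> W \<and> smooth_on W F \<and>
        (\<forall>y K. (y, K) \<in> TW \<longrightarrow> y \<in> fst c \<inter> V \<longrightarrow> (snd c y, to_frame \<phi> y K) \<in> W \<longrightarrow>
          to_frame \<phi> y (snd (deform_map B (y, K))) = F (snd c y, to_frame \<phi> y K))"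
  proof (rule exI[of _ W], rule exI[of _ "\<lambda>q. deform mul_i (?b' q) (snd q)"], intro conjI oW sF allI impI)
    have xVc: "x \<in> V" "x \<in> fst c" using p xK by auto
    interpret frame_at X V \<phi> x by (rule frame_atI[OF t xVc(1)])
    interpret s: skew_deformation "gram X \<phi> x" mul_i "?b x" by (rule skew_deformation_frame[OF B_alt[OF B]])
    have "blinfun_invertible (twist mul_i (?b x) (to_frame \<phi> x K))"
      using s.twist_invertible p(1) xK by (simp add: twistor_frame)
    then show "(snd c (fst p), to_frame \<phi> (fst p) (snd p)) \<in> W"
      using imageI[of x "fst c \<inter> V" "snd c"] xVc chart_inv[OF c xVc(2)] by (simp add: W_def xK)
    fix y L assume y: "(y, L) \<in> TW" "y \<in> fst c \<inter> V"
    then show "to_frame \<phi> y (snd (deform_map B (y, L))) =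
        deform mul_i (?b' (snd c y, to_frame \<phi> y L)) (snd (snd c y, to_frame \<phi> y L))"
      using to_frame_deform_map[OF y(1) frame_atI[OF t]] chart_inv[OF c] by simp
  qed
qed auto

end

end

section \<open>Parallel transport of endomorphisms\<close>

context herm_hol_bundle
begin

lemma smooth_curve_const: "smooth_curve (charts X) UNIV \<epsilon> (\<lambda>t. x)"
proof (rule smooth_curveI)
  fix t :: real and c :: "('m, complex^'n) chart" assume "x \<in> fst c"
  then show "\<exists>\<delta>>0. (\<lambda>t. x) ` ball t \<delta> \<subseteq> fst c \<and> smooth_on (ball t \<delta>) (snd c \<circ> (\<lambda>t. x))"
    by (intro exI[of _ 1]) (auto simp: o_def smooth_on_const)
qed simp

lemma gram_deriv:
  assumes N: "metric_in_frames X N" and t: "(V, \<phi>) \<in> trivs X" "x \<in> V"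
    and v: "v \<in> tangent_space (charts X) UNIV x"
  shows "dfun (charts X) (gram X \<phi>) x v p \<bullet> q =
    gram X \<phi> x (conn_mat \<phi> N x v p) \<bullet> q + gram X \<phi> x p \<bullet> conn_mat \<phi> N x v q"
proof -
  note o = triv_open[OF t(1)] and Lsm = gram_smooth[OF t(1)]
  have l: "bounded_linear (\<lambda>L. blinfun_apply L p \<bullet> q :: real)"
    by (intro bounded_linear_compose[OF bounded_linear_inner_left] blinfun.bounded_linear_left)
  have "dfun (charts X) (\<lambda>y. gram X \<phi> y p \<bullet> q) x v = dfun (charts X) (\<lambda>y. metric X y (\<phi> y p) (\<phi> y q)) x v"
    by (rule dfun_cong[OF o smooth_fun_bounded_linear[OF o l Lsm] _ t(2) v])
      (rule frame_at.gram_inner[OF frame_atI[OF t(1)]])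
  then show ?thesis
    using N t v unfolding metric_in_frames_def by (simp add: dfun_bounded_linear[OF l o Lsm t(2) v])
qed

context
  fixes N assumes conn: "connection X N"
begin

text \<open>The covariant derivative along a curve is defined through one chosen trivialization at each
  point; by the Leibniz rule every trivialization gives the same result.\<close>

lemma cov_along_frame:
  assumes t: "(V, \<phi>) \<in> trivs X" and \<gamma>: "smooth_curve (charts X) UNIV \<epsilon> \<gamma>" "\<bar>s\<bar> < \<epsilon>"
    and loc: "\<delta> > 0" "\<And>r. r \<in> ball s \<delta> \<Longrightarrow> \<gamma> r \<in> V \<and> \<sigma> r = \<phi> (\<gamma> r) (h r)"
    and h: "(h has_vector_derivative h') (at s)"
  shows "cov_along X N \<gamma> \<sigma> s = \<phi> (\<gamma> s) (h' + conn_mat \<phi> N (\<gamma> s) (velocity (charts X) \<gamma> s) (h s))"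
proof -
  define \<phi>1 where "\<phi>1 = triv_at X (\<gamma> s)"
  define V1 where "V1 = dom_at X (\<gamma> s)"
  define v where "v = velocity (charts X) \<gamma> s"
  have v: "v \<in> tangent_space (charts X) UNIV (\<gamma> s)"
    unfolding v_def by (rule velocity_in_tangent_space[OF \<gamma>])
  have t1: "(V1, \<phi>1) \<in> trivs X" "\<gamma> s \<in> V1" using triv_at by (auto simp: \<phi>1_def V1_def)
  have sV: "\<gamma> s \<in> V" using loc by auto
  have oV: "open (V \<inter> V1)" using triv_open t t1 by auto
  interpret g: frame_at X V \<phi> "\<gamma> s" by (rule frame_atI[OF t sV])
  interpret g1: frame_at X V1 \<phi>1 "\<gamma> s" by (rule frame_atI[OF t1])
  let ?T = "trans_mat \<phi> \<phi>1"
  have Tsm: "smooth_fun (charts X) (V \<inter> V1) ?T" by (rule trans_mat_smooth[OF t t1(1)])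
  obtain \<delta>1 where \<delta>1: "\<delta>1 > 0" "\<bar>s\<bar> + \<delta>1 \<le> \<epsilon>" "\<gamma> ` ball s \<delta>1 \<subseteq> V1"
    by (rule curve_continuous[OF \<gamma> triv_open[OF t1(1)] t1(2)])
  let ?f = "\<lambda>r. inv (\<phi>1 (\<gamma> r)) (\<sigma> r)"
  let ?d = "min \<delta> \<delta>1"
  have fT: "?T (\<gamma> r) (h r) = ?f r" if r: "r \<in> ball s ?d" for r
  proof -
    have rr: "\<gamma> r \<in> V" "\<gamma> r \<in> V1" "\<sigma> r = \<phi> (\<gamma> r) (h r)"
      using loc(2)[of r] \<delta>1(3) r by (auto simp: image_subset_iff)
    interpret r1: frame_at X V1 \<phi>1 "\<gamma> r" by (rule frame_atI[OF t1(1) rr(2)])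
    show ?thesis
      unfolding rr(3) trans_mat_apply[OF frame_atI[OF t rr(1)] r1.frame_at_axioms, symmetric] by simp
  qed
  have dT: "((?T \<circ> \<gamma>) has_vector_derivative dfun (charts X) ?T (\<gamma> s) v) (at s)"
    unfolding v_def by (rule dfun_along[OF oV Tsm \<gamma>]) (use sV t1 in auto)
  have "((\<lambda>r. (?T \<circ> \<gamma>) r (h r)) has_vector_derivative
      ((?T \<circ> \<gamma>) s h' + dfun (charts X) ?T (\<gamma> s) v (h s))) (at s)"
    by (rule bounded_bilinear.has_vector_derivative[OF bounded_bilinear_blinfun_apply dT h])
  then have "(?f has_vector_derivative (?T (\<gamma> s) h' + dfun (charts X) ?T (\<gamma> s) v (h s))) (at s)"
    unfolding comp_apply
    by (rule has_vector_derivative_transform_within_open[OF _ open_ball[of s ?d]]) (use fT loc(1) \<delta>1 in auto)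
  then have f': "vector_derivative ?f (at s) = ?T (\<gamma> s) h' + dfun (charts X) ?T (\<gamma> s) v (h s)"
    by (rule vector_derivative_at)
  have fs: "?f s = ?T (\<gamma> s) (h s)" using fT[of s] loc(1) \<delta>1(1) by simp
  have sum1: "(\<Sum>b\<in>Basis. (a \<bullet> b) *\<^sub>R N (\<gamma> s) v (\<lambda>y. \<phi>1 y b)) = \<phi>1 (\<gamma> s) (conn_mat \<phi>1 N (\<gamma> s) v a)" for a
  proof -
    have "(\<Sum>b\<in>Basis. (a \<bullet> b) *\<^sub>R N (\<gamma> s) v (\<lambda>y. \<phi>1 y b)) = \<phi>1 (\<gamma> s) (conn_mat \<phi>1 N (\<gamma> s) v (\<Sum>b\<in>Basis. (a \<bullet> b) *\<^sub>R b))"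
      by (simp add: conn_mat_apply[OF conn t1 v, symmetric] blinfun.sum_right blinfun.scaleR_right g1.f.sum g1.f.scale)
    then show ?thesis by (simp add: euclidean_representation)
  qed
  have cov: "cov_along X N \<gamma> \<sigma> s = \<phi>1 (\<gamma> s) (?T (\<gamma> s) h') +
      \<phi>1 (\<gamma> s) (dfun (charts X) ?T (\<gamma> s) v (h s) + conn_mat \<phi>1 N (\<gamma> s) v (?T (\<gamma> s) (h s)))"
    by (simp add: cov_along_def Let_def \<phi>1_def[symmetric] v_def[symmetric] f' fs sum1 g1.f.add)
  have bla: "bounded_linear (\<lambda>T. blinfun_apply T (h s))" by (rule blinfun.bounded_linear_left)
  have sv: "\<gamma> s \<in> V \<inter> V1" using sV t1 by simp
  have sec: "smooth_section X (V \<inter> V1) (\<lambda>y. \<phi> y (h s))"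
    by (rule frame_smooth_section[OF t oV _ smooth_fun_const[OF oV]]) auto
  have eq: "\<phi> y (h s) = \<phi>1 y (?T y (h s))" if y: "y \<in> V \<inter> V1" for y
    using trans_mat_apply[OF frame_atI[OF t] frame_atI[OF t1(1)]] y by simp
  have "\<phi> (\<gamma> s) (conn_mat \<phi> N (\<gamma> s) v (h s)) = N (\<gamma> s) v (\<lambda>y. \<phi> y (h s))"
    by (rule conn_mat_apply[OF conn t sV v])
  also have "\<dots> = N (\<gamma> s) v (\<lambda>y. \<phi>1 y (?T y (h s)))"
    by (rule conn_ax(2)[OF conn oV sv sec smooth_section_cong[OF oV sec eq] v eq])
  also have "\<dots> = \<phi>1 (\<gamma> s) (dfun (charts X) (\<lambda>y. ?T y (h s)) (\<gamma> s) v + conn_mat \<phi>1 N (\<gamma> s) v (?T (\<gamma> s) (h s)))"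
    by (rule conn_Leibniz[OF conn t1(1) oV _ sv smooth_fun_bounded_linear[OF oV bla Tsm] v]) auto
  also have "dfun (charts X) (\<lambda>y. ?T y (h s)) (\<gamma> s) v = dfun (charts X) ?T (\<gamma> s) v (h s)"
    by (rule dfun_bounded_linear[OF bla oV Tsm sv v])
  finally show ?thesis
    unfolding cov v_def[symmetric]
    using trans_mat_apply[OF g.frame_at_axioms g1.frame_at_axioms, of h'] by (simp add: g.f.add)
qed

text \<open>Testing parallelism on the sections that are constant in the frame gives \<open>k' = [k, \<theta>]\<close>.  In
  particular the velocity depends only on the initial data, which makes the horizontal lift
  unique.\<close>

lemma parallel_endo_derivative:
  assumes par: "parallel_endo X N \<epsilon> \<gamma> K" and \<epsilon>: "\<epsilon> > 0"
    and t: "(V, \<phi>) \<in> trivs X" "\<gamma> 0 \<in> V" and c: "c \<in> charts X" "\<gamma> 0 \<in> fst c"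
  defines "k \<equiv> to_frame \<phi> (\<gamma> 0) (K 0)" and "\<theta> \<equiv> conn_mat \<phi> N (\<gamma> 0) (velocity (charts X) \<gamma> 0)"
  shows "velocity EC (\<lambda>t. (\<gamma> t, K t)) 0 (end_chart X c (V, \<phi>)) =
    (velocity (charts X) \<gamma> 0 c, (k o\<^sub>L \<theta>) - (\<theta> o\<^sub>L k))"
proof -
  let ?\<Gamma> = "\<lambda>t. (\<gamma> t, K t)"
  let ?d = "end_chart X c (V, \<phi>)"
  have \<gamma>: "smooth_curve (charts X) UNIV \<epsilon> \<gamma>" and \<Gamma>: "smooth_curve EC ET \<epsilon> ?\<Gamma>"
    using par unfolding parallel_endo_def by blast+
  have cov: "cov_along X N \<gamma> (\<lambda>\<tau>. K \<tau> (s \<tau>)) r = K r (cov_along X N \<gamma> s r)"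
    if "open T" "T \<subseteq> {-\<epsilon><..<\<epsilon>}" "smooth_along X T \<gamma> s" "r \<in> T" for T s r
    using par that unfolding parallel_endo_def by blast
  have v1: "fst (velocity EC ?\<Gamma> 0 ?d) = velocity (charts X) \<gamma> 0 c"
    using end_curve_velocity(2)[OF \<Gamma> \<epsilon>, of c V \<phi>] c t by (simp add: o_def)
  let ?\<kappa> = "snd (velocity EC ?\<Gamma> 0 ?d)"
  have k': "((\<lambda>r. to_frame \<phi> (\<gamma> r) (K r)) has_vector_derivative ?\<kappa>) (at 0)"
    using end_curve_velocity(1)[OF \<Gamma> \<epsilon>, of c V \<phi>] c t by simp
  obtain \<delta> where \<delta>: "\<delta> > 0" "\<bar>0\<bar> + \<delta> \<le> \<epsilon>" "\<gamma> ` ball 0 \<delta> \<subseteq> V"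
    by (rule curve_continuous[OF \<gamma> _ triv_open[OF t(1)] t(2)]) (use \<epsilon> in auto)
  have \<delta>V: "\<gamma> r \<in> V" if "r \<in> ball 0 \<delta>" for r :: real using \<delta>(3) that by auto
  have KE: "K r \<in> End_fibre X (\<gamma> r)" if "r \<in> ball 0 \<delta>" for r :: real
    using smooth_curve_mem[OF \<Gamma>, of r] that \<delta>(2) by (simp add: End_total_def)
  interpret frame_at X V \<phi> "\<gamma> 0" by (rule frame_atI[OF t])
  have K0: "K 0 \<in> End_fibre X (\<gamma> 0)" using KE[of 0] \<delta>(1) by simp
  have "?\<kappa> a = ((k o\<^sub>L \<theta>) - (\<theta> o\<^sub>L k)) a" for a
  proof -
    let ?s = "\<lambda>r. \<phi> (\<gamma> r) a"
    have al: "smooth_along X (ball 0 \<delta>) \<gamma> ?s"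
      unfolding smooth_along_def
    proof (intro ballI conjI)
      fix r :: real assume r: "r \<in> ball 0 \<delta>"
      then have r': "\<bar>r\<bar> < \<epsilon>" using \<delta>(2) by simp
      show "?s r \<in> fibre X (\<gamma> r)" by (rule frame_at.f_in[OF frame_atI[OF t(1) \<delta>V[OF r]]])
      fix T assume T: "T \<in> trivs X"
      then obtain V' \<phi>' where TT: "T = (V', \<phi>')" "(V', \<phi>') \<in> trivs X" by (cases T) auto
      have oV: "open (V \<inter> V')" using triv_open t TT by auto
      have "\<exists>\<delta>>0. \<gamma> ` ball r \<delta> \<subseteq> V' \<and> smooth_on (ball r \<delta>) (\<lambda>\<tau>. inv (\<phi>' (\<gamma> \<tau>)) (\<phi> (\<gamma> \<tau>) a))" if rV': "\<gamma> r \<in> V'"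
      proof -
        have "\<gamma> r \<in> V \<inter> V'" using \<delta>V[OF r] rV' by simp
        from curve_continuous[OF \<gamma> r' oV this] obtain e where e: "e > 0" "\<bar>r\<bar> + e \<le> \<epsilon>" "\<gamma> ` ball r e \<subseteq> V \<inter> V'"
          by metis
        have "ball r e \<subseteq> {-\<epsilon><..<\<epsilon>}" using e(2) by (auto simp: dist_real_def)
        from smooth_fun_along[OF oV triv_transition_smooth[OF t(1) TT(2)] \<gamma> this e(3), of a]
        show ?thesis using e by (intro exI[of _ e]) (auto simp: o_def)
      qed
      then show "case T of (V, \<phi>') \<Rightarrow> \<gamma> r \<in> V \<longrightarrow> (\<exists>\<delta>>0. \<gamma> ` ball r \<delta> \<subseteq> V \<and>
          smooth_on (ball r \<delta>) (\<lambda>\<tau>. inv (\<phi>' (\<gamma> \<tau>)) (\<phi> (\<gamma> \<tau>) a)))"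
        unfolding TT by simp
    qed
    have "ball (0::real) \<delta> \<subseteq> {-\<epsilon><..<\<epsilon>}" using \<delta>(2) by (auto simp: dist_real_def)
    from cov[OF open_ball this al] have 1: "cov_along X N \<gamma> (\<lambda>\<tau>. K \<tau> (?s \<tau>)) 0 = K 0 (cov_along X N \<gamma> ?s 0)"
      using \<delta>(1) by simp
    have 2: "cov_along X N \<gamma> ?s 0 = f (0 + \<theta> a)"
      unfolding \<theta>_def
      by (rule cov_along_frame[OF t(1) \<gamma> _ \<delta>(1), where h = "\<lambda>r. a"]) (use \<epsilon> \<delta>V in auto)
    have ka: "((\<lambda>r. to_frame \<phi> (\<gamma> r) (K r) a) has_vector_derivative ?\<kappa> a) (at 0)"
      by (rule bounded_linear.has_vector_derivative[OF blinfun.bounded_linear_left k'])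
    have 3: "cov_along X N \<gamma> (\<lambda>\<tau>. K \<tau> (?s \<tau>)) 0 = f (?\<kappa> a + \<theta> (k a))"
      unfolding \<theta>_def k_def
    proof (rule cov_along_frame[OF t(1) \<gamma> _ \<delta>(1) _ ka])
      show "\<gamma> r \<in> V \<and> K r (\<phi> (\<gamma> r) a) = \<phi> (\<gamma> r) (to_frame \<phi> (\<gamma> r) (K r) a)" if "r \<in> ball 0 \<delta>" for r
        using frame_at.f_to_frame[OF frame_atI[OF t(1) \<delta>V[OF that]] KE[OF that]] \<delta>V[OF that] by simp
    qed (use \<epsilon> in simp)
    have "f (?\<kappa> a + \<theta> (k a)) = f (k (\<theta> a))"
      using 1 unfolding 2 3 by (simp add: k_def f_to_frame[OF K0])
    then have "?\<kappa> a + \<theta> (k a) = k (\<theta> a)" by simp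
    then show ?thesis by (simp add: blinfun.diff_left eq_diff_eq)
  qed
  then have "?\<kappa> = (k o\<^sub>L \<theta>) - (\<theta> o\<^sub>L k)" by (rule blinfun_eqI)
  then show ?thesis using v1 by (simp add: prod_eq_iff)
qed

context
  assumes met: "metric_in_frames X N"
begin

text \<open>Along a coordinate line the connection matrix is smooth, and \<open>U\<close> solves the linear equation of
  parallel transport.  For a metric connection \<open>U\<close> is isometric, which yields its invertibility.\<close>

lemma parallel_frame:
  assumes v: "v \<in> tangent_space (charts X) UNIV x" and t: "(V, \<phi>) \<in> trivs X" "x \<in> V"
  obtains \<epsilon> \<gamma> U where "\<epsilon> > 0" "smooth_curve (charts X) UNIV \<epsilon> \<gamma>" "\<gamma> 0 = x" "velocity (charts X) \<gamma> 0 = v"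
    "\<And>s. \<bar>s\<bar> < \<epsilon> \<Longrightarrow> \<gamma> s \<in> V" "smooth_on {-\<epsilon><..<\<epsilon>} U" "U 0 = id_blinfun"
    "\<And>s. \<bar>s\<bar> < \<epsilon> \<Longrightarrow> (U has_vector_derivative - (conn_mat \<phi> N (\<gamma> s) (velocity (charts X) \<gamma> s) o\<^sub>L U s)) (at s)"
    "\<And>s a c. \<bar>s\<bar> < \<epsilon> \<Longrightarrow> gram X \<phi> (\<gamma> s) (U s a) \<bullet> U s c = gram X \<phi> x a \<bullet> c"
    "\<And>s. \<bar>s\<bar> < \<epsilon> \<Longrightarrow> blinfun_invertible (U s)"
proof -
  obtain c where c: "c \<in> charts X" "x \<in> fst c" using chart_covers by blast
  define \<xi> where "\<xi> = v c"
  define \<gamma> where "\<gamma> = (\<lambda>t. inv_into (fst c) (snd c) (snd c x + t *\<^sub>R \<xi>))"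
  obtain \<epsilon>1 where \<epsilon>1: "\<epsilon>1 > 0" "smooth_curve (charts X) UNIV \<epsilon>1 \<gamma>" "\<And>t. \<bar>t\<bar> < \<epsilon>1 \<Longrightarrow> \<gamma> t \<in> fst c \<inter> V"
    "\<And>t. \<bar>t\<bar> < \<epsilon>1 \<Longrightarrow> snd c (\<gamma> t) = snd c x + t *\<^sub>R \<xi>"
    using coord_line[OF c triv_open[OF t(1)] t(2), of \<xi>] unfolding \<gamma>_def by metis
  have \<gamma>0: "\<gamma> 0 = x" using chart_inv[OF c] by (simp add: \<gamma>_def)
  have vel: "velocity (charts X) \<gamma> s = coord_vec (charts X) c \<xi> (\<gamma> s)" if "\<bar>s\<bar> < \<epsilon>1" for s
    unfolding \<gamma>_def by (rule velocity_coord_line[OF c]) (use \<epsilon>1(4)[OF that] in \<open>simp add: \<gamma>_def\<close>)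
  have vel0: "velocity (charts X) \<gamma> 0 = v"
    using vel[of 0] tangent_vector_coord[OF v c] \<epsilon>1(1) by (simp add: \<gamma>0 \<xi>_def)
  define \<theta> where "\<theta> s = conn_mat \<phi> N (\<gamma> s) (velocity (charts X) \<gamma> s)" for s
  have oI: "open {-\<epsilon>1<..<\<epsilon>1}" by simp
  have "smooth_on {-\<epsilon>1<..<\<epsilon>1} ((\<lambda>x. conn_mat \<phi> N x (coord_vec (charts X) c \<xi> x)) \<circ> \<gamma>)"
    by (rule smooth_fun_along[OF _ conn_mat_smooth[OF conn t(1) c(1)] \<epsilon>1(2) subset_refl])
      (use triv_open[OF t(1)] chart_props(1)[OF c(1)] \<epsilon>1(3) in auto)
  then have \<theta>sm: "smooth_on {-\<epsilon>1<..<\<epsilon>1} \<theta>"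
    by (rule smooth_on_cong[OF oI]) (auto simp: \<theta>_def vel)
  have m\<theta>: "smooth_on {-\<epsilon>1<..<\<epsilon>1} (\<lambda>s. - \<theta> s)" by (rule smooth_on_minus[OF oI \<theta>sm])
  have "continuous_on {-(\<epsilon>1/2)..\<epsilon>1/2} (\<lambda>s. - \<theta> s)"
    by (rule continuous_on_subset[OF smooth_on_continuous[OF m\<theta>]]) (use \<epsilon>1(1) in auto)
  then obtain \<epsilon> U where U: "0 < \<epsilon>" "\<epsilon> \<le> \<epsilon>1/2" "U 0 = id_blinfun"
    "\<And>s. \<bar>s\<bar> < \<epsilon> \<Longrightarrow> (U has_vector_derivative (- \<theta> s o\<^sub>L U s)) (at s)"
    by (rule linear_ode_solution[rotated]) (use \<epsilon>1(1) in auto)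
  have \<epsilon>: "\<bar>s\<bar> < \<epsilon>1" if "\<bar>s\<bar> < \<epsilon>" for s using that U(2) \<epsilon>1(1) by auto
  have "{-\<epsilon><..<\<epsilon>} \<subseteq> {-\<epsilon>1<..<\<epsilon>1}" using U(2) \<epsilon>1(1) by auto
  then have Usm: "smooth_on {-\<epsilon><..<\<epsilon>} U"
    using U(4) by (intro linear_ode_smooth[OF _ smooth_on_subset[OF m\<theta>]]) auto
  have V: "\<gamma> s \<in> V" if "\<bar>s\<bar> < \<epsilon>" for s using \<epsilon>1(3)[OF \<epsilon>[OF that]] by auto
  have iso: "gram X \<phi> (\<gamma> s) (U s a) \<bullet> U s q = gram X \<phi> x a \<bullet> q" if s: "\<bar>s\<bar> < \<epsilon>" for s a q
  proof -
    let ?G = "\<lambda>s. gram X \<phi> (\<gamma> s) (U s a) \<bullet> U s q"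
    have "(?G has_vector_derivative 0) (at r)" if r: "\<bar>r\<bar> < \<epsilon>" for r
    proof -
      let ?v = "velocity (charts X) \<gamma> r"
      have dG: "((gram X \<phi> \<circ> \<gamma>) has_vector_derivative dfun (charts X) (gram X \<phi>) (\<gamma> r) ?v) (at r)"
        by (rule dfun_along[OF triv_open[OF t(1)] gram_smooth[OF t(1)] \<epsilon>1(2) \<epsilon>[OF r] V[OF r]])
      have dU: "((\<lambda>s. U s b) has_vector_derivative (- \<theta> r o\<^sub>L U r) b) (at r)" for b
        by (rule bounded_linear.has_vector_derivative[OF blinfun.bounded_linear_left U(4)[OF r]])
      have "(?G has_vector_derivative (gram X \<phi> (\<gamma> r) (U r a) \<bullet> (- \<theta> r o\<^sub>L U r) q +
          (gram X \<phi> (\<gamma> r) ((- \<theta> r o\<^sub>L U r) a) + dfun (charts X) (gram X \<phi>) (\<gamma> r) ?v (U r a)) \<bullet> U r q)) (at r)"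
        using bounded_bilinear.has_vector_derivative[OF bounded_bilinear_inner
          bounded_bilinear.has_vector_derivative[OF bounded_bilinear_blinfun_apply dG dU[of a]] dU[of q]] by simp
      moreover have vr: "?v \<in> tangent_space (charts X) UNIV (\<gamma> r)"
        by (rule velocity_in_tangent_space[OF \<epsilon>1(2) \<epsilon>[OF r]])
      ultimately show ?thesis
        by (simp add: inner_add_left inner_diff_left gram_deriv[OF met t(1) V[OF r] vr] \<theta>_def[symmetric] blinfun.minus_left blinfun.minus_right)
    qed
    then have "(?G has_derivative (\<lambda>h. 0)) (at r within {-\<epsilon><..<\<epsilon>})" if "r \<in> {-\<epsilon><..<\<epsilon>}" for r
      using that unfolding has_vector_derivative_def by (auto intro: has_derivative_at_withinI)
    then obtain k where "\<And>r. r \<in> {-\<epsilon><..<\<epsilon>} \<Longrightarrow> ?G r = k"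
      using has_derivative_zero_constant[of "{-\<epsilon><..<\<epsilon>}" ?G] by auto
    then have "?G s = ?G 0" using s U(1) by (simp add: abs_less_iff)
    then show ?thesis by (simp add: U(3) \<gamma>0)
  qed
  have inv: "blinfun_invertible (U s)" if s: "\<bar>s\<bar> < \<epsilon>" for s
  proof (rule blinfun_invertibleI, rule ccontr)
    fix a assume a: "U s a = 0" "a \<noteq> 0"
    interpret frame_at X V \<phi> x by (rule frame_atI[OF t])
    show False using iso[OF s, of a a] a metric_pos[of "f a" x] by (simp add: gram_inner)
  qed
  show ?thesis
  proof (rule that[OF U(1) smooth_curve_shrink[OF \<epsilon>1(2)] \<gamma>0 vel0 V Usm U(3) _ iso inv])
    show "\<epsilon> \<le> \<epsilon>1" using U(2) \<epsilon>1(1) by simp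
    show "(U has_vector_derivative - (conn_mat \<phi> N (\<gamma> s) (velocity (charts X) \<gamma> s) o\<^sub>L U s)) (at s)" if "\<bar>s\<bar> < \<epsilon>" for s
      using U(4)[OF that] by (simp add: \<theta>_def blinfun_compose_simps)
  qed auto
qed

end

end

end

section \<open>Tangent vectors of the twistor space\<close>

lemma smooth_curve_restrict:
  assumes "smooth_curve A S \<epsilon> \<gamma>" "\<And>t. \<bar>t\<bar> < \<epsilon> \<Longrightarrow> \<gamma> t \<in> S'"
  shows "smooth_curve A S' \<epsilon> \<gamma>"
  unfolding smooth_curve_def[of A S']
proof (intro allI impI conjI)
  fix t assume t: "\<bar>t\<bar> < \<epsilon>"
  show "\<gamma> t \<in> S'" by (rule assms(2)[OF t])
  show "\<forall>(U, z)\<in>A. \<gamma> t \<in> U \<longrightarrow> (\<exists>\<delta>>0. \<gamma> ` ball t \<delta> \<subseteq> U \<and> smooth_on (ball t \<delta>) (z \<circ> \<gamma>))"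
    by (rule conjunct2[OF smooth_curveD[OF assms(1) t]])
qed

lemma orth_cstr_conj:
  fixes L L' U k :: "'a::euclidean_space \<Rightarrow>\<^sub>L 'a"
  assumes k: "orth_cstr L k" and U: "blinfun_invertible U" "\<And>u v. L' (U u) \<bullet> U v = L u \<bullet> v"
  shows "orth_cstr L' (U o\<^sub>L (k o\<^sub>L blinfun_inv U))"
proof -
  note inv = blinfun_inv_apply[OF U(1)]
  have iso: "L (k u) \<bullet> k v = L u \<bullet> v" for u v using k by (simp add: orth_cstr_def)
  have iso': "L (blinfun_inv U u) \<bullet> blinfun_inv U v = L' u \<bullet> v" for u v
    using U(2)[of "blinfun_inv U u" "blinfun_inv U v"] by (simp add: inv)
  show ?thesis unfolding orth_cstr_def
    by (auto intro!: blinfun_eqI simp: inv orth_cstr_apply[OF k] blinfun.minus_right uminus_blinfun.rep_eq U(2) iso iso')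
qed

lemma has_vector_derivative_blinfun_inv:
  fixes U :: "real \<Rightarrow> 'a::euclidean_space \<Rightarrow>\<^sub>L 'a"
  assumes "(U has_vector_derivative U') (at s)" "open S" "s \<in> S" "\<And>r. r \<in> S \<Longrightarrow> blinfun_invertible (U r)"
  shows "((\<lambda>s. blinfun_inv (U s)) has_vector_derivative - (blinfun_inv (U s) o\<^sub>L (U' o\<^sub>L blinfun_inv (U s)))) (at s)"
  using has_derivative_blinfun_inv[OF assms(2,3) assms(1)[unfolded has_vector_derivative_def] assms(4)]
  by (simp add: has_vector_derivative_def blinfun_compose_simps)

lemmas has_vector_derivative_blinfun_compose = bounded_bilinear.has_vector_derivative[OF bounded_bilinear_blinfun_compose]

text \<open>The curve is \<open>C k C\<^sup>-\<^sup>1\<close> with \<open>C = 1 + s R\<close> and \<open>R = k a / 2\<close>.  Although \<open>C\<close> is not orthogonal, the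
  conjugate is: \<open>R\<close> is skew and anticommutes with \<open>k\<close>, so \<open>C\<^sup>T C = 1 - s\<^sup>2 R\<^sup>2\<close> commutes with \<open>k\<close>.\<close>

lemma orth_cstr_curve:
  fixes L k a :: "'a::euclidean_space \<Rightarrow>\<^sub>L 'a"
  assumes L: "\<And>u v. L u \<bullet> v = L v \<bullet> u" "\<And>u. u \<noteq> 0 \<Longrightarrow> L u \<bullet> u > 0"
    and k: "orth_cstr L k" and a: "\<And>u v. L (a u) \<bullet> v = - (L u \<bullet> a v)" "(a o\<^sub>L k) + (k o\<^sub>L a) = 0"
  obtains \<kappa> :: "real \<Rightarrow> 'a \<Rightarrow>\<^sub>L 'a" where "smooth_on UNIV \<kappa>" "\<And>s. orth_cstr L (\<kappa> s)" "\<kappa> 0 = k" "(\<kappa> has_vector_derivative a) (at 0)"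
proof -
  define R where "R = (1/2) *\<^sub>R (k o\<^sub>L a)"
  define C where "C s = id_blinfun + s *\<^sub>R R" for s :: real
  have kk: "k o\<^sub>L k = - id_blinfun" and iso: "L (k u) \<bullet> k v = L u \<bullet> v" for u v
    using k by (auto simp: orth_cstr_def)
  have ak: "a o\<^sub>L k = - (k o\<^sub>L a)" using a(2) by (simp add: eq_neg_iff_add_eq_0)
  have Rk: "R o\<^sub>L k = (1/2) *\<^sub>R a" "k o\<^sub>L R = - ((1/2) *\<^sub>R a)"
    by (simp_all add: R_def blinfun_compose_simps blinfun_compose_assoc ak kk kk[THEN blinfun_compose_assoc_eq])
  have ak': "a (k u) = - k (a u)" for u
    using arg_cong[OF ak, of "\<lambda>F. blinfun_apply F u"] by (simp add: uminus_blinfun.rep_eq)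
  have Rk': "R (k u) = - k (R u)" for u
    by (simp add: R_def ak' blinfun.scaleR_left blinfun.scaleR_right orth_cstr_apply[OF k] blinfun.minus_right)
  have ksk: "L (k u) \<bullet> v = - (L u \<bullet> k v)" for u v
    using iso[of u "k v"] by (simp add: orth_cstr_apply[OF k])
  have Rsk: "L (R u) \<bullet> v = - (L u \<bullet> R v)" for u v
    by (simp add: R_def blinfun.scaleR_left blinfun.scaleR_right ksk a(1) ak')
  have C: "blinfun_invertible (C s)" for s
  proof (rule blinfun_invertibleI, rule ccontr)
    fix u assume u: "C s u = 0" "u \<noteq> 0"
    have "L (R u) \<bullet> u = 0" using Rsk[of u u] L(1)[of "R u" u] by simp
    then have "L (C s u) \<bullet> u = L u \<bullet> u"
      by (simp add: C_def blinfun.add_left blinfun.add_right blinfun.scaleR_left blinfun.scaleR_right inner_add_left)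
    then show False using u L(2)[of u] by simp
  qed
  define \<kappa> where "\<kappa> s = C s o\<^sub>L (k o\<^sub>L blinfun_inv (C s))" for s
  have Csm: "smooth_on UNIV C" unfolding C_def
    by (intro smooth_on_add smooth_on_const smooth_on_linear bounded_linear_scaleR_left) auto
  have sm: "smooth_on UNIV \<kappa>" unfolding \<kappa>_def
    by (intro smooth_on_blinfun_compose smooth_on_const smooth_on_blinfun_inv Csm C) auto
  have "orth_cstr L (\<kappa> s)" for s
  proof -
    note inv = blinfun_inv_apply[OF C[of s]]
    have Ck: "C s (k u) = k (u - s *\<^sub>R R u)" for u
      by (simp add: C_def blinfun.add_left blinfun.diff_right blinfun.scaleR_left blinfun.scaleR_right Rk')
    have *: "L (C s (k u)) \<bullet> C s (k v) = L (C s u) \<bullet> C s v" for u v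
      unfolding Ck iso using Rsk[of u v]
      by (simp add: C_def blinfun.add_left blinfun.add_right blinfun.diff_right blinfun.scaleR_left blinfun.scaleR_right
          inner_add_left inner_add_right inner_diff_left inner_diff_right algebra_simps)
    show ?thesis unfolding orth_cstr_def \<kappa>_def
      by (auto intro!: blinfun_eqI simp: inv orth_cstr_apply[OF k] blinfun.minus_right uminus_blinfun.rep_eq *)
  qed
  moreover have C0: "C 0 = id_blinfun" by (simp add: C_def)
  have inv0: "blinfun_inv (id_blinfun :: 'a \<Rightarrow>\<^sub>L 'a) = id_blinfun"
    using blinfun_inv(1)[OF C[of 0]] by (simp add: C0)
  have \<kappa>0: "\<kappa> 0 = k" by (simp add: \<kappa>_def C0 inv0)
  have dC: "(C has_vector_derivative R) (at 0)" unfolding C_def by (auto intro!: derivative_eq_intros)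
  have dI: "((\<lambda>s. blinfun_inv (C s)) has_vector_derivative - R) (at 0)"
    using has_vector_derivative_blinfun_inv[OF dC open_UNIV UNIV_I C] by (simp add: C0 inv0)
  have "(\<kappa> has_vector_derivative ((C 0 o\<^sub>L ((k o\<^sub>L - R) + (0 o\<^sub>L blinfun_inv (C 0)))) + (R o\<^sub>L (k o\<^sub>L blinfun_inv (C 0))))) (at 0)"
    unfolding \<kappa>_def
    by (intro has_vector_derivative_blinfun_compose dC dI has_vector_derivative_const)
  moreover have "((C 0 o\<^sub>L ((k o\<^sub>L - R) + (0 o\<^sub>L blinfun_inv (C 0)))) + (R o\<^sub>L (k o\<^sub>L blinfun_inv (C 0)))) = a"
    by (simp add: C0 inv0 blinfun_compose_simps Rk scaleR_add_left[symmetric])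
  ultimately show ?thesis using that[OF sm _ \<kappa>0] by simp
qed

context herm_hol_bundle
begin

lemma vert_vec_coords:
  assumes K: "K \<in> End_fibre X x" and A: "A \<in> End_fibre X x" 
    and t: "(V, \<phi>) \<in> trivs X" "x \<in> V" and c: "c \<in> charts X" "x \<in> fst c"
  shows "vert_vec X (x, K) A \<in> tangent_space EC ET (x, K)"
    "vert_vec X (x, K) A (end_chart X c (V, \<phi>)) = (0, to_frame \<phi> x A)"
proof -
  interpret frame_at X V \<phi> x by (rule frame_atI[OF t])
  let ?k = "to_frame \<phi> x K" and ?a = "to_frame \<phi> x A"
  let ?\<Gamma> = "\<lambda>s. (x, of_frame X \<phi> x (?k + s *\<^sub>R ?a))"
  have eq: "(\<lambda>s. (x, \<lambda>u\<in>fibre X x. K u + s *\<^sub>R A u)) = ?\<Gamma>"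
    by (auto simp: fun_eq_iff of_frame_def restrict_def blinfun.add_left blinfun.scaleR_left f.add f.scale
        f_to_frame[OF K] f_to_frame[OF A])
  have sm: "smooth_on {-1<..<1} (\<lambda>s::real. ?k + s *\<^sub>R ?a)"
    by (intro smooth_on_add smooth_on_const smooth_on_linear bounded_linear_scaleR_left) auto
  have \<Gamma>: "smooth_curve EC ET 1 ?\<Gamma>"
    by (rule end_chart_curve[OF t(1) smooth_curve_const t(2) sm])
  have 0: "?\<Gamma> 0 = (x, K)" by (simp add: of_frame_to_frame[OF K])
  have vv: "vert_vec X (x, K) A = velocity EC ?\<Gamma> 0" by (simp add: vert_vec_def eq)
  show "vert_vec X (x, K) A \<in> tangent_space EC ET (x, K)"
    unfolding vv by (rule tangent_spaceI[OF _ \<Gamma> 0]) simp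
  have "((\<lambda>s. ?k + s *\<^sub>R ?a) has_vector_derivative ?a) (at 0)" by (auto intro!: derivative_eq_intros)
  moreover have "((\<lambda>s. ?k + s *\<^sub>R ?a) has_vector_derivative snd (velocity EC ?\<Gamma> 0 (end_chart X c (V, \<phi>)))) (at 0)"
    using end_curve_velocity(1)[OF \<Gamma> _ c(1) _ t(1)] c t by (simp add: to_frame_of_frame)
  ultimately have "snd (velocity EC ?\<Gamma> 0 (end_chart X c (V, \<phi>))) = ?a" by (metis vector_derivative_unique_at)
  moreover have "fst (velocity EC ?\<Gamma> 0 (end_chart X c (V, \<phi>))) = 0"
    using end_curve_velocity(2)[OF \<Gamma> _ c(1) _ t(1)] c t by (simp add: o_def velocity_def)
  ultimately show "vert_vec X (x, K) A (end_chart X c (V, \<phi>)) = (0, ?a)"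
    unfolding vv by (simp add: prod_eq_iff)
qed

lemma end_chart_EC: "c \<in> charts X \<Longrightarrow> (V, \<phi>) \<in> trivs X \<Longrightarrow> end_chart X c (V, \<phi>) \<in> EC"
  unfolding End_charts_end_chart by blast

context
  fixes N assumes conn: "connection X N" and met: "metric_in_frames X N"
begin

text \<open>A parallel frame carries a curve of orthogonal complex structures of one fibre to a curve in the
  twistor space over a curve of the base.  A constant curve gives a parallel one; a curve with
  velocity \<open>k'\<close> adds the vertical vector \<open>k'\<close> to the horizontal lift of \<open>v\<close>.\<close>

lemma transported_curve:
  assumes t: "(V, \<phi>) \<in> trivs X" "x \<in> V" and c: "c \<in> charts X" "x \<in> fst c"
    and v: "v \<in> tangent_space (charts X) UNIV x"
    and k: "smooth_on UNIV k" "\<And>s. orth_cstr (gram X \<phi> x) (k s)" "(k has_vector_derivative k') (at 0)"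
  defines "\<theta> \<equiv> conn_mat \<phi> N x v"
  obtains \<Gamma> \<epsilon> where "\<epsilon> > 0" "smooth_curve EC TW \<epsilon> \<Gamma>" "\<Gamma> 0 = (x, of_frame X \<phi> x (k 0))"
    "velocity (charts X) (\<lambda>s. fst (\<Gamma> s)) 0 = v"
    "velocity EC \<Gamma> 0 (end_chart X c (V, \<phi>)) = (v c, k' + (k 0 o\<^sub>L \<theta>) - (\<theta> o\<^sub>L k 0))"
    "(\<forall>s. k s = k 0) \<Longrightarrow> parallel_endo X N \<epsilon> (\<lambda>s. fst (\<Gamma> s)) (\<lambda>s. snd (\<Gamma> s))"
proof -
  obtain \<epsilon> \<gamma> U where \<epsilon>: "\<epsilon> > 0" and \<gamma>: "smooth_curve (charts X) UNIV \<epsilon> \<gamma>" "\<gamma> 0 = x" "velocity (charts X) \<gamma> 0 = v"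
    "\<And>s. \<bar>s\<bar> < \<epsilon> \<Longrightarrow> \<gamma> s \<in> V" and U: "smooth_on {-\<epsilon><..<\<epsilon>} U" "U 0 = id_blinfun"
    "\<And>s. \<bar>s\<bar> < \<epsilon> \<Longrightarrow> (U has_vector_derivative - (conn_mat \<phi> N (\<gamma> s) (velocity (charts X) \<gamma> s) o\<^sub>L U s)) (at s)"
    "\<And>s a c. \<bar>s\<bar> < \<epsilon> \<Longrightarrow> gram X \<phi> (\<gamma> s) (U s a) \<bullet> U s c = gram X \<phi> x a \<bullet> c"
    "\<And>s. \<bar>s\<bar> < \<epsilon> \<Longrightarrow> blinfun_invertible (U s)"
    by (rule parallel_frame[OF conn met v t]) blast
  define W where "W s = blinfun_inv (U s)" for s
  define \<kappa> where "\<kappa> s = U s o\<^sub>L (k s o\<^sub>L W s)" for s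
  define \<Theta> where "\<Theta> s = conn_mat \<phi> N (\<gamma> s) (velocity (charts X) \<gamma> s)" for s
  let ?I = "{-\<epsilon><..<\<epsilon>}"
  have I: "s \<in> ?I \<longleftrightarrow> \<bar>s\<bar> < \<epsilon>" for s by auto
  have UW: "W s o\<^sub>L U s = id_blinfun" "U s o\<^sub>L W s = id_blinfun" if "\<bar>s\<bar> < \<epsilon>" for s
    unfolding W_def using blinfun_inv[OF U(5)[OF that]] by auto
  have Wsm: "smooth_on ?I W" unfolding W_def
    by (rule smooth_on_blinfun_inv[OF _ U(1) U(5)]) auto
  have \<kappa>sm: "smooth_on ?I \<kappa>" unfolding \<kappa>_def
    by (intro smooth_on_blinfun_compose U(1) Wsm smooth_on_subset[OF k(1)]) auto
  have \<kappa>o: "orth_cstr (gram X \<phi> (\<gamma> s)) (\<kappa> s)" if s: "\<bar>s\<bar> < \<epsilon>" for s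
    unfolding \<kappa>_def W_def by (rule orth_cstr_conj[OF k(2) U(5)[OF s] U(4)[OF s]])
  define \<Gamma> where "\<Gamma> = (\<lambda>s. (\<gamma> s, of_frame X \<phi> (\<gamma> s) (\<kappa> s)))"
  have \<Gamma>ET: "smooth_curve EC ET \<epsilon> \<Gamma>" unfolding \<Gamma>_def by (rule end_chart_curve[OF t(1) \<gamma>(1,4) \<kappa>sm])
  have \<Gamma>TW: "smooth_curve EC TW \<epsilon> \<Gamma>"
  proof (rule smooth_curve_restrict[OF \<Gamma>ET])
    fix s assume s: "\<bar>s\<bar> < \<epsilon>"
    interpret frame_at X V \<phi> "\<gamma> s" by (rule frame_atI[OF t(1) \<gamma>(4)[OF s]])
    show "\<Gamma> s \<in> TW" using \<kappa>o[OF s] by (simp add: \<Gamma>_def twistor_frame of_frame_End to_frame_of_frame)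
  qed
  have dW: "(W has_vector_derivative (W s o\<^sub>L \<Theta> s)) (at s)" if s: "\<bar>s\<bar> < \<epsilon>" for s
  proof -
    have "((\<lambda>s. blinfun_inv (U s)) has_vector_derivative - (W s o\<^sub>L (- (\<Theta> s o\<^sub>L U s) o\<^sub>L W s))) (at s)"
      unfolding W_def
      by (rule has_vector_derivative_blinfun_inv[OF U(3)[OF s, folded \<Theta>_def], of ?I]) (use s U(5) in auto)
    moreover have "- (W s o\<^sub>L (- (\<Theta> s o\<^sub>L U s) o\<^sub>L W s)) = W s o\<^sub>L \<Theta> s"
      by (simp add: blinfun_compose_simps blinfun_compose_assoc UW[OF s])
    ultimately show ?thesis unfolding W_def by simp
  qed
  have d\<kappa>: "(\<kappa> has_vector_derivative ((U s o\<^sub>L (\<k>' o\<^sub>L W s)) + (\<kappa> s o\<^sub>L \<Theta> s) - (\<Theta> s o\<^sub>L \<kappa> s))) (at s)"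
    if s: "\<bar>s\<bar> < \<epsilon>" and dk: "(k has_vector_derivative \<k>') (at s)" for s \<k>'
  proof -
    have "(\<kappa> has_vector_derivative ((U s o\<^sub>L ((k s o\<^sub>L (W s o\<^sub>L \<Theta> s)) + (\<k>' o\<^sub>L W s))) +
        (- (\<Theta> s o\<^sub>L U s) o\<^sub>L (k s o\<^sub>L W s)))) (at s)"
      unfolding \<kappa>_def
      by (intro has_vector_derivative_blinfun_compose dk dW[OF s] U(3)[OF s, folded \<Theta>_def])
    then show ?thesis by (simp add: \<kappa>_def blinfun_compose_simps blinfun_compose_assoc algebra_simps)
  qed
  have W0: "W 0 = id_blinfun" using UW(1)[of 0] \<epsilon> U(2) by simp
  have \<kappa>0: "\<kappa> 0 = k 0" by (simp add: \<kappa>_def U(2) W0)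
  have \<Theta>0: "\<Theta> 0 = \<theta>" by (simp add: \<Theta>_def \<theta>_def \<gamma>)
  have d\<kappa>0: "(\<kappa> has_vector_derivative k' + (k 0 o\<^sub>L \<theta>) - (\<theta> o\<^sub>L k 0)) (at 0)"
    using d\<kappa>[OF _ k(3)] \<epsilon> by (simp add: U(2) W0 \<kappa>0 \<Theta>0)
  have snd_v: "snd (velocity EC \<Gamma> 0 (end_chart X c (V, \<phi>))) = k' + (k 0 o\<^sub>L \<theta>) - (\<theta> o\<^sub>L k 0)"
  proof (rule vector_derivative_unique_at[OF _ d\<kappa>0])
    have "((\<lambda>s. to_frame \<phi> (fst (\<Gamma> s)) (snd (\<Gamma> s))) has_vector_derivative
        snd (velocity EC \<Gamma> 0 (end_chart X c (V, \<phi>)))) (at 0)"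
      by (rule end_curve_velocity(1)[OF \<Gamma>ET \<epsilon> c(1) _ t(1)]) (use c t \<gamma> in \<open>auto simp: \<Gamma>_def\<close>)
    then show "(\<kappa> has_vector_derivative snd (velocity EC \<Gamma> 0 (end_chart X c (V, \<phi>)))) (at 0)"
    proof (rule has_vector_derivative_transform_within_open[of _ _ _ ?I])
      show "to_frame \<phi> (fst (\<Gamma> s)) (snd (\<Gamma> s)) = \<kappa> s" if "s \<in> ?I" for s
        unfolding \<Gamma>_def fst_conv snd_conv
        by (rule frame_at.to_frame_of_frame[OF frame_atI[OF t(1) \<gamma>(4)]]) (use that in auto)
    qed (use \<epsilon> in auto)
  qed
  have fst_v: "fst (velocity EC \<Gamma> 0 (end_chart X c (V, \<phi>))) = v c"
    using end_curve_velocity(2)[OF \<Gamma>ET \<epsilon> c(1) _ t(1)] c t \<gamma> by (simp add: \<Gamma>_def o_def)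
  show ?thesis
  proof (rule that[OF \<epsilon> \<Gamma>TW])
    show "\<Gamma> 0 = (x, of_frame X \<phi> x (k 0))" by (simp add: \<Gamma>_def \<gamma> \<kappa>0)
    show "velocity (charts X) (\<lambda>s. fst (\<Gamma> s)) 0 = v" by (simp add: \<Gamma>_def \<gamma>)
    show "velocity EC \<Gamma> 0 (end_chart X c (V, \<phi>)) = (v c, k' + (k 0 o\<^sub>L \<theta>) - (\<theta> o\<^sub>L k 0))"
      using fst_v snd_v by (simp add: prod_eq_iff)
    assume const: "\<forall>s. k s = k 0"
    show "parallel_endo X N \<epsilon> (\<lambda>s. fst (\<Gamma> s)) (\<lambda>s. snd (\<Gamma> s))"
      unfolding parallel_endo_def
    proof (intro conjI allI impI ballI)
      show "smooth_curve (charts X) UNIV \<epsilon> (\<lambda>s. fst (\<Gamma> s))" using \<gamma>(1) by (simp add: \<Gamma>_def)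
      show "smooth_curve EC ET \<epsilon> (\<lambda>s. (fst (\<Gamma> s), snd (\<Gamma> s)))" using \<Gamma>ET by simp
      fix T \<sigma> r assume T: "open T \<and> T \<subseteq> {-\<epsilon><..<\<epsilon>} \<and> smooth_along X T (\<lambda>s. fst (\<Gamma> s)) \<sigma>" and r: "r \<in> T"
      have r\<epsilon>: "\<bar>r\<bar> < \<epsilon>" using T r I by blast
      have al: "smooth_along X T \<gamma> \<sigma>" using T by (simp add: \<Gamma>_def)
      have \<sigma>in: "\<sigma> s \<in> fibre X (\<gamma> s)" if "s \<in> T" for s using al that unfolding smooth_along_def by blast
      have "\<forall>(V, \<phi>)\<in>trivs X. \<gamma> r \<in> V \<longrightarrow> (\<exists>\<delta>>0. \<gamma> ` ball r \<delta> \<subseteq> V \<and>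
          smooth_on (ball r \<delta>) (\<lambda>\<tau>. inv (\<phi> (\<gamma> \<tau>)) (\<sigma> \<tau>)))"
        using al r unfolding smooth_along_def by blast
      from bspec[OF this t(1)] \<gamma>(4)[OF r\<epsilon>] obtain \<delta>1 where \<delta>1: "\<delta>1 > 0" "\<gamma> ` ball r \<delta>1 \<subseteq> V"
        "smooth_on (ball r \<delta>1) (\<lambda>\<tau>. inv (\<phi> (\<gamma> \<tau>)) (\<sigma> \<tau>))" by auto
      obtain \<delta>2 where \<delta>2: "\<delta>2 > 0" "ball r \<delta>2 \<subseteq> T" using T r open_contains_ball by metis
      define \<delta> where "\<delta> = min \<delta>1 \<delta>2"
      define h where "h = (\<lambda>\<tau>. inv (\<phi> (\<gamma> \<tau>)) (\<sigma> \<tau>))"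
      define h' where "h' = vector_derivative h (at r)"
      have dh: "(h has_vector_derivative h') (at r)"
        unfolding h'_def h_def by (rule smooth_on_has_vector_derivative[OF \<delta>1(3)]) (use \<delta>1 in auto)
      have loc: "\<gamma> s \<in> V \<and> \<sigma> s = \<phi> (\<gamma> s) (h s)" if s: "s \<in> ball r \<delta>" for s
      proof -
        have sT: "s \<in> T" and sV: "\<gamma> s \<in> V" using s \<delta>1(2) \<delta>2(2) by (auto simp: \<delta>_def image_subset_iff)
        show ?thesis using frame_at.f_fi[OF frame_atI[OF t(1) sV] \<sigma>in[OF sT]] sV by (simp add: h_def)
      qed
      have \<delta>: "\<delta> > 0" using \<delta>1 \<delta>2 by (simp add: \<delta>_def)
      have 1: "cov_along X N \<gamma> \<sigma> r = \<phi> (\<gamma> r) (h' + \<Theta> r (h r))"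
        unfolding \<Theta>_def by (rule cov_along_frame[OF conn t(1) \<gamma>(1) r\<epsilon> \<delta> loc dh])
      have keq: "k = (\<lambda>s. k 0)" using const by auto
      have "(k has_vector_derivative 0) (at r)" by (subst keq) simp
      from d\<kappa>[OF r\<epsilon> this] have d: "(\<kappa> has_vector_derivative (\<kappa> r o\<^sub>L \<Theta> r) - (\<Theta> r o\<^sub>L \<kappa> r)) (at r)"
        by (simp add: blinfun_compose_simps)
      have d\<kappa>h: "((\<lambda>s. \<kappa> s (h s)) has_vector_derivative (\<kappa> r h' + ((\<kappa> r o\<^sub>L \<Theta> r) - (\<Theta> r o\<^sub>L \<kappa> r)) (h r))) (at r)"
        by (rule bounded_bilinear.has_vector_derivative[OF bounded_bilinear_blinfun_apply d dh])
      interpret frame_at X V \<phi> "\<gamma> r" by (rule frame_atI[OF t(1) \<gamma>(4)[OF r\<epsilon>]])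
      have "cov_along X N \<gamma> (\<lambda>s. of_frame X \<phi> (\<gamma> s) (\<kappa> s) (\<sigma> s)) r =
          \<phi> (\<gamma> r) ((\<kappa> r h' + ((\<kappa> r o\<^sub>L \<Theta> r) - (\<Theta> r o\<^sub>L \<kappa> r)) (h r)) + \<Theta> r (\<kappa> r (h r)))"
        unfolding \<Theta>_def
      proof (rule cov_along_frame[OF conn t(1) \<gamma>(1) r\<epsilon> \<delta> _ d\<kappa>h[unfolded \<Theta>_def]])
        fix s assume s: "s \<in> ball r \<delta>"
        show "\<gamma> s \<in> V \<and> of_frame X \<phi> (\<gamma> s) (\<kappa> s) (\<sigma> s) = \<phi> (\<gamma> s) (\<kappa> s (h s))"
          using loc[OF s] frame_at.of_frame_apply[OF frame_atI[OF t(1)], of "\<gamma> s"] by simp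
      qed
      also have "\<dots> = \<phi> (\<gamma> r) (\<kappa> r (h' + \<Theta> r (h r)))"
        by (simp add: blinfun.diff_left blinfun.add_right)
      also have "\<dots> = of_frame X \<phi> (\<gamma> r) (\<kappa> r) (cov_along X N \<gamma> \<sigma> r)"
        unfolding 1 of_frame_apply ..
      finally show "cov_along X N (\<lambda>s. fst (\<Gamma> s)) (\<lambda>\<tau>. snd (\<Gamma> \<tau>) (\<sigma> \<tau>)) r =
          snd (\<Gamma> r) (cov_along X N (\<lambda>s. fst (\<Gamma> s)) \<sigma> r)"
        by (simp add: \<Gamma>_def)
    qed
  qed
qed

lemma hlift_coords:
  assumes t: "(V, \<phi>) \<in> trivs X" "x \<in> V" and c: "c \<in> charts X" "x \<in> fst c"
    and K: "(x, K) \<in> TW" and v: "v \<in> tangent_space (charts X) UNIV x"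
  shows "hlift X N (x, K) v \<in> tangent_space EC TW (x, K)"
    "hlift X N (x, K) v (end_chart X c (V, \<phi>)) =
      (v c, (to_frame \<phi> x K o\<^sub>L conn_mat \<phi> N x v) - (conn_mat \<phi> N x v o\<^sub>L to_frame \<phi> x K))"
proof -
  interpret frame_at X V \<phi> x by (rule frame_atI[OF t])
  let ?k = "to_frame \<phi> x K" and ?d = "end_chart X c (V, \<phi>)"
  have KE: "K \<in> End_fibre X x" and ko: "orth_cstr (gram X \<phi> x) ?k" using K by (auto simp: twistor_frame)
  obtain \<Gamma> \<epsilon> where \<Gamma>: "\<epsilon> > 0" "smooth_curve EC TW \<epsilon> \<Gamma>" "\<Gamma> 0 = (x, of_frame X \<phi> x ?k)"
    "velocity (charts X) (\<lambda>s. fst (\<Gamma> s)) 0 = v"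
    "velocity EC \<Gamma> 0 ?d = (v c, 0 + (?k o\<^sub>L conn_mat \<phi> N x v) - (conn_mat \<phi> N x v o\<^sub>L ?k))"
    "(\<forall>s::real. ?k = ?k) \<Longrightarrow> parallel_endo X N \<epsilon> (\<lambda>s. fst (\<Gamma> s)) (\<lambda>s. snd (\<Gamma> s))"
    by (rule transported_curve[OF t c v, of "\<lambda>s. ?k" 0]) (auto simp: smooth_on_const ko)
  have \<Gamma>0: "\<Gamma> 0 = (x, K)" using \<Gamma>(3) by (simp add: of_frame_to_frame[OF KE])
  have p: "(x, K) \<in> ET" "?d \<in> EC" "(x, K) \<in> fst ?d" using KE c t end_chart_EC by (auto simp: End_total_def)
  have vT: "velocity EC \<Gamma> 0 \<in> tangent_space EC TW (x, K)" by (rule tangent_spaceI[OF \<Gamma>(1,2) \<Gamma>0])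
  have "hlift X N (x, K) v = velocity EC \<Gamma> 0"
    unfolding hlift_def
  proof (rule the_equality)
    show "\<exists>\<epsilon> \<gamma> L. \<epsilon> > 0 \<and> parallel_endo X N \<epsilon> \<gamma> L \<and> (\<gamma> 0, L 0) = (x, K) \<and>
        velocity (charts X) \<gamma> 0 = v \<and> velocity EC \<Gamma> 0 = velocity EC (\<lambda>t. (\<gamma> t, L t)) 0"
      using \<Gamma>(1,4,6) \<Gamma>0 by (intro exI[of _ \<epsilon>] exI[of _ "\<lambda>s. fst (\<Gamma> s)"] exI[of _ "\<lambda>s. snd (\<Gamma> s)"]) simp
    fix w assume "\<exists>\<epsilon> \<gamma> L. \<epsilon> > 0 \<and> parallel_endo X N \<epsilon> \<gamma> L \<and> (\<gamma> 0, L 0) = (x, K) \<and>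
        velocity (charts X) \<gamma> 0 = v \<and> w = velocity EC (\<lambda>t. (\<gamma> t, L t)) 0"
    then obtain \<epsilon>' \<gamma> L where w: "\<epsilon>' > 0" "parallel_endo X N \<epsilon>' \<gamma> L" "\<gamma> 0 = x" "L 0 = K"
        "velocity (charts X) \<gamma> 0 = v" "w = velocity EC (\<lambda>t. (\<gamma> t, L t)) 0" by auto
    have sc: "smooth_curve EC ET \<epsilon>' (\<lambda>t. (\<gamma> t, L t))" using w(2) unfolding parallel_endo_def by blast
    have eq: "w ?d = velocity EC \<Gamma> 0 ?d"
      using parallel_endo_derivative[OF conn w(2,1) t(1) _ c(1)] t c w by (simp add: \<Gamma>(5))
    show "w = velocity EC \<Gamma> 0"
      by (rule tangent_space_eqI[OF atlas_on_ET p])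
        (use eq tangent_spaceI[OF w(1) sc] w tangent_space_mono[OF TW_ET] vT in auto)
  qed
  then show "hlift X N (x, K) v \<in> tangent_space EC TW (x, K)"
    "hlift X N (x, K) v ?d = (v c, (?k o\<^sub>L conn_mat \<phi> N x v) - (conn_mat \<phi> N x v o\<^sub>L ?k))"
    using vT \<Gamma>(5) by auto
qed

end

end

lemma smooth_map_cong:
  assumes "smooth_map A S A' S' f" "\<And>p. p \<in> S \<Longrightarrow> f p = g p"
  shows "smooth_map A S A' S' g"
proof (rule smooth_mapI)
  show "g ` S \<subseteq> S'" using assms unfolding smooth_map_def by (metis (no_types, lifting) image_cong)
  fix p c c' assume p: "p \<in> S" "c \<in> A" "c' \<in> A'" "p \<in> fst c" "g p \<in> fst c'"
  obtain W F where W: "open W" "snd c p \<in> W" "smooth_on W F"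
    "\<And>q. q \<in> S \<Longrightarrow> q \<in> fst c \<Longrightarrow> snd c q \<in> W \<Longrightarrow> f q \<in> fst c' \<and> snd c' (f q) = F (snd c q)"
    by (rule smooth_mapE[OF assms(1) p(1-4)]) (use p assms(2) in auto)
  show "\<exists>W F. open W \<and> snd c p \<in> W \<and> smooth_on W F \<and>
        (\<forall>q\<in>S \<inter> fst c. snd c q \<in> W \<longrightarrow> g q \<in> fst c' \<and> snd c' (g q) = F (snd c q))"
    by (rule exI[of _ W], rule exI[of _ F]) (use W assms(2) in auto)
qed

context skew_deformation
begin

text \<open>The inverse of \<open>exp(- g\<^sup>-\<^sup>1 B)\<close> is \<open>exp(g\<^sup>-\<^sup>1 B)\<close>; correspondingly the twist by \<open>-b\<close> at the deformed
  structure inverts the twist by \<open>b\<close>.\<close>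

lemma deform_inverse:
  assumes k: "orth_cstr L k"
  shows "deform J (- b) (deform J b k) = k"
proof -
  let ?A = "twist J b k" and ?k' = "deform J b k"
  let ?A' = "twist J (- b) ?k'"
  note inv = blinfun_inv[OF twist_invertible[OF k]]
  have kk: "k o\<^sub>L k = - id_blinfun" using k by (simp add: orth_cstr_def)
  have "?A' o\<^sub>L ?A = ?A + (b o\<^sub>L ?A) - (J o\<^sub>L (b o\<^sub>L (?k' o\<^sub>L ?A)))"
    by (simp add: twist_def[of J "- b"] blinfun_compose_simps blinfun_compose_assoc)
  also have "\<dots> = id_blinfun"
    unfolding deform_twist[OF k]
    by (simp add: twist_def blinfun_compose_simps blinfun_compose_assoc kk b_J J_J
        b_J[THEN blinfun_compose_assoc_eq] J_J[THEN blinfun_compose_assoc_eq])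
  finally have A'A: "?A' o\<^sub>L ?A = id_blinfun" .
  have "?A' o\<^sub>L (?A o\<^sub>L blinfun_inv ?A) = blinfun_inv ?A"
    by (simp only: blinfun_compose_assoc[symmetric] A'A blinfun_compose_id)
  then have A': "?A' = blinfun_inv ?A" by (simp only: inv blinfun_compose_id)
  have "blinfun_invertible ?A'" unfolding blinfun_invertible_def A' using inv by blast
  note inv' = blinfun_inv[OF this]
  have "(blinfun_inv ?A' o\<^sub>L ?A') o\<^sub>L ?A = ?A"
    by (simp only: inv'(1) blinfun_compose_id)
  then have "blinfun_inv ?A' = ?A" by (simp only: blinfun_compose_assoc A'A blinfun_compose_id)
  then have "deform J (- b) ?k' = blinfun_inv ?A o\<^sub>L (?k' o\<^sub>L ?A)"
    by (simp add: deform_def[of J "- b"] A')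
  also have "\<dots> = k" unfolding deform_twist[OF k]
    by (simp only: blinfun_compose_assoc[symmetric] inv blinfun_compose_id)
  finally show ?thesis .
qed

end

context frame_at
begin

lemma vertical_frame:
  assumes K: "(x, K) \<in> twistor_space X"
  shows "A \<in> vertical_space X (x, K) \<longleftrightarrow> A \<in> End_fibre X x \<and>
    (\<forall>u v. gram X \<phi> x (to_frame \<phi> x A u) \<bullet> v = - (gram X \<phi> x u \<bullet> to_frame \<phi> x A v)) \<and>
    (to_frame \<phi> x A o\<^sub>L to_frame \<phi> x K) + (to_frame \<phi> x K o\<^sub>L to_frame \<phi> x A) = 0"
proof (cases "A \<in> End_fibre X x")
  case True
  have KE: "K \<in> End_fibre X x" using K by (simp add: twistor_space_def)
  have "(\<forall>u\<in>fibre X x. \<forall>v\<in>fibre X x. metric X x (A u) v = - metric X x u (A v)) \<longleftrightarrow>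
    (\<forall>a c. metric X x (A (f a)) (f c) = - metric X x (f a) (A (f c)))"
    using fibreE f_in by metis
  moreover have "(\<forall>u\<in>fibre X x. A (K u) + K (A u) = 0) \<longleftrightarrow> (\<forall>a. A (K (f a)) + K (A (f a)) = 0)"
    using fibreE f_in by metis
  moreover have "A (K (f a)) + K (A (f a)) =
      f (((to_frame \<phi> x A o\<^sub>L to_frame \<phi> x K) + (to_frame \<phi> x K o\<^sub>L to_frame \<phi> x A)) a)" for a
    by (simp add: blinfun.add_left f.add f_to_frame[OF True] f_to_frame[OF KE])
  moreover have "(\<forall>a. F a = 0) \<longleftrightarrow> F = 0" for F :: "(complex^'r) \<Rightarrow>\<^sub>L (complex^'r)"
    using blinfun_eqI[of F 0] by auto
  ultimately show ?thesis using True
    by (simp add: vertical_space_def gram_inner f_to_frame[OF True])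
qed (simp add: vertical_space_def)

end

section \<open>The almost complex structure of the twistor space\<close>

context herm_hol_bundle
begin

abbreviation "base_chart x \<equiv> chart_at (charts X) x"

text \<open>The chart at \<open>x\<close> in which all computations with tangent vectors are made.  Its trivialization is
  the one that the \<open>\<partial>\<close>-bar operators and the covariant derivative use at \<open>x\<close>.\<close>

definition main_chart :: "'m \<Rightarrow> ('m \<times> ('v \<Rightarrow> 'v), (complex^'n) \<times> ((complex^'r) \<Rightarrow>\<^sub>L (complex^'r))) chart" where
  "main_chart x = end_chart X (base_chart x) (dom_at X x, triv_at X x)"

definition base_vec :: "'m \<Rightarrow> complex^'n \<Rightarrow> ('m, complex^'n) tvec" where
  "base_vec x \<xi> = coord_vec (charts X) (base_chart x) \<xi> x"

lemma base_vec_tangent: "base_vec x \<xi> \<in> tangent_space (charts X) UNIV x"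
  and base_vec_coord: "base_vec x \<xi> (base_chart x) = \<xi>"
  unfolding base_vec_def using coord_vec_tangent chart_at by auto

lemma base_vec_eq: "v \<in> tangent_space (charts X) UNIV x \<Longrightarrow> base_vec x (v (base_chart x)) = v"
  unfolding base_vec_def by (rule tangent_vector_coord) (auto simp: chart_at)

lemma cI_base_vec: "cI (base_vec x \<xi>) = base_vec x (\<i> *s \<xi>)"
  using base_vec_eq[OF cI_tangent[OF base_vec_tangent, of x \<xi>]] by (simp add: cI_apply base_vec_coord)

lemma main_chart_TW: "(x, K) \<in> TW \<Longrightarrow> (x, K) \<in> fst (main_chart x)" "main_chart x \<in> EC"
  by (auto simp: main_chart_def chart_at triv_at twistor_space_def intro: end_chart_EC[OF chart_at(1) triv_at(1)])

text \<open>The vertical part of a tangent vector with coordinates \<open>q\<close>: what is left after its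
  horizontal part, which \<open>fst q\<close> determines, has been subtracted.\<close>

definition vert_coord :: "('m, 'v, 'n) conn \<Rightarrow> 'm \<Rightarrow> ('v \<Rightarrow> 'v) \<Rightarrow> (complex^'n) \<times> ((complex^'r) \<Rightarrow>\<^sub>L (complex^'r)) \<Rightarrow> (complex^'r) \<Rightarrow>\<^sub>L (complex^'r)" where
  "vert_coord N x K q = snd q + (conn_mat (triv_at X x) N x (base_vec x (fst q)) o\<^sub>L to_frame (triv_at X x) x K) -
    (to_frame (triv_at X x) x K o\<^sub>L conn_mat (triv_at X x) N x (base_vec x (fst q)))"

context
  fixes N assumes conn: "connection X N" and met: "metric_in_frames X N"
begin

lemma lift_coords:
  assumes K: "(x, K) \<in> TW" and A: "A \<in> vertical_space X (x, K)" and v: "v \<in> tangent_space (charts X) UNIV x"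
  shows "tadd (vert_vec X (x, K) A) (hlift X N (x, K) v) (main_chart x) =
    (v (base_chart x), to_frame (triv_at X x) x A + (to_frame (triv_at X x) x K o\<^sub>L conn_mat (triv_at X x) N x v) -
      (conn_mat (triv_at X x) N x v o\<^sub>L to_frame (triv_at X x) x K))"
    "tadd (vert_vec X (x, K) A) (hlift X N (x, K) v) \<in> tangent_space EC TW (x, K)"
proof -
  let ?\<phi> = "triv_at X x"
  interpret frame_at X "dom_at X x" ?\<phi> x by (rule frame_at_triv_at)
  have KE: "K \<in> End_fibre X x" and AE: "A \<in> End_fibre X x" and k: "orth_cstr (gram X ?\<phi> x) (to_frame ?\<phi> x K)"
    and a: "gram X ?\<phi> x (to_frame ?\<phi> x A u) \<bullet> v = - (gram X ?\<phi> x u \<bullet> to_frame ?\<phi> x A v)"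
      "(to_frame ?\<phi> x A o\<^sub>L to_frame ?\<phi> x K) + (to_frame ?\<phi> x K o\<^sub>L to_frame ?\<phi> x A) = 0" for u v
    using K A unfolding vertical_frame[OF K] by (auto simp: twistor_frame)
  note vc = vert_vec_coords[OF KE AE triv_at chart_at] and hc = hlift_coords[OF conn met triv_at chart_at K v]
  show 1: "tadd (vert_vec X (x, K) A) (hlift X N (x, K) v) (main_chart x) =
    (v (base_chart x), to_frame ?\<phi> x A + (to_frame ?\<phi> x K o\<^sub>L conn_mat ?\<phi> N x v) - (conn_mat ?\<phi> N x v o\<^sub>L to_frame ?\<phi> x K))"
    by (simp add: tadd_def main_chart_def vc hc)
  obtain \<kappa> :: "real \<Rightarrow> (complex^'r) \<Rightarrow>\<^sub>L (complex^'r)" where \<kappa>: "smooth_on UNIV \<kappa>"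
    "\<And>s. orth_cstr (gram X ?\<phi> x) (\<kappa> s)" "\<kappa> 0 = to_frame ?\<phi> x K"
    "(\<kappa> has_vector_derivative to_frame ?\<phi> x A) (at 0)"
    by (rule orth_cstr_curve[OF _ _ k a]) (simp_all add: gram_inner metric_sym metric_pos)
  obtain \<Gamma> \<epsilon> where \<Gamma>: "\<epsilon> > 0" "smooth_curve EC TW \<epsilon> \<Gamma>" "\<Gamma> 0 = (x, of_frame X ?\<phi> x (\<kappa> 0))"
    "velocity EC \<Gamma> 0 (main_chart x) = (v (base_chart x), to_frame ?\<phi> x A +
      (\<kappa> 0 o\<^sub>L conn_mat ?\<phi> N x v) - (conn_mat ?\<phi> N x v o\<^sub>L \<kappa> 0))"
    unfolding main_chart_def by (rule transported_curve[OF conn met triv_at chart_at v \<kappa>(1,2,4)])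
  have \<Gamma>0: "\<Gamma> 0 = (x, K)" using \<Gamma>(3) by (simp add: \<kappa>(3) of_frame_to_frame[OF KE])
  have vT: "velocity EC \<Gamma> 0 \<in> tangent_space EC TW (x, K)" by (rule tangent_spaceI[OF \<Gamma>(1,2) \<Gamma>0])
  have "velocity EC \<Gamma> 0 = tadd (vert_vec X (x, K) A) (hlift X N (x, K) v)"
  proof (rule tangent_space_taddI[OF atlas_on_ET _ main_chart_TW(2) main_chart_TW(1)[OF K]])
    show "velocity EC \<Gamma> 0 (main_chart x) =
        vert_vec X (x, K) A (main_chart x) + hlift X N (x, K) v (main_chart x)"
      unfolding \<Gamma>(4) 1[unfolded tadd_def] \<kappa>(3) ..
  qed (use K TW_ET vc(1) subsetD[OF tangent_space_mono[OF TW_ET] hc(1)] subsetD[OF tangent_space_mono[OF TW_ET] vT] in auto)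
  then show "tadd (vert_vec X (x, K) A) (hlift X N (x, K) v) \<in> tangent_space EC TW (x, K)" using vT by simp
qed

text \<open>Differentiating \<open>k\<^sup>2 = -1\<close> and the orthogonality of \<open>k\<close> along a curve in the twistor space.  The
  derivative of the Gram matrix, expressed by the connection, supplies the terms that turn the
  derivative of \<open>k\<close> into the covariant one.\<close>

lemma twistor_tangent_vertical:
  assumes K: "(x, K) \<in> TW" and w: "w \<in> tangent_space EC TW (x, K)"
  shows "of_frame X (triv_at X x) x (vert_coord N x K (w (main_chart x))) \<in> vertical_space X (x, K)"
proof -
  let ?\<phi> = "triv_at X x"
  interpret frame_at X "dom_at X x" ?\<phi> x by (rule frame_at_triv_at)
  obtain \<Gamma> \<epsilon> where \<Gamma>: "\<epsilon> > 0" "smooth_curve EC TW \<epsilon> \<Gamma>" "\<Gamma> 0 = (x, K)" "w = velocity EC \<Gamma> 0"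
    by (rule tangent_spaceE[OF w])
  have \<Gamma>E: "smooth_curve EC ET \<epsilon> \<Gamma>" by (rule smooth_curve_subset[OF \<Gamma>(2) TW_ET])
  define \<gamma> where "\<gamma> = fst \<circ> \<Gamma>"
  have \<gamma>: "smooth_curve (charts X) UNIV \<epsilon> \<gamma>" "\<gamma> 0 = x" using fst_curve[OF \<Gamma>E] \<Gamma>(3) by (auto simp: \<gamma>_def)
  define k where "k = (\<lambda>t. to_frame ?\<phi> (fst (\<Gamma> t)) (snd (\<Gamma> t)))"
  define \<kappa> where "\<kappa> = snd (w (main_chart x))"
  have dk: "(k has_vector_derivative \<kappa>) (at 0)"
    unfolding k_def \<kappa>_def \<Gamma>(4) main_chart_def
    by (rule end_curve_velocity(1)[OF \<Gamma>E \<Gamma>(1) chart_at(1) _ triv_at(1)]) (use \<Gamma>(3) chart_at triv_at in auto)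
  have "fst (w (main_chart x)) = velocity (charts X) \<gamma> 0 (base_chart x)"
    unfolding \<Gamma>(4) main_chart_def \<gamma>_def
    by (rule end_curve_velocity(2)[OF \<Gamma>E \<Gamma>(1) chart_at(1) _ triv_at(1)]) (use \<Gamma>(3) chart_at triv_at in auto)
  moreover have vT: "velocity (charts X) \<gamma> 0 \<in> tangent_space (charts X) UNIV x"
    using velocity_in_tangent_space[OF \<gamma>(1), of 0] \<Gamma>(1) \<gamma>(2) by simp
  ultimately have v: "base_vec x (fst (w (main_chart x))) = velocity (charts X) \<gamma> 0"
    using base_vec_eq by simp
  define \<theta> where "\<theta> = conn_mat ?\<phi> N x (velocity (charts X) \<gamma> 0)"
  have k0: "k 0 = to_frame ?\<phi> x K" by (simp add: k_def \<Gamma>(3))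
  have a: "vert_coord N x K (w (main_chart x)) = \<kappa> + (\<theta> o\<^sub>L k 0) - (k 0 o\<^sub>L \<theta>)"
    by (simp add: vert_coord_def \<kappa>_def v \<theta>_def k0)
  obtain \<delta> where \<delta>: "\<delta> > 0" "\<bar>0\<bar> + \<delta> \<le> \<epsilon>" "\<gamma> ` ball 0 \<delta> \<subseteq> dom_at X x"
    by (rule curve_continuous[OF \<gamma>(1) _ triv_open[OF triv_at(1)], of 0 x]) (use \<Gamma>(1) \<gamma>(2) triv_at in auto)
  have ko: "orth_cstr (gram X ?\<phi> (\<gamma> s)) (k s)" if s: "s \<in> ball 0 \<delta>" for s
  proof -
    interpret s: frame_at X "dom_at X x" ?\<phi> "\<gamma> s" by (rule frame_atI[OF triv_at(1)]) (use \<delta>(3) s in auto)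
    have "\<bar>s\<bar> < \<epsilon>" using s \<delta>(2) by simp
    then have "\<Gamma> s \<in> TW" by (rule smooth_curve_mem[OF \<Gamma>(2)])
    then show ?thesis using s.twistor_frame[of "snd (\<Gamma> s)"] by (simp add: \<gamma>_def k_def)
  qed
  have ko0: "orth_cstr (gram X ?\<phi> x) (k 0)" using ko[of 0] \<delta>(1) \<gamma>(2) by simp
  have kk: "k 0 o\<^sub>L k 0 = - id_blinfun" using ko0 by (simp add: orth_cstr_def)
  have "((\<lambda>s. k s o\<^sub>L k s) has_vector_derivative ((k 0 o\<^sub>L \<kappa>) + (\<kappa> o\<^sub>L k 0))) (at 0)"
    by (rule has_vector_derivative_blinfun_compose[OF dk dk])
  then have "((\<lambda>s. - id_blinfun) has_vector_derivative ((k 0 o\<^sub>L \<kappa>) + (\<kappa> o\<^sub>L k 0))) (at 0)"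
    by (rule has_vector_derivative_transform_within_open[OF _ open_ball[of 0 \<delta>]])
      (use \<delta> ko in \<open>auto simp: orth_cstr_def\<close>)
  then have k\<kappa>: "(k 0 o\<^sub>L \<kappa>) + (\<kappa> o\<^sub>L k 0) = 0"
    using vector_derivative_unique_at[OF _ has_vector_derivative_const] by blast
  let ?a = "\<kappa> + (\<theta> o\<^sub>L k 0) - (k 0 o\<^sub>L \<theta>)"
  have "(?a o\<^sub>L k 0) + (k 0 o\<^sub>L ?a) = (k 0 o\<^sub>L \<kappa>) + (\<kappa> o\<^sub>L k 0)"
    by (simp add: blinfun_compose_simps blinfun_compose_assoc kk kk[THEN blinfun_compose_assoc_eq])
  then have anti: "(?a o\<^sub>L k 0) + (k 0 o\<^sub>L ?a) = 0" using k\<kappa> by simp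
  let ?G = "gram X ?\<phi>" and ?dG = "dfun (charts X) (gram X ?\<phi>) x (velocity (charts X) \<gamma> 0)"
  have dG: "((?G \<circ> \<gamma>) has_vector_derivative ?dG) (at 0)"
    using dfun_along[OF triv_open[OF triv_at(1)] gram_smooth[OF triv_at(1)] \<gamma>(1), of 0 x] \<Gamma>(1) \<gamma>(2) triv_at by simp
  have deriv: "?G x (k 0 u) \<bullet> \<kappa> q + (?G x (\<kappa> u) + ?dG (k 0 u)) \<bullet> k 0 q = ?dG u \<bullet> q" for u q
  proof -
    have dku: "((\<lambda>s. k s u) has_vector_derivative \<kappa> u) (at 0)" for u
      by (rule bounded_linear.has_vector_derivative[OF blinfun.bounded_linear_left dk])
    have "((\<lambda>s. (?G \<circ> \<gamma>) s (k s u) \<bullet> k s q) has_vector_derivative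
        ((?G \<circ> \<gamma>) 0 (k 0 u) \<bullet> \<kappa> q + ((?G \<circ> \<gamma>) 0 (\<kappa> u) + ?dG (k 0 u)) \<bullet> k 0 q)) (at 0)"
      by (intro bounded_bilinear.has_vector_derivative[OF bounded_bilinear_inner]
          bounded_bilinear.has_vector_derivative[OF bounded_bilinear_blinfun_apply] dG dku)
    then have 1: "((\<lambda>s. (?G \<circ> \<gamma>) s u \<bullet> q) has_vector_derivative
        (?G x (k 0 u) \<bullet> \<kappa> q + (?G x (\<kappa> u) + ?dG (k 0 u)) \<bullet> k 0 q)) (at 0)"
      unfolding comp_apply \<gamma>(2)
      by (rule has_vector_derivative_transform_within_open[OF _ open_ball[of 0 \<delta>]])
        (use \<delta> ko in \<open>auto simp: orth_cstr_def\<close>)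
    have "((\<lambda>s. (?G \<circ> \<gamma>) s u \<bullet> q) has_vector_derivative ?dG u \<bullet> q) (at 0)"
      by (rule bounded_linear.has_vector_derivative[OF bounded_linear_inner_left
          bounded_linear.has_vector_derivative[OF blinfun.bounded_linear_left dG]])
    from vector_derivative_unique_at[OF 1 this] show ?thesis .
  qed
  have iso: "?G x (k 0 u) \<bullet> k 0 q = ?G x u \<bullet> q" for u q using ko0 by (simp add: orth_cstr_def)
  note gd = gram_deriv[OF met triv_at vT, folded \<theta>_def]
  have ak: "?G x (?a u) \<bullet> k 0 q = - (?G x (k 0 u) \<bullet> ?a q)" for u q
    using deriv[of u q] iso[of "\<theta> u" q] iso[of u "\<theta> q"]
    by (simp add: blinfun.add_left blinfun.diff_left blinfun.add_right blinfun.diff_right inner_add_left inner_add_right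
        inner_diff_left inner_diff_right gd)
  have akk: "?a (k 0 q) = - k 0 (?a q)" for q
    using arg_cong[OF anti, of "\<lambda>F. blinfun_apply F q"] by (simp add: blinfun.add_left eq_neg_iff_add_eq_0)
  have "?G x (?a u) \<bullet> q = - (?G x u \<bullet> ?a q)" for u q
  proof -
    have "?G x (?a u) \<bullet> q = - (?G x (?a u) \<bullet> k 0 (k 0 q))" by (simp add: orth_cstr_apply[OF ko0])
    also have "\<dots> = ?G x (k 0 u) \<bullet> ?a (k 0 q)" by (simp only: ak minus_minus)
    also have "\<dots> = - (?G x u \<bullet> ?a q)" unfolding akk by (simp only: inner_minus_right iso)
    finally show ?thesis .
  qed
  then show ?thesis
    unfolding vertical_frame[OF K] a using anti by (simp add: of_frame_End to_frame_of_frame k0)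
qed

lemma twistor_tangent_split:
  assumes K: "(x, K) \<in> TW" and w: "w \<in> tangent_space EC TW (x, K)"
  shows "w = tadd (vert_vec X (x, K) (of_frame X (triv_at X x) x (vert_coord N x K (w (main_chart x)))))
    (hlift X N (x, K) (base_vec x (fst (w (main_chart x)))))"
proof -
  let ?\<phi> = "triv_at X x"
  interpret frame_at X "dom_at X x" ?\<phi> x by (rule frame_at_triv_at)
  note l = lift_coords[OF K twistor_tangent_vertical[OF K w] base_vec_tangent]
  show ?thesis
    by (rule tangent_space_eqI[OF atlas_on_TW K main_chart_TW(2) main_chart_TW(1)[OF K] w l(2)])
      (unfold l(1), simp add: base_vec_coord to_frame_of_frame vert_coord_def prod_eq_iff)
qed

context
  assumes holo: "holo_in_frames X N"
begin

lemma conn_mat_cI: "conn_mat (triv_at X x) N x (base_vec x (\<i> *s \<xi>)) = mul_i o\<^sub>L conn_mat (triv_at X x) N x (base_vec x \<xi>)"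
  using holo base_vec_tangent unfolding holo_in_frames_def cI_base_vec[symmetric] by blast

text \<open>The decomposition into a vertical and a horizontal vector is unique: the base component gives
  \<open>v\<close>, and subtracting the horizontal lift gives \<open>A\<close>.\<close>

lemma twistor_J_coords:
  assumes K: "(x, K) \<in> TW" and w: "w \<in> tangent_space EC TW (x, K)"
  defines "k \<equiv> to_frame (triv_at X x) x K"
    and "\<theta> \<equiv> conn_mat (triv_at X x) N x (base_vec x (fst (w (main_chart x))))"
  shows "twistor_J X N (x, K) w \<in> tangent_space EC TW (x, K)"
    "twistor_J X N (x, K) w (main_chart x) = (\<i> *s fst (w (main_chart x)),
      (k o\<^sub>L vert_coord N x K (w (main_chart x))) + (k o\<^sub>L (mul_i o\<^sub>L \<theta>)) - ((mul_i o\<^sub>L \<theta>) o\<^sub>L k))"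
proof -
  let ?\<phi> = "triv_at X x" and ?d = "main_chart x"
  interpret frame_at X "dom_at X x" ?\<phi> x by (rule frame_at_triv_at)
  define a where "a = vert_coord N x K (w ?d)"
  define A where "A = of_frame X ?\<phi> x a"
  define \<xi> where "\<xi> = fst (w ?d)"
  have KE: "K \<in> End_fibre X x" and ko: "orth_cstr (gram X ?\<phi> x) k" using K by (auto simp: twistor_frame k_def)
  have AV: "A \<in> vertical_space X (x, K)" unfolding A_def a_def by (rule twistor_tangent_vertical[OF K w])
  then have a: "gram X ?\<phi> x (a u) \<bullet> v = - (gram X ?\<phi> x u \<bullet> a v)" "(a o\<^sub>L k) + (k o\<^sub>L a) = 0" for u v
    unfolding vertical_frame[OF K] by (auto simp: A_def to_frame_of_frame k_def)
  have split: "w = tadd (vert_vec X (x, K) A) (hlift X N (x, K) (base_vec x \<xi>))"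
    unfolding A_def a_def \<xi>_def by (rule twistor_tangent_split[OF K w])
  let ?KA = "compose (fibre X x) K A"
  have KA: "?KA = of_frame X ?\<phi> x (k o\<^sub>L a)"
    by (auto simp: fun_eq_iff compose_def of_frame_def A_def k_def f_to_frame[OF KE] restrict_def)
  have akk: "a (k q) = - k (a q)" for q
    using arg_cong[OF a(2), of "\<lambda>F. blinfun_apply F q"] by (simp add: blinfun.add_left eq_neg_iff_add_eq_0)
  have KAV: "?KA \<in> vertical_space X (x, K)"
    unfolding vertical_frame[OF K]
  proof (intro conjI allI)
    show "?KA \<in> End_fibre X x" unfolding KA by (rule of_frame_End)
    have iso: "gram X ?\<phi> x (k u) \<bullet> k q = gram X ?\<phi> x u \<bullet> q" for u q using ko by (simp add: orth_cstr_def)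
    have ksk: "gram X ?\<phi> x (k u) \<bullet> v = - (gram X ?\<phi> x u \<bullet> k v)" for u v
      using iso[of u "k v"] by (simp add: orth_cstr_apply[OF ko])
    show "gram X ?\<phi> x (to_frame ?\<phi> x ?KA u) \<bullet> v = - (gram X ?\<phi> x u \<bullet> to_frame ?\<phi> x ?KA v)" for u v
      by (simp add: KA to_frame_of_frame ksk a(1) akk)
    have "(a o\<^sub>L k) = - (k o\<^sub>L a)" using a(2) by (simp add: eq_neg_iff_add_eq_0)
    then show "(to_frame ?\<phi> x ?KA o\<^sub>L to_frame ?\<phi> x K) + (to_frame ?\<phi> x K o\<^sub>L to_frame ?\<phi> x ?KA) = 0"
      by (simp add: KA to_frame_of_frame k_def[symmetric] blinfun_compose_simps blinfun_compose_assoc)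
  qed
  let ?Jw = "tadd (vert_vec X (x, K) ?KA) (hlift X N (x, K) (cI (base_vec x \<xi>)))"
  have J: "twistor_J X N (x, K) w = ?Jw"
    unfolding twistor_J_def fst_conv snd_conv
  proof (rule the_equality)
    show "\<exists>A\<in>vertical_space X (x, K). \<exists>v\<in>tangent_space (charts X) UNIV x.
        w = tadd (vert_vec X (x, K) A) (hlift X N (x, K) v) \<and>
        ?Jw = tadd (vert_vec X (x, K) (compose (fibre X x) K A)) (hlift X N (x, K) (cI v))"
      using AV base_vec_tangent split by blast
    fix w' assume "\<exists>A\<in>vertical_space X (x, K). \<exists>v\<in>tangent_space (charts X) UNIV x.
        w = tadd (vert_vec X (x, K) A) (hlift X N (x, K) v) \<and>
        w' = tadd (vert_vec X (x, K) (compose (fibre X x) K A)) (hlift X N (x, K) (cI v))"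
    then obtain A' v where A': "A' \<in> vertical_space X (x, K)" and v: "v \<in> tangent_space (charts X) UNIV x"
      and w1: "w = tadd (vert_vec X (x, K) A') (hlift X N (x, K) v)"
      and w2: "w' = tadd (vert_vec X (x, K) (compose (fibre X x) K A')) (hlift X N (x, K) (cI v))" by blast
    note l = lift_coords(1)[OF K A' v, folded w1]
    have v\<xi>: "v = base_vec x \<xi>" using base_vec_eq[OF v] l by (simp add: \<xi>_def)
    have "to_frame ?\<phi> x A' = to_frame ?\<phi> x A"
      using l lift_coords(1)[OF K AV base_vec_tangent[of x \<xi>], folded split] by (simp add: v\<xi>)
    moreover have "A' \<in> End_fibre X x" "A \<in> End_fibre X x" using A' AV by (auto simp: vertical_frame[OF K])
    ultimately have "A' = A" using of_frame_to_frame by metis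
    then show "w' = ?Jw" using w2 v\<xi> by simp
  qed
  note l = lift_coords[OF K KAV cI_tangent[OF base_vec_tangent[of x \<xi>]]]
  show "twistor_J X N (x, K) w \<in> tangent_space EC TW (x, K)" unfolding J by (rule l(2))
  show "twistor_J X N (x, K) w ?d = (\<i> *s fst (w ?d), (k o\<^sub>L vert_coord N x K (w ?d)) + (k o\<^sub>L (mul_i o\<^sub>L \<theta>)) - ((mul_i o\<^sub>L \<theta>) o\<^sub>L k))"
    unfolding J l(1)
    by (simp add: cI_base_vec base_vec_coord conn_mat_cI KA to_frame_of_frame k_def \<theta>_def a_def \<xi>_def)
qed

lemma twistor_J_almost_complex: "almost_complex EC TW (twistor_J X N)"
  unfolding almost_complex_def
proof (intro ballI conjI)
  fix p w assume "p \<in> TW" and "w \<in> tangent_space EC TW p"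
  then obtain x K where p: "p = (x, K)" and K: "(x, K) \<in> TW" and w: "w \<in> tangent_space EC TW (x, K)"
    by (cases p) auto
  let ?\<phi> = "triv_at X x" and ?d = "main_chart x"
  interpret frame_at X "dom_at X x" ?\<phi> x by (rule frame_at_triv_at)
  define k where "k = to_frame ?\<phi> x K"
  have kk: "k o\<^sub>L k = - id_blinfun" using K by (simp add: twistor_frame k_def orth_cstr_def)
  have ii': "mul_i o\<^sub>L mul_i = (- id_blinfun :: (complex^'r) \<Rightarrow>\<^sub>L (complex^'r))"
    by (auto intro!: blinfun_eqI simp: ii uminus_blinfun.rep_eq)
  note J1 = twistor_J_coords[OF K w]
  note J2 = twistor_J_coords[OF K J1(1)]
  show "twistor_J X N p w \<in> tangent_space EC TW p" unfolding p by (rule J1(1))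
  have "\<i> *s (\<i> *s \<xi>) = - \<xi>" for \<xi> :: "complex^'n" by (simp add: vec_eq_iff)
  then have "twistor_J X N (x, K) (twistor_J X N (x, K) w) ?d = (- 1) *\<^sub>R w ?d"
    unfolding J2(2) J1(2)
    by (simp add: prod_eq_iff vert_coord_def conn_mat_cI k_def[symmetric] blinfun_compose_simps blinfun_compose_assoc
        kk kk[THEN blinfun_compose_assoc_eq] ii' ii'[THEN blinfun_compose_assoc_eq])
  then show "twistor_J X N p (twistor_J X N p w) = tscale (- 1) w"
    unfolding p
    by (rule tangent_space_tscaleI[OF atlas_on_TW K main_chart_TW(2) main_chart_TW(1)[OF K] J2(1) w])
qed

end

end

end

section \<open>The deformation is biholomorphic\<close>

context herm_hol_bundle
begin

context
  fixes B assumes B: "section_L2 X B"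
begin

lemma deform_map_curve: "smooth_curve EC TW \<epsilon> \<Gamma> \<Longrightarrow> smooth_curve EC TW \<epsilon> (deform_map B \<circ> \<Gamma>)"
  by (rule smooth_map_curve[OF fin_dim_end_chart deform_map_smooth[OF B]])
    (use atlas_on_TW in \<open>auto simp: atlas_on_def\<close>)

text \<open>The equation \<open>k' A = A k\<close> holds along the whole curve; differentiating it determines the
  velocity of \<open>k'\<close> without differentiating an inverse.\<close>

lemma deform_velocity:
  assumes \<Gamma>: "\<epsilon> > 0" "smooth_curve EC TW \<epsilon> \<Gamma>" "\<Gamma> 0 = (x, K)"
  defines "w \<equiv> velocity EC \<Gamma> 0 (main_chart x)"
    and "w' \<equiv> velocity EC (deform_map B \<circ> \<Gamma>) 0 (main_chart x)"
    and "b \<equiv> \<lambda>y. form_end X (triv_at X x) y (B y)"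
    and "k \<equiv> to_frame (triv_at X x) x K"
  defines "db \<equiv> dfun (charts X) b x (base_vec x (fst w))"
  shows "fst w' = fst w"
    "(snd w' o\<^sub>L twist mul_i (b x) k) + (deform mul_i (b x) k o\<^sub>L (- db + (mul_i o\<^sub>L ((db o\<^sub>L k) + (b x o\<^sub>L snd w))))) =
      snd w - (db o\<^sub>L k) - (b x o\<^sub>L snd w) - (mul_i o\<^sub>L db)"
proof -
  let ?\<phi> = "triv_at X x" and ?f = "deform_map B"
  have K: "(x, K) \<in> TW" using smooth_curve_mem[OF \<Gamma>(2), of 0] \<Gamma> by simp
  have \<Gamma>E: "smooth_curve EC ET \<epsilon> \<Gamma>" by (rule smooth_curve_subset[OF \<Gamma>(2) TW_ET])
  have f\<Gamma>E: "smooth_curve EC ET \<epsilon> (?f \<circ> \<Gamma>)" by (rule smooth_curve_subset[OF deform_map_curve[OF \<Gamma>(2)] TW_ET])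
  have ff: "fst (?f (\<Gamma> s)) = fst (\<Gamma> s)" for s by (simp add: deform_map_def induced_map_def case_prod_beta)
  define \<gamma> where "\<gamma> = fst \<circ> \<Gamma>"
  have \<gamma>: "smooth_curve (charts X) UNIV \<epsilon> \<gamma>" "\<gamma> 0 = x" using fst_curve[OF \<Gamma>E] \<Gamma>(3) by (auto simp: \<gamma>_def)
  define k1 where "k1 = (\<lambda>t. to_frame ?\<phi> (fst (\<Gamma> t)) (snd (\<Gamma> t)))"
  define k2 where "k2 = (\<lambda>t. to_frame ?\<phi> (fst ((?f \<circ> \<Gamma>) t)) (snd ((?f \<circ> \<Gamma>) t)))"
  have f0: "fst ((?f \<circ> \<Gamma>) 0) = x" using ff[of 0] \<Gamma>(3) by simp
  have dk1: "(k1 has_vector_derivative snd w) (at 0)"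
    unfolding k1_def w_def main_chart_def
    by (rule end_curve_velocity(1)[OF \<Gamma>E \<Gamma>(1) chart_at(1) _ triv_at(1)]) (use \<Gamma>(3) chart_at triv_at in auto)
  have dk2: "(k2 has_vector_derivative snd w') (at 0)"
    unfolding k2_def w'_def main_chart_def
    by (rule end_curve_velocity(1)[OF f\<Gamma>E \<Gamma>(1) chart_at(1) _ triv_at(1)]) (simp_all only: f0 chart_at triv_at)
  have w1: "fst w = velocity (charts X) \<gamma> 0 (base_chart x)"
    unfolding w_def main_chart_def \<gamma>_def
    by (rule end_curve_velocity(2)[OF \<Gamma>E \<Gamma>(1) chart_at(1) _ triv_at(1)]) (use \<Gamma>(3) chart_at triv_at in auto)
  have "fst w' = velocity (charts X) (fst \<circ> (?f \<circ> \<Gamma>)) 0 (base_chart x)"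
    unfolding w'_def main_chart_def
    by (rule end_curve_velocity(2)[OF f\<Gamma>E \<Gamma>(1) chart_at(1) _ triv_at(1)]) (simp_all only: f0 chart_at triv_at)
  then show "fst w' = fst w" by (simp add: w1 \<gamma>_def o_def ff)
  have vT: "velocity (charts X) \<gamma> 0 \<in> tangent_space (charts X) UNIV x"
    using velocity_in_tangent_space[OF \<gamma>(1), of 0] \<Gamma>(1) \<gamma>(2) by simp
  have v: "base_vec x (fst w) = velocity (charts X) \<gamma> 0" using base_vec_eq[OF vT] by (simp add: w1)
  have db: "((b \<circ> \<gamma>) has_vector_derivative db) (at 0)"
    using dfun_along[OF triv_open[OF triv_at(1)] form_end_smooth[OF B triv_at(1)] \<gamma>(1), of 0 x] \<Gamma>(1) \<gamma>(2) triv_at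
    unfolding db_def v b_def by simp
  obtain \<delta> where \<delta>: "\<delta> > 0" "\<bar>0\<bar> + \<delta> \<le> \<epsilon>" "\<gamma> ` ball 0 \<delta> \<subseteq> dom_at X x"
    by (rule curve_continuous[OF \<gamma>(1) _ triv_open[OF triv_at(1)], of 0 x]) (use \<Gamma>(1) \<gamma>(2) triv_at in auto)
  have rel: "k2 s = deform mul_i (b (\<gamma> s)) (k1 s) \<and> k2 s o\<^sub>L twist mul_i (b (\<gamma> s)) (k1 s) =
      k1 s - (b (\<gamma> s) o\<^sub>L k1 s) - (mul_i o\<^sub>L b (\<gamma> s))" if s: "s \<in> ball 0 \<delta>" for s
  proof -
    have g: "frame_at X (dom_at X x) ?\<phi> (\<gamma> s)" by (rule frame_atI[OF triv_at(1)]) (use \<delta>(3) s in auto)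
    interpret s: frame_at X "dom_at X x" ?\<phi> "\<gamma> s" by (rule g)
    interpret sd: skew_deformation "gram X ?\<phi> (\<gamma> s)" mul_i "b (\<gamma> s)"
      unfolding b_def by (rule s.skew_deformation_frame[OF B_alt[OF B]])
    have "\<bar>s\<bar> < \<epsilon>" using s \<delta>(2) by simp
    then have "\<Gamma> s \<in> TW" by (rule smooth_curve_mem[OF \<Gamma>(2)])
    then have \<Gamma>s: "(\<gamma> s, snd (\<Gamma> s)) \<in> TW" by (simp add: \<gamma>_def)
    have ko: "orth_cstr (gram X ?\<phi> (\<gamma> s)) (k1 s)"
      using \<Gamma>s s.twistor_frame[of "snd (\<Gamma> s)"] by (simp add: k1_def \<gamma>_def)
    have "k2 s = deform mul_i (b (\<gamma> s)) (k1 s)"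
      using to_frame_deform_map[OF B \<Gamma>s g] by (simp add: k2_def k1_def ff \<gamma>_def b_def)
    then show ?thesis using sd.deform_twist[OF ko] sd.twist_compose[OF ko] by simp
  qed
  have k10: "k1 0 = k" by (simp add: k1_def k_def \<Gamma>(3))
  have k20: "k2 0 = deform mul_i (b x) k" using rel[of 0] \<delta>(1) by (simp add: \<gamma>(2) k10)
  note c = has_vector_derivative_blinfun_compose
  have const: "((\<lambda>s. C) has_vector_derivative 0) (at 0)" for C :: "(complex^'r) \<Rightarrow>\<^sub>L (complex^'r)" by simp
  have dA: "((\<lambda>s. twist mul_i ((b \<circ> \<gamma>) s) (k1 s)) has_vector_derivative
      (0 - db + ((mul_i o\<^sub>L (((b \<circ> \<gamma>) 0 o\<^sub>L snd w) + (db o\<^sub>L k1 0))) + (0 o\<^sub>L ((b \<circ> \<gamma>) 0 o\<^sub>L k1 0))))) (at 0)"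
    unfolding twist_def
    by (intro has_vector_derivative_add has_vector_derivative_diff c const db dk1)
  have "((\<lambda>s. k2 s o\<^sub>L twist mul_i ((b \<circ> \<gamma>) s) (k1 s)) has_vector_derivative
      ((k2 0 o\<^sub>L (0 - db + ((mul_i o\<^sub>L (((b \<circ> \<gamma>) 0 o\<^sub>L snd w) + (db o\<^sub>L k1 0))) + (0 o\<^sub>L ((b \<circ> \<gamma>) 0 o\<^sub>L k1 0))))) +
       (snd w' o\<^sub>L twist mul_i ((b \<circ> \<gamma>) 0) (k1 0)))) (at 0)"
    by (rule c[OF dk2 dA])
  then have 1: "((\<lambda>s. k1 s - ((b \<circ> \<gamma>) s o\<^sub>L k1 s) - (mul_i o\<^sub>L (b \<circ> \<gamma>) s)) has_vector_derivative
      ((k2 0 o\<^sub>L (0 - db + ((mul_i o\<^sub>L (((b \<circ> \<gamma>) 0 o\<^sub>L snd w) + (db o\<^sub>L k1 0))) + (0 o\<^sub>L ((b \<circ> \<gamma>) 0 o\<^sub>L k1 0))))) +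
       (snd w' o\<^sub>L twist mul_i ((b \<circ> \<gamma>) 0) (k1 0)))) (at 0)"
    by (rule has_vector_derivative_transform_within_open[OF _ open_ball[of 0 \<delta>]]) (use \<delta>(1) rel[THEN conjunct2] in auto)
  have 2: "((\<lambda>s. k1 s - ((b \<circ> \<gamma>) s o\<^sub>L k1 s) - (mul_i o\<^sub>L (b \<circ> \<gamma>) s)) has_vector_derivative
      (snd w - (((b \<circ> \<gamma>) 0 o\<^sub>L snd w) + (db o\<^sub>L k1 0)) - ((mul_i o\<^sub>L db) + (0 o\<^sub>L (b \<circ> \<gamma>) 0)))) (at 0)"
    by (intro has_vector_derivative_diff c const db dk1)
  from vector_derivative_unique_at[OF 1 2]
  show "(snd w' o\<^sub>L twist mul_i (b x) k) + (deform mul_i (b x) k o\<^sub>L (- db + (mul_i o\<^sub>L ((db o\<^sub>L k) + (b x o\<^sub>L snd w))))) =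
      snd w - (db o\<^sub>L k) - (b x o\<^sub>L snd w) - (mul_i o\<^sub>L db)"
    by (simp add: \<gamma>(2) k10 k20 blinfun_compose_simps algebra_simps)
qed

text \<open>The tangent vector and its image under the almost complex structure are realized by two curves
  in the twistor space.  In \<open>main_chart x\<close> the claim for the velocities of their images is
  \<open>deformation_holomorphic_identity\<close>.\<close>

lemma deform_map_intertwines:
  assumes chern: "chern_connection X N_Ch"
    and N: "connection X N" "conn01_eq_plus X N N_Ch D"
    and N': "connection X N'" "conn01_eq_plus X N' N_Ch (\<lambda>x v a b. D x v a b + dbar_L2 X B x v a b)"
    and D: "section_form01_L2 X D"
    and p: "p \<in> TW" and w: "w \<in> tangent_space EC TW p"
  shows "differential EC TW EC (deform_map B) p (twistor_J X N p w) =
    twistor_J X N' (deform_map B p) (differential EC TW EC (deform_map B) p w)"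
proof -
  let ?f = "deform_map B"
  obtain x K where pK: "p = (x, K)" by (cases p)
  let ?\<phi> = "triv_at X x" and ?d = "main_chart x"
  interpret frame_at X "dom_at X x" ?\<phi> x by (rule frame_at_triv_at)
  have K: "(x, K) \<in> TW" and w: "w \<in> tangent_space EC TW (x, K)" using p w pK by auto
  have alt: "alt_form10 X y (D y v)" if "v \<in> tangent_space (charts X) UNIV y" for y v
    by (rule section_form01_alt[OF D that])
  have alt': "alt_form10 X y (\<lambda>a b. D y v a b + dbar_L2 X B y v a b)" if "v \<in> tangent_space (charts X) UNIV y" for y v
    by (rule alt_form_add[OF alt[OF that] dbar_L2_alt[OF B that]])
  note good = eq_plus_metric[OF N(1) chern N(2) alt] eq_plus_holo[OF N(1) chern N(2) alt]
  note good' = eq_plus_metric[OF N'(1) chern N'(2) alt'] eq_plus_holo[OF N'(1) chern N'(2) alt']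
  define b where "b = (\<lambda>y. form_end X ?\<phi> y (B y))"
  define k where "k = to_frame ?\<phi> x K"
  define \<xi> where "\<xi> = fst (w ?d)"
  define \<theta> where "\<theta> = conn_mat ?\<phi> N x (base_vec x \<xi>)"
  define \<theta>' where "\<theta>' = conn_mat ?\<phi> N' x (base_vec x \<xi>)"
  define db where "db = dfun (charts X) b x (base_vec x \<xi>)"
  define dbI where "dbI = dfun (charts X) b x (base_vec x (\<i> *s \<xi>))"
  interpret sd: skew_deformation "gram X ?\<phi> x" mul_i "b x"
    unfolding b_def by (rule skew_deformation_frame[OF B_alt[OF B]])
  have ko: "orth_cstr (gram X ?\<phi> x) k" using K by (simp add: twistor_frame k_def)
  note J = twistor_J_coords[OF N(1) good K w]
  obtain \<Gamma> \<epsilon> where \<Gamma>: "\<epsilon> > 0" "smooth_curve EC TW \<epsilon> \<Gamma>" "\<Gamma> 0 = (x, K)" "w = velocity EC \<Gamma> 0"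
    by (rule tangent_spaceE[OF w])
  obtain \<Gamma>2 \<epsilon>2 where \<Gamma>2: "\<epsilon>2 > 0" "smooth_curve EC TW \<epsilon>2 \<Gamma>2" "\<Gamma>2 0 = (x, K)" "twistor_J X N (x, K) w = velocity EC \<Gamma>2 0"
    by (rule tangent_spaceE[OF J(1)])
  have cov: "\<exists>d\<in>EC. (x, K) \<in> fst d" using main_chart_TW K by blast
  have d1: "differential EC TW EC ?f (x, K) w = velocity EC (?f \<circ> \<Gamma>) 0"
    unfolding \<Gamma>(4) by (rule differential_velocity[OF deform_map_smooth[OF B] K cov \<Gamma>(1-3)])
  have d2: "differential EC TW EC ?f (x, K) (twistor_J X N (x, K) w) = velocity EC (?f \<circ> \<Gamma>2) 0"
    unfolding \<Gamma>2(4) by (rule differential_velocity[OF deform_map_smooth[OF B] K cov \<Gamma>2(1-3)])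
  obtain K' where fK: "?f (x, K) = (x, K')" using fst_deform_map[OF B K] by (metis fst_conv prod.collapse)
  have K': "(x, K') \<in> TW" using deform_map_TW[OF B K] fK by simp
  define k' where "k' = to_frame ?\<phi> x K'"
  have k': "k' = deform mul_i (b x) k"
    using to_frame_deform_map[OF B K frame_at_axioms] by (simp add: fK k'_def k_def b_def)
  have T1: "velocity EC (?f \<circ> \<Gamma>) 0 \<in> tangent_space EC TW (x, K')"
    by (rule tangent_spaceI[OF \<Gamma>(1) deform_map_curve[OF \<Gamma>(2)]]) (simp add: \<Gamma>(3) fK)
  have T2: "velocity EC (?f \<circ> \<Gamma>2) 0 \<in> tangent_space EC TW (x, K')"
    by (rule tangent_spaceI[OF \<Gamma>2(1) deform_map_curve[OF \<Gamma>2(2)]]) (simp add: \<Gamma>2(3) fK)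
  note J' = twistor_J_coords[OF N'(1) good' K' T1]
  define \<kappa> where "\<kappa> = snd (w ?d)"
  define \<kappa>2 where "\<kappa>2 = snd (twistor_J X N (x, K) w ?d)"
  define \<kappa>' where "\<kappa>' = snd (velocity EC (?f \<circ> \<Gamma>) 0 ?d)"
  define \<kappa>2' where "\<kappa>2' = snd (velocity EC (?f \<circ> \<Gamma>2) 0 ?d)"
  have J1: "fst (twistor_J X N (x, K) w ?d) = \<i> *s \<xi>" by (simp add: J(2) \<xi>_def)
  have f1: "fst (velocity EC (?f \<circ> \<Gamma>) 0 ?d) = \<xi>"
    using deform_velocity(1)[OF \<Gamma>(1-3)] by (simp add: \<xi>_def \<Gamma>(4))
  have f2: "fst (velocity EC (?f \<circ> \<Gamma>2) 0 ?d) = \<i> *s \<xi>"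
    using deform_velocity(1)[OF \<Gamma>2(1-3)] J1 by (simp add: \<Gamma>2(4))
  have eq1: "(\<kappa>' o\<^sub>L twist mul_i (b x) k) + (k' o\<^sub>L (- db + (mul_i o\<^sub>L ((db o\<^sub>L k) + (b x o\<^sub>L \<kappa>))))) =
      \<kappa> - (db o\<^sub>L k) - (b x o\<^sub>L \<kappa>) - (mul_i o\<^sub>L db)"
    using deform_velocity(2)[OF \<Gamma>(1-3)]
    unfolding \<kappa>'_def k' db_def \<kappa>_def \<xi>_def k_def b_def \<Gamma>(4) .
  have eq2: "(\<kappa>2' o\<^sub>L twist mul_i (b x) k) + (k' o\<^sub>L (- dbI + (mul_i o\<^sub>L ((dbI o\<^sub>L k) + (b x o\<^sub>L \<kappa>2))))) =
      \<kappa>2 - (dbI o\<^sub>L k) - (b x o\<^sub>L \<kappa>2) - (mul_i o\<^sub>L dbI)"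
    using deform_velocity(2)[OF \<Gamma>2(1-3)]
    unfolding \<kappa>2'_def k' dbI_def \<kappa>2_def J1[symmetric] k_def b_def \<Gamma>2(4) .
  have anti: "db o\<^sub>L mul_i = - (mul_i o\<^sub>L db)" "dbI o\<^sub>L mul_i = - (mul_i o\<^sub>L dbI)"
    unfolding db_def dbI_def b_def by (rule form_end_deriv_anti[OF B triv_at base_vec_tangent])+
  have \<theta>': "\<theta>' = \<theta> + db - (mul_i o\<^sub>L dbI) + ((\<theta> - (mul_i o\<^sub>L (\<theta> o\<^sub>L mul_i))) o\<^sub>L b x)"
    using conn_mat_gauge[OF B chern base_vec_tangent N N' alt alt', of x \<xi>]
    by (simp only: \<theta>'_def \<theta>_def db_def dbI_def b_def cI_base_vec)
  have \<kappa>2: "\<kappa>2 = (k o\<^sub>L (\<kappa> + (\<theta> o\<^sub>L k) - (k o\<^sub>L \<theta>))) - ((mul_i o\<^sub>L \<theta>) o\<^sub>L k) + (k o\<^sub>L (mul_i o\<^sub>L \<theta>))"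
    by (simp add: \<kappa>2_def J(2) vert_coord_def \<kappa>_def k_def[symmetric] \<theta>_def \<xi>_def)
  have kk: "k o\<^sub>L k = - id_blinfun" using ko by (simp add: orth_cstr_def)
  have kk': "k' o\<^sub>L k' = - id_blinfun"
    using sd.deform_orth_cstr[OF ko] by (simp add: k' orth_cstr_def)
  have k'A: "k' o\<^sub>L twist mul_i (b x) k = k - (b x o\<^sub>L k) - (mul_i o\<^sub>L b x)"
    unfolding k' using sd.deform_twist[OF ko] sd.twist_compose[OF ko] by simp
  have "\<kappa>2' = (k' o\<^sub>L (\<kappa>' + (\<theta>' o\<^sub>L k') - (k' o\<^sub>L \<theta>'))) - ((mul_i o\<^sub>L \<theta>') o\<^sub>L k') + (k' o\<^sub>L (mul_i o\<^sub>L \<theta>'))"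
    by (rule deformation_holomorphic_identity[OF sd.J_J sd.b_J anti kk kk' twist_def k'A sd.twist_invertible[OF ko] eq1 eq2 \<kappa>2 \<theta>'])
  then have eq: "velocity EC (?f \<circ> \<Gamma>2) 0 ?d = twistor_J X N' (x, K') (velocity EC (?f \<circ> \<Gamma>) 0) ?d"
    unfolding prod_eq_iff
    by (simp add: J'(2) f1 f2 vert_coord_def \<kappa>2'_def[symmetric] \<kappa>'_def[symmetric] k'_def[symmetric] \<theta>'_def[symmetric])
  have "velocity EC (?f \<circ> \<Gamma>2) 0 = twistor_J X N' (x, K') (velocity EC (?f \<circ> \<Gamma>) 0)"
    by (rule tangent_space_eqI[OF atlas_on_TW K' main_chart_TW(2) main_chart_TW(1)[OF K'] T2 J'(1) eq])
  then show ?thesis unfolding pK d1 d2 fK .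
qed

lemma minus_section: "section_L2 X (\<lambda>x a c. - B x a c)"
  unfolding section_L2_def
proof (intro conjI allI impI)
  have bl: "bounded_linear (\<lambda>z::complex. - z)" by (rule bounded_linear_minus[OF bounded_linear_ident])
  show "alt_form10 X x (\<lambda>a c. - B x a c)" for x
    unfolding alt_form10_def
  proof (intro ballI allI)
    fix u v w z assume "u \<in> E10 X x" "v \<in> E10 X x" "w \<in> E10 X x"
    then have "B x (cmul z u + v) w = z * B x u w + B x v w \<and> B x u v = - B x v u"
      using B_alt[OF B, of x] unfolding alt_form10_def by blast
    then show "- B x (cmul z u + v) w = z * (- B x u w) + - B x v w \<and> - B x u v = - (- B x v u)" by simp
  qed
  show "smooth_fun (charts X) U (\<lambda>x. - B x (s x) (t x))"
    if "open U \<and> smooth_section10 X U s \<and> smooth_section10 X U t" for U s t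
    using smooth_fun_bounded_linear[OF _ bl, of U "\<lambda>x. B x (s x) (t x)"] that B unfolding section_L2_def by blast
qed

end

lemma deform_map_inverse:
  assumes B: "section_L2 X B" and p: "p \<in> TW"
  shows "deform_map (\<lambda>x a c. - B x a c) (deform_map B p) = p"
proof -
  let ?B = "\<lambda>x a c. - B x a c"
  obtain x K where pK: "p = (x, K)" by (cases p)
  let ?\<phi> = "triv_at X x"
  interpret frame_at X "dom_at X x" ?\<phi> x by (rule frame_at_triv_at)
  have K: "(x, K) \<in> TW" using p pK by simp
  let ?b = "form_end X ?\<phi> x (B x)" and ?k = "to_frame ?\<phi> x K"
  interpret sd: skew_deformation "gram X ?\<phi> x" mul_i ?b
    by (rule skew_deformation_frame[OF B_alt[OF B]])
  have b': "form_end X ?\<phi> x (?B x) = - ?b"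
  proof (rule blinfun_eqI, rule gram_eqI)
    fix a c
    show "gram X ?\<phi> x (form_end X ?\<phi> x (?B x) a) \<bullet> c = gram X ?\<phi> x ((- ?b) a) \<bullet> c"
      using B_alt[OF minus_section[OF B], of x]
      by (simp add: form_end_inner form_end_inner[OF B_alt[OF B]] blinfun.minus_left blinfun.minus_right)
  qed
  obtain K' where fK: "deform_map B (x, K) = (x, K')" using fst_deform_map[OF B K] by (metis fst_conv prod.collapse)
  have K': "(x, K') \<in> TW" using deform_map_TW[OF B K] fK by simp
  have k': "to_frame ?\<phi> x K' = deform mul_i ?b ?k"
    using to_frame_deform_map[OF B K frame_at_axioms] by (simp add: fK)
  have KE: "K \<in> End_fibre X x" and ko: "orth_cstr (gram X ?\<phi> x) ?k" using K by (auto simp: twistor_frame)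
  show ?thesis
    unfolding pK fK deform_map_frame[OF minus_section[OF B] K' frame_at_axioms] b' k' sd.deform_inverse[OF ko]
      of_frame_to_frame[OF KE] ..
qed

lemma deform_map_bij:
  assumes B: "section_L2 X B"
  shows "bij_betw (deform_map B) TW TW" "\<And>q. q \<in> TW \<Longrightarrow> inv_into TW (deform_map B) q = deform_map (\<lambda>x a c. - B x a c) q"
proof -
  let ?B = "\<lambda>x a c. - B x a c"
  have i1: "\<forall>p\<in>TW. deform_map ?B (deform_map B p) = p" using deform_map_inverse[OF B] by blast
  have i2: "\<forall>p\<in>TW. deform_map B (deform_map ?B p) = p" using deform_map_inverse[OF minus_section[OF B]] by simp
  show bij: "bij_betw (deform_map B) TW TW"
    by (rule bij_betw_byWitness[OF i1 i2]) (use deform_map_TW[OF B] deform_map_TW[OF minus_section[OF B]] in auto)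
  fix q assume q: "q \<in> TW"
  show "inv_into TW (deform_map B) q = deform_map ?B q"
    by (rule inv_into_f_eq[OF bij_betw_imp_inj_on[OF bij]])
      (use i2 q deform_map_TW[OF minus_section[OF B]] in auto)
qed

end

theorem proposition5p15:
  fixes X :: "('m::{t2_space,second_countable_topology}, 'v::real_normed_vector, 'n::finite, 'r::finite) herm_bundle"
    and D :: "'m \<Rightarrow> ('m, complex^'n) tvec \<Rightarrow> 'v bform"
    and B :: "'m \<Rightarrow> 'v bform"
    and N_Ch N N' :: "('m, 'v, 'n) conn"
  assumes "holomorphic_vector_bundle X" and "hermitian_metric X"
    and "section_form01_L2 X D" and "dbar_closed X D"
    and "section_L2 X B"
    and "chern_connection X N_Ch"
    and "connection X N" and "conn01_eq_plus X N N_Ch D"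
    and "connection X N'"
    and "conn01_eq_plus X N' N_Ch (\<lambda>x v a b. D x v a b + dbar_L2 X B x v a b)"
  shows "let P = (\<lambda>x. endo_exp (\<lambda>u. - g_inv X x (B x) u)) in
         (\<forall>(x, K)\<in>twistor_space X. \<exists>!K'. corresponds X P x K K') \<and>
         (\<forall>p\<in>twistor_space X. fst (induced_map X P p) = fst p) \<and>
         biholomorphism
           (End_charts X) (twistor_space X) (twistor_J X N)
           (End_charts X) (twistor_space X) (twistor_J X N')
           (induced_map X P)"
proof -
  interpret herm_hol_bundle X by standard (rule assms)+
  note B = assms(5) and chern = assms(6)
  have alt: "alt_form10 X x (D x v)" if "v \<in> tangent_space (charts X) UNIV x" for x v
    by (rule section_form01_alt[OF assms(3) that])
  have alt': "alt_form10 X x (\<lambda>a b. D x v a b + dbar_L2 X B x v a b)" if "v \<in> tangent_space (charts X) UNIV x" for x v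
    by (rule alt_form_add[OF alt[OF that] dbar_L2_alt[OF B that]])
  have 1: "\<exists>!K'. corresponds X (\<lambda>x. endo_exp (\<lambda>u. - g_inv X x (B x) u)) x K K'" if "(x, K) \<in> TW" for x K
    using frame_at.corresponds_iff[where B = B, OF frame_at_triv_at that B_alt[OF B]] by simp
  have 2: "biholomorphism EC TW (twistor_J X N) EC TW (twistor_J X N') (deform_map B)"
    unfolding biholomorphism_def
  proof (intro conjI ballI)
    show "almost_complex EC TW (twistor_J X N)"
      by (rule twistor_J_almost_complex[OF assms(7) eq_plus_metric[OF assms(7) chern assms(8) alt]
          eq_plus_holo[OF assms(7) chern assms(8) alt]])
    show "almost_complex EC TW (twistor_J X N')"
      by (rule twistor_J_almost_complex[OF assms(9) eq_plus_metric[OF assms(9) chern assms(10) alt']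
          eq_plus_holo[OF assms(9) chern assms(10) alt']])
    show "bij_betw (deform_map B) TW TW" by (rule deform_map_bij(1)[OF B])
    show "smooth_map EC TW EC TW (deform_map B)" by (rule deform_map_smooth[OF B])
    show "smooth_map EC TW EC TW (inv_into TW (deform_map B))"
      by (rule smooth_map_cong[OF deform_map_smooth[OF minus_section[OF B]]]) (simp add: deform_map_bij(2)[OF B])
    show "differential EC TW EC (deform_map B) p (twistor_J X N p w) =
        twistor_J X N' (deform_map B p) (differential EC TW EC (deform_map B) p w)"
      if "p \<in> TW" "w \<in> tangent_space EC TW p" for p w
      by (rule deform_map_intertwines[OF B chern assms(7,8) assms(9,10) assms(3) that])
  qed
  show ?thesis
    unfolding Let_def deform_map_def[symmetric]
  proof (intro conjI ballI 2 fst_deform_map[OF B])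
    fix p assume "p \<in> TW"
    then show "case p of (x, K) \<Rightarrow> \<exists>!K'. corresponds X (\<lambda>x. endo_exp (\<lambda>u. - g_inv X x (B x) u)) x K K'"
      using 1[of "fst p" "snd p"] by (cases p) simp
  qed
qed

end
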